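(* Let $l,m\in\mathbb N$ and let $E=\bigcup_{j=1}^{l}[a_{2j-1},a_{2j}]$ with $-\infty<a_1<a_2<\dots<a_{2l}<\infty$. Let $(n)$ be a strictly monotone increasing subsequence of $\mathbb N$, and for each $n$ in this subsequence let $I_n=\bigcup_{k=1}^{m}[B_{k,n},C_{k,n}]$ be a union of $m$ pairwise disjoint real intervals with $B_{k,n}<C_{k,n}$. Assume that there is a constant $\delta>0$ independent of $n$ with $\operatorname{dist}(E,I_n)\ge\delta$ for all $n$, and that $\bigcap_{n}[B_{k,n},C_{k,n}]=\{c_k\}$ for $k=1,\dots,m$. Put $\omega_{k,n}=\omega(\infty,[B_{k,n},C_{k,n}],E\cup I_n)$ and assume that $\omega_{k,n}\to0$ as $n\to\infty$ for $k=1,\dots,m$. Then, as $n\to\infty$ along the subsequence, uniformly on compact subsets of $\mathbb C\setminus(E\cup\{c_1,\dots,c_m\})$, $$\phi(z,\infty,E\cup I_n)=\frac{\phi(z,\infty,E)}{\prod_{k=1}^{m}\bigl(\phi(z,c_k,E)\bigr)^{\omega_{k,n}}}\Bigl(1+O\bigl(\max_{1\le k\le m}\omega_{k,n}^2\bigr)\Bigr).$$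
   Context: For a finite union $K$ of disjoint compact real intervals, $\omega(z,A,K)$ denotes the harmonic measure, at the point $z\in\overline{\mathbb C}\setminus K$ and with respect to the domain $\overline{\mathbb C}\setminus K$, of the set $A\subset K$. For $z_0\in(\mathbb R\cup\{\infty\})\setminus K$ let $g_K(z,z_0)$ be the Green's function of the domain $\overline{\mathbb C}\setminus K$ with pole at $z_0$. The complex Green's function $\phi(z,z_0,K)$ is the (in general multi-valued) analytic function on $\overline{\mathbb C}\setminus K$ with a simple pole at $z_0$, with $|\phi(z,z_0,K)|>1$ off $K$, and with $|\phi(z,z_0,K)|\to1$ as $z\to x\in K$; that is, $\log|\phi(z,z_0,K)|=g_K(z,z_0)$. Branches and normalization: for $K=E$ and for $K=E\cup I_n$ the point $a_{2l}$ is an endpoint of a component of $K$. In the open upper half-plane (and likewise in the open lower half-plane) let $\log\phi(z,z_0,K)=g_K(z,z_0)+i\tilde g_K(z,z_0)$, where $\tilde g_K$ is the harmonic conjugate of $g_K$ there with $\log\phi(z,z_0,K)\to0$ as $z\to a_{2l}$. Set $\phi=\exp(\log\phi)$ and $\phi^{\omega}=\exp(\omega\log\phi)$ for real $\omega$. Equivalently, $\log\phi$ is obtained by integrating its derivative from $a_{2l}$ to $z$ along a path in that half-plane. At real points $z$ outside $K\cup\{z_0\}$, the values are the boundary values from the upper, respectively lower, half-plane. The asymptotic formula is understood with all functions taken from the same half-plane. For a given compact set it is asserted for all sufficiently large $n$ (so that the compact set does not meet $I_n$). *)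

theory Defs
  imports "HOL-Analysis.Analysis"
begin

text \<open>
  Real-valued harmonic functions of a complex variable: twice continuously differentiable with
  vanishing Laplacian. Here \<open>u1\<close>, \<open>u2\<close> are the partial derivatives with respect to the real and the
  imaginary part, and \<open>u11\<close>, \<dots>, \<open>u22\<close> the second partial derivatives.
\<close>

definition harmonic_on :: "(complex \<Rightarrow> real) \<Rightarrow> complex set \<Rightarrow> bool" where
  "harmonic_on u S \<longleftrightarrow>
     (\<exists>u1 u2 u11 u12 u21 u22.
        (\<forall>z\<in>S. (u has_derivative (\<lambda>h. u1 z * Re h + u2 z * Im h)) (at z) \<and>
               (u1 has_derivative (\<lambda>h. u11 z * Re h + u12 z * Im h)) (at z) \<and>
               (u2 has_derivative (\<lambda>h. u21 z * Re h + u22 z * Im h)) (at z) \<and>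
               u11 z + u22 z = 0) \<and>
        continuous_on S u11 \<and> continuous_on S u12 \<and>
        continuous_on S u21 \<and> continuous_on S u22)"

text \<open>
  The Riemann sphere is modelled by \<^typ>\<open>complex option\<close>, with \<^term>\<open>None\<close> in the role of the point
  at infinity. Harmonicity there is tested in the chart \<open>w \<mapsto> 1 / w\<close>. The set \<open>S\<close> is meant
  to be open in the sphere.
\<close>

definition at_inverse :: "complex \<Rightarrow> complex option" where
  "at_inverse w = (if w = 0 then None else Some (1 / w))"

definition sphere_harmonic_on :: "(complex option \<Rightarrow> real) \<Rightarrow> complex option set \<Rightarrow> bool" where
  "sphere_harmonic_on u S \<longleftrightarrow>
     harmonic_on (\<lambda>z. u (Some z)) {z. Some z \<in> S} \<and>
     (None \<in> S \<longrightarrow> (\<exists>r>0. harmonic_on (\<lambda>w. u (at_inverse w)) (ball 0 r)))"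

text \<open>
  \<open>is_harmonic_measure z A K \<omega>\<close>: the harmonic measure of \<open>A \<subseteq> K\<close> at \<open>z\<close> with respect to the
  complement of \<open>K\<close> in the sphere is \<open>\<omega>\<close>, i.e. \<open>\<omega>\<close> is the value at \<open>z\<close> of the bounded solution of
  the Dirichlet problem whose boundary data is the indicator function of \<open>A\<close>. Finitely many
  discontinuities of the data on \<open>K\<close> are allowed, and no boundary value is prescribed at them.
  If \<open>A\<close> is a union of components of \<open>K\<close> (\<open>K\<close> a finite union of intervals), there are none.
\<close>

definition is_harmonic_measure ::
    "complex option \<Rightarrow> complex set \<Rightarrow> complex set \<Rightarrow> real \<Rightarrow> bool" where
  "is_harmonic_measure z A K \<omega> \<longleftrightarrow>
     A \<subseteq> K \<and> z \<notin> Some ` K \<and>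
     finite {x\<in>K. \<not> continuous (at x within K) (indicator A :: complex \<Rightarrow> real)} \<and>
     (\<exists>u. sphere_harmonic_on u (- (Some ` K)) \<and>
          bounded (u ` (- (Some ` K))) \<and>
          (\<forall>x\<in>K. continuous (at x within K) (indicator A :: complex \<Rightarrow> real) \<longrightarrow>
             ((\<lambda>y. u (Some y)) \<longlongrightarrow> indicator A x) (at x within - K)) \<and>
          \<omega> = u z)"

text \<open>
  \<open>g\<close> is the Green's function, with pole at \<open>z0\<close>, of the complement of \<open>K\<close> in the sphere, for a
  set \<open>K\<close> all of whose points are regular boundary points of the complement (such as a finite
  union of non-degenerate compact intervals). The value of \<open>g\<close> at the pole is irrelevant.
\<close>

definition is_green_function ::
    "complex set \<Rightarrow> complex option \<Rightarrow> (complex option \<Rightarrow> real) \<Rightarrow> bool" where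
  "is_green_function K z0 g \<longleftrightarrow>
     z0 \<notin> Some ` K \<and>
     sphere_harmonic_on g (- (Some ` K) - {z0}) \<and>
     (\<forall>x\<in>K. ((\<lambda>z. g (Some z)) \<longlongrightarrow> 0) (at x within - K)) \<and>
     (\<exists>r>0. \<exists>v. harmonic_on v (ball 0 r) \<and>
        (\<forall>w\<in>ball 0 r - {0}.
           (case z0 of
              None \<Rightarrow> g (Some (1 / w))
            | Some p \<Rightarrow> g (Some (p + w))) = ln (1 / cmod w) + v w))"

text \<open>
  \<open>L\<close> is \<open>log \<phi>(\<cdot>, z0, K) = g + i * (harmonic conjugate of g)\<close> in the half-plane \<open>H\<close> (one of the two
  components of the complement of the real axis), normalised by \<open>L \<longlongrightarrow> 0\<close> at \<open>a\<close>. At points of the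
  boundary of \<open>H\<close> outside \<open>K\<close> and different from \<open>z0\<close>, \<open>L\<close> takes the boundary values from \<open>H\<close>;
  nothing is said about \<open>L\<close> elsewhere. The complex Green's function is \<open>\<phi> = exp \<circ> L\<close>, and
  \<open>\<phi>\<^sup>\<omega> = exp (\<omega> L)\<close>.
\<close>

definition is_log_complex_green ::
    "complex set \<Rightarrow> complex option \<Rightarrow> complex \<Rightarrow> complex set \<Rightarrow> (complex \<Rightarrow> complex) \<Rightarrow> bool" where
  "is_log_complex_green K z0 a H L \<longleftrightarrow>
     (\<exists>g. is_green_function K z0 g \<and> (\<forall>z\<in>H. Re (L z) = g (Some z))) \<and>
     L holomorphic_on H \<and>
     (L \<longlongrightarrow> 0) (at a within H) \<and>
     (\<forall>x\<in>frontier H. x \<notin> K \<longrightarrow> Some x \<noteq> z0 \<longrightarrow> (L \<longlongrightarrow> L x) (at x within H))"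

end

theory Submission
  imports Defs "HOL-Complex_Analysis.Complex_Analysis" "HOL-Real_Asymp.Real_Asymp"
begin

text \<open>
  For \<open>D = log \<phi>(\<cdot>, \<infinity>, E \<union> I\<^sub>n) - log \<phi>(\<cdot>, \<infinity>, E) + (\<Sum>k. \<omega>\<^sub>k * log \<phi>(\<cdot>, c\<^sub>k, E))\<close> the claim is
  \<open>D = O(s)\<close> with \<open>s = max \<omega>\<^sub>k\<^sup>2\<close>. The harmonic function \<open>h = Re D\<close> vanishes on \<open>E\<close>. By Green's identity
  in a half-plane, \<open>Im log \<phi>(\<cdot>, \<infinity>, E \<union> I\<^sub>n)\<close> changes by \<open>pi * \<omega>\<^sub>k\<close> across \<open>[B\<^sub>k, C\<^sub>k]\<close>, which is what the
  pole at \<open>c\<^sub>k\<close> contributes; so \<open>h\<close> is the real part of a single-valued function on an annulus around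
  \<open>c\<^sub>k\<close>. Its principal part there is bounded by the length of \<open>[B\<^sub>k, C\<^sub>k]\<close>. A logarithmic lower bound for
  harmonic measure makes that length exponentially small in \<open>1 / \<omega>\<^sub>k\<close>, hence \<open>O(s)\<close>, and comparison with
  the Green's functions of \<open>E\<close> shows that \<open>sup |h|\<close> on small circles around the \<open>c\<^sub>k\<close> is at most half of
  itself plus \<open>O(s)\<close>. Finally \<open>Im D\<close> is obtained by integrating the gradient of \<open>h\<close> from the endpoint
  \<open>a\<^sub>2\<^sub>l\<close>, where it has at worst an inverse square root singularity.
\<close>

section \<open>Harmonic functions as local real parts\<close>

text \<open>The estimate of \<open>h\<close> hinges on the zero flux around each slit. A multiple of
  \<open>ln (|z - c k| / \<rho>)\<close> vanishes on the circle of radius \<rho> and is large inside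
  it, so values on a large circle would say nothing about smaller ones. Once this term is excluded,
  \<open>h\<close> is the real part of a Laurent series near \<open>c k\<close>, and its size on a
  circle of radius \<open>r0\<close> is that on the circle of radius \<rho> plus a principal part.
  The factor 1/2 arises on the way out: \<open>Gsum\<close>, the sum of the Green's functions of
  \<open>E\<close> with poles \<open>c k\<close>, is at least \<open>2 * Sm\<close> on the circles
  of radius \<open>r0\<close> and at most \<open>Sm\<close> on those of radius \<rho>, so comparison
  with a multiple of \<open>Gsum\<close> halves the maximum of \<open>|h|\<close>. The inner circle
  for the principal part has radius \<open>s = (max \<omega>)^2\<close>. There a crude O(1) bound
  for \<open>h\<close> is enough, because \<open>\<omega> k * ln (2 / s) <= 1\<close>, and a
  function of size O(1) on a circle of radius \<open>s\<close> has a principal part of size O(s) at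
  fixed distance. The exponential smallness of the slits is what makes them fit inside that
  circle.\<close>

definition harm :: "(complex \<Rightarrow> real) \<Rightarrow> complex set \<Rightarrow> bool" where
  "harm u S \<longleftrightarrow> open S \<and>
     (\<forall>z\<in>S. \<exists>r f. r > 0 \<and> ball z r \<subseteq> S \<and> f holomorphic_on ball z r \<and> (\<forall>y\<in>ball z r. u y = Re (f y)))"

text \<open>The derivative of any holomorphic function with real part \<open>u\<close>.\<close>
definition cgrad :: "(complex \<Rightarrow> real) \<Rightarrow> complex \<Rightarrow> complex" where
  "cgrad u z = Complex (frechet_derivative u (at z) 1) (- frechet_derivative u (at z) \<i>)"

text \<open>Only the values of \<open>u\<close> at finite points enter. The value at infinity is
  that of the harmonic extension \<open>q\<close> at 0 in the chart \<open>1 / w\<close>, so no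
  point at infinity has to be carried along.\<close>

definition harm_at_inf :: "(complex \<Rightarrow> real) \<Rightarrow> bool" where
  "harm_at_inf u \<longleftrightarrow> (\<exists>r>0. \<exists>q. harm q (ball 0 r) \<and> (\<forall>w\<in>ball 0 r - {0}. q w = u (1 / w)))"

lemma DERIV_along_Re:
  assumes "(v has_derivative (\<lambda>h. a * Re h + b * Im h)) (at (y + of_real t))"
  shows "((\<lambda>t. v (y + of_real t)) has_real_derivative a) (at t)"
proof -
  have "((\<lambda>t. y + of_real t) has_derivative (\<lambda>h. of_real h)) (at t)"
    by (auto intro!: derivative_eq_intros)
  from diff_chain_at[OF this assms] show ?thesis
    by (simp add: o_def has_field_derivative_def mult_commute_abs)
qed

lemma DERIV_along_Im:
  assumes "(v has_derivative (\<lambda>h. a * Re h + b * Im h)) (at (y + \<i> * of_real t))"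
  shows "((\<lambda>t. v (y + \<i> * of_real t)) has_real_derivative b) (at t)"
proof -
  have "((\<lambda>t. y + \<i> * of_real t) has_derivative (\<lambda>h. \<i> * of_real h)) (at t)"
    by (auto intro!: derivative_eq_intros)
  from diff_chain_at[OF this assms] show ?thesis
    by (simp add: o_def has_field_derivative_def mult_commute_abs)
qed

text \<open>Schwarz's theorem. The second difference of \<open>u\<close> over a square of side
  \<open>t\<close> is evaluated by two applications of the mean value theorem, in either order. This
  makes \<open>u12\<close> and \<open>u21\<close> agree at two points near \<open>z\<close>, while
  by continuity each stays within half of the supposed gap of its value at \<open>z\<close>.\<close>

lemma mixed_partials_eq:
  assumes S: "open S" "z \<in> S"
    and u: "\<And>y. y \<in> S \<Longrightarrow> (u has_derivative (\<lambda>h. u1 y * Re h + u2 y * Im h)) (at y)"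
    and u1: "\<And>y. y \<in> S \<Longrightarrow> (u1 has_derivative (\<lambda>h. u11 y * Re h + u12 y * Im h)) (at y)"
    and u2: "\<And>y. y \<in> S \<Longrightarrow> (u2 has_derivative (\<lambda>h. u21 y * Re h + u22 y * Im h)) (at y)"
    and c: "continuous_on S u12" "continuous_on S u21"
  shows "u12 z = u21 z"
proof (rule ccontr)
  assume ne: "u12 z \<noteq> u21 z"
  define e where "e = \<bar>u12 z - u21 z\<bar> / 2"
  have e: "e > 0" using ne by (simp add: e_def)
  have "isCont u12 z" "isCont u21 z" using c S continuous_on_eq_continuous_at by blast+
  then have "\<forall>\<^sub>F y in nhds z. dist (u12 y) (u12 z) < e" "\<forall>\<^sub>F y in nhds z. dist (u21 y) (u21 z) < e"
    using e by (auto simp only: isCont_def tendsto_at_iff_tendsto_nhds dest: tendstoD)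
  moreover have "\<forall>\<^sub>F y in nhds z. y \<in> S" using S by (simp add: eventually_nhds_in_open)
  ultimately have "\<forall>\<^sub>F y in nhds z. dist (u12 y) (u12 z) < e \<and> dist (u21 y) (u21 z) < e \<and> y \<in> S"
    by eventually_elim auto
  then obtain d where d: "d > 0" "\<And>y. dist y z < d \<Longrightarrow> dist (u12 y) (u12 z) < e \<and> dist (u21 y) (u21 z) < e \<and> y \<in> S"
    unfolding eventually_nhds_metric by blast
  define t where "t = d / 4"
  have t: "t > 0" using d by (simp add: t_def)
  have near: "dist (z + of_real x + \<i> * of_real y) z < d" if "0 \<le> x" "x \<le> t" "0 \<le> y" "y \<le> t" for x y
  proof -
    have "cmod (of_real x + \<i> * of_real y) \<le> x + y"
      by (rule order_trans[OF norm_triangle_ineq]) (use that in \<open>simp add: norm_mult\<close>)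
    also have "\<dots> < d" using that d(1) by (simp add: t_def)
    finally show ?thesis by (simp add: dist_norm)
  qed
  have inS: "z + of_real x + \<i> * of_real y \<in> S" if "0 \<le> x" "x \<le> t" "0 \<le> y" "y \<le> t" for x y
    using near[OF that] d(2) by blast
  define a where "a = (\<lambda>x y. z + complex_of_real x + \<i> * of_real y)"
  have dx: "((\<lambda>x. v (a x y)) has_real_derivative p (a x y)) (at x)"
    if "\<And>y. y \<in> S \<Longrightarrow> (v has_derivative (\<lambda>h. p y * Re h + q y * Im h)) (at y)" "0 \<le> x" "x \<le> t" "0 \<le> y" "y \<le> t" for v p q x y
    using DERIV_along_Re[of v "p (a x y)" "q (a x y)" "z + \<i> * of_real y" x] that(1)[OF inS[OF that(2-5)]]
    by (simp add: a_def algebra_simps)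
  have dy: "((\<lambda>y. v (a x y)) has_real_derivative q (a x y)) (at y)"
    if "\<And>y. y \<in> S \<Longrightarrow> (v has_derivative (\<lambda>h. p y * Re h + q y * Im h)) (at y)" "0 \<le> x" "x \<le> t" "0 \<le> y" "y \<le> t" for v p q x y
    using DERIV_along_Im[of v "p (a x y)" "q (a x y)" "z + of_real x" y] that(1)[OF inS[OF that(2-5)]]
    by (simp add: a_def algebra_simps)
  have "\<exists>s. 0 < s \<and> s < t \<and> (u (a t t) - u (a t 0)) - (u (a 0 t) - u (a 0 0)) = (t - 0) * (u1 (a s t) - u1 (a s 0))"
    by (rule MVT2[OF t, where f = "\<lambda>x. u (a x t) - u (a x 0)"]) (intro DERIV_diff dx[OF u]; use t in auto)
  then obtain s where s: "0 < s" "s < t" "u (a t t) - u (a t 0) - (u (a 0 t) - u (a 0 0)) = t * (u1 (a s t) - u1 (a s 0))"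
    by auto
  have "\<exists>s'. 0 < s' \<and> s' < t \<and> u1 (a s t) - u1 (a s 0) = (t - 0) * u12 (a s s')"
    by (rule MVT2[OF t, where f = "\<lambda>y. u1 (a s y)"]) (rule dy[OF u1]; use s t in auto)
  then obtain s' where s': "0 < s'" "s' < t" "u1 (a s t) - u1 (a s 0) = t * u12 (a s s')" by auto
  have "\<exists>s. 0 < s \<and> s < t \<and> (u (a t t) - u (a 0 t)) - (u (a t 0) - u (a 0 0)) = (t - 0) * (u2 (a t s) - u2 (a 0 s))"
    by (rule MVT2[OF t, where f = "\<lambda>y. u (a t y) - u (a 0 y)"]) (intro DERIV_diff dy[OF u]; use t in auto)
  then obtain r where r: "0 < r" "r < t" "u (a t t) - u (a 0 t) - (u (a t 0) - u (a 0 0)) = t * (u2 (a t r) - u2 (a 0 r))"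
    by auto
  have "\<exists>s'. 0 < s' \<and> s' < t \<and> u2 (a t r) - u2 (a 0 r) = (t - 0) * u21 (a s' r)"
    by (rule MVT2[OF t, where f = "\<lambda>x. u2 (a x r)"]) (rule dx[OF u2]; use r t in auto)
  then obtain r' where r': "0 < r'" "r' < t" "u2 (a t r) - u2 (a 0 r) = t * u21 (a r' r)" by auto
  have "t * (t * u12 (a s s')) = t * (t * u21 (a r' r))"
    using s(3) s'(3) r(3) r'(3) by (simp add: algebra_simps)
  then have eq: "u12 (a s s') = u21 (a r' r)" using t by simp
  have "dist (u12 (a s s')) (u12 z) < e" "dist (u21 (a r' r)) (u21 z) < e"
    unfolding a_def using near d(2) s s' r r' by auto
  then have "\<bar>u12 z - u21 z\<bar> < 2 * e" using eq by (simp add: dist_real_def)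
  then show False by (simp add: e_def)
qed

lemma Re_holomorphic_has_derivative:
  assumes "f holomorphic_on T" "open T" "z \<in> T" "\<And>y. y \<in> T \<Longrightarrow> u y = Re (f y)"
  shows "(u has_derivative (\<lambda>h. Re (deriv f z * h))) (at z)"
proof -
  have "(f has_field_derivative deriv f z) (at z)"
    using assms holomorphic_derivI by blast
  then have "((\<lambda>y. Re (f y)) has_derivative (\<lambda>h. Re (deriv f z * h))) (at z)"
    unfolding has_field_derivative_def by (rule has_derivative_Re)
  then show ?thesis
    by (rule has_derivative_transform_within_open[OF _ assms(2,3)]) (simp add: assms(4))
qed

lemma cgrad_eq_if_has_derivative:
  assumes "(u has_derivative (\<lambda>h. Re (a * h))) (at z)"
  shows "cgrad u z = a"
  using frechet_derivative_at[OF assms, symmetric] by (simp add: cgrad_def complex_eq_iff)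

lemma cgrad_Re:
  assumes "f holomorphic_on T" "open T" "z \<in> T" "\<And>y. y \<in> T \<Longrightarrow> u y = Re (f y)"
  shows "cgrad u z = deriv f z"
  by (rule cgrad_eq_if_has_derivative[OF Re_holomorphic_has_derivative[OF assms]])

lemma harm_open: "harm u S \<Longrightarrow> open S"
  by (simp add: harm_def)

lemma harm_has_derivative:
  assumes "harm u S" "z \<in> S"
  shows "(u has_derivative (\<lambda>h. Re (cgrad u z * h))) (at z)"
proof -
  obtain r f where "r > 0" "ball z r \<subseteq> S" "f holomorphic_on ball z r" "\<forall>y\<in>ball z r. u y = Re (f y)"
    using assms by (auto simp: harm_def)
  then show ?thesis
    using Re_holomorphic_has_derivative[of f "ball z r" z u] cgrad_Re[of f "ball z r" z u] by simp
qed

lemma harm_isCont: "harm u S \<Longrightarrow> z \<in> S \<Longrightarrow> isCont u z"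
  using harm_has_derivative has_derivative_continuous by blast

lemma harm_continuous_on: "harm u S \<Longrightarrow> continuous_on S u"
  using harm_isCont continuous_at_imp_continuous_on by blast

lemma holomorphic_cgrad:
  assumes "harm u S" shows "cgrad u holomorphic_on S"
proof (rule holomorphic_onI)
  fix z assume z: "z \<in> S"
  obtain r f where r: "r > 0" "ball z r \<subseteq> S" "f holomorphic_on ball z r" "\<forall>y\<in>ball z r. u y = Re (f y)"
    using assms z by (auto simp: harm_def)
  have "deriv f holomorphic_on ball z r" using r by (simp add: holomorphic_deriv)
  moreover have "cgrad u y = deriv f y" if "y \<in> ball z r" for y
    by (rule cgrad_Re[of f "ball z r"]) (use r that in auto)
  ultimately have "cgrad u holomorphic_on ball z r" using holomorphic_cong by (metis (mono_tags, lifting))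
  then have "cgrad u field_differentiable at z"
    using r holomorphic_on_imp_differentiable_at by (metis centre_in_ball open_ball)
  then show "cgrad u field_differentiable at z within S"
    using field_differentiable_at_within by blast
qed

text \<open>On a convex set the holomorphic function \<open>cgrad u\<close> has a primitive. Its
  real part has the same derivative as \<open>u\<close>, and the value at one point fixes the
  constant.\<close>

lemma harm_convex_Re:
  assumes "harm u S" "convex S"
  obtains F where "F holomorphic_on S" "\<And>z. z \<in> S \<Longrightarrow> u z = Re (F z)"
    "\<And>z. z \<in> S \<Longrightarrow> (F has_field_derivative cgrad u z) (at z)"
proof (cases "S = {}")
  case True then show ?thesis using that[of "\<lambda>_. 0"] by auto
next
  case False
  then obtain z0 where z0: "z0 \<in> S" by blast
  have op: "open S" using assms harm_open by blast
  obtain g where g: "\<And>x. x \<in> S \<Longrightarrow> (g has_field_derivative cgrad u x) (at x within S)"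
    using holomorphic_convex_primitive'[OF assms(2) op holomorphic_cgrad[OF assms(1)]] by blast
  then have g: "\<And>x. x \<in> S \<Longrightarrow> (g has_field_derivative cgrad u x) (at x)"
    using op at_within_open by metis
  define F where "F = (\<lambda>z. g z - g z0 + of_real (u z0))"
  have F: "(F has_field_derivative cgrad u x) (at x)" if "x \<in> S" for x
    unfolding F_def by (auto intro!: derivative_eq_intros g that)
  have "((\<lambda>z. u z - Re (F z)) has_derivative (\<lambda>h. 0)) (at x within S)" if "x \<in> S" for x
  proof -
    have "((\<lambda>z. Re (F z)) has_derivative (\<lambda>h. Re (cgrad u x * h))) (at x)"
      using F[OF that] unfolding has_field_derivative_def by (rule has_derivative_Re)
    from has_derivative_diff[OF harm_has_derivative[OF assms(1) that] this]
    show ?thesis using has_derivative_at_withinI by fastforce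
  qed
  then have "u z - Re (F z) = u z0 - Re (F z0)" if "z \<in> S" for z
    by (rule has_derivative_zero_unique[OF assms(2)]) (use that z0 in auto)
  then have "u z = Re (F z)" if "z \<in> S" for z using that by (simp add: F_def)
  moreover have "F holomorphic_on S" using F holomorphic_on_open op by blast
  ultimately show ?thesis using that F by blast
qed

lemma harm_I:
  assumes "open S" "\<And>z. z \<in> S \<Longrightarrow> \<exists>T f. open T \<and> z \<in> T \<and> f holomorphic_on T \<and> (\<forall>y\<in>T. u y = Re (f y))"
  shows "harm u S"
  unfolding harm_def
proof (intro conjI ballI assms(1))
  fix z assume z: "z \<in> S"
  then obtain T f where T: "open T" "z \<in> T" "f holomorphic_on T" "\<forall>y\<in>T. u y = Re (f y)" using assms by blast
  have "open (T \<inter> S)" "z \<in> T \<inter> S" using T z assms by auto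
  then obtain r where "r > 0" "ball z r \<subseteq> T \<inter> S" by (meson open_contains_ball)
  then show "\<exists>r f. 0 < r \<and> ball z r \<subseteq> S \<and> f holomorphic_on ball z r \<and> (\<forall>y\<in>ball z r. u y = Re (f y))"
    using T holomorphic_on_subset[of f T "ball z r"] by (intro exI[of _ r] exI[of _ f]) blast
qed

lemma harm_Re: "f holomorphic_on S \<Longrightarrow> open S \<Longrightarrow> harm (\<lambda>z. Re (f z)) S"
  by (rule harm_I) auto

lemma harm_E:
  assumes "harm u S" "z \<in> S"
  obtains r f where "r > 0" "ball z r \<subseteq> S" "f holomorphic_on ball z r" "\<And>y. y \<in> ball z r \<Longrightarrow> u y = Re (f y)"
  using assms unfolding harm_def by blast

lemma harm_subset:
  assumes "harm u S" "open T" "T \<subseteq> S" shows "harm u T"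
proof (rule harm_I[OF assms(2)])
  fix z assume "z \<in> T"
  then obtain r f where "r > 0" "ball z r \<subseteq> S" "f holomorphic_on ball z r" "\<And>y. y \<in> ball z r \<Longrightarrow> u y = Re (f y)"
    using assms harm_E by blast
  then show "\<exists>T f. open T \<and> z \<in> T \<and> f holomorphic_on T \<and> (\<forall>y\<in>T. u y = Re (f y))"
    by (intro exI[of _ "ball z r"] exI[of _ f]) auto
qed

lemma harm_cong:
  assumes "harm u S" "\<And>z. z \<in> S \<Longrightarrow> u z = v z" shows "harm v S"
proof (rule harm_I)
  show "open S" using assms harm_open by blast
  fix z assume "z \<in> S"
  then obtain r f where "r > 0" "ball z r \<subseteq> S" "f holomorphic_on ball z r" "\<And>y. y \<in> ball z r \<Longrightarrow> u y = Re (f y)"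
    using assms(1) harm_E by blast
  then show "\<exists>T f. open T \<and> z \<in> T \<and> f holomorphic_on T \<and> (\<forall>y\<in>T. v y = Re (f y))"
    using assms(2) by (intro exI[of _ "ball z r"] exI[of _ f]) (auto simp: subset_iff)
qed

lemma harm_comp:
  assumes "harm u S" "f holomorphic_on T" "open T" "f ` T \<subseteq> S"
  shows "harm (\<lambda>z. u (f z)) T"
proof (rule harm_I[OF assms(3)])
  fix z assume z: "z \<in> T"
  then have "f z \<in> S" using assms(4) by blast
  then obtain r g where g: "r > 0" "ball (f z) r \<subseteq> S" "g holomorphic_on ball (f z) r" "\<And>y. y \<in> ball (f z) r \<Longrightarrow> u y = Re (g y)"
    using assms(1) harm_E by blast
  define V where "V = T \<inter> f -` ball (f z) r"
  have "open V" unfolding V_def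
    using assms(2,3) continuous_open_preimage holomorphic_on_imp_continuous_on open_ball by blast
  moreover have "z \<in> V" using z g by (simp add: V_def)
  moreover have "(g \<circ> f) holomorphic_on V"
    by (rule holomorphic_on_compose_gen[OF _ g(3)]) (use assms(2) holomorphic_on_subset in \<open>auto simp: V_def\<close>)
  ultimately show "\<exists>V g. open V \<and> z \<in> V \<and> g holomorphic_on V \<and> (\<forall>y\<in>V. u (f y) = Re (g y))"
    using g(4) by (intro exI[of _ V] exI[of _ "g \<circ> f"]) (auto simp: V_def)
qed

lemma holomorphic_on_cnj_cnj:
  assumes "f holomorphic_on S" "open S"
  shows "(\<lambda>z. cnj (f (cnj z))) holomorphic_on cnj -` S"
proof -
  have "open (cnj -` S)" by (rule open_vimage[OF assms(2)]) (intro continuous_intros)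
  moreover have "f holomorphic_on cnj ` (cnj -` S)" by (rule holomorphic_on_subset[OF assms(1)]) auto
  ultimately show ?thesis using holomorphic_on_compose_cnj_cnj[of f "cnj -` S"] by (simp add: o_def)
qed

lemma harm_cnj:
  assumes "harm u S" shows "harm (\<lambda>z. u (cnj z)) (cnj -` S)"
proof (rule harm_I)
  show "open (cnj -` S)" by (rule open_vimage[OF harm_open[OF assms]]) (intro continuous_intros)
  fix z assume "z \<in> cnj -` S"
  then obtain r f where r: "r > 0" "ball (cnj z) r \<subseteq> S" "f holomorphic_on ball (cnj z) r" "\<And>y. y \<in> ball (cnj z) r \<Longrightarrow> u y = Re (f y)"
    using assms harm_E[of u S "cnj z"] by auto
  then show "\<exists>T f. open T \<and> z \<in> T \<and> f holomorphic_on T \<and> (\<forall>y\<in>T. u (cnj y) = Re (f y))"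
    using holomorphic_on_cnj_cnj[OF r(3)] open_vimage[OF open_ball, of cnj "cnj z" r] continuous_on_cnj[OF continuous_on_id]
    by (intro exI[of _ "cnj -` ball (cnj z) r"] exI[of _ "\<lambda>z. cnj (f (cnj z))"]) auto
qed

text \<open>Real-linear operations on real parts lift to the holomorphic functions; \<open>k\<close>
  is the lift of \<open>h\<close>. Sum, difference and scalar multiple are instances.\<close>

lemma harm_binop:
  assumes "harm u S" "harm v S"
    and "\<And>x y. h (Re x) (Re y) = Re (k x y)" "\<And>f g T. f holomorphic_on T \<Longrightarrow> g holomorphic_on T \<Longrightarrow> (\<lambda>z. k (f z) (g z)) holomorphic_on T"
  shows "harm (\<lambda>z. h (u z) (v z)) S"
proof (rule harm_I)
  show "open S" using assms harm_open by blast
  fix z assume z: "z \<in> S"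
  obtain r f where r: "r > 0" "ball z r \<subseteq> S" "f holomorphic_on ball z r" "\<And>y. y \<in> ball z r \<Longrightarrow> u y = Re (f y)"
    using harm_E[OF assms(1) z] by blast
  obtain r' f' where r': "r' > 0" "ball z r' \<subseteq> S" "f' holomorphic_on ball z r'" "\<And>y. y \<in> ball z r' \<Longrightarrow> v y = Re (f' y)"
    using harm_E[OF assms(2) z] by blast
  show "\<exists>T f. open T \<and> z \<in> T \<and> f holomorphic_on T \<and> (\<forall>y\<in>T. h (u y) (v y) = Re (f y))"
    using r r' assms(3) by (intro exI[of _ "ball z r \<inter> ball z r'"] exI[of _ "\<lambda>z. k (f z) (f' z)"])
      (auto intro!: assms(4) intro: holomorphic_on_subset)
qed

lemma harm_add: "harm u S \<Longrightarrow> harm v S \<Longrightarrow> harm (\<lambda>z. u z + v z) S"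
  by (rule harm_binop[where h = "(+)" and k = "(+)"]) (auto intro: holomorphic_intros)

lemma harm_diff: "harm u S \<Longrightarrow> harm v S \<Longrightarrow> harm (\<lambda>z. u z - v z) S"
  by (rule harm_binop[where h = "(-)" and k = "(-)"]) (auto intro: holomorphic_intros)

lemma harm_cmult: "harm u S \<Longrightarrow> harm (\<lambda>z. c * u z) S"
  by (rule harm_binop[where h = "\<lambda>x y. c * x" and k = "\<lambda>x y. of_real c * x", of u S u]) (auto intro: holomorphic_intros)

lemma harm_minus: "harm u S \<Longrightarrow> harm (\<lambda>z. - u z) S"
  using harm_cmult[of u S "-1"] by simp

lemma harm_const: "open S \<Longrightarrow> harm (\<lambda>z. c) S"
  using harm_Re[of "\<lambda>z. of_real c" S] by simp

lemma harm_sum: "open S \<Longrightarrow> (\<And>i. i \<in> I \<Longrightarrow> harm (u i) S) \<Longrightarrow> harm (\<lambda>z. \<Sum>i\<in>I. u i z) S"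
  by (induction I rule: infinite_finite_induct) (auto simp: harm_const harm_add)

text \<open>Near \<open>z\<close>, \<open>ln |y|\<close> is the real part of
  \<open>Ln (y / z)\<close> plus a constant. On the ball of radius \<open>|z|\<close> around
  \<open>z\<close> the quotient \<open>y / z\<close> stays within distance 1 of 1 and hence off the
  branch cut. The general case is a composition.\<close>

lemma harm_ln_norm:
  assumes "f holomorphic_on S" "open S" "\<And>z. z \<in> S \<Longrightarrow> f z \<noteq> 0"
  shows "harm (\<lambda>z. ln (cmod (f z))) S"
proof -
  have "harm (\<lambda>z. ln (cmod z)) (- {0})"
  proof (rule harm_I)
    fix z :: complex assume z: "z \<in> - {0}"
    have "ln (cmod y) = Re (Ln (y / z) + of_real (ln (cmod z)))" if "y \<in> ball z (cmod z)" for y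
    proof -
      have "y \<noteq> 0" using that by (auto simp: dist_norm)
      then show ?thesis using z by (simp add: norm_divide ln_div)
    qed
    moreover have "(\<lambda>y. Ln (y / z) + of_real (ln (cmod z))) holomorphic_on ball z (cmod z)"
    proof -
      have "y / z \<notin> \<real>\<^sub>\<le>\<^sub>0" if "y \<in> ball z (cmod z)" for y
      proof
        assume "y / z \<in> \<real>\<^sub>\<le>\<^sub>0"
        then have "cmod (y / z - 1) \<ge> 1" using complex_nonpos_Reals_iff[of "y / z"] abs_Re_le_cmod[of "y / z - 1"] by auto
        moreover have "cmod (y / z - 1) < 1" using that z by (simp add: dist_norm norm_minus_commute divide_simps norm_divide diff_divide_distrib[symmetric] flip: diff_divide_eq_iff)
        ultimately show False by simp
      qed
      then show ?thesis using z by (auto intro!: holomorphic_intros)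
    qed
    moreover have "z \<in> ball z (cmod z)" using z by simp
    ultimately show "\<exists>T f. open T \<and> z \<in> T \<and> f holomorphic_on T \<and> (\<forall>y\<in>T. ln (cmod y) = Re (f y))"
      using open_ball by blast
  qed auto
  from harm_comp[OF this assms(1,2)] show ?thesis using assms(3) by force
qed

text \<open>\<open>u1 - i * u2\<close> satisfies the Cauchy-Riemann equations: one is the vanishing
  of the Laplacian, the other the symmetry of the mixed partials. A local primitive of it has real
  part \<open>u\<close> up to a constant. In the form \<open>harm\<close>, composition with
  holomorphic maps, reflection and the maximum principle are immediate.\<close>

lemma harmonic_on_imp_harm:
  assumes "harmonic_on u S" "open S"
  shows "harm u S"
proof -
  obtain u1 u2 u11 u12 u21 u22 where u:
    "\<And>z. z \<in> S \<Longrightarrow> (u has_derivative (\<lambda>h. u1 z * Re h + u2 z * Im h)) (at z)"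
    "\<And>z. z \<in> S \<Longrightarrow> (u1 has_derivative (\<lambda>h. u11 z * Re h + u12 z * Im h)) (at z)"
    "\<And>z. z \<in> S \<Longrightarrow> (u2 has_derivative (\<lambda>h. u21 z * Re h + u22 z * Im h)) (at z)"
    "\<And>z. z \<in> S \<Longrightarrow> u11 z + u22 z = 0" "continuous_on S u12" "continuous_on S u21"
    using assms(1) unfolding harmonic_on_def by blast
  define f where "f = (\<lambda>z. complex_of_real (u1 z) - \<i> * of_real (u2 z))"
  have "(f has_field_derivative Complex (u11 z) (- u21 z)) (at z)" if z: "z \<in> S" for z
  proof -
    have eq: "u12 z = u21 z" by (rule mixed_partials_eq[OF assms(2) z u(1-3,5,6)])
    have "(f has_derivative (\<lambda>h. of_real (u11 z * Re h + u12 z * Im h) - \<i> * of_real (u21 z * Re h + u22 z * Im h))) (at z)"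
      unfolding f_def by (intro has_derivative_diff has_derivative_mult_right has_derivative_of_real u z)
    also have "(\<lambda>h. of_real (u11 z * Re h + u12 z * Im h) - \<i> * of_real (u21 z * Re h + u22 z * Im h)) = (*) (Complex (u11 z) (- u21 z))"
      using eq u(4)[OF z] by (auto simp: fun_eq_iff complex_eq_iff algebra_simps add_eq_0_iff)
    finally show ?thesis by (simp add: has_field_derivative_def)
  qed note f = this
  have holf: "f holomorphic_on S" using f assms(2) holomorphic_on_open by blast
  show ?thesis
  proof (rule harm_I[OF assms(2)])
    fix z assume z: "z \<in> S"
    obtain r where r: "r > 0" "ball z r \<subseteq> S" using assms(2) z open_contains_ball by blast
    obtain g where g: "\<And>x. x \<in> ball z r \<Longrightarrow> (g has_field_derivative f x) (at x within ball z r)"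
      using holomorphic_convex_primitive'[OF convex_ball open_ball holomorphic_on_subset[OF holf r(2)]] by blast
    then have g: "\<And>x. x \<in> ball z r \<Longrightarrow> (g has_field_derivative f x) (at x)"
      using at_within_open open_ball by metis
    have "((\<lambda>z. u z - Re (g z)) has_derivative (\<lambda>h. 0)) (at x within ball z r)" if "x \<in> ball z r" for x
    proof -
      have "((\<lambda>z. Re (g z)) has_derivative (\<lambda>h. Re (f x * h))) (at x)"
        using g[OF that] unfolding has_field_derivative_def by (rule has_derivative_Re)
      from has_derivative_diff[OF u(1) this] show ?thesis using that r has_derivative_at_withinI
        by (fastforce simp: f_def algebra_simps)
    qed
    then have "u y - Re (g y) = u z - Re (g z)" if "y \<in> ball z r" for y
      by (rule has_derivative_zero_unique[OF convex_ball]) (use that r in auto)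
    then have "u y = Re (g y + of_real (u z - Re (g z)))" if "y \<in> ball z r" for y using that by fastforce
    moreover have "(\<lambda>y. g y + of_real (u z - Re (g z))) holomorphic_on ball z r"
      using g by (intro holomorphic_intros) (use holomorphic_on_open open_ball in blast)
    moreover have "z \<in> ball z r" using r by simp
    ultimately show "\<exists>T f. open T \<and> z \<in> T \<and> f holomorphic_on T \<and> (\<forall>y\<in>T. u y = Re (f y))"
      using open_ball by blast
  qed
qed

section \<open>The maximum principle\<close>

text \<open>\<open>exp\<close> turns the real part into a modulus, so the maximum modulus principle
  applies.\<close>

lemma Re_local_max_const:
  assumes "f holomorphic_on ball z r" "r > 0" "\<And>y. y \<in> ball z r \<Longrightarrow> Re (f y) \<le> Re (f z)" "y \<in> ball z r"
  shows "Re (f y) = Re (f z)"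
proof -
  have "(\<lambda>y. exp (f y)) constant_on ball z r"
    by (rule maximum_modulus_principle[of _ _ "ball z r" z])
      (use assms in \<open>auto intro!: holomorphic_intros simp: convex_connected\<close>)
  then have "exp (f y) = exp (f z)"
    using assms(2,4) by (metis centre_in_ball constant_on_def)
  then have "exp (Re (f y)) = exp (Re (f z))" by (metis norm_exp_eq_Re)
  then show ?thesis by simp
qed

lemma harm_local_max_const:
  assumes "harm u S" "z \<in> S" "\<And>y. y \<in> S \<Longrightarrow> u y \<le> u z"
  obtains r where "r > 0" "ball z r \<subseteq> S" "\<And>y. y \<in> ball z r \<Longrightarrow> u y = u z"
proof -
  obtain r f where r: "r > 0" "ball z r \<subseteq> S" "f holomorphic_on ball z r" "\<And>y. y \<in> ball z r \<Longrightarrow> u y = Re (f y)"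
    using harm_E[OF assms(1,2)] by blast
  have "u y = u z" if "y \<in> ball z r" for y
    using Re_local_max_const[OF r(3,1) _ that] r assms(3) that by (metis centre_in_ball subset_iff)
  then show ?thesis using that r by blast
qed

text \<open>If the maximum were attained, consider a point of the level set closest to a point outside \<open>S\<close>.\<close>
lemma harm_max_not_attained:
  assumes u: "harm u S" and e: "e \<notin> S" and le: "\<And>z. z \<in> S \<Longrightarrow> u z \<le> s"
    and cl: "closed {z \<in> S. s \<le> u z}" and z: "z \<in> S" "u z = s"
  shows False
proof -
  let ?T = "{z \<in> S. s \<le> u z}"
  have "?T \<noteq> {}" using z by auto
  then obtain y where y: "y \<in> ?T" "\<And>x. x \<in> ?T \<Longrightarrow> dist e y \<le> dist e x"
    using distance_attains_inf[OF cl] by blast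
  have uy: "u y = s" using y(1) le by force
  obtain r where r: "r > 0" "ball y r \<subseteq> S" "\<And>x. x \<in> ball y r \<Longrightarrow> u x = u y"
    by (rule harm_local_max_const[OF u, of y]) (use y le uy in auto)
  have "y \<noteq> e" using y e by auto
  define t where "t = min (1/2) (r / (2 * dist e y))"
  have t: "0 < t" "t < 1" "t * dist e y < r"
    using r \<open>y \<noteq> e\<close> by (auto simp: t_def min_def field_simps)
  define x where "x = y + of_real t * (e - y)"
  have "dist y x < r" using t by (simp add: x_def dist_norm norm_mult norm_minus_commute)
  then have "x \<in> ?T" using r uy by auto
  then have "dist e y \<le> dist e x" by (rule y(2))
  also have "e - x = of_real (1 - t) * (e - y)" by (simp add: x_def algebra_simps)
  then have "dist e x = (1 - t) * dist e y" using t by (simp add: dist_norm norm_mult del: of_real_diff)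
  finally have "t * dist e y \<le> 0" by (simp add: algebra_simps)
  moreover have "t * dist e y > 0" using t \<open>y \<noteq> e\<close> by simp
  ultimately show False by linarith
qed

text \<open>For a positive level the boundary condition keeps points of the frontier from being
  limit points of the superlevel set, so that it is closed in the plane and not merely in
  \<open>S\<close>.\<close>

lemma closed_superlevel:
  assumes u: "harm u S" and t: "t > 0"
    and bd: "\<And>x \<epsilon>. x \<in> frontier S \<Longrightarrow> \<epsilon> > 0 \<Longrightarrow> \<forall>\<^sub>F z in at x within S. u z < \<epsilon>"
  shows "closed {z \<in> S. t \<le> u z}"
  unfolding closed_limpt
proof (intro allI impI)
  fix x assume lim: "x islimpt {z \<in> S. t \<le> u z}"
  then have ne: "\<not> (\<forall>\<^sub>F y in at x. y \<notin> {z \<in> S. t \<le> u z})" by (simp add: islimpt_iff_eventually)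
  have op: "open S" using u harm_open by blast
  show "x \<in> {z \<in> S. t \<le> u z}"
  proof (cases "x \<in> S")
    case True
    have "t \<le> u x"
    proof (rule ccontr)
      assume "\<not> t \<le> u x"
      then have "\<forall>\<^sub>F y in at x. u y < t"
        using harm_isCont[OF u True] order_tendstoD(2)[of u "u x" "at x" t] by (auto simp: isCont_def)
      then have "\<forall>\<^sub>F y in at x. y \<notin> {z \<in> S. t \<le> u z}" by eventually_elim auto
      then show False using ne by simp
    qed
    then show ?thesis using True by simp
  next
    case False
    have "x islimpt S" using lim islimpt_subset by blast
    then have "x \<in> closure S" by (simp add: closure_def)
    then have "x \<in> frontier S" using False op by (simp add: frontier_def interior_open)
    then have "\<forall>\<^sub>F z in at x within S. u z < t" using bd t by blast
    then have "\<forall>\<^sub>F y in at x. y \<notin> {z \<in> S. t \<le> u z}"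
      unfolding eventually_at_filter by eventually_elim auto
    then show ?thesis using ne by simp
  qed
qed

text \<open>Outside the disc of radius \<open>R\<close> the function stays below \<open>t\<close>,
  so the superlevel set is compact and the maximum over \<open>S\<close> is attained, which
  \<open>harm_max_not_attained\<close> forbids. The point \<open>e\<close> outside \<open>S\<close>
  is the one from which that lemma measures distances.\<close>

lemma max_principle_aux:
  assumes u: "harm u S" and e: "e \<notin> S" and t: "t > 0"
    and bd: "\<And>x \<epsilon>. x \<in> frontier S \<Longrightarrow> \<epsilon> > 0 \<Longrightarrow> \<forall>\<^sub>F z in at x within S. u z < \<epsilon>"
    and R: "\<And>z. z \<in> S \<Longrightarrow> R < cmod z \<Longrightarrow> u z < t" and z0: "z0 \<in> S" "u z0 \<ge> t"
  shows False
proof -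
  let ?C = "{z \<in> S. t \<le> u z} \<inter> cball 0 R"
  have "closed {z \<in> S. t \<le> u z}" by (rule closed_superlevel[OF u t]) (rule bd)
  then have "compact ?C" using closed_Int_compact[OF _ compact_cball[of 0 R]] by blast
  moreover have "z0 \<in> ?C" using z0 R[of z0] by force
  moreover have "continuous_on ?C u" by (rule continuous_on_subset[OF harm_continuous_on[OF u]]) auto
  ultimately obtain y where y: "y \<in> ?C" "\<And>z. z \<in> ?C \<Longrightarrow> u z \<le> u y"
    using continuous_attains_sup[of ?C u] by blast
  have "u z \<le> u y" if "z \<in> S" for z
  proof (rule ccontr)
    assume less: "\<not> u z \<le> u y"
    have ty: "t \<le> u y" using y(1) by auto
    have "cmod z \<le> R" using R[OF that] less ty by linarith
    then have "z \<in> ?C" using that less ty by auto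
    then show False using y(2) less by blast
  qed
  moreover have "closed {z \<in> S. u y \<le> u z}" by (rule closed_superlevel[OF u]) (use y t bd in auto)
  ultimately show False using harm_max_not_attained[OF u e, of "u y" y] y by blast
qed

lemma max_principle:
  assumes u: "harm u S" and e: "e \<notin> S"
    and bd: "\<And>x \<epsilon>. x \<in> frontier S \<Longrightarrow> \<epsilon> > 0 \<Longrightarrow> \<forall>\<^sub>F z in at x within S. u z < \<epsilon>"
    and inf: "\<And>\<epsilon>. \<epsilon> > 0 \<Longrightarrow> \<exists>R. \<forall>z\<in>S. R < cmod z \<longrightarrow> u z < \<epsilon>"
    and z: "z \<in> S"
  shows "u z \<le> 0"
proof (rule ccontr)
  assume "\<not> u z \<le> 0"
  then have t: "u z > 0" by simp
  obtain R where R: "\<forall>y\<in>S. R < cmod y \<longrightarrow> u y < u z" using inf[OF t] by blast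
  show False by (rule max_principle_aux[OF u e t, of R z]) (use bd R z in auto)
qed

lemma max_principle_bounded:
  assumes u: "harm u S" and b: "bounded S"
    and bd: "\<And>x \<epsilon>. x \<in> frontier S \<Longrightarrow> \<epsilon> > 0 \<Longrightarrow> \<forall>\<^sub>F z in at x within S. u z < \<epsilon>"
    and z: "z \<in> S"
  shows "u z \<le> 0"
proof -
  obtain R where R: "\<forall>z\<in>S. cmod z \<le> R" using b bounded_iff by blast
  have "of_real (\<bar>R\<bar> + 1) \<notin> S" using R by fastforce
  moreover have "\<exists>R. \<forall>z\<in>S. R < cmod z \<longrightarrow> u z < \<epsilon>" for \<epsilon>
    by (rule exI[of _ R]) (use R in force)
  ultimately show ?thesis using bd by (intro max_principle[OF u _ _ _ z])
qed

text \<open>Here \<open>S\<close> contains a neighbourhood of infinity, and harmonicity at infinity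
  takes the place of a growth condition. The supremum may then be attained at infinity; the local
  argument in the chart moves it to a finite point.\<close>

lemma max_principle_sphere:
  assumes u: "harm u S" and e: "e \<notin> S" and cof: "bounded (- S)"
    and bd: "\<And>x \<epsilon>. x \<in> frontier S \<Longrightarrow> \<epsilon> > 0 \<Longrightarrow> \<forall>\<^sub>F z in at x within S. u z < \<epsilon>"
    and inf: "harm_at_inf u"
    and z: "z \<in> S"
  shows "u z \<le> 0"
proof (rule ccontr)
  assume "\<not> u z \<le> 0"
  then have t: "u z > 0" by simp
  obtain r q where r: "r > 0" and q: "harm q (ball 0 r)" and qu: "\<And>w. w \<in> ball 0 r - {0} \<Longrightarrow> q w = u (1 / w)"
    using inf unfolding harm_at_inf_def by blast
  obtain R0 where R0: "\<And>z. R0 < cmod z \<Longrightarrow> z \<in> S"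
    using cof unfolding bounded_iff by (metis ComplI leD)
  define R where "R = max (2 / r) R0 + 1"
  have R2: "2 / r < R" "2 / r > 0" using r by (auto simp: R_def)
  have R: "R > 0" "1 / R < r"
    using R2 r by (linarith, smt (verit) divide_less_eq mult.commute)
  have out: "q (1 / z) = u z" if "R < cmod z" for z
  proof -
    have "1 / cmod z < 1 / R" using that R by (intro divide_strict_left_mono mult_pos_pos) auto
    moreover have "z \<noteq> 0" using that R by auto
    ultimately show ?thesis using qu[of "1 / z"] R by (auto simp: norm_divide)
  qed
  have sub: "cball 0 (1/R) \<subseteq> ball 0 r" using R by auto
  have "continuous_on (cball 0 (1/R)) q" by (rule continuous_on_subset[OF harm_continuous_on[OF q] sub])
  then obtain w where w: "w \<in> cball 0 (1/R)" "\<And>y. y \<in> cball 0 (1/R) \<Longrightarrow> q y \<le> q w"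
    using continuous_attains_sup[of "cball 0 (1/R)" q] R by (metis cball_eq_empty compact_cball less_imp_le not_less zero_less_divide_1_iff)
  have le: "u z \<le> q w" if "R < cmod z" for z
  proof -
    have "1 / cmod z \<le> 1 / R" using that R by (intro divide_left_mono mult_pos_pos) auto
    then show ?thesis using w(2)[of "1 / z"] out[OF that] by (auto simp: norm_divide)
  qed
  show False
  proof (cases "\<exists>y\<in>S. u y > max 0 (q w)")
    case True
    then obtain y where y: "y \<in> S" "u y > 0" "u y > q w" by auto
    show False by (rule max_principle_aux[OF u e y(2), of R y]) (use bd y le in force)+
  next
    case False
    then have qw: "q w > 0" using t z by force
    have all: "u y \<le> q w" if "y \<in> S" for y using False that qw by force
    \<comment> \<open>If the maximum of \<open>q\<close> over the closed disc sits at 0, that is, at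
      infinity, then \<open>q\<close> is constant near 0. So there is a maximiser other than 0, and
      \<open>u\<close> attains its maximum at a finite point.\<close>
    have "\<exists>w'. w' \<in> cball 0 (1/R) \<and> w' \<noteq> 0 \<and> q w' = q w"
    proof (cases "w = 0")
      case True
      have "harm q (ball 0 (1/R))" by (rule harm_subset[OF q]) (use sub ball_subset_cball in auto)
      have q0: "q y \<le> q 0" if "y \<in> ball 0 (1/R)" for y using w(2)[of y] True that by simp
      have "(0::complex) \<in> ball 0 (1/R)" using R(1) by simp
      with \<open>harm q (ball 0 (1/R))\<close> obtain d where d: "d > 0" "ball 0 d \<subseteq> ball (0::complex) (1/R)" "\<And>y. y \<in> ball 0 d \<Longrightarrow> q y = q 0"
        by (rule harm_local_max_const, use q0 in blast) (rule that)
      have dd: "of_real (d/2) \<in> ball (0::complex) d" using d(1) by simp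
      have "of_real (d/2) \<noteq> (0::complex)" using d(1) by simp
      moreover have "of_real (d/2) \<in> cball (0::complex) (1/R)"
        by (rule subsetD[OF order_trans[OF d(2) ball_subset_cball] dd])
      moreover have "q (of_real (d/2)) = q w" using d(3)[OF dd] True by simp
      ultimately show ?thesis by blast
    qed (use w in auto)
    then obtain w' where w': "w' \<in> cball 0 (1/R)" "w' \<noteq> 0" "q w' = q w" by blast
    have uw: "u (1 / w') = q w" using qu[of w'] w' R(2) by auto
    have "R \<le> cmod (1 / w')" using w' R by (simp add: norm_divide le_divide_eq divide_le_eq mult.commute)
    then have "1 / w' \<in> S" using R0 by (simp add: R_def max_def split: if_splits)
    moreover have "closed {z \<in> S. q w \<le> u z}" by (rule closed_superlevel[OF u qw]) (rule bd)
    ultimately show False using harm_max_not_attained[OF u e all _ _ uw] by blast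
  qed
qed

section \<open>Gradient estimates\<close>

text \<open>\<open>exp (F / A)\<close> has modulus between \<open>exp (-1)\<close> and
  \<open>exp 1\<close>, although \<open>Im F\<close> is not controlled. Cauchy's inequality on the
  circle of radius \<open>d / 2\<close> bounds its derivative, and dividing by the modulus gives
  \<open>2 * exp 2 * A / d\<close>, where \<open>2 * exp 2 < 16\<close>.\<close>

lemma cgrad_bound:
  assumes u: "harm u (ball z d)" and d: "d > 0" and A: "A > 0" and le: "\<And>y. y \<in> ball z d \<Longrightarrow> \<bar>u y\<bar> \<le> A"
  shows "cmod (cgrad u z) \<le> 16 * A / d"
proof -
  obtain F where F: "F holomorphic_on ball z d" "\<And>y. y \<in> ball z d \<Longrightarrow> u y = Re (F y)"
    "\<And>y. y \<in> ball z d \<Longrightarrow> (F has_field_derivative cgrad u y) (at y)"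
    using harm_convex_Re[OF u convex_ball] by blast
  define G where "G = (\<lambda>y. exp (F y / of_real A))"
  have hG: "G holomorphic_on ball z d" unfolding G_def using A by (intro holomorphic_intros F) auto
  have sub: "cball z (d/2) \<subseteq> ball z d" using d by auto
  have nG: "cmod (G y) = exp (u y / A)" if "y \<in> ball z d" for y
    using F(2)[OF that] by (simp add: G_def)
  have "cmod ((deriv ^^ 1) G z) \<le> fact 1 * exp 1 / (d/2) ^ 1"
  proof (rule Cauchy_inequality)
    show "G holomorphic_on ball z (d/2)" using hG holomorphic_on_subset sub ball_subset_cball by blast
    show "continuous_on (cball z (d/2)) G" using hG holomorphic_on_imp_continuous_on continuous_on_subset sub by blast
    show "cmod (G x) \<le> exp 1" if "cmod (z - x) = d / 2" for x
    proof -
      have x: "x \<in> ball z d" using that d by (auto simp: dist_norm)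
      then show ?thesis using nG[OF x] le[OF x] A by (auto simp: divide_simps)
    qed
  qed (use d in auto)
  moreover have z: "z \<in> ball z d" using d by auto
  have "(G has_field_derivative G z * (cgrad u z / of_real A)) (at z)"
    unfolding G_def using A by (auto intro!: derivative_eq_intros F(3) z)
  then have "deriv G z = G z * (cgrad u z / of_real A)" by (rule DERIV_imp_deriv)
  ultimately have *: "cmod (G z) * cmod (cgrad u z) / A \<le> exp 1 * 2 / d"
    using A by (simp add: norm_mult norm_divide)
  have "exp (-1) \<le> cmod (G z)" using nG[OF z] le[OF z] A by (auto simp: divide_simps)
  then have "exp (-1) * cmod (cgrad u z) / A \<le> cmod (G z) * cmod (cgrad u z) / A"
    using A by (intro divide_right_mono mult_right_mono) auto
  with * have "exp (-1) * cmod (cgrad u z) / A \<le> exp 1 * 2 / d" by linarith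
  then have "exp 1 * (exp (-1) * cmod (cgrad u z) / A) \<le> exp 1 * (exp 1 * 2 / d)" by (rule mult_left_mono) auto
  then have "cmod (cgrad u z) / A \<le> exp 1 * exp 1 * 2 / d" by (simp add: exp_minus field_simps)
  also have "\<dots> \<le> 16 / d"
  proof -
    have "exp 1 * exp 1 \<le> (2.8 :: real) * 2.8" by (intro mult_mono) (use e_less_272 in auto)
    then show ?thesis using d by (intro divide_right_mono) auto
  qed
  finally show ?thesis using A d by (simp add: field_simps)
qed

lemma plus_inverse_strict_mono:
  fixes s t :: real
  assumes "1 \<le> s" "s < t" shows "s + 1 / s < t + 1 / t"
proof -
  have "(t + 1 / t) - (s + 1 / s) = (t - s) * (s * t - 1) / (s * t)"
    using assms by (simp add: field_simps)
  moreover have "1 < s * t" using assms by (smt (verit) mult_less_cancel_left1 mult_le_cancel_left1)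
  ultimately show ?thesis using assms by (smt (verit) divide_pos_pos mult_pos_pos)
qed

lemma less_if_plus_inverse_less:
  fixes s t :: real
  assumes "1 \<le> t" "1 \<le> s" "s + 1 / s < t + 1 / t" shows "s < t"
proof (rule ccontr)
  assume "\<not> s < t"
  then consider "s = t" | "t < s" by linarith
  then show False using plus_inverse_strict_mono[of t s] assms by cases auto
qed

lemma dist_sum_on_segment:
  assumes "z \<in> complex_of_real ` {al..be}"
  shows "cmod (z - of_real al) + cmod (z - of_real be) = be - al"
  using assms by (auto simp flip: of_real_diff simp del: of_real_diff)

text \<open>The two roots \<open>c + s\<close> and \<open>c - s\<close> of
  \<open>w + 1 / w = 2 * c\<close> have product 1, so one of them has modulus at least 1.\<close>

lemma joukowski_exists:
  fixes c :: complex
  obtains w where "cmod w \<ge> 1" "w + 1 / w = 2 * c"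
proof -
  define s where "s = csqrt (c\<^sup>2 - 1)"
  have p: "(c + s) * (c - s) = 1" by (simp add: s_def algebra_simps power2_eq_square[symmetric])
  then have inv: "1 / (c + s) = c - s" "1 / (c - s) = c + s"
    using inverse_unique[OF p] inverse_unique[of "c - s" "c + s"] by (auto simp: divide_inverse mult.commute)
  have "cmod (c + s) * cmod (c - s) = 1" using p by (metis norm_mult norm_one)
  then have "cmod (c + s) \<ge> 1 \<or> cmod (c - s) \<ge> 1"
    by (smt (verit) mult_le_one mult_less_cancel_left2 norm_ge_zero mult_strict_mono')
  then show ?thesis using that[of "c + s"] that[of "c - s"] inv by auto
qed

lemma cgrad_comp:
  assumes "harm u S" "f z \<in> S" "(f has_field_derivative D) (at z)"
  shows "cgrad (\<lambda>z. u (f z)) z = cgrad u (f z) * D"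
proof (rule cgrad_eq_if_has_derivative)
  have "(f has_derivative (\<lambda>h. D * h)) (at z)" using assms(3) by (simp add: has_field_derivative_def)
  from diff_chain_at[OF this harm_has_derivative[OF assms(1,2)]]
  show "((\<lambda>z. u (f z)) has_derivative (\<lambda>h. Re (cgrad u (f z) * D * h))) (at z)"
    by (simp add: o_def mult.assoc)
qed

text \<open>The inverse Joukowski map turns the ellipse with foci \<open>al\<close>, \<open>be\<close> minus the slit into an annulus, where \<open>v\<close>
  is compared with a multiple of \<open>ln |w|\<close>.\<close>
lemma slit_cgrad_bound:
  fixes al be R A :: real and v :: "complex \<Rightarrow> real"
  defines "J \<equiv> complex_of_real ` {al..be}"
  defines "N \<equiv> \<lambda>R. {z. cmod (z - of_real al) + cmod (z - of_real be) < (be - al) / 2 * (R + 1 / R)}"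
  assumes ab: "al < be" and R: "1 < R" and A: "A > 0"
    and v: "harm v (N R - J)" and le: "\<And>z. z \<in> N R - J \<Longrightarrow> \<bar>v z\<bar> \<le> A"
    and bd: "\<And>x. x \<in> J \<Longrightarrow> (v \<longlongrightarrow> 0) (at x within - J)"
    and z: "z \<in> N ((1 + R) / 2) - J"
  shows "cmod (cgrad v z) * sqrt (cmod (z - of_real al) * cmod (z - of_real be)) \<le> 32 * A * R / ln R"
proof -
  define l where "l = (be - al) / 4"
  define m where "m = (al + be) / 2"
  have l: "l > 0" using ab by (simp add: l_def)
  have alm: "al = m - 2 * l" and bem: "be = m + 2 * l" by (auto simp: l_def m_def field_simps)
  \<comment> \<open>Scaled Joukowski map: \<open>w = 1\<close> and \<open>w = -1\<close> go to the
    foci \<open>be\<close> and \<open>al\<close>, the unit circle goes into the slit, and on the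
    image of the circle of radius \<open>t\<close> the focal distances sum to
    \<open>2 * l * (t + 1 / t)\<close>.\<close>
  define j where "j = (\<lambda>w. of_real m + of_real l * (w + 1 / w) :: complex)"
  have jal: "j w - of_real al = of_real l * (w + 1)\<^sup>2 / w" if "w \<noteq> 0" for w
    using that by (simp add: j_def alm field_simps power2_eq_square)
  have jbe: "j w - of_real be = of_real l * (w - 1)\<^sup>2 / w" if "w \<noteq> 0" for w
    using that by (simp add: j_def bem field_simps power2_eq_square)
  have par: "(cmod (w + 1))\<^sup>2 + (cmod (w - 1))\<^sup>2 = 2 * ((cmod w)\<^sup>2 + 1)" for w
    unfolding cmod_power2 by (simp add: power2_eq_square algebra_simps)
  have jsum: "cmod (j w - of_real al) + cmod (j w - of_real be) = 2 * l * (cmod w + 1 / cmod w)" if "w \<noteq> 0" for w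
  proof -
    have "cmod (j w - of_real al) + cmod (j w - of_real be) = l * ((cmod (w + 1))\<^sup>2 + (cmod (w - 1))\<^sup>2) / cmod w"
      using l by (simp add: jal[OF that] jbe[OF that] norm_mult norm_divide norm_power add_divide_distrib distrib_left)
    then show ?thesis using that unfolding par by (simp add: field_simps power2_eq_square)
  qed
  have l2: "(be - al) / 2 = 2 * l" by (simp add: l_def)
  define Ann where "Ann = {w. 1 < cmod w \<and> cmod w < R}"
  have opA: "open Ann" unfolding Ann_def by (intro open_Collect_conj open_Collect_less continuous_intros)
  have jN: "j w \<in> N T - J" if "1 < cmod w" "cmod w < T" for w T
  proof -
    have "w \<noteq> 0" using that by auto
    note s = jsum[OF this]
    have "cmod w + 1 / cmod w < T + 1 / T" using plus_inverse_strict_mono[of "cmod w" T] that by simp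
    then have "j w \<in> N T" using s l by (simp add: N_def l2)
    moreover have "1 + 1 / 1 < cmod w + 1 / cmod w" using plus_inverse_strict_mono[of 1 "cmod w"] that by simp
    then have "cmod (j w - of_real al) + cmod (j w - of_real be) > 4 * l" using s l by simp
    then have "j w \<notin> J" using dist_sum_on_segment[of "j w" al be] by (auto simp: J_def l_def)
    ultimately show ?thesis by simp
  qed
  have jcirc: "j w \<in> J" if "cmod w = 1" for w
  proof -
    have "1 / w = cnj w" using that complex_div_cnj[of 1 w] by simp
    then have "j w = of_real (m + 2 * l * Re w)" by (simp add: j_def complex_eq_iff)
    moreover have "\<bar>Re w\<bar> \<le> 1" using abs_Re_le_cmod[of w] that by simp
    then have "m + 2 * l * Re w \<in> {al..be}" using l by (auto simp: alm bem abs_le_iff) (smt (verit) mult_left_mono mult_minus_right mult_cancel_left2)+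
    ultimately show ?thesis unfolding J_def by (metis imageI)
  qed
  have jhol: "j holomorphic_on - {0}" unfolding j_def by (intro holomorphic_intros) auto
  have jcont: "isCont j w" if "w \<noteq> 0" for w unfolding j_def using that by (intro continuous_intros)
  define vh where "vh = (\<lambda>w. v (j w))"
  have vh: "harm vh Ann" unfolding vh_def
  proof (rule harm_comp[OF v _ opA])
    show "j holomorphic_on Ann" by (rule holomorphic_on_subset[OF jhol]) (auto simp: Ann_def)
    show "j ` Ann \<subseteq> N R - J" using jN[of _ R] by (auto simp: Ann_def)
  qed
  have vhle: "\<bar>vh w\<bar> \<le> A" if "w \<in> Ann" for w
    unfolding vh_def using jN[of w R] that le by (auto simp: Ann_def)
  have lnR: "ln R > 0" using R by simp
  have logharm: "harm (\<lambda>w. ln (cmod w)) Ann"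
    by (rule harm_ln_norm[OF _ opA, of "\<lambda>w. w"]) (auto simp: Ann_def)
  \<comment> \<open>Comparison with \<open>A * ln |w| / ln R\<close>, which is 0 on the unit circle,
    where \<open>vh\<close> tends to 0, and \<open>A\<close> on the outer circle. The sign \<sigma>
    covers the upper and the lower bound.\<close>
  have bnd: "\<sigma> * vh w - A / ln R * ln (cmod w) \<le> 0" if w: "w \<in> Ann" and s: "\<bar>\<sigma>\<bar> = 1" for \<sigma> w
  proof (rule max_principle_bounded[where u = "\<lambda>w. \<sigma> * vh w - A / ln R * ln (cmod w)", OF _ _ _ w])
    show "harm (\<lambda>w. \<sigma> * vh w - A / ln R * ln (cmod w)) Ann"
      by (intro harm_diff harm_cmult vh logharm)
    show "bounded Ann" unfolding bounded_iff Ann_def by (rule exI[of _ R]) auto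
    fix x \<epsilon> :: "_" assume x: "x \<in> frontier Ann" and e: "(\<epsilon>::real) > 0"
    have "x \<notin> Ann" using x opA by (simp add: frontier_def interior_open)
    moreover have "Ann \<subseteq> {w. 1 \<le> cmod w \<and> cmod w \<le> R}" by (auto simp: Ann_def)
    then have "closure Ann \<subseteq> {w. 1 \<le> cmod w \<and> cmod w \<le> R}"
      by (rule closure_minimal) (intro closed_Collect_conj closed_Collect_le continuous_intros)
    then have "1 \<le> cmod x" "cmod x \<le> R" using x by (auto simp: frontier_def)
    ultimately have "cmod x = 1 \<or> cmod x = R" by (auto simp: Ann_def)
    then have x0: "x \<noteq> 0" using R by auto
    have lnlim: "((\<lambda>w. A / ln R * ln (cmod w)) \<longlongrightarrow> A / ln R * ln (cmod x)) (at x within Ann)"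
      by (intro tendsto_intros) (use x0 in auto)
    from \<open>cmod x = 1 \<or> cmod x = R\<close> show "\<forall>\<^sub>F w in at x within Ann. \<sigma> * vh w - A / ln R * ln (cmod w) < \<epsilon>"
    proof
      assume x1: "cmod x = 1"
      have "filterlim j (at (j x) within - J) (at x within Ann)"
        unfolding filterlim_at
      proof
        show "(j \<longlongrightarrow> j x) (at x within Ann)" using jcont[OF x0] isContD tendsto_within_subset by blast
        show "\<forall>\<^sub>F w in at x within Ann. j w \<in> - J \<and> j w \<noteq> j x"
        proof -
          have "j w \<in> - J \<and> j w \<noteq> j x" if "w \<in> Ann" for w
            using jN[of w R] jcirc[OF x1] that by (auto simp: Ann_def)
          then show ?thesis by (simp add: eventually_at_filter)
        qed
      qed
      then have "(vh \<longlongrightarrow> 0) (at x within Ann)"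
        unfolding vh_def using bd[OF jcirc[OF x1]] filterlim_compose by blast
      then have "((\<lambda>w. \<sigma> * vh w - A / ln R * ln (cmod w)) \<longlongrightarrow> \<sigma> * 0 - A / ln R * ln (cmod x)) (at x within Ann)"
        by (intro tendsto_diff lnlim tendsto_mult_left)
      then show ?thesis using x1 e by (auto dest: order_tendstoD(2))
    next
      assume xR: "cmod x = R"
      have "\<forall>\<^sub>F w in at x within Ann. A / ln R * ln (cmod w) > A - \<epsilon>"
        using order_tendstoD(1)[OF lnlim, of "A - \<epsilon>"] xR lnR e by simp
      moreover have "\<forall>\<^sub>F w in at x within Ann. w \<in> Ann" by (simp add: eventually_at_filter)
      ultimately show ?thesis
      proof eventually_elim
        case (elim w)
        have "\<sigma> * vh w \<le> A" using vhle[OF elim(2)] s by (smt (verit) mult_cancel_right2 mult_minus_left mult_cancel_right1)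
        then show ?case using elim by linarith
      qed
    qed
  qed
  have vlog: "\<bar>vh w\<bar> \<le> A / ln R * ln (cmod w)" if "w \<in> Ann" for w
    using bnd[OF that, of 1] bnd[OF that, of "-1"] by auto
  obtain w where w: "cmod w \<ge> 1" "w + 1 / w = 2 * ((z - of_real m) / (2 * of_real l))"
    using joukowski_exists by blast
  have w0: "w \<noteq> 0" using w by auto
  have "2 * (a / (2 * b)) = a / b" for a b :: complex by simp
  then have "w + 1 / w = (z - of_real m) / of_real l" using w(2) by metis
  then have jw: "j w = z" using l by (simp add: j_def)
  have w1: "cmod w > 1" using w(1) jcirc[of w] jw z by force
  have "cmod w + 1 / cmod w < (1 + R) / 2 + 1 / ((1 + R) / 2)"
    using z jsum[OF w0] l by (auto simp: N_def l2 jw)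
  then have wR: "cmod w < (1 + R) / 2" by (rule less_if_plus_inverse_less[rotated 2]) (use w1 R in auto)
  \<comment> \<open>\<open>d\<close> is the distance from \<open>w\<close> to the unit circle. On
    the ball of radius \<open>d\<close> the function \<open>vh\<close> is at most
    \<open>2 * d * A / ln R\<close>, so \<open>d\<close> cancels in the gradient bound. That
    \<open>z\<close> lies in the smaller ellipse gives \<open>|w| < (1 + R) / 2\<close>, which keeps
    this ball inside the annulus.\<close>
  define d where "d = cmod w - 1"
  have d: "d > 0" using w1 by (simp add: d_def)
  have ballA: "y \<in> Ann \<and> cmod y < 2 * cmod w - 1" if "y \<in> ball w d" for y
    using norm_triangle_ineq2[of w y] norm_triangle_ineq2[of y w] that wR
    by (auto simp: Ann_def d_def dist_norm norm_minus_commute)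
  have "cmod (cgrad vh w) \<le> 16 * (A / ln R * (2 * d)) / d"
  proof (rule cgrad_bound[OF _ d])
    show "harm vh (ball w d)" by (rule harm_subset[OF vh]) (use ballA in auto)
    show "A / ln R * (2 * d) > 0" using A lnR d by simp
    show "\<bar>vh y\<bar> \<le> A / ln R * (2 * d)" if "y \<in> ball w d" for y
    proof -
      have y: "y \<in> Ann" "cmod y < 2 * cmod w - 1" using ballA[OF that] by auto
      have "ln (cmod y) \<le> cmod y - 1" using y by (intro ln_le_minus_one) (auto simp: Ann_def)
      also have "\<dots> \<le> 2 * d" using y by (simp add: d_def)
      finally have "A / ln R * ln (cmod y) \<le> A / ln R * (2 * d)" using A lnR by (intro mult_left_mono) auto
      then show ?thesis using vlog[OF y(1)] by linarith
    qed
  qed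
  then have g: "cmod (cgrad vh w) \<le> 32 * A / ln R" using d by (simp add: field_simps)
  have "(j has_field_derivative of_real l * (1 - 1 / w\<^sup>2)) (at w)"
    unfolding j_def using w0 by (auto intro!: derivative_eq_intros simp: power2_eq_square field_simps)
  then have "cgrad vh w = cgrad v z * (of_real l * (1 - 1 / w\<^sup>2))"
    unfolding vh_def using cgrad_comp[OF v] jN[of w R] w1 wR R jw by simp
  then have "cmod (cgrad vh w) = cmod (cgrad v z) * (l * cmod (1 - 1 / w\<^sup>2))"
    using l by (simp add: norm_mult)
  \<comment> \<open>The left side is the modulus of the derivative of \<open>j\<close> at
    \<open>w\<close>. The product of the focal distances is the square of
    \<open>l * |w^2 - 1| / |w|\<close>, which is the origin of the square root in the claim.\<close>
  also have "l * cmod (1 - 1 / w\<^sup>2) = sqrt (cmod (z - of_real al) * cmod (z - of_real be)) / cmod w"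
  proof -
    have "cmod (z - of_real al) * cmod (z - of_real be) = (l * cmod (w\<^sup>2 - 1) / cmod w)\<^sup>2"
    proof -
      have "(z - of_real al) * (z - of_real be) = (of_real l * (w\<^sup>2 - 1) / w)\<^sup>2"
      proof -
        have "(z - of_real al) * (z - of_real be) = (of_real l * (w + 1)\<^sup>2 / w) * (of_real l * (w - 1)\<^sup>2 / w)"
          using jal[OF w0] jbe[OF w0] unfolding jw by simp
        also have "\<dots> = (of_real l * (w\<^sup>2 - 1) / w)\<^sup>2"
          by (simp add: power2_eq_square) (simp add: algebra_simps)
        finally show ?thesis .
      qed
      then have "cmod ((z - of_real al) * (z - of_real be)) = (cmod (of_real l * (w\<^sup>2 - 1) / w))\<^sup>2"
        by (simp add: norm_power)
      then show ?thesis using l by (simp add: norm_mult norm_divide)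
    qed
    then have A1: "sqrt (cmod (z - of_real al) * cmod (z - of_real be)) = l * cmod (w\<^sup>2 - 1) / cmod w"
      using l by (simp add: real_sqrt_unique)
    have B1: "cmod (1 - 1 / w\<^sup>2) = cmod (w\<^sup>2 - 1) / (cmod w)\<^sup>2"
    proof -
      have "1 - 1 / w\<^sup>2 = (w\<^sup>2 - 1) / w\<^sup>2" using w0 by (simp add: field_simps)
      then show ?thesis by (simp add: norm_divide norm_power)
    qed
    show ?thesis unfolding A1 B1 by (simp add: power2_eq_square)
  qed
  finally have "cmod (cgrad v z) * sqrt (cmod (z - of_real al) * cmod (z - of_real be)) = cmod (cgrad vh w) * cmod w"
    using w0 by (simp add: field_simps)
  also have "\<dots> \<le> 32 * A / ln R * R"
    using g wR R w1 A lnR by (intro mult_mono) auto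
  finally show ?thesis by simp
qed

section \<open>Green's functions and harmonic measure\<close>

lemma harm_at_inf_binop:
  assumes "harm_at_inf u" "harm_at_inf v"
    and h: "\<And>u v S. harm u S \<Longrightarrow> harm v S \<Longrightarrow> harm (\<lambda>z. h (u z) (v z)) S"
  shows "harm_at_inf (\<lambda>z. h (u z) (v z))"
proof -
  obtain r q where r: "r > 0" "harm q (ball 0 r)" "\<And>w. w \<in> ball 0 r - {0} \<Longrightarrow> q w = u (1 / w)"
    using assms(1) unfolding harm_at_inf_def by blast
  obtain r' q' where r': "r' > 0" "harm q' (ball 0 r')" "\<And>w. w \<in> ball 0 r' - {0} \<Longrightarrow> q' w = v (1 / w)"
    using assms(2) unfolding harm_at_inf_def by blast
  have "harm (\<lambda>z. h (q z) (q' z)) (ball 0 (min r r'))"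
    by (intro h harm_subset[OF r(2)] harm_subset[OF r'(2)]) auto
  then show ?thesis unfolding harm_at_inf_def
    using r r' by (intro exI[of _ "min r r'"] conjI exI[of _ "\<lambda>z. h (q z) (q' z)"]) auto
qed

lemma harm_at_inf_add: "harm_at_inf u \<Longrightarrow> harm_at_inf v \<Longrightarrow> harm_at_inf (\<lambda>z. u z + v z)"
  by (rule harm_at_inf_binop[where h = "(+)"]) (auto intro: harm_add)

lemma harm_at_inf_diff: "harm_at_inf u \<Longrightarrow> harm_at_inf v \<Longrightarrow> harm_at_inf (\<lambda>z. u z - v z)"
  by (rule harm_at_inf_binop[where h = "(-)"]) (auto intro: harm_diff)

lemma harm_at_inf_cmult: "harm_at_inf u \<Longrightarrow> harm_at_inf (\<lambda>z. c * u z)"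
  by (rule harm_at_inf_binop[where h = "\<lambda>x y. c * x", of u u]) (auto intro: harm_cmult)

lemma harm_at_inf_const: "harm_at_inf (\<lambda>z. c)"
  unfolding harm_at_inf_def by (intro exI[of _ 1] conjI exI[of _ "\<lambda>_. c"]) (auto simp: harm_const)

lemma harm_at_inf_sum: "(\<And>i. i \<in> I \<Longrightarrow> harm_at_inf (u i)) \<Longrightarrow> harm_at_inf (\<lambda>z. \<Sum>i\<in>I. u i z)"
  by (induction I rule: infinite_finite_induct) (auto simp: harm_at_inf_const harm_at_inf_add)

lemma harm_at_inf_minus: "harm_at_inf u \<Longrightarrow> harm_at_inf (\<lambda>z. - u z)"
  using harm_at_inf_cmult[of u "-1"] by simp

lemma tendsto_at_infinity_of_inverse:
  assumes "isCont q 0" "r > 0" "\<And>w. w \<in> ball 0 r - {0} \<Longrightarrow> q w = u (1 / w)"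
  shows "(u \<longlongrightarrow> q 0) (at_infinity :: complex filter)"
proof -
  have "((\<lambda>z. q (inverse z)) \<longlongrightarrow> q 0) (at_infinity :: complex filter)"
    using isCont_tendsto_compose[OF assms(1) tendsto_inverse_0] .
  moreover have "\<forall>\<^sub>F z in at_infinity. q (inverse z) = u z"
    unfolding eventually_at_infinity
  proof (intro exI[of _ "1 / r + 1"] allI impI)
    fix z :: complex assume z: "1 / r + 1 \<le> cmod z"
    then have zr: "1 / r < cmod z" "z \<noteq> 0" using assms(2) by (auto simp: add_pos_pos not_le)
      (smt (verit) zero_less_divide_1_iff)
    have "1 / cmod z < r" using zr assms(2) by (simp add: pos_divide_less_eq mult.commute)
    then have "cmod (inverse z) < r" by (simp add: norm_inverse divide_inverse)
    then show "q (inverse z) = u z" using assms(3)[of "inverse z"] zr by (simp add: inverse_eq_divide)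
  qed
  ultimately show ?thesis by (rule Lim_transform_eventually)
qed

lemma harm_at_inf_tendsto:
  assumes "harm_at_inf u" obtains c where "(u \<longlongrightarrow> c) at_infinity"
proof -
  obtain r q where r: "r > 0" "harm q (ball 0 r)" "\<And>w. w \<in> ball 0 r - {0} \<Longrightarrow> q w = u (1 / w)"
    using assms unfolding harm_at_inf_def by blast
  have "isCont q 0" using harm_isCont[OF r(2)] r(1) by simp
  from tendsto_at_infinity_of_inverse[OF this r(1,3)] that show ?thesis by blast
qed

text \<open>Subtracting \<open>ln |z|\<close> removes the pole at infinity, so that the difference
  of two such functions qualifies for \<open>max_principle_sphere\<close>.\<close>

definition green_inf :: "complex set \<Rightarrow> (complex \<Rightarrow> real) \<Rightarrow> bool" where
  "green_inf K G \<longleftrightarrow> harm G (- K) \<and> (\<forall>x\<in>K. (G \<longlongrightarrow> 0) (at x within - K)) \<and> harm_at_inf (\<lambda>z. G z - ln (cmod z))"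

definition green_pt :: "complex set \<Rightarrow> complex \<Rightarrow> (complex \<Rightarrow> real) \<Rightarrow> bool" where
  "green_pt K p G \<longleftrightarrow> p \<notin> K \<and> harm G (- K - {p}) \<and> (\<forall>x\<in>K. (G \<longlongrightarrow> 0) (at x within - K)) \<and> harm_at_inf G \<and>
     (\<exists>r>0. \<exists>v. harm v (ball p r) \<and> (\<forall>z\<in>ball p r - {p}. G z = v z - ln (cmod (z - p))))"

text \<open>The indicator is the boundary value at every point of \<open>K\<close>, which suits a
  set \<open>A\<close> that is relatively open and closed in \<open>K\<close>, such as a component.
  The harmonic measure itself is the value of \<open>U\<close> at infinity, read off in the chart
  \<open>1 / w\<close>.\<close>

definition hmeas :: "complex set \<Rightarrow> complex set \<Rightarrow> (complex \<Rightarrow> real) \<Rightarrow> real \<Rightarrow> bool" where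
  "hmeas K A U \<omega> \<longleftrightarrow> harm U (- K) \<and> (\<forall>x\<in>K. (U \<longlongrightarrow> indicator A x) (at x within - K)) \<and>
     (\<exists>r>0. \<exists>q. harm q (ball 0 r) \<and> q 0 = \<omega> \<and> (\<forall>w\<in>ball 0 r - {0}. q w = U (1 / w)))"

section \<open>Passage from functions on the sphere to functions on the plane\<close>

lemma green_inf_if_is_green_function:
  assumes g: "is_green_function K None g" and K: "compact K"
  shows "green_inf K (\<lambda>z. g (Some z))"
proof -
  have op: "open (- K)" using K compact_imp_closed by blast
  have 1: "{z. Some z \<in> - (Some ` K) - {None}} = - K" by auto
  have h: "harm (\<lambda>z. g (Some z)) (- K)"
    using g harmonic_on_imp_harm[OF _ op] unfolding is_green_function_def sphere_harmonic_on_def 1 by blast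
  obtain r v where r: "r > 0" "harmonic_on v (ball 0 r)" "\<And>w. w \<in> ball 0 r - {0} \<Longrightarrow> g (Some (1 / w)) = ln (1 / cmod w) + v w"
    using g unfolding is_green_function_def by auto
  have "harm_at_inf (\<lambda>z. g (Some z) - ln (cmod z))"
    unfolding harm_at_inf_def
  proof (intro exI conjI ballI)
    show "r > 0" by fact
    show "harm v (ball 0 r)" using harmonic_on_imp_harm r(2) by auto
    show "v w = g (Some (1 / w)) - ln (cmod (1 / w))" if "w \<in> ball 0 r - {0}" for w
      using r(3)[OF that] by (simp add: norm_divide)
  qed
  then show ?thesis using h g unfolding green_inf_def is_green_function_def by auto
qed

lemma green_pt_if_is_green_function:
  assumes g: "is_green_function K (Some p) g" and K: "compact K"
  shows "green_pt K p (\<lambda>z. g (Some z))"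
proof -
  have op: "open (- K - {p})" using K compact_imp_closed by blast
  have 1: "{z. Some z \<in> - (Some ` K) - {Some p}} = - K - {p}" by auto
  have h: "harm (\<lambda>z. g (Some z)) (- K - {p})"
    using g harmonic_on_imp_harm[OF _ op] unfolding is_green_function_def sphere_harmonic_on_def 1 by blast
  obtain r v where r: "r > 0" "harmonic_on v (ball 0 r)" "\<And>w. w \<in> ball 0 r - {0} \<Longrightarrow> g (Some (p + w)) = ln (1 / cmod w) + v w"
    using g unfolding is_green_function_def by auto
  have "\<exists>r>0. \<exists>v. harm v (ball p r) \<and> (\<forall>z\<in>ball p r - {p}. g (Some z) = v z - ln (cmod (z - p)))"
  proof (intro exI conjI ballI)
    show "r > 0" by fact
    have "harm v (ball 0 r)" using harmonic_on_imp_harm r(2) by auto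
    then show "harm (\<lambda>z. v (z - p)) (ball p r)"
      by (rule harm_comp) (auto intro!: holomorphic_intros simp: dist_norm norm_minus_commute)
    show "g (Some z) = v (z - p) - ln (cmod (z - p))" if "z \<in> ball p r - {p}" for z
    proof -
      have "z - p \<in> ball 0 r - {0}" using that by (auto simp: dist_norm norm_minus_commute)
      from r(3)[OF this] that show ?thesis by (simp add: ln_div)
    qed
  qed
  moreover have "harm_at_inf (\<lambda>z. g (Some z))"
  proof -
    have "None \<in> - (Some ` K) - {Some p}" by auto
    then obtain r where r: "r > 0" "harmonic_on (\<lambda>w. g (at_inverse w)) (ball 0 r)"
      using g unfolding is_green_function_def sphere_harmonic_on_def by auto
    show ?thesis unfolding harm_at_inf_def
      using r harmonic_on_imp_harm[OF r(2)] by (intro exI[of _ r] conjI exI[of _ "\<lambda>w. g (at_inverse w)"]) (auto simp: at_inverse_def)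
  qed
  ultimately show ?thesis using h g unfolding green_pt_def is_green_function_def by auto
qed

lemma hmeas_if_is_harmonic_measure:
  assumes u: "is_harmonic_measure None A K \<omega>" and K: "compact K"
    and cont: "\<And>x. x \<in> K \<Longrightarrow> continuous (at x within K) (indicator A :: complex \<Rightarrow> real)"
  obtains U where "hmeas K A U \<omega>"
proof -
  have op: "open (- K)" using K compact_imp_closed by blast
  obtain u where u: "sphere_harmonic_on u (- (Some ` K))" "\<omega> = u None"
    "\<And>x. x \<in> K \<Longrightarrow> ((\<lambda>y. u (Some y)) \<longlongrightarrow> indicator A x) (at x within - K)"
    using u cont unfolding is_harmonic_measure_def by blast
  have 1: "{z. Some z \<in> - (Some ` K)} = - K" by auto
  have "harm (\<lambda>z. u (Some z)) (- K)"
    using u(1) harmonic_on_imp_harm[OF _ op] unfolding sphere_harmonic_on_def 1 by blast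
  moreover have "None \<in> - (Some ` K)" by auto
  then obtain r where r: "r > 0" "harmonic_on (\<lambda>w. u (at_inverse w)) (ball 0 r)"
    using u(1) unfolding sphere_harmonic_on_def by auto
  have "\<exists>r>0. \<exists>q. harm q (ball 0 r) \<and> q 0 = \<omega> \<and> (\<forall>w\<in>ball 0 r - {0}. q w = u (Some (1 / w)))"
    using r harmonic_on_imp_harm[OF r(2)] u(2)
    by (intro exI[of _ r] conjI exI[of _ "\<lambda>w. u (at_inverse w)"]) (auto simp: at_inverse_def)
  ultimately show ?thesis using u(3) that[of "\<lambda>z. u (Some z)"] unfolding hmeas_def by blast
qed

lemma hmeas_harm_at_inf: "hmeas K A U \<omega> \<Longrightarrow> harm_at_inf U"
  unfolding hmeas_def harm_at_inf_def by blast

section \<open>Symmetry under complex conjugation\<close>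

lemma frontier_Compl_finite:
  fixes K F :: "complex set"
  assumes "closed K" "x \<in> frontier (- K - F)" "finite F" shows "x \<in> K \<union> F"
proof -
  have "open (- K - F)" using assms by (intro open_Diff) (auto intro: finite_imp_closed)
  then have "x \<notin> - K - F" using assms(2) by (simp add: frontier_def interior_open)
  then show ?thesis by auto
qed

lemma tendsto_cnj_within:
  assumes "(u \<longlongrightarrow> c) (at x within S)" "cnj x = x" "cnj -` S = S"
  shows "((\<lambda>z. u (cnj z)) \<longlongrightarrow> c) (at x within S)"
proof -
  have "filterlim cnj (at x within S) (at x within S)"
    unfolding filterlim_at
  proof
    have "(cnj \<longlongrightarrow> cnj x) (at x within S)" by (intro tendsto_intros)
    then show "(cnj \<longlongrightarrow> x) (at x within S)" by (simp add: assms(2))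
    show "\<forall>\<^sub>F z in at x within S. cnj z \<in> S \<and> cnj z \<noteq> x"
      using assms(2,3) by (auto simp: eventually_at_filter set_eq_iff) (metis (mono_tags, lifting) complex_cnj_cnj eventuallyI)
  qed
  from filterlim_compose[OF assms(1) this] show ?thesis .
qed

text \<open>\<open>u (cnj z) - u z\<close> changes sign under conjugation, so the upper bound 0 at
  both \<open>z\<close> and \<open>cnj z\<close> forces equality.\<close>

lemma cnj_symmetric:
  assumes u: "harm u S" and S: "cnj -` S = S" "e \<notin> S"
    and bd: "\<And>x. x \<in> frontier S \<Longrightarrow> ((\<lambda>z. u (cnj z) - u z) \<longlongrightarrow> 0) (at x within S)"
    and inf: "((\<lambda>z. u (cnj z) - u z) \<longlongrightarrow> 0) at_infinity" and z: "z \<in> S"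
  shows "u (cnj z) = u z"
proof -
  have le: "u (cnj z) - u z \<le> 0" if "z \<in> S" for z
  proof (rule max_principle[where u = "\<lambda>z. u (cnj z) - u z", OF _ S(2) _ _ that])
    show "harm (\<lambda>z. u (cnj z) - u z) S" using harm_diff[OF harm_cnj[OF u, unfolded S(1)] u] .
    show "\<forall>\<^sub>F z in at x within S. u (cnj z) - u z < \<epsilon>" if "x \<in> frontier S" "\<epsilon> > 0" for x \<epsilon>
      using order_tendstoD(2)[OF bd[OF that(1)] that(2)] .
    show "\<exists>R. \<forall>z\<in>S. R < cmod z \<longrightarrow> u (cnj z) - u z < \<epsilon>" if "\<epsilon> > 0" for \<epsilon>
      using order_tendstoD(2)[OF inf that] unfolding eventually_at_infinity by (meson less_imp_le)
  qed
  have "cnj z \<in> S" using z S(1) by blast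
  from le[OF z] le[OF this] show ?thesis by simp
qed

lemma tendsto_cnj_at_infinity:
  assumes "(u \<longlongrightarrow> c) at_infinity" shows "((\<lambda>z. u (cnj z)) \<longlongrightarrow> c) at_infinity"
proof -
  have "filterlim cnj at_infinity at_infinity"
    unfolding filterlim_at_infinity[OF order_refl] by (auto simp: eventually_at_infinity)
  from filterlim_compose[OF assms this] show ?thesis .
qed

lemma real_set_cnj:
  assumes "K \<subseteq> \<real>" shows "cnj -` (- K) = - K" "x \<in> K \<Longrightarrow> cnj x = x"
proof -
  have "cnj z \<in> K \<longleftrightarrow> z \<in> K" for z using assms by (metis Reals_cnj_iff complex_cnj_cnj subsetD)
  then show "cnj -` (- K) = - K" by auto
  show "x \<in> K \<Longrightarrow> cnj x = x" using assms Reals_cnj_iff by blast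
qed

text \<open>At infinity \<open>G\<close> is unbounded, but \<open>G - ln |z|\<close> has a limit,
  and the logarithm is the same at \<open>z\<close> and at \<open>cnj z\<close>.\<close>

lemma green_inf_cnj:
  assumes G: "green_inf K G" and K: "compact K" "K \<noteq> {}" "K \<subseteq> \<real>" and z: "z \<notin> K"
  shows "G (cnj z) = G z"
proof -
  obtain e where e: "e \<in> K" using K by blast
  show ?thesis
  proof (rule cnj_symmetric[of G "- K" e])
    show "harm G (- K)" using G by (simp add: green_inf_def)
    show "cnj -` (- K) = - K" by (rule real_set_cnj[OF K(3)])
    show "((\<lambda>z. G (cnj z) - G z) \<longlongrightarrow> 0) (at x within - K)" if "x \<in> frontier (- K)" for x
    proof -
      have x: "x \<in> K" using frontier_Compl_finite[of K x "{}"] that K by (auto simp: compact_imp_closed)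
      then have "(G \<longlongrightarrow> 0) (at x within - K)" using G by (simp add: green_inf_def)
      from tendsto_diff[OF tendsto_cnj_within[OF this real_set_cnj(2)[OF K(3) x] real_set_cnj(1)[OF K(3)]] this]
      show ?thesis by simp
    qed
    obtain c where c: "((\<lambda>z. G z - ln (cmod z)) \<longlongrightarrow> c) at_infinity"
      using G harm_at_inf_tendsto unfolding green_inf_def by blast
    from tendsto_diff[OF tendsto_cnj_at_infinity[OF c] c]
    show "((\<lambda>z. G (cnj z) - G z) \<longlongrightarrow> 0) at_infinity" by simp
  qed (use z e in auto)
qed

text \<open>At the real pole the logarithms cancel because \<open>|cnj z - p| = |z - p|\<close>, and
  only the difference of the regular parts remains.\<close>

lemma green_pt_cnj:
  assumes G: "green_pt K p G" and K: "compact K" "K \<noteq> {}" "K \<subseteq> \<real>" and p: "p \<in> \<real>" and z: "z \<notin> K" "z \<noteq> p"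
  shows "G (cnj z) = G z"
proof -
  obtain e where e: "e \<in> K" using K by blast
  have sym: "cnj -` (- K - {p}) = - K - {p}"
    using real_set_cnj[of "K \<union> {p}"] K p by (simp add: Diff_eq Compl_Un[symmetric] del: Compl_Un)
  show ?thesis
  proof (rule cnj_symmetric[of G "- K - {p}" e])
    show "harm G (- K - {p})" using G by (simp add: green_pt_def)
    show "cnj -` (- K - {p}) = - K - {p}" by fact
    show "((\<lambda>z. G (cnj z) - G z) \<longlongrightarrow> 0) (at x within - K - {p})" if "x \<in> frontier (- K - {p})" for x
    proof (cases "x = p")
      case False
      then have x: "x \<in> K" using frontier_Compl_finite[of K x "{p}"] that K by (auto simp: compact_imp_closed)
      then have "(G \<longlongrightarrow> 0) (at x within - K)" using G by (simp add: green_pt_def)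
      from tendsto_diff[OF tendsto_cnj_within[OF this real_set_cnj(2)[OF K(3) x] real_set_cnj(1)[OF K(3)]] this]
      have "((\<lambda>z. G (cnj z) - G z) \<longlongrightarrow> 0) (at x within - K)" by simp
      then show ?thesis by (rule tendsto_within_subset) auto
    next
      case True
      obtain r v where r: "r > 0" "harm v (ball p r)" "\<And>z. z \<in> ball p r - {p} \<Longrightarrow> G z = v z - ln (cmod (z - p))"
        using G unfolding green_pt_def by blast
      have cp: "cnj p = p" using p Reals_cnj_iff by blast
      have n: "cmod (cnj z - p) = cmod (z - p)" for z
        by (metis cp complex_cnj_diff complex_mod_cnj)
      have v: "(v \<longlongrightarrow> v p) (at p)" using harm_isCont[OF r(2), of p] r(1) by (simp add: isCont_def)
      from tendsto_diff[OF tendsto_cnj_within[OF this cp] this]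
      have "((\<lambda>z. v (cnj z) - v z) \<longlongrightarrow> 0) (at p)" by simp
      moreover have "\<forall>\<^sub>F z in at p. v (cnj z) - v z = G (cnj z) - G z"
        unfolding eventually_at
      proof (intro exI[of _ r] conjI ballI impI r(1))
        fix z assume z: "z \<noteq> p \<and> dist z p < r"
        then have "cnj z \<noteq> p" using cp by auto
        then show "v (cnj z) - v z = G (cnj z) - G z"
          using z r(3)[of z] r(3)[of "cnj z"] n[of z] by (auto simp: dist_norm norm_minus_commute)
      qed
      ultimately have "((\<lambda>z. G (cnj z) - G z) \<longlongrightarrow> 0) (at p)" by (rule Lim_transform_eventually)
      then show ?thesis using True tendsto_within_subset by blast
    qed
    obtain c where c: "(G \<longlongrightarrow> c) at_infinity"
      using G harm_at_inf_tendsto unfolding green_pt_def by blast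
    from tendsto_diff[OF tendsto_cnj_at_infinity[OF c] c]
    show "((\<lambda>z. G (cnj z) - G z) \<longlongrightarrow> 0) at_infinity" by simp
  qed (use z e in auto)
qed

lemma hmeas_cnj:
  assumes U: "hmeas K A U \<omega>" and K: "compact K" "K \<noteq> {}" "K \<subseteq> \<real>" and z: "z \<notin> K"
  shows "U (cnj z) = U z"
proof -
  obtain e where e: "e \<in> K" using K by blast
  show ?thesis
  proof (rule cnj_symmetric[of U "- K" e])
    show "harm U (- K)" using U by (simp add: hmeas_def)
    show "cnj -` (- K) = - K" by (rule real_set_cnj[OF K(3)])
    show "((\<lambda>z. U (cnj z) - U z) \<longlongrightarrow> 0) (at x within - K)" if "x \<in> frontier (- K)" for x
    proof -
      have x: "x \<in> K" using frontier_Compl_finite[of K x "{}"] that K by (auto simp: compact_imp_closed)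
      then have "(U \<longlongrightarrow> indicator A x) (at x within - K)" using U by (simp add: hmeas_def)
      from tendsto_diff[OF tendsto_cnj_within[OF this real_set_cnj(2)[OF K(3) x] real_set_cnj(1)[OF K(3)]] this]
      show ?thesis by simp
    qed
    obtain c where c: "(U \<longlongrightarrow> c) at_infinity"
      using hmeas_harm_at_inf[OF U] harm_at_inf_tendsto by blast
    from tendsto_diff[OF tendsto_cnj_at_infinity[OF c] c]
    show "((\<lambda>z. U (cnj z) - U z) \<longlongrightarrow> 0) at_infinity" by simp
  qed (use z e in auto)
qed

section \<open>Nonnegativity of Green's functions and harmonic measure\<close>

lemma bounded_Compl_Compl: "compact K \<Longrightarrow> bounded (- (- K - {p}))" "compact K \<Longrightarrow> bounded (- (- K))"
  by (auto simp: compact_imp_bounded Compl_Diff_eq)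

lemma green_inf_nonneg:
  assumes G: "green_inf K G" and K: "compact K" "K \<noteq> {}" and z: "z \<notin> K"
  shows "0 \<le> G z"
proof -
  obtain e where e: "e \<in> K" using K by blast
  have "- G z \<le> 0"
  proof (rule max_principle[of "\<lambda>z. - G z" "- K" e])
    show "harm (\<lambda>z. - G z) (- K)" using G by (simp add: green_inf_def harm_minus)
    show "\<forall>\<^sub>F z in at x within - K. - G z < \<epsilon>" if "x \<in> frontier (- K)" "\<epsilon> > 0" for x \<epsilon>
    proof -
      have x: "x \<in> K" using frontier_Compl_finite[of K x "{}"] that K by (auto simp: compact_imp_closed)
      then have "(G \<longlongrightarrow> 0) (at x within - K)" using G by (simp add: green_inf_def)
      from order_tendstoD(1)[OF this, of "- \<epsilon>"] that(2) show ?thesis by (auto elim: eventually_mono)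
    qed
    show "\<exists>R. \<forall>z\<in>- K. R < cmod z \<longrightarrow> - G z < \<epsilon>" if e: "\<epsilon> > 0" for \<epsilon>
    proof -
      obtain c where c: "((\<lambda>z. G z - ln (cmod z)) \<longlongrightarrow> c) at_infinity"
        using G harm_at_inf_tendsto unfolding green_inf_def by blast
      from order_tendstoD(1)[OF this, of "c - 1"] obtain b where b: "\<And>z. b \<le> cmod z \<Longrightarrow> c - 1 < G z - ln (cmod z)"
        by (auto simp: eventually_at_infinity)
      have "- G z < \<epsilon>" if z: "max b (exp (1 - c)) < cmod z" for z
      proof -
        have "exp (1 - c) < cmod z" using z by simp
        then have "ln (cmod z) > 1 - c" by (smt (verit) exp_gt_zero ln_exp ln_less_cancel_iff)
        then show ?thesis using b[of z] z e by simp
      qed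
      then show ?thesis by blast
    qed
  qed (use z e in auto)
  then show ?thesis by simp
qed

lemma green_pt_nonneg:
  assumes G: "green_pt K p G" and K: "compact K" "K \<noteq> {}" and z: "z \<notin> K" "z \<noteq> p"
  shows "0 \<le> G z"
proof -
  obtain e where e: "e \<in> K" using K by blast
  have "- G z \<le> 0"
  proof (rule max_principle_sphere[of "\<lambda>z. - G z" "- K - {p}" e])
    show "harm (\<lambda>z. - G z) (- K - {p})" using G by (simp add: green_pt_def harm_minus)
    show "bounded (- (- K - {p}))" using K bounded_Compl_Compl by blast
    show "harm_at_inf (\<lambda>z. - G z)" using G by (simp add: green_pt_def harm_at_inf_minus)
    show "\<forall>\<^sub>F z in at x within - K - {p}. - G z < \<epsilon>" if "x \<in> frontier (- K - {p})" "\<epsilon> > 0" for x \<epsilon>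
    proof (cases "x = p")
      case False
      then have x: "x \<in> K" using frontier_Compl_finite[of K x "{p}"] that K by (auto simp: compact_imp_closed)
      then have "(G \<longlongrightarrow> 0) (at x within - K)" using G by (simp add: green_pt_def)
      then have "(G \<longlongrightarrow> 0) (at x within - K - {p})" by (rule tendsto_within_subset) auto
      from order_tendstoD(1)[OF this, of "- \<epsilon>"] that(2) show ?thesis by (auto elim: eventually_mono)
    next
      case True
      obtain r v where r: "r > 0" "harm v (ball p r)" "\<And>z. z \<in> ball p r - {p} \<Longrightarrow> G z = v z - ln (cmod (z - p))"
        using G unfolding green_pt_def by blast
      have v: "(v \<longlongrightarrow> v p) (at p)" using harm_isCont[OF r(2), of p] r(1) by (simp add: isCont_def)
      then have "\<forall>\<^sub>F z in at p. v p - 1 < v z" by (rule order_tendstoD) simp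
      moreover have "\<forall>\<^sub>F z in at p. z \<noteq> p \<and> dist z p < min r (exp (v p - 1))"
        unfolding eventually_at using r(1) by (intro exI[of _ "min r (exp (v p - 1))"]) auto
      ultimately have "\<forall>\<^sub>F z in at p. - G z < \<epsilon>"
      proof eventually_elim
        case (elim z)
        have "G z = v z - ln (cmod (z - p))" using r(3) elim by (auto simp: dist_commute)
        moreover have "ln (cmod (z - p)) < ln (exp (v p - 1))"
          using elim by (intro ln_strict_mono) (auto simp: dist_norm)
        then have "ln (cmod (z - p)) < v p - 1" by simp
        ultimately show ?case using elim that(2) by linarith
      qed
      then show ?thesis using True eventually_at_filter by (auto simp: eventually_at_filter elim: eventually_mono)
    qed
  qed (use z e in auto)
  then show ?thesis by simp
qed

lemma hmeas_nonneg:
  assumes U: "hmeas K A U \<omega>" and K: "compact K" "K \<noteq> {}" and z: "z \<notin> K"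
  shows "0 \<le> U z"
proof -
  obtain e where e: "e \<in> K" using K by blast
  have "- U z \<le> 0"
  proof (rule max_principle_sphere[of "\<lambda>z. - U z" "- K" e])
    show "harm (\<lambda>z. - U z) (- K)" using U by (simp add: hmeas_def harm_minus)
    show "bounded (- (- K))" using K bounded_Compl_Compl by blast
    show "harm_at_inf (\<lambda>z. - U z)" using hmeas_harm_at_inf[OF U] by (simp add: harm_at_inf_minus)
    show "\<forall>\<^sub>F z in at x within - K. - U z < \<epsilon>" if "x \<in> frontier (- K)" "\<epsilon> > 0" for x \<epsilon>
    proof -
      have x: "x \<in> K" using frontier_Compl_finite[of K x "{}"] that K by (auto simp: compact_imp_closed)
      then have "(U \<longlongrightarrow> indicator A x) (at x within - K)" using U by (simp add: hmeas_def)
      moreover have "- \<epsilon> < (indicator A x :: real)" using that(2) by (simp add: indicator_def)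
      ultimately have "\<forall>\<^sub>F z in at x within - K. - \<epsilon> < U z" by (rule order_tendstoD(1))
      then show ?thesis by (auto elim: eventually_mono)
    qed
  qed (use z e in auto)
  then show ?thesis by simp
qed

section \<open>Boundary values of the complex Green's function on the real line\<close>

lemma Re_zero_imp_constant:
  assumes "f holomorphic_on S" "open S" "convex S" "\<And>z. z \<in> S \<Longrightarrow> Re (f z) = 0"
  obtains k where "\<And>z. z \<in> S \<Longrightarrow> f z = k"
proof (cases "S = {}")
  case False
  then obtain z0 where z0: "z0 \<in> S" by blast
  have "(f has_derivative (\<lambda>h. 0)) (at z within S)" if z: "z \<in> S" for z
  proof -
    have "cgrad (\<lambda>z. 0) z = deriv f z" by (rule cgrad_Re[OF assms(1,2) z]) (simp add: assms(4))
    moreover have "cgrad (\<lambda>z. 0) z = 0" by (rule cgrad_eq_if_has_derivative) simp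
    ultimately have "(f has_field_derivative 0) (at z)" using holomorphic_derivI[OF assms(1,2) z] by simp
    then show ?thesis by (simp add: has_field_derivative_def lambda_zero has_derivative_at_withinI)
  qed
  then have "f z = f z0" if "z \<in> S" for z
    by (rule has_derivative_zero_unique[OF assms(3)]) (use that z0 in auto)
  then show ?thesis using that by blast
qed (use that in auto)

text \<open>\<open>F z - cnj (F (cnj z))\<close> has vanishing real part, hence is constant on the
  convex set, and at a real point it equals \<open>2 * i * Im (F x)\<close>. In other words, a
  symmetric harmonic function has no normal derivative on the real axis, so its conjugate is
  constant along it.\<close>

lemma Im_constant_on_reals:
  assumes F: "F holomorphic_on V" and V: "open V" "convex V" "cnj -` V = V"
    and sym: "\<And>z. z \<in> V \<Longrightarrow> Re (F (cnj z)) = Re (F z)"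
    and x: "x \<in> V" "y \<in> V" "Im x = 0" "Im y = 0"
  shows "Im (F x) = Im (F y)"
proof -
  have "(\<lambda>z. F z - cnj (F (cnj z))) holomorphic_on V"
    using holomorphic_on_cnj_cnj[OF F V(1)] unfolding V(3) by (intro holomorphic_on_diff F)
  then obtain k where k: "\<And>z. z \<in> V \<Longrightarrow> F z - cnj (F (cnj z)) = k"
    by (rule Re_zero_imp_constant[OF _ V(1,2)]) (auto simp: sym)
  have "cnj x = x" "cnj y = y" using x by (auto simp: complex_eq_iff)
  then have "F x - cnj (F x) = F y - cnj (F y)" using k x by metis
  then show ?thesis by (simp add: complex_eq_iff)
qed

lemma islimpt_upper_half:
  assumes "Im x = 0" shows "x islimpt {z. Im z > 0}"
proof -
  have "x \<in> closure {z. Im z > 0}" using assms closure_halfspace_gt[of "\<i>" 0]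
    by (simp add: inner_complex_def)
  then show ?thesis using assms by (auto simp: closure_def)
qed

lemma upper_half_limit_eq:
  fixes L F :: "complex \<Rightarrow> complex"
  assumes "Im x = 0" "(L \<longlongrightarrow> b) (at x within {z. Im z > 0})" "isCont F x" "open V" "x \<in> V"
    and eq: "\<And>z. z \<in> V \<Longrightarrow> Im z > 0 \<Longrightarrow> L z = F z"
  shows "b = F x"
proof -
  have "(F \<longlongrightarrow> F x) (at x within {z. Im z > 0})"
    using assms(3) by (simp add: continuous_at_imp_continuous_at_within continuous_within[symmetric])
  moreover have "\<forall>\<^sub>F z in at x within {z. Im z > 0}. F z = L z"
    unfolding eventually_at_filter using eventually_nhds_in_open[OF assms(4,5)] by eventually_elim (auto simp: eq)
  ultimately have "(L \<longlongrightarrow> F x) (at x within {z. Im z > 0})" by (rule Lim_transform_eventually)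
  moreover have "at x within {z. Im z > 0} \<noteq> bot" using islimpt_upper_half[OF assms(1)] by (simp add: trivial_limit_within)
  ultimately show ?thesis using tendsto_unique[OF _ assms(2)] by simp
qed

lemma convex_upper_half: "convex {z. Im z > 0}" "open {z. Im z > 0}"
  by (auto simp: convex_halfspace_Im_gt open_halfspace_Im_gt)

text \<open>In the upper part of \<open>V\<close>, \<open>L\<close> differs by a constant from a
  function holomorphic on all of \<open>V\<close>, so the values of \<open>L\<close> on the axis are
  those of that function up to the constant.\<close>

lemma Im_log_green_const:
  assumes G: "harm G V" and V: "convex V" "cnj -` V = V" and sym: "\<And>z. z \<in> V \<Longrightarrow> G (cnj z) = G z"
    and L: "L holomorphic_on {z. Im z > 0}" "\<And>z. z \<in> V \<Longrightarrow> Im z > 0 \<Longrightarrow> Re (L z) = G z"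
    and x: "x \<in> V" "Im x = 0" "(L \<longlongrightarrow> L x) (at x within {z. Im z > 0})"
    and y: "y \<in> V" "Im y = 0" "(L \<longlongrightarrow> L y) (at y within {z. Im z > 0})"
  shows "Im (L x) = Im (L y)"
proof -
  have op: "open V" using G harm_open by blast
  obtain F where F: "F holomorphic_on V" "\<And>z. z \<in> V \<Longrightarrow> G z = Re (F z)"
    by (rule harm_convex_Re[OF G V(1)]) (rule that)
  let ?H = "{z. Im z > 0}"
  have h1: "(\<lambda>z. L z - F z) holomorphic_on (V \<inter> ?H)"
    by (intro holomorphic_on_diff holomorphic_on_subset[OF L(1)] holomorphic_on_subset[OF F(1)]) auto
  have h2: "open (V \<inter> ?H)" "convex (V \<inter> ?H)" using op V convex_upper_half by (auto intro: convex_Int)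
  have h3: "Re (L z - F z) = 0" if "z \<in> V \<inter> ?H" for z using that L(2) F(2) by simp
  obtain k where k0: "\<And>z. z \<in> V \<inter> ?H \<Longrightarrow> L z - F z = k"
    by (rule Re_zero_imp_constant[OF h1 h2 h3]) (assumption, rule that)
  have k: "L z = F z + k" if "z \<in> V" "Im z > 0" for z using k0[of z] that by (simp add: algebra_simps)
  have "isCont (\<lambda>z. F z + k) w" if "w \<in> V" for w
    using holomorphic_on_imp_continuous_on[OF F(1)] continuous_on_eq_continuous_at[OF op] that
    by (auto intro!: continuous_add)
  then have "L x = F x + k" "L y = F y + k" using upper_half_limit_eq[OF x(2,3) _ op x(1) k] upper_half_limit_eq[OF y(2,3) _ op y(1) k] x(1) y(1) by auto
  moreover have "Im (F x) = Im (F y)"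
    by (rule Im_constant_on_reals[OF F(1) op V _ x(1) y(1) x(2) y(2)]) (metis F(2) V(2) sym vimageI2 vimage_eq)
  ultimately show ?thesis by simp
qed

text \<open>A thin rectangle around the interval is convex, symmetric and contained in
  \<open>S\<close>, which reduces the claim to the convex case.\<close>

lemma Im_log_green_gap:
  assumes G: "harm G S" and sym: "\<And>z. z \<in> S \<Longrightarrow> G (cnj z) = G z"
    and L: "L holomorphic_on {z. Im z > 0}" "\<And>z. z \<in> S \<Longrightarrow> Im z > 0 \<Longrightarrow> Re (L z) = G z"
    and lim: "\<And>x. x \<in> S \<Longrightarrow> Im x = 0 \<Longrightarrow> (L \<longlongrightarrow> L x) (at x within {z. Im z > 0})"
    and ab: "a \<le> b" "complex_of_real ` {a..b} \<subseteq> S"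
  shows "Im (L (of_real a)) = Im (L (of_real b))"
proof -
  have "compact (complex_of_real ` {a..b})" by (intro compact_continuous_image continuous_intros) auto
  then obtain e where e: "e > 0" "{x. infdist x (complex_of_real ` {a..b}) \<le> e} \<subseteq> S"
    using compact_in_open_separated[OF _ _ harm_open[OF G] ab(2)] ab(1) by auto
  define d where "d = e / 2"
  define V where "V = {z. Re z > a - d} \<inter> {z. Re z < b + d} \<inter> {z. Im z > - d} \<inter> {z. Im z < d}"
  have d: "d > 0" using e by (simp add: d_def)
  have VS: "V \<subseteq> S"
  proof
    fix z assume z: "z \<in> V"
    define x where "x = max a (min b (Re z))"
    have x: "x \<in> {a..b}" "\<bar>Re z - x\<bar> \<le> d" using z ab(1) d by (auto simp: V_def x_def)
    have "infdist z (complex_of_real ` {a..b}) \<le> dist z (of_real x)" using x by (intro infdist_le) auto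
    also have "\<dots> \<le> \<bar>Re z - x\<bar> + \<bar>Im z\<bar>" using cmod_le[of "z - of_real x"] by (simp add: dist_norm)
    also have "\<bar>Im z\<bar> \<le> d" using z by (auto simp: V_def)
    then have "\<bar>Re z - x\<bar> + \<bar>Im z\<bar> \<le> e" using x by (simp add: d_def)
    finally show "z \<in> S" using e by auto
  qed
  show ?thesis
  proof (rule Im_log_green_const[of G V L "of_real a" "of_real b"])
    show "harm G V" by (rule harm_subset[OF G _ VS])
      (auto simp: V_def intro!: open_Int open_halfspace_Re_gt open_halfspace_Re_lt open_halfspace_Im_gt open_halfspace_Im_lt)
    show "convex V" unfolding V_def
      by (intro convex_Int convex_halfspace_Re_gt convex_halfspace_Re_lt convex_halfspace_Im_gt convex_halfspace_Im_lt)
    show "cnj -` V = V" by (auto simp: V_def)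
    show "of_real a \<in> V" "of_real b \<in> V" using d ab by (auto simp: V_def)
  qed (use sym L lim VS ab in \<open>auto simp: image_subset_iff\<close>)
qed

text \<open>Near the pole \<open>L\<close> is a holomorphic function with symmetric real part minus
  a logarithm of \<open>z - p\<close>. The argument of \<open>z - p\<close> is 0 to the right of
  \<open>p\<close> and \<open>pi\<close> to the left, so the logarithm alone produces the
  jump.\<close>

lemma Im_log_green_jump:
  assumes G: "green_pt K (of_real p) G" and sym: "\<And>z. z \<notin> K \<Longrightarrow> z \<noteq> of_real p \<Longrightarrow> G (cnj z) = G z" and K: "compact K"
    and L: "L holomorphic_on {z. Im z > 0}" "\<And>z. Im z > 0 \<Longrightarrow> Re (L z) = G z"
    and lim: "\<And>x. x \<notin> K \<Longrightarrow> x \<noteq> of_real p \<Longrightarrow> Im x = 0 \<Longrightarrow> (L \<longlongrightarrow> L x) (at x within {z. Im z > 0})"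
  obtains t0 where "t0 > 0" "\<And>t. 0 < t \<Longrightarrow> t < t0 \<Longrightarrow> Im (L (of_real (p - t))) - Im (L (of_real (p + t))) = - pi"
proof -
  obtain r1 v where r1: "r1 > 0" "harm v (ball (of_real p) r1)"
    "\<And>z. z \<in> ball (of_real p) r1 - {of_real p} \<Longrightarrow> G z = v z - ln (cmod (z - of_real p))"
    using G unfolding green_pt_def by blast
  have "open (- K)" "of_real p \<in> - K" using G K unfolding green_pt_def by (auto simp: compact_imp_closed)
  then obtain r2 where r2: "r2 > 0" "ball (of_real p) r2 \<subseteq> - K" using open_contains_ball by blast
  define r where "r = min r1 r2"
  define V where "V = ball (complex_of_real p) r"
  have r: "r > 0" using r1 r2 by (simp add: r_def)
  have v: "harm v V" by (rule harm_subset[OF r1(2)]) (auto simp: V_def r_def)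
  have VK: "z \<notin> K" if "z \<in> V" for z using that r2(2) by (auto simp: V_def r_def)
  have n: "cmod (cnj z - of_real p) = cmod (z - of_real p)" for z
    by (metis complex_cnj_complex_of_real complex_cnj_diff complex_mod_cnj)
  have symV: "cnj -` V = V" using n by (auto simp: V_def dist_norm norm_minus_commute)
  have Gv: "G z = v z - ln (cmod (z - of_real p))" if "z \<in> V" "z \<noteq> of_real p" for z
    using r1(3) that by (auto simp: V_def r_def)
  have vsym: "v (cnj z) = v z" if "z \<in> V" for z
  proof (cases "z = of_real p")
    case False
    then have "cnj z \<noteq> of_real p" by (metis complex_cnj_cnj complex_cnj_complex_of_real)
    moreover have "z \<in> cnj -` V" using that by (simp only: symV)
    then have "cnj z \<in> V" by simp
    ultimately show ?thesis using Gv[OF that False] Gv[of "cnj z"] sym[OF VK[OF that] False] n by auto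
  qed simp
  obtain F where F: "F holomorphic_on V" "\<And>z. z \<in> V \<Longrightarrow> v z = Re (F z)"
    by (rule harm_convex_Re[OF v]) (simp add: V_def, rule that)
  \<comment> \<open>A branch of \<open>log (z - p)\<close> whose cut runs from \<open>p\<close> in
    the direction of the negative imaginary axis, so that it is continuous on the closed upper
    half-plane without \<open>p\<close>.\<close>
  define N where "N = (\<lambda>z. Ln (- \<i> * (z - of_real p)) + \<i> * of_real (pi / 2))"
  have isN: "isCont N z" if "Im z \<ge> 0" "z \<noteq> of_real p" for z
  proof -
    have "- \<i> * (z - of_real p) \<notin> \<real>\<^sub>\<le>\<^sub>0"
      using that by (auto simp: complex_nonpos_Reals_iff complex_eq_iff)
    then show ?thesis unfolding N_def by (intro continuous_intros) auto
  qed
  have ReN: "Re (N z) = ln (cmod (z - of_real p))" if "z \<noteq> of_real p" for z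
    using that by (simp add: N_def norm_mult)
  let ?H = "{z. Im z > 0}"
  have h1: "(\<lambda>z. L z - (F z - N z)) holomorphic_on (V \<inter> ?H)"
  proof -
    have "- \<i> * (z - of_real p) \<notin> \<real>\<^sub>\<le>\<^sub>0" if "z \<in> ?H" for z
      using that by (auto simp: complex_nonpos_Reals_iff)
    then have "N holomorphic_on ?H" unfolding N_def by (intro holomorphic_intros) auto
    then show ?thesis
      by (intro holomorphic_on_diff holomorphic_on_subset[OF L(1)] holomorphic_on_subset[OF F(1)]) (auto intro: holomorphic_on_subset)
  qed
  have h2: "open (V \<inter> ?H)" "convex (V \<inter> ?H)" using convex_upper_half by (auto intro: convex_Int simp: V_def)
  have h3: "Re (L z - (F z - N z)) = 0" if "z \<in> V \<inter> ?H" for z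
  proof -
    have "z \<noteq> of_real p" using that by auto
    then show ?thesis using that L(2) F(2) ReN Gv by simp
  qed
  obtain k where k0: "\<And>z. z \<in> V \<inter> ?H \<Longrightarrow> L z - (F z - N z) = k"
    by (rule Re_zero_imp_constant[OF h1 h2 h3]) (assumption, rule that)
  have k: "L z = F z - N z + k" if "z \<in> V" "Im z > 0" for z using k0[of z] that by (simp add: algebra_simps)
  have Lx: "L x = F x - N x + k" if "x \<in> V" "Im x = 0" "x \<noteq> of_real p" for x
  proof -
    have "isCont (\<lambda>z. F z - N z + k) x"
      using holomorphic_on_imp_continuous_on[OF F(1)] continuous_on_eq_continuous_at[of V F] that isN[of x]
      by (auto intro!: continuous_add continuous_diff simp: V_def)
    from upper_half_limit_eq[OF that(2) lim[OF VK[OF that(1)] that(3,2)] this _ that(1) k]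
    show ?thesis by (auto simp: V_def)
  qed
  have "Im (L (of_real (p - t))) - Im (L (of_real (p + t))) = - pi" if t: "0 < t" "t < r" for t
  proof -
    have V: "of_real (p - t) \<in> V" "of_real (p + t) \<in> V" using t by (auto simp: V_def dist_norm)
    have "Im (F (of_real (p - t))) = Im (F (of_real (p + t)))"
    proof (rule Im_constant_on_reals[OF F(1) _ _ symV _ V])
      fix z assume z: "z \<in> V"
      then have "z \<in> cnj -` V" by (simp only: symV)
      then show "Re (F (cnj z)) = Re (F z)" using F(2) vsym[OF z] z by simp
    qed (auto simp: V_def)
    moreover have "Im (N (of_real (p - t))) = pi"
    proof -
      have "- \<i> * (of_real (p - t) - of_real p) = of_real t * \<i>" by simp
      then show ?thesis using t Ln_times_of_real[of t \<i>] by (simp add: N_def mult.commute[of \<i> "of_real t"])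
    qed
    moreover have "Im (N (of_real (p + t))) = 0"
    proof -
      have "- \<i> * (of_real (p + t) - of_real p) = of_real t * (- \<i>)" by simp
      then show ?thesis unfolding N_def using t Ln_times_of_real[of t "- \<i>"] by (simp add: mult.commute[of \<i> "of_real t"])
    qed
    ultimately show ?thesis using Lx[OF V(1)] Lx[OF V(2)] t by simp
  qed
  then show ?thesis using that r by blast
qed

section \<open>Gradient bounds near a slit\<close>

lemma off_segment_sum_gt:
  assumes "al \<le> be" "z \<notin> complex_of_real ` {al..be}"
  shows "be - al < cmod (z - of_real al) + cmod (z - of_real be)"
proof (rule ccontr)
  assume "\<not> ?thesis"
  moreover have "be - al \<le> cmod (z - of_real al) + cmod (z - of_real be)"
    using assms(1) norm_triangle_ineq4[of "z - of_real al" "z - of_real be"] by (simp flip: of_real_diff)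
  ultimately have "dist (complex_of_real al) (of_real be) = dist (complex_of_real al) z + dist z (of_real be)"
    using assms(1) by (simp add: dist_norm norm_minus_commute flip: of_real_diff)
  then have "z \<in> closed_segment (of_real al) (of_real be)"
    by (simp add: between flip: between_mem_segment)
  then obtain t where t: "0 \<le> t" "t \<le> 1" "z = (1 - t) *\<^sub>R of_real al + t *\<^sub>R of_real be"
    by (auto simp: closed_segment_def)
  then have "z = of_real (al + t * (be - al))" by (simp add: scaleR_conv_of_real algebra_simps)
  moreover have "t * (be - al) \<le> be - al" "0 \<le> t * (be - al)" using t assms(1) by (auto intro: mult_left_le_one_le)
  then have "al + t * (be - al) \<in> {al..be}" by auto
  ultimately show False using assms(2) by blast
qed

text \<open>Off the segment the focal distances sum to more than \<open>be - al\<close>, on the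
  compact set \<open>C\<close> by a definite margin, and \<open>(be - al) / 2 * (R + 1 / R)\<close>
  tends to \<open>be - al\<close> as \<open>R\<close> decreases to 1.\<close>

lemma ellipse_avoid:
  assumes ab: "al < be" and C: "compact C" "C \<inter> complex_of_real ` {al..be} = {}"
  obtains R where "R > 1" "\<And>z. z \<in> C \<Longrightarrow> (be - al) / 2 * (R + 1 / R) \<le> cmod (z - of_real al) + cmod (z - of_real be)"
proof -
  have "\<exists>s>be - al. \<forall>z\<in>C. s \<le> cmod (z - of_real al) + cmod (z - of_real be)"
  proof (cases "C = {}")
    case True then show ?thesis by (intro exI[of _ "be - al + 1"]) auto
  next
    case False
    have "continuous_on C (\<lambda>z. cmod (z - of_real al) + cmod (z - of_real be))" by (intro continuous_intros)
    from continuous_attains_inf[OF C(1) False this] obtain x where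
      "x \<in> C" "\<forall>y\<in>C. cmod (x - of_real al) + cmod (x - of_real be) \<le> cmod (y - of_real al) + cmod (y - of_real be)" by blast
    then show ?thesis using off_segment_sum_gt[of al be x] C(2) ab
      by (intro exI[of _ "cmod (x - of_real al) + cmod (x - of_real be)"]) auto
  qed
  then obtain s where s: "s > be - al" "\<And>z. z \<in> C \<Longrightarrow> s \<le> cmod (z - of_real al) + cmod (z - of_real be)" by blast
  have "((\<lambda>R. (be - al) / 2 * (R + 1 / R)) \<longlongrightarrow> (be - al) / 2 * (1 + 1 / 1)) (at_right 1)"
    by (intro tendsto_intros) auto
  then have "\<forall>\<^sub>F R in at_right 1. (be - al) / 2 * (R + 1 / R) < s"
    by (rule order_tendstoD) (use s in auto)
  moreover have "\<forall>\<^sub>F R in at_right 1. R > (1::real)" by (simp add: eventually_at_filter)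
  ultimately have "\<forall>\<^sub>F R in at_right 1. R > 1 \<and> (be - al) / 2 * (R + 1 / R) < s" by eventually_elim auto
  then obtain R where "R > 1" "(be - al) / 2 * (R + 1 / R) < s"
    using eventually_happens'[of "at_right (1::real)"] by force
  then show ?thesis using that[of R] s(2) by force
qed

text \<open>\<open>C\<close> may touch \<open>K\<close>. The limits from outside \<open>K\<close>
  give local bounds there, and compactness leaves finitely many of them.\<close>

lemma locally_bounded_imp_bounded:
  fixes v :: "complex \<Rightarrow> real"
  assumes C: "compact C" and cont: "\<And>x. x \<in> - K \<Longrightarrow> isCont v x"
    and lim: "\<And>x. x \<in> K \<Longrightarrow> \<exists>c. (v \<longlongrightarrow> c) (at x within - K)"
  obtains B where "B > 0" "\<And>z. z \<in> C - K \<Longrightarrow> \<bar>v z\<bar> \<le> B"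
proof -
  have "\<exists>T B. open T \<and> x \<in> T \<and> (\<forall>z\<in>T - K. \<bar>v z\<bar> \<le> B)" for x
  proof -
    obtain c where c: "(v \<longlongrightarrow> c) (at x within - K)"
      using cont[of x] lim[of x] by (cases "x \<in> K") (auto simp: isCont_def intro: tendsto_within_subset)
    then have "\<forall>\<^sub>F z in at x within - K. dist (v z) c < 1" by (rule tendstoD) simp
    then obtain d where d: "d > 0" "\<And>z. z \<in> - K \<Longrightarrow> z \<noteq> x \<Longrightarrow> dist z x < d \<Longrightarrow> dist (v z) c < 1"
      unfolding eventually_at by blast
    have "\<bar>v z\<bar> \<le> max (\<bar>c\<bar> + 1) \<bar>v x\<bar>" if "z \<in> ball x d - K" for z
      using d(2)[of z] that by (cases "z = x") (auto simp: dist_real_def dist_commute)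
    then show ?thesis using d(1) by (intro exI[of _ "ball x d"] exI[of _ "max (\<bar>c\<bar> + 1) \<bar>v x\<bar>"]) auto
  qed
  then obtain T B where TB: "\<And>x. open (T x) \<and> x \<in> T x \<and> (\<forall>z\<in>T x - K. \<bar>v z\<bar> \<le> B x)" by metis
  obtain X where X: "X \<subseteq> C" "finite X" "C \<subseteq> (\<Union>x\<in>X. T x)"
    by (rule compactE_image[OF C, of C T]) (use TB in auto)
  define M where "M = (\<Sum>x\<in>X. \<bar>B x\<bar>) + 1"
  have "\<bar>v z\<bar> \<le> M" if z: "z \<in> C - K" for z
  proof -
    obtain x where x: "x \<in> X" "z \<in> T x" using X z by blast
    then have "\<bar>v z\<bar> \<le> \<bar>B x\<bar>" using TB[of x] z by force
    also have "\<dots> \<le> (\<Sum>x\<in>X. \<bar>B x\<bar>)" using X x by (intro member_le_sum) auto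
    finally show ?thesis by (simp add: M_def)
  qed
  moreover have "M > 0" by (simp add: M_def add_nonneg_pos sum_nonneg)
  ultimately show ?thesis using that by blast
qed

lemma cgrad_diff_const:
  assumes "harm v S" "z \<in> S" shows "cgrad (\<lambda>z. v z - c) z = cgrad v z"
  by (rule cgrad_eq_if_has_derivative) (use has_derivative_diff[OF harm_has_derivative[OF assms] has_derivative_const] in simp)

text \<open>\<open>v - c\<close> has boundary values 0 on this slit and the same gradient as
  \<open>v\<close>; inside a confocal ellipse that misses the rest of \<open>K\<close> it falls
  under \<open>slit_cgrad_bound\<close>.\<close>

lemma cgrad_bound_near_slit:
  fixes p q :: real
  assumes pq: "p < q" and K: "closed K" "complex_of_real ` {p..q} \<subseteq> K" "compact (K - complex_of_real ` {p..q})"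
    and v: "harm v (- K)" and bd: "\<And>x. x \<in> complex_of_real ` {p..q} \<Longrightarrow> (v \<longlongrightarrow> c) (at x within - K)"
    and lim: "\<And>x. x \<in> K \<Longrightarrow> \<exists>c. (v \<longlongrightarrow> c) (at x within - K)"
  obtains T C where "open T" "complex_of_real ` {p..q} \<subseteq> T" "C > 0"
    "\<And>z. z \<in> T - K \<Longrightarrow> cmod (cgrad v z) * sqrt (cmod (z - of_real p) * cmod (z - of_real q)) \<le> C"
proof -
  let ?J = "complex_of_real ` {p..q}"
  obtain R where R: "R > 1" "\<And>z. z \<in> K - ?J \<Longrightarrow> (q - p) / 2 * (R + 1 / R) \<le> cmod (z - of_real p) + cmod (z - of_real q)"
    by (rule ellipse_avoid[OF pq K(3)]) (blast, rule that)
  define N where "N = (\<lambda>R. {z. cmod (z - of_real p) + cmod (z - of_real q) < (q - p) / 2 * (R + 1 / R)})"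
  have opN: "open (N R)" for R unfolding N_def by (intro open_Collect_less continuous_intros)
  have NK: "N R - ?J \<subseteq> - K" using R(2) by (force simp: N_def)
  have "bounded (N R)" unfolding bounded_iff
  proof (intro exI ballI)
    fix z assume "z \<in> N R"
    then have "cmod (z - of_real p) + cmod (z - of_real q) < (q - p) / 2 * (R + 1 / R)"
      unfolding N_def mem_Collect_eq .
    moreover have "cmod z \<le> cmod (z - of_real p) + \<bar>p\<bar>" using norm_triangle_ineq[of "z - of_real p" "of_real p"] by simp
    ultimately show "cmod z \<le> (q - p) / 2 * (R + 1 / R) + \<bar>p\<bar>"
      using norm_ge_zero[of "z - of_real q"] by linarith
  qed
  then have "compact (closure (N R))" by simp
  then obtain B where B: "B > 0" "\<And>z. z \<in> closure (N R) - K \<Longrightarrow> \<bar>v z\<bar> \<le> B"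
    by (rule locally_bounded_imp_bounded[OF _ harm_isCont[OF v] lim]) (assumption+, rule that)
  have JN: "?J \<subseteq> N R'" if "R' > 1" for R'
  proof
    fix z assume z: "z \<in> ?J"
    have "q - p = (q - p) / 2 * 2" by simp
    also have "\<dots> < (q - p) / 2 * (R' + 1 / R')"
      using plus_inverse_strict_mono[of 1 R'] that pq by (intro mult_strict_left_mono) auto
    finally show "z \<in> N R'" unfolding N_def mem_Collect_eq dist_sum_on_segment[OF z] .
  qed
  have "cmod (cgrad v z) * sqrt (cmod (z - of_real p) * cmod (z - of_real q)) \<le> 32 * (B + \<bar>c\<bar>) * R / ln R"
    if z: "z \<in> N ((1 + R) / 2) - K" for z
  proof -
    have zJ: "z \<in> N ((1 + R) / 2) - ?J" using z K by auto
    have "cmod (cgrad (\<lambda>z. v z - c) z) * sqrt (cmod (z - of_real p) * cmod (z - of_real q)) \<le> 32 * (B + \<bar>c\<bar>) * R / ln R"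
    proof (rule slit_cgrad_bound[OF pq R(1)])
      show "B + \<bar>c\<bar> > 0" using B by simp
      have "open (N R - ?J)" using opN by (intro open_Diff compact_imp_closed compact_continuous_image continuous_intros) auto
      then show "harm (\<lambda>z. v z - c) ({z. cmod (z - of_real p) + cmod (z - of_real q) < (q - p) / 2 * (R + 1 / R)} - ?J)"
        using NK unfolding N_def by (intro harm_diff harm_subset[OF v] harm_const)
      show "\<bar>v z - c\<bar> \<le> B + \<bar>c\<bar>" if "z \<in> {z. cmod (z - of_real p) + cmod (z - of_real q) < (q - p) / 2 * (R + 1 / R)} - ?J" for z
      proof -
        have z: "z \<in> N R - ?J" using that by (simp add: N_def)
        then have "z \<notin> K" using NK by blast
        moreover have "z \<in> closure (N R)" using z closure_subset by blast
        ultimately have "\<bar>v z\<bar> \<le> B" using B(2) by simp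
        then show ?thesis by linarith
      qed
      show "z \<in> {z. cmod (z - of_real p) + cmod (z - of_real q) < (q - p) / 2 * ((1 + R) / 2 + 1 / ((1 + R) / 2))} - ?J"
        using zJ by (simp add: N_def)
      show "((\<lambda>z. v z - c) \<longlongrightarrow> 0) (at x within - ?J)" if x: "x \<in> ?J" for x
      proof -
        have "((\<lambda>z. v z - c) \<longlongrightarrow> c - c) (at x within - K)" by (intro tendsto_intros bd x)
        moreover have "at x within - K = at x within - ?J"
        proof (rule at_within_nhd[of x "N R"])
          show "x \<in> N R" using JN[OF R(1)] x by blast
          show "- K \<inter> N R - {x} = - ?J \<inter> N R - {x}" using NK K(2) by blast
        qed (rule opN)
        ultimately show ?thesis by simp
      qed
    qed
    moreover have "cgrad (\<lambda>z. v z - c) z = cgrad v z" by (rule cgrad_diff_const[OF v]) (use z in auto)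
    ultimately show ?thesis by simp
  qed
  moreover have "32 * (B + \<bar>c\<bar>) * R / ln R > 0" using B R(1) by simp
  ultimately show ?thesis using that[OF opN JN[of "(1 + R) / 2"]] R(1) by force
qed

section \<open>The flux through a slit\<close>

lemma inverse_sqrt_integrable:
  fixes a b e :: real
  assumes "a \<le> b"
  shows "(\<lambda>x. 1 / sqrt \<bar>x - e\<bar>) integrable_on {a..b}"
proof -
  \<comment> \<open>This is \<open>2 * sgn (x - e) * sqrt \<bar>x - e\<bar>\<close>, a primitive
    that is continuous across the singularity.\<close>
  define h where "h = (\<lambda>x. 2 * sqrt (max 0 (x - e)) - 2 * sqrt (max 0 (e - x)))"
  have "((\<lambda>x. 1 / sqrt \<bar>x - e\<bar>) has_integral (h b - h a)) {a..b}"
  proof (rule fundamental_theorem_of_calculus_interior_strong[of "{e}"])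
    show "continuous_on {a..b} h" unfolding h_def by (intro continuous_intros)
    fix x assume x: "x \<in> {a<..<b} - {e}"
    have "(h has_real_derivative 1 / sqrt \<bar>x - e\<bar>) (at x)"
    proof (cases "x > e")
      case True
      have "((\<lambda>x. 2 * sqrt (x - e)) has_real_derivative 1 / sqrt \<bar>x - e\<bar>) (at x)"
        using True by (auto intro!: derivative_eq_intros simp: field_simps)
      then show ?thesis
        by (rule has_field_derivative_transform_within_open[of _ _ _ "{e<..}"]) (use True in \<open>auto simp: h_def\<close>)
    next
      case False
      then have less: "x < e" using x by auto
      have "((\<lambda>x. - 2 * sqrt (e - x)) has_real_derivative 1 / sqrt \<bar>x - e\<bar>) (at x)"
        using less by (auto intro!: derivative_eq_intros simp: field_simps)
      then show ?thesis
        by (rule has_field_derivative_transform_within_open[of _ _ _ "{..<e}"]) (use less in \<open>auto simp: h_def\<close>)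
    qed
    then show "(h has_vector_derivative 1 / sqrt \<bar>x - e\<bar>) (at x)"
      by (simp add: has_real_derivative_iff_has_vector_derivative)
  qed (use assms in auto)
  then show ?thesis by blast
qed

text \<open>One of the two distances is at least half of \<open>q - p\<close>, so only the other one
  can carry the singularity.\<close>

lemma inverse_sqrt_mult_le:
  fixes p q x :: real
  assumes "p < q" "x \<noteq> p" "x \<noteq> q"
  shows "1 / sqrt (\<bar>x - p\<bar> * \<bar>x - q\<bar>) \<le> sqrt (2 / (q - p)) * (1 / sqrt \<bar>x - p\<bar> + 1 / sqrt \<bar>x - q\<bar>)"
proof -
  have *: "1 / sqrt (s * t) \<le> sqrt (2 / (q - p)) * (1 / sqrt t)" if "s \<ge> (q - p) / 2" "t > 0" for s t :: real
  proof -
    have s: "s > 0" using that assms by simp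
    have "1 / s \<le> 2 / (q - p)" using that s assms by (simp add: field_simps)
    then have "sqrt (1 / s) \<le> sqrt (2 / (q - p))" by simp
    then have "sqrt (1 / s) * (1 / sqrt t) \<le> sqrt (2 / (q - p)) * (1 / sqrt t)" using that by (intro mult_right_mono) auto
    then show ?thesis by (simp add: real_sqrt_mult real_sqrt_divide)
  qed
  have pos: "sqrt (2 / (q - p)) * (1 / sqrt \<bar>x - p\<bar>) \<ge> 0" "sqrt (2 / (q - p)) * (1 / sqrt \<bar>x - q\<bar>) \<ge> 0" using assms by auto
  have "\<bar>x - p\<bar> \<ge> (q - p) / 2 \<or> \<bar>x - q\<bar> \<ge> (q - p) / 2" by (auto simp: abs_if)
  then show ?thesis
  proof
    assume "(q - p) / 2 \<le> \<bar>x - p\<bar>"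
    then have "1 / sqrt (\<bar>x - p\<bar> * \<bar>x - q\<bar>) \<le> sqrt (2 / (q - p)) * (1 / sqrt \<bar>x - q\<bar>)"
      by (rule *) (use assms in simp)
    then show ?thesis unfolding distrib_left using pos by linarith
  next
    assume "(q - p) / 2 \<le> \<bar>x - q\<bar>"
    then have "1 / sqrt (\<bar>x - q\<bar> * \<bar>x - p\<bar>) \<le> sqrt (2 / (q - p)) * (1 / sqrt \<bar>x - p\<bar>)"
      by (rule *) (use assms in simp)
    then show ?thesis unfolding distrib_left mult.commute[of "\<bar>x - q\<bar>"] using pos by linarith
  qed
qed

lemma Im_one_divide: "Im (1 / w) = - Im w / (cmod w)\<^sup>2"
  by (simp add: Im_divide cmod_power2)

text \<open>Slits are given by their pairs of endpoints, so that inserting the intervals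
  \<open>[B k, C k]\<close> into \<open>E\<close> is a union of sets of pairs.\<close>

definition slit_system :: "(real \<times> real) set \<Rightarrow> bool" where
  "slit_system P \<longleftrightarrow> finite P \<and> P \<noteq> {} \<and> (\<forall>(p, q)\<in>P. p < q) \<and> disjoint_family_on (\<lambda>(p, q). {p..q}) P"

definition slits :: "(real \<times> real) set \<Rightarrow> complex set" where
  "slits P = (\<Union>(p, q)\<in>P. complex_of_real ` {p..q})"

lemma compact_slits: "finite P \<Longrightarrow> compact (slits P)"
  unfolding slits_def by (intro compact_UN) (auto intro!: compact_continuous_image continuous_intros)

lemma slits_real: "slits P \<subseteq> \<real>"
  by (auto simp: slits_def)

lemma slits_nonempty: "slit_system P \<Longrightarrow> slits P \<noteq> {}"
  unfolding slit_system_def slits_def by fastforce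

lemma slits_remove:
  assumes "slit_system P" "(p, q) \<in> P"
  shows "slits P - complex_of_real ` {p..q} = slits (P - {(p, q)})"
proof -
  have "complex_of_real ` {p..q} \<inter> complex_of_real ` {p'..q'} = {}" if "(p', q') \<in> P" "(p', q') \<noteq> (p, q)" for p' q'
  proof -
    have "{p..q} \<inter> {p'..q'} = {}"
      using assms that unfolding slit_system_def disjoint_family_on_def by fastforce
    then show ?thesis by (metis (no_types) image_Int image_empty inj_of_real)
  qed
  then show ?thesis using assms unfolding slits_def by blast
qed

text \<open>The bound depends on the abscissa alone and is uniform in the height \<open>y\<close>.
  It is thus one integrable majorant for all horizontal lines, as dominated convergence in
  \<open>flux_inner\<close> requires.\<close>

lemma cgrad_bound_near_slits:
  assumes P: "slit_system P" and v: "harm v (- slits P)"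
    and bd: "\<And>p q. (p, q) \<in> P \<Longrightarrow> \<exists>c. \<forall>x\<in>complex_of_real ` {p..q}. (v \<longlongrightarrow> c) (at x within - slits P)"
  obtains C where "C > 0" "\<And>x y. \<bar>x\<bar> \<le> X \<Longrightarrow> 0 \<le> y \<Longrightarrow> y \<le> 1 \<Longrightarrow> \<i> * of_real y + of_real x \<notin> slits P \<Longrightarrow>
      x \<notin> fst ` P \<union> snd ` P \<Longrightarrow>
      cmod (cgrad v (\<i> * of_real y + of_real x)) \<le> C * (1 + (\<Sum>(p, q)\<in>P. 1 / sqrt \<bar>x - p\<bar> + 1 / sqrt \<bar>x - q\<bar>))"
proof -
  let ?K = "slits P"
  have fin: "finite P" using P by (simp add: slit_system_def)
  have cl: "closed ?K" using compact_slits[OF fin] compact_imp_closed by blast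
  have lim: "\<exists>c. (v \<longlongrightarrow> c) (at x within - ?K)" if "x \<in> ?K" for x
    using that bd unfolding slits_def by fast
  have "\<exists>T C. open T \<and> complex_of_real ` {fst j..snd j} \<subseteq> T \<and> C > 0 \<and> (\<forall>z\<in>T - ?K. cmod (cgrad v z) * sqrt (cmod (z - of_real (fst j)) * cmod (z - of_real (snd j))) \<le> C)"
    if j: "j \<in> P" for j
  proof -
    obtain p q where pq: "j = (p, q)" by force
    obtain c where c: "\<And>x. x \<in> complex_of_real ` {p..q} \<Longrightarrow> (v \<longlongrightarrow> c) (at x within - ?K)" using bd j pq by blast
    have 1: "p < q" using P j pq by (auto simp: slit_system_def)
    have 2: "complex_of_real ` {p..q} \<subseteq> ?K" using j pq by (auto simp: slits_def)
    have 3: "compact (?K - complex_of_real ` {p..q})"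
      using slits_remove[OF P] j pq compact_slits[of "P - {(p, q)}"] fin by simp
    obtain T C where "open T" "complex_of_real ` {p..q} \<subseteq> T" "C > 0"
      "\<And>z. z \<in> T - ?K \<Longrightarrow> cmod (cgrad v z) * sqrt (cmod (z - of_real p) * cmod (z - of_real q)) \<le> C"
      by (rule cgrad_bound_near_slit[OF 1 cl 2 3 v c lim]) (assumption+, rule that)
    then show ?thesis unfolding pq by (intro exI[of _ T] exI[of _ C]) auto
  qed
  then obtain T C where TC: "\<And>j. j \<in> P \<Longrightarrow> open (T j)" "\<And>j. j \<in> P \<Longrightarrow> complex_of_real ` {fst j..snd j} \<subseteq> T j"
    "\<And>j. j \<in> P \<Longrightarrow> C j > 0" "\<And>j z. j \<in> P \<Longrightarrow> z \<in> T j - ?K \<Longrightarrow> cmod (cgrad v z) * sqrt (cmod (z - of_real (fst j)) * cmod (z - of_real (snd j))) \<le> C j"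
    by metis
  define box where "box = cbox (Complex (-X) 0) (Complex X 1)"
  have KT: "?K \<subseteq> (\<Union>j\<in>P. T j)" using TC(2) unfolding slits_def by fastforce
  have "compact (box - (\<Union>j\<in>P. T j))" unfolding box_def using TC(1) by (intro compact_diff compact_cbox open_UN) auto
  moreover have "continuous_on (box - (\<Union>j\<in>P. T j)) (cgrad v)"
    by (rule continuous_on_subset[OF holomorphic_on_imp_continuous_on[OF holomorphic_cgrad[OF v]]]) (use KT in auto)
  ultimately have "bounded (cgrad v ` (box - (\<Union>j\<in>P. T j)))" by (intro compact_imp_bounded compact_continuous_image)
  then obtain C0 where C0: "C0 > 0" "\<And>z. z \<in> box - (\<Union>j\<in>P. T j) \<Longrightarrow> cmod (cgrad v z) \<le> C0"
    unfolding bounded_pos by blast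
  define D where "D = (\<lambda>j. C j * sqrt (2 / (snd j - fst j)))"
  have D: "D j \<ge> 0" if "j \<in> P" for j using TC(3)[OF that] P that by (auto simp: D_def slit_system_def)
  define M where "M = C0 + (\<Sum>j\<in>P. D j)"
  have MD: "D j \<le> M" if "j \<in> P" for j
    using member_le_sum[of j P D] that D fin C0 by (auto simp: M_def)
  have M: "M > 0" "C0 \<le> M" using C0 sum_nonneg[of P D] D by (auto simp: M_def)
  define s where "s = (\<lambda>x j. 1 / sqrt \<bar>x - fst j\<bar> + 1 / sqrt \<bar>x - snd j\<bar>)"
  have s0: "s x j \<ge> 0" for x j by (simp add: s_def)
  have main: "cmod (cgrad v (\<i> * of_real y + of_real x)) \<le> M * (1 + (\<Sum>j\<in>P. s x j))"
    if xy: "\<bar>x\<bar> \<le> X" "0 \<le> y" "y \<le> 1" "\<i> * of_real y + of_real x \<notin> ?K" "x \<notin> fst ` P \<union> snd ` P" for x y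
  proof (cases "\<exists>j\<in>P. \<i> * of_real y + of_real x \<in> T j")
    case False
    then have "cmod (cgrad v (\<i> * of_real y + of_real x)) \<le> C0"
      using xy by (intro C0) (auto simp: box_def in_cbox_complex_iff)
    also have "\<dots> \<le> M * 1" using M by simp
    also have "\<dots> \<le> M * (1 + (\<Sum>j\<in>P. s x j))" using M s0 by (intro mult_left_mono) (auto simp: sum_nonneg)
    finally show ?thesis .
  next
    case True
    define z where "z = \<i> * of_real y + of_real x"
    obtain j where j: "j \<in> P" "z \<in> T j" using True by (auto simp: z_def)
    have ne: "x \<noteq> fst j" "x \<noteq> snd j" using xy(5) j by auto
    have pq: "fst j < snd j" using P j by (auto simp: slit_system_def)
    have "\<bar>x - e\<bar> \<le> cmod (z - of_real e)" for e
      using abs_Re_le_cmod[of "z - of_real e"] by (simp add: z_def)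
    then have "sqrt (\<bar>x - fst j\<bar> * \<bar>x - snd j\<bar>) \<le> sqrt (cmod (z - of_real (fst j)) * cmod (z - of_real (snd j)))"
      by (intro real_sqrt_le_mono mult_mono) auto
    then have "cmod (cgrad v z) * sqrt (\<bar>x - fst j\<bar> * \<bar>x - snd j\<bar>) \<le> cmod (cgrad v z) * sqrt (cmod (z - of_real (fst j)) * cmod (z - of_real (snd j)))"
      by (rule mult_left_mono) simp
    also have "\<dots> \<le> C j" using TC(4)[OF j(1)] j xy by (auto simp: z_def)
    finally have "cmod (cgrad v z) \<le> C j * (1 / sqrt (\<bar>x - fst j\<bar> * \<bar>x - snd j\<bar>))"
      using ne by (simp add: field_simps)
    also have "\<dots> \<le> C j * (sqrt (2 / (snd j - fst j)) * s x j)"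
      unfolding s_def using inverse_sqrt_mult_le[OF pq ne] TC(3)[OF j(1)] by (intro mult_left_mono) auto
    also have "\<dots> = D j * s x j" by (simp add: D_def)
    also have "\<dots> \<le> M * s x j" using MD[OF j(1)] s0 by (intro mult_right_mono) auto
    also have "\<dots> \<le> M * (1 + (\<Sum>j\<in>P. s x j))"
      using M member_le_sum[of j P "s x"] j fin s0 by (intro mult_left_mono) (auto intro: add_increasing)
    finally show ?thesis by (simp add: z_def)
  qed
  show ?thesis
    by (rule that[OF M(1)]) (use main in \<open>auto simp: s_def case_prod_beta\<close>)
qed

lemma holomorphic_lipschitz_at_0:
  assumes "Q holomorphic_on ball 0 r" "r > 0"
  obtains C where "C > 0" "\<And>w. cmod w \<le> r / 2 \<Longrightarrow> cmod (Q w - Q 0) \<le> C * cmod w"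
proof -
  define h where "h = (\<lambda>z. if z = 0 then deriv Q 0 else (Q z - Q 0) / (z - 0))"
  have "h holomorphic_on ball 0 r" unfolding h_def by (rule pole_lemma_open[OF assms(1)]) simp
  then have "continuous_on (cball 0 (r/2)) h"
    by (rule continuous_on_subset[OF holomorphic_on_imp_continuous_on]) (use assms(2) in auto)
  then have "bounded (h ` cball 0 (r/2))" by (intro compact_imp_bounded compact_continuous_image) auto
  then obtain C where C: "C > 0" "\<And>w. w \<in> cball 0 (r/2) \<Longrightarrow> cmod (h w) \<le> C" unfolding bounded_pos by blast
  have "cmod (Q w - Q 0) \<le> C * cmod w" if "cmod w \<le> r / 2" for w
  proof (cases "w = 0")
    case False
    then show ?thesis using C(2)[of w] that by (simp add: h_def norm_divide field_simps)
  qed simp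
  then show ?thesis using C(1) that by blast
qed

lemma cgrad_cong:
  assumes "harm u S" "z \<in> S" "\<And>y. y \<in> S \<Longrightarrow> u y = v y" shows "cgrad v z = cgrad u z"
  by (rule cgrad_eq_if_has_derivative)
    (rule has_derivative_transform_within_open[OF harm_has_derivative[OF assms(1,2)] harm_open[OF assms(1)] assms(2,3)])

lemma cgrad_add:
  assumes "harm u S" "harm v S" "z \<in> S" shows "cgrad (\<lambda>z. u z + v z) z = cgrad u z + cgrad v z"
  by (rule cgrad_eq_if_has_derivative)
    (use has_derivative_add[OF harm_has_derivative[OF assms(1,3)] harm_has_derivative[OF assms(2,3)]] in \<open>simp add: distrib_right\<close>)

lemma cgrad_ln_norm:
  assumes "z \<noteq> 0" shows "cgrad (\<lambda>z. ln (cmod z)) z = 1 / z"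
proof -
  have *: "y / z \<notin> \<real>\<^sub>\<le>\<^sub>0" if "y \<in> ball z (cmod z)" for y
  proof
    assume "y / z \<in> \<real>\<^sub>\<le>\<^sub>0"
    then have "cmod (y / z - 1) \<ge> 1" using complex_nonpos_Reals_iff[of "y / z"] abs_Re_le_cmod[of "y / z - 1"] by auto
    moreover have "y / z - 1 = (y - z) / z" using assms by (simp add: field_simps)
    then have "cmod (y / z - 1) < 1" using that assms by (simp add: dist_norm norm_minus_commute norm_divide)
    ultimately show False by simp
  qed
  have "cgrad (\<lambda>z. ln (cmod z)) z = deriv (\<lambda>y. Ln (y / z) + of_real (ln (cmod z))) z"
  proof (rule cgrad_Re)
    show "(\<lambda>y. Ln (y / z) + of_real (ln (cmod z))) holomorphic_on ball z (cmod z)"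
      using assms * by (auto intro!: holomorphic_intros)
    show "ln (cmod y) = Re (Ln (y / z) + of_real (ln (cmod z)))" if "y \<in> ball z (cmod z)" for y
    proof -
      have "y \<noteq> 0" using that by (auto simp: dist_norm)
      then show ?thesis using assms by (simp add: norm_divide ln_div)
    qed
  qed (use assms in auto)
  also have "\<dots> = 1 / z"
    by (rule DERIV_imp_deriv) (use assms in \<open>auto intro!: derivative_eq_intros simp: field_simps\<close>)
  finally show ?thesis .
qed

text \<open>Green's identity for \<open>U\<close> and \<open>G\<close> on a large half-disc above the line \<open>Im z = y\<close>: the arc contributes the
  residue at infinity.\<close>
lemma flux_outer:
  assumes G: "green_inf K G" and U: "hmeas K A U \<omega>" and K: "compact K" "K \<subseteq> \<real>"
  obtains C X0 where "X0 > 0" "\<And>X y. X \<ge> X0 \<Longrightarrow> 0 < y \<Longrightarrow> y \<le> 1 \<Longrightarrow>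
    \<exists>N. ((\<lambda>x. U (\<i> * of_real y + of_real x) * Im (cgrad G (\<i> * of_real y + of_real x)) -
              G (\<i> * of_real y + of_real x) * Im (cgrad U (\<i> * of_real y + of_real x))) has_integral N) {-X..X} \<and>
         \<bar>N + pi * \<omega>\<bar> \<le> C * (1 + ln (X + 1)) / X"
proof -
  let ?H = "{z. Im z > 0}"
  have HK: "?H \<subseteq> - K" using K(2) by (auto elim!: Reals_cases)
  have UH: "harm U ?H" using U HK convex_upper_half by (auto simp: hmeas_def intro: harm_subset)
  have GH: "harm G ?H" using G HK convex_upper_half by (auto simp: green_inf_def intro: harm_subset)
  obtain Fu where Fu: "Fu holomorphic_on ?H" "\<And>z. z \<in> ?H \<Longrightarrow> U z = Re (Fu z)" "\<And>z. z \<in> ?H \<Longrightarrow> (Fu has_field_derivative cgrad U z) (at z)"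
    by (rule harm_convex_Re[OF UH convex_upper_half(1)]) (rule that)
  obtain rq q where q: "rq > 0" "harm q (ball 0 rq)" "q 0 = \<omega>" "\<And>w. w \<in> ball 0 rq - {0} \<Longrightarrow> q w = U (1 / w)"
    using U unfolding hmeas_def by blast
  obtain Q where Q: "Q holomorphic_on ball 0 rq" "\<And>z. z \<in> ball 0 rq \<Longrightarrow> q z = Re (Q z)"
    by (rule harm_convex_Re[OF q(2) convex_ball]) (rule that)
  have inv: "1 / w \<in> ?H" if "Im w < 0" for w
    using that unfolding mem_Collect_eq Im_one_divide by (intro divide_pos_pos) auto
  define T where "T = ball 0 rq \<inter> {w. Im w < 0}"
  have hT: "(\<lambda>w. Fu (1 / w) - Q w) holomorphic_on T"
  proof -
    have "(Fu \<circ> (\<lambda>w. 1 / w)) holomorphic_on T"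
      by (rule holomorphic_on_compose_gen[OF _ Fu(1)]) (use inv in \<open>auto simp: T_def intro!: holomorphic_intros\<close>)
    then show ?thesis using Q(1) by (auto simp: T_def o_def intro!: holomorphic_on_diff intro: holomorphic_on_subset)
  qed
  have oT: "open T" "convex T" by (auto simp: T_def open_halfspace_Im_lt convex_halfspace_Im_lt intro: convex_Int)
  have rT: "Re (Fu (1 / w) - Q w) = 0" if "w \<in> T" for w
  proof -
    have "w \<noteq> 0" "Im w < 0" "w \<in> ball 0 rq" using that by (auto simp: T_def)
    then show ?thesis using q(4)[of w] Q(2)[of w] Fu(2)[OF inv[of w]] by simp
  qed
  obtain k where k: "\<And>w. w \<in> T \<Longrightarrow> Fu (1 / w) - Q w = k"
    by (rule Re_zero_imp_constant[OF hT oT rT]) (assumption, rule that)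
  \<comment> \<open>Holomorphic completion of \<open>U\<close>, with the imaginary constant chosen
    so that \<open>Uh\<close> tends to the real number \<omega> at infinity, at rate
    \<open>1 / |z|\<close>.\<close>
  define Uh where "Uh = (\<lambda>z. Fu z - \<i> * of_real (Im k) - \<i> * of_real (Im (Q 0)))"
  have Uh: "Uh holomorphic_on ?H" unfolding Uh_def by (intro holomorphic_intros Fu)
  have Uhd: "(Uh has_field_derivative cgrad U z) (at z)" if "z \<in> ?H" for z
    unfolding Uh_def by (auto intro!: derivative_eq_intros Fu(3)[OF that])
  have ReUh: "Re (Uh z) = U z" if "z \<in> ?H" for z using Fu(2)[OF that] by (simp add: Uh_def)
  obtain C1 where C1: "C1 > 0" "\<And>w. cmod w \<le> rq / 2 \<Longrightarrow> cmod (Q w - Q 0) \<le> C1 * cmod w"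
    by (rule holomorphic_lipschitz_at_0[OF Q(1) q(1)]) (rule that)
  have Uhb: "cmod (Uh z - of_real \<omega>) \<le> C1 / cmod z" if "z \<in> ?H" "cmod z \<ge> 2 / rq" for z
  proof -
    have z0: "z \<noteq> 0" using that by auto
    have iz: "cmod (1 / z) \<le> rq / 2" using that q(1) z0 by (simp add: norm_divide field_simps)
    have "Im (1 / z) < 0" using that(1) z0 unfolding Im_one_divide by (intro divide_neg_pos) auto
    then have w: "1 / z \<in> T" using iz q(1) by (auto simp: T_def)
    then have "Fu z - Q (1 / z) = k" using k[of "1 / z"] by simp
    moreover have "Re (Q 0) = \<omega>" using Q(2)[of 0] q by simp
    moreover have "U z = Re (Q (1 / z))" using q(4)[of "1/z"] Q(2)[of "1/z"] w z0 by (auto simp: T_def)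
    ultimately have "Uh z - of_real \<omega> = Q (1 / z) - Q 0" using ReUh[OF that(1)]
      by (auto simp: complex_eq_iff Uh_def)
    then show ?thesis using C1(2)[OF iz] by (simp add: norm_divide)
  qed
  obtain rg qg where qg: "rg > 0" "harm qg (ball 0 rg)" "\<And>w. w \<in> ball 0 rg - {0} \<Longrightarrow> qg w = G (1 / w) - ln (cmod (1 / w))"
    using G unfolding green_inf_def harm_at_inf_def by blast
  have sub: "cball 0 (rg / 2) \<subseteq> ball (0::complex) rg" using qg(1) by auto
  have "bounded (cgrad qg ` cball 0 (rg / 2))"
    by (intro compact_imp_bounded compact_continuous_image compact_cball
      continuous_on_subset[OF holomorphic_on_imp_continuous_on[OF holomorphic_cgrad[OF qg(2)]] sub])
  then obtain C2 where C2: "C2 > 0" "\<And>w. w \<in> cball 0 (rg / 2) \<Longrightarrow> cmod (cgrad qg w) \<le> C2" unfolding bounded_pos by blast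
  have "bounded (qg ` cball 0 (rg / 2))"
    by (intro compact_imp_bounded compact_continuous_image compact_cball
      continuous_on_subset[OF harm_continuous_on[OF qg(2)] sub])
  then obtain C3 where C3: "C3 > 0" "\<And>w. w \<in> cball 0 (rg / 2) \<Longrightarrow> \<bar>qg w\<bar> \<le> C3" unfolding bounded_pos by auto
  have inb: "1 / z \<in> cball 0 (rg / 2)" "z \<noteq> 0" if "cmod z \<ge> 2 / rg" for z
  proof -
    have "cmod z > 0" using that qg(1) by (smt (verit) divide_pos_pos)
    then show "z \<noteq> 0" by auto
    then show "1 / z \<in> cball 0 (rg / 2)" using that qg(1) by (simp add: norm_divide field_simps)
  qed
  have Gb: "\<bar>G z\<bar> \<le> ln (cmod z) + C3" if "cmod z \<ge> 2 / rg" "cmod z \<ge> 1" for z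
  proof -
    have "qg (1 / z) = G z - ln (cmod z)" using qg(3)[of "1 / z"] inb[OF that(1)] sub by auto
    moreover have "ln (cmod z) \<ge> 0" using that by simp
    ultimately show ?thesis using C3(2)[OF inb(1)[OF that(1)]] by linarith
  qed
  have Gd: "cmod (cgrad G z - 1 / z) \<le> C2 / (cmod z)\<^sup>2" if "cmod z \<ge> 2 / rg" for z
  proof -
    let ?S = "- cball (0::complex) (1 / rg)"
    have in1: "1 / z \<in> ball 0 rg - {0}" if "z \<in> ?S" for z
    proof -
      have "z \<noteq> 0" using that qg(1) by auto
      then show ?thesis using that qg(1) by (auto simp: norm_divide field_simps)
    qed
    have S0: "w \<noteq> 0" if "w \<in> ?S" for w using that qg(1) by auto
    have h1: "harm (\<lambda>z. ln (cmod z)) ?S" by (rule harm_ln_norm[of "\<lambda>z. z"]) (use S0 in auto)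
    have h2: "harm (\<lambda>z. qg (1 / z)) ?S"
      by (rule harm_comp[OF qg(2), of "\<lambda>z. 1 / z"]) (use in1 S0 qg(1) in \<open>auto intro!: holomorphic_intros\<close>)
    have "2 / rg > 1 / rg" using qg(1) by (simp add: field_simps)
    then have zS: "z \<in> ?S" using that by auto
    have z0: "z \<noteq> 0" using S0[OF zS] .
    have "cgrad G z = cgrad (\<lambda>z. ln (cmod z) + qg (1 / z)) z"
      by (rule cgrad_cong[OF harm_add[OF h1 h2] zS]) (use qg(3)[OF in1] in auto)
    also have "\<dots> = 1 / z + cgrad (\<lambda>z. qg (1 / z)) z"
      using cgrad_add[OF h1 h2 zS] cgrad_ln_norm[OF z0] by simp
    also have "cgrad (\<lambda>z. qg (1 / z)) z = cgrad qg (1 / z) * (- 1 / z\<^sup>2)"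
      by (rule cgrad_comp[OF qg(2)]) (use in1[OF zS] z0 in \<open>auto intro!: derivative_eq_intros simp: power2_eq_square\<close>)
    finally have "cgrad G z - 1 / z = cgrad qg (1 / z) * (- 1 / z\<^sup>2)" by simp
    then have "cmod (cgrad G z - 1 / z) = cmod (cgrad qg (1 / z)) / (cmod z)\<^sup>2"
      by (simp add: norm_mult norm_divide norm_power)
    also have "\<dots> \<le> C2 / (cmod z)\<^sup>2" using C2(2)[OF inb(1)[OF that]] by (intro divide_right_mono) auto
    finally show ?thesis .
  qed
  \<comment> \<open>Integration by parts: along horizontal lines
    \<open>U * Im (cgrad G) - G * Im (cgrad U)\<close> is the derivative of
    \<open>Im \<Psi> - G * Im Uh\<close>, where \<Psi> is a primitive of \<open>f\<close>.\<close>
  define f where "f = (\<lambda>z. Uh z * cgrad G z)"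
  have "f holomorphic_on ?H" unfolding f_def by (intro holomorphic_on_mult Uh holomorphic_cgrad GH)
  then obtain \<Psi> where "\<And>z. z \<in> ?H \<Longrightarrow> (\<Psi> has_field_derivative f z) (at z within ?H)"
    using holomorphic_convex_primitive'[OF convex_upper_half] by blast
  then have Psi: "\<And>z. z \<in> ?H \<Longrightarrow> (\<Psi> has_field_derivative f z) (at z)"
    using at_within_open convex_upper_half(2) by metis
  define X0 where "X0 = max (2 / rq) (2 / rg) + 1"
  have X0: "X0 \<ge> 1" "X0 \<ge> 2 / rq" "X0 \<ge> 2 / rg" using q(1) qg(1) by (auto simp: X0_def max_def)
  define B where "B = C1 * (1 + C2) + \<bar>\<omega>\<bar> * (C2 + 1)"
  have B: "B > 0" using C1 C2 by (auto simp: B_def intro!: add_pos_nonneg)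
  define C where "C = B * pi + 2 * (C1 * (1 + C3))"
  have main: "\<exists>N. ((\<lambda>x. U (\<i> * of_real y + of_real x) * Im (cgrad G (\<i> * of_real y + of_real x)) -
              G (\<i> * of_real y + of_real x) * Im (cgrad U (\<i> * of_real y + of_real x))) has_integral N) {-X..X} \<and>
         \<bar>N + pi * \<omega>\<bar> \<le> C * (1 + ln (X + 1)) / X" if X: "X \<ge> X0" and y: "0 < y" "y \<le> 1" for X y
  proof -
    have Xp: "X \<ge> 1" using X X0 by linarith
    define z where "z = (\<lambda>x. \<i> * of_real y + complex_of_real x)"
    have zH: "z x \<in> ?H" for x using y by (simp add: z_def)
    define \<Phi> where "\<Phi> = (\<lambda>x. Im (\<Psi> (z x)) - G (z x) * Im (Uh (z x)))"
    have d: "(\<Phi> has_real_derivative U (z x) * Im (cgrad G (z x)) - G (z x) * Im (cgrad U (z x))) (at x)" for x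
    proof -
      have 1: "((\<lambda>x. Im (\<Psi> (z x))) has_real_derivative Im (f (z x))) (at x)"
      proof -
        have "((\<lambda>w. Im (\<Psi> w)) has_derivative (\<lambda>h. Im (f (z x) * h))) (at (z x))"
          using Psi[OF zH] unfolding has_field_derivative_def by (rule has_derivative_Im)
        then have "((\<lambda>w. Im (\<Psi> w)) has_derivative (\<lambda>h. Im (f (z x)) * Re h + Re (f (z x)) * Im h)) (at (\<i> * of_real y + of_real x))"
          by (simp add: z_def add.commute)
        from DERIV_along_Re[OF this] show ?thesis by (simp add: z_def)
      qed
      have 2: "((\<lambda>x. Im (Uh (z x))) has_real_derivative Im (cgrad U (z x))) (at x)"
      proof -
        have "((\<lambda>w. Im (Uh w)) has_derivative (\<lambda>h. Im (cgrad U (z x) * h))) (at (z x))"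
          using Uhd[OF zH] unfolding has_field_derivative_def by (rule has_derivative_Im)
        then have "((\<lambda>w. Im (Uh w)) has_derivative (\<lambda>h. Im (cgrad U (z x)) * Re h + Re (cgrad U (z x)) * Im h)) (at (\<i> * of_real y + of_real x))"
          by (simp add: z_def add.commute)
        from DERIV_along_Re[OF this] show ?thesis by (simp add: z_def)
      qed
      have 3: "((\<lambda>x. G (z x)) has_real_derivative Re (cgrad G (z x))) (at x)"
      proof -
        have "(G has_derivative (\<lambda>h. Re (cgrad G (z x)) * Re h + (- Im (cgrad G (z x))) * Im h)) (at (\<i> * of_real y + of_real x))"
          using harm_has_derivative[OF GH zH[of x]] by (simp add: z_def)
        from DERIV_along_Re[OF this] show ?thesis by (simp add: z_def)
      qed
      show ?thesis unfolding \<Phi>_def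
        by (rule DERIV_cong[OF DERIV_diff[OF 1 DERIV_mult[OF 3 2]]]) (simp add: f_def ReUh[OF zH] algebra_simps)
    qed
    have int: "((\<lambda>x. U (z x) * Im (cgrad G (z x)) - G (z x) * Im (cgrad U (z x))) has_integral (\<Phi> X - \<Phi> (-X))) {-X..X}"
      by (rule fundamental_theorem_of_calculus)
        (use Xp d in \<open>auto simp: has_real_derivative_iff_has_vector_derivative[symmetric] intro: has_field_derivative_at_within\<close>)
    \<comment> \<open>Semicircle raised by \<open>y\<close>, so that its ends are exactly the ends
      of the horizontal segment.\<close>
    define c where "c = (\<lambda>t. \<i> * of_real y + of_real X * cis t)"
    have cH: "c t \<in> ?H" and cX: "X \<le> cmod (c t)" if t: "t \<in> {0..pi}" for t
    proof -
      have s: "sin t \<ge> 0" using t sin_ge_zero by auto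
      then show "c t \<in> ?H" using y Xp by (simp add: c_def add_pos_nonneg)
      have "X\<^sup>2 = (X * cos t)\<^sup>2 + (X * sin t)\<^sup>2" by (simp add: power_mult_distrib flip: distrib_left)
      also have "\<dots> \<le> (X * cos t)\<^sup>2 + (y + X * sin t)\<^sup>2"
        using s y Xp by (intro add_left_mono power_mono) auto
      also have "\<dots> = (cmod (c t))\<^sup>2" by (simp add: cmod_power2 c_def)
      finally show "X \<le> cmod (c t)" using power2_le_imp_le norm_ge_zero by blast
    qed
    \<comment> \<open>On the arc \<open>f\<close> behaves like \<open>\<omega> / z\<close>, so the
      integrand tends to \<open>i * \<omega>\<close>, and subtracting this limit leaves O(1 / X).
      Traversed from right to left, the arc changes \<open>Im \<Psi>\<close> by
      \<open>pi * \<omega>\<close> up to that error.\<close>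
    have arcd: "((\<lambda>t. \<Psi> (c t) - \<i> * of_real \<omega> * of_real t) has_vector_derivative (f (c t) * (\<i> * of_real X * cis t) - \<i> * of_real \<omega>)) (at t within {0..pi})" if t: "t \<in> {0..pi}" for t
    proof -
      have "(c has_vector_derivative (\<i> * of_real X * cis t)) (at t)"
        unfolding c_def cis_conv_exp
        by (rule has_vector_derivative_real_field) (auto intro!: derivative_eq_intros simp: algebra_simps)
      from field_vector_diff_chain_at[OF this Psi[OF cH[OF t]]]
      have "((\<lambda>t. \<Psi> (c t)) has_vector_derivative (\<i> * of_real X * cis t * f (c t))) (at t)" by (simp add: o_def)
      moreover have "((\<lambda>t. \<i> * of_real \<omega> * of_real t) has_vector_derivative (\<i> * of_real \<omega>)) (at t)"
        unfolding has_vector_derivative_def by (auto intro!: derivative_eq_intros simp: scaleR_conv_of_real)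
      ultimately have "((\<lambda>t. \<Psi> (c t) - \<i> * of_real \<omega> * of_real t) has_vector_derivative (\<i> * of_real X * cis t * f (c t) - \<i> * of_real \<omega>)) (at t)"
        by (rule has_vector_derivative_diff)
      then show ?thesis by (simp add: mult.commute has_vector_derivative_at_within)
    qed
    have arci: "((\<lambda>t. f (c t) * (\<i> * of_real X * cis t) - \<i> * of_real \<omega>) has_integral
        ((\<Psi> (c pi) - \<i> * of_real \<omega> * of_real pi) - (\<Psi> (c 0) - \<i> * of_real \<omega> * of_real 0))) {0..pi}"
      by (rule fundamental_theorem_of_calculus[OF _ arcd]) auto
    have arcb: "cmod (f (c t) * (\<i> * of_real X * cis t) - \<i> * of_real \<omega>) \<le> B / X" if t: "t \<in> {0..pi}" for t
    proof -
      define w where "w = c t"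
      define zeta where "zeta = of_real X * cis t"
      have wz: "w = \<i> * of_real y + zeta" by (simp add: w_def c_def zeta_def)
      have nz: "cmod zeta = X" using Xp by (simp add: zeta_def norm_mult)
      have w1: "X \<le> cmod w" "w \<in> ?H" using cX[OF t] cH[OF t] by (auto simp: w_def)
      have w2: "cmod w \<ge> 1" "cmod w \<ge> 2 / rq" "cmod w \<ge> 2 / rg" "cmod w > 0" "w \<noteq> 0" using w1 X X0 by auto
      have u1: "cmod (Uh w - of_real \<omega>) \<le> C1 / X"
        using Uhb[OF w1(2) w2(2)] divide_left_mono[OF w1(1), of C1] C1 Xp w2(4) by (smt (verit) mult_pos_pos)
      have g1: "cmod (cgrad G w - 1 / w) \<le> C2 / X\<^sup>2"
        by (rule order_trans[OF Gd[OF w2(3)]]) (use w1 Xp C2 w2 in \<open>auto intro!: divide_left_mono power_mono mult_pos_pos\<close>)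
      have iw: "cmod (1 / w) \<le> 1 / X" using w1 Xp w2 by (simp add: norm_divide frac_le)
      have "C2 / X\<^sup>2 \<le> C2 / X" using Xp C2 by (intro divide_left_mono) (auto simp: power2_eq_square mult_pos_pos)
      then have g2: "cmod (cgrad G w) \<le> (1 + C2) / X"
        using norm_triangle_ineq[of "cgrad G w - 1 / w" "1 / w"] g1 iw by (simp add: add_divide_distrib)
      have "(\<i> * of_real y + zeta) * (1 / w) = 1" using w2(5) by (simp flip: wz)
      then have "zeta * cgrad G w - 1 = zeta * (cgrad G w - 1 / w) + (- \<i> * of_real y) * (1 / w)"
        unfolding right_diff_distrib distrib_right by (simp only: mult_minus_left) algebra
      then have "cmod (zeta * cgrad G w - 1) \<le> X * cmod (cgrad G w - 1 / w) + y * cmod (1 / w)"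
        using norm_triangle_ineq[of "zeta * (cgrad G w - 1 / w)" "(- \<i> * of_real y) * (1 / w)"] y nz by (simp add: norm_mult norm_divide)
      also have "\<dots> \<le> X * (C2 / X\<^sup>2) + 1 * (1 / X)"
        using g1 iw Xp y by (intro add_mono mult_mono) auto
      also have "\<dots> = (C2 + 1) / X" using Xp by (simp add: power2_eq_square add_divide_distrib)
      finally have e1: "cmod (zeta * cgrad G w - 1) \<le> (C2 + 1) / X" .
      have "f w * (\<i> * zeta) - \<i> * of_real \<omega> = \<i> * ((Uh w - of_real \<omega>) * (zeta * cgrad G w) + of_real \<omega> * (zeta * cgrad G w - 1))"
        by (simp add: f_def algebra_simps)
      then have "cmod (f w * (\<i> * zeta) - \<i> * of_real \<omega>) \<le> cmod (Uh w - of_real \<omega>) * (X * cmod (cgrad G w)) + \<bar>\<omega>\<bar> * cmod (zeta * cgrad G w - 1)"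
        using norm_triangle_ineq[of "(Uh w - of_real \<omega>) * (zeta * cgrad G w)" "of_real \<omega> * (zeta * cgrad G w - 1)"] nz by (simp add: norm_mult)
      also have "\<dots> \<le> C1 / X * (X * ((1 + C2) / X)) + \<bar>\<omega>\<bar> * ((C2 + 1) / X)"
        using u1 g2 e1 Xp C1 by (intro add_mono mult_mono) auto
      also have "\<dots> = B / X" using Xp by (simp add: B_def field_simps)
      finally show ?thesis by (simp add: w_def zeta_def mult.assoc)
    qed
    have "cmod ((\<Psi> (c pi) - \<i> * of_real \<omega> * of_real pi) - (\<Psi> (c 0) - \<i> * of_real \<omega> * of_real 0)) \<le> B / X * measure lborel {0..pi}"
      by (rule has_integral_bound_real[OF _ finite.emptyI arci]) (use arcb B Xp in auto)
    then have arc: "cmod (\<Psi> (c pi) - \<Psi> (c 0) - \<i> * of_real \<omega> * of_real pi) \<le> B / X * pi" by (simp add: algebra_simps)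
    have ce: "c pi = z (-X)" "c 0 = z X" by (auto simp: c_def z_def)
    \<comment> \<open>At the two ends \<open>G\<close> is O(ln X) and \<open>Im Uh\<close> is O(1 /
      X), so the terms left over from the integration by parts vanish as \<open>X\<close>
      grows.\<close>
    have bdry: "\<bar>G (z x) * Im (Uh (z x))\<bar> \<le> (1 + C3) * (1 + ln (X + 1)) * (C1 / X)" if "x = X \<or> x = - X" for x
    proof -
      have n1: "X \<le> cmod (z x)" using abs_Re_le_cmod[of "z x"] that by (auto simp: z_def)
      have n2: "cmod (z x) \<le> X + 1" using cmod_le[of "z x"] that y Xp by (auto simp: z_def)
      have w2: "cmod (z x) \<ge> 1" "cmod (z x) \<ge> 2 / rq" "cmod (z x) \<ge> 2 / rg" using n1 X X0 by auto
      have "ln (cmod (z x)) \<le> ln (X + 1)" using n2 w2 by (subst ln_le_cancel_iff) auto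
      then have g: "\<bar>G (z x)\<bar> \<le> ln (X + 1) + C3" using Gb[OF w2(3,1)] by linarith
      have l0: "ln (X + 1) \<ge> 0" using Xp by simp
      have "\<bar>Im (Uh (z x))\<bar> \<le> cmod (Uh (z x) - of_real \<omega>)" using abs_Im_le_cmod[of "Uh (z x) - of_real \<omega>"] by simp
      also have "\<dots> \<le> C1 / cmod (z x)" by (rule Uhb[OF zH w2(2)])
      also have "\<dots> \<le> C1 / X" using n1 Xp C1 w2 by (intro divide_left_mono) (auto intro!: mult_pos_pos)
      finally have u: "\<bar>Im (Uh (z x))\<bar> \<le> C1 / X" .
      have "\<bar>G (z x)\<bar> * \<bar>Im (Uh (z x))\<bar> \<le> (ln (X + 1) + C3) * (C1 / X)"
        using g u l0 C3 by (intro mult_mono) auto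
      also have "\<dots> \<le> (1 + C3) * (1 + ln (X + 1)) * (C1 / X)"
        using l0 C3 C1 Xp by (intro mult_right_mono) (auto simp: algebra_simps)
      finally show ?thesis by (simp add: abs_mult)
    qed
    have "\<Phi> X - \<Phi> (-X) + pi * \<omega> = - Im (\<Psi> (c pi) - \<Psi> (c 0) - \<i> * of_real \<omega> * of_real pi) - G (z X) * Im (Uh (z X)) + G (z (-X)) * Im (Uh (z (-X)))"
      by (simp add: \<Phi>_def ce)
    note e1 = this
    have lin: "\<bar>t\<bar> \<le> M1 + M2 + M3" if "t = - a - b + d" "\<bar>a\<bar> \<le> M1" "\<bar>b\<bar> \<le> M2" "\<bar>d\<bar> \<le> M3" for t a b d M1 M2 M3 :: real
      using that by linarith
    have e2: "\<bar>Im (\<Psi> (c pi) - \<Psi> (c 0) - \<i> * of_real \<omega> * of_real pi)\<bar> \<le> B / X * pi"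
      by (rule order_trans[OF abs_Im_le_cmod arc])
    have "\<bar>\<Phi> X - \<Phi> (-X) + pi * \<omega>\<bar> \<le> B / X * pi + (1 + C3) * (1 + ln (X + 1)) * (C1 / X) + (1 + C3) * (1 + ln (X + 1)) * (C1 / X)"
      by (rule lin[OF e1 e2 bdry[OF disjI1[OF refl]] bdry[OF disjI2[OF refl]]])
    also have "\<dots> = (B * pi + 2 * ((1 + C3) * (1 + ln (X + 1)) * C1)) / X" by (simp add: add_divide_distrib)
    also have "\<dots> \<le> C * (1 + ln (X + 1)) / X"
    proof -
      have "B * pi * 1 \<le> B * pi * (1 + ln (X + 1))" using B Xp by (intro mult_left_mono) auto
      then have "B * pi + 2 * ((1 + C3) * (1 + ln (X + 1)) * C1) \<le> C * (1 + ln (X + 1))"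
        unfolding C_def by (simp add: algebra_simps)
      then show ?thesis using Xp by (intro divide_right_mono) auto
    qed
    finally show ?thesis using int unfolding z_def by blast
  qed
  show ?thesis by (rule that[OF _ main]) (use X0 in auto)
qed

text \<open>Differentiating \<open>v (cnj z) = v z\<close> at a real point shows that
  \<open>cgrad v x\<close> equals its own conjugate.\<close>

lemma Im_cgrad_real:
  assumes v: "harm v S" "x \<in> S" "Im x = 0" and sym: "\<And>z. z \<in> S \<Longrightarrow> v (cnj z) = v z"
  shows "Im (cgrad v x) = 0"
proof -
  have cx: "cnj x = x" using v(3) by (simp add: complex_eq_iff)
  have c1: "(cnj has_derivative cnj) (at x)" by (rule bounded_linear_imp_has_derivative[OF bounded_linear_cnj])
  have c2: "(v has_derivative (\<lambda>h. Re (cgrad v x * h))) (at (cnj x))"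
    using harm_has_derivative[OF v(1,2)] by (simp only: cx)
  have "((\<lambda>z. v (cnj z)) has_derivative (\<lambda>h. Re (cgrad v x * cnj h))) (at x)"
    using diff_chain_at[OF c1 c2] by (simp only: o_def)
  then have "(v has_derivative (\<lambda>h. Re (cgrad v x * cnj h))) (at x)"
    by (rule has_derivative_transform_within_open[OF _ harm_open[OF v(1)] v(2)]) (rule sym)
  also have "(\<lambda>h. Re (cgrad v x * cnj h)) = (\<lambda>h. Re (cnj (cgrad v x) * h))" by (simp add: fun_eq_iff)
  finally have "(v has_derivative (\<lambda>h. Re (cnj (cgrad v x) * h))) (at x)" .
  then have "cgrad v x = cnj (cgrad v x)" by (rule cgrad_eq_if_has_derivative)
  then show ?thesis by (simp add: complex_eq_iff)
qed

lemma tendsto_vertical: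
  "((\<lambda>n. \<i> * of_real (1 / real (Suc n)) + of_real x) \<longlonglongrightarrow> complex_of_real x)"
proof -
  have "(\<lambda>n. \<i> * of_real (1 / real (Suc n)) + of_real x) \<longlonglongrightarrow> \<i> * of_real 0 + complex_of_real x"
    by (intro tendsto_intros LIMSEQ_Suc[OF lim_1_over_n])
  then show ?thesis by simp
qed

lemma filterlim_vertical:
  "filterlim (\<lambda>n. \<i> * of_real (1 / real (Suc n)) + complex_of_real x) (at (of_real x) within {z. Im z > 0}) sequentially"
  unfolding filterlim_at using tendsto_vertical[of x]
  by (auto intro!: always_eventually simp: complex_eq_iff)

text \<open>The horizontal line descends to the real axis. On the slits \<open>G\<close> tends to 0
  and \<open>U\<close> to 1 or 0; in the gaps both gradients have vanishing imaginary part. Hence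
  the integrand is asymptotically \<open>chi * Im (cgrad G)\<close>, whose integral is an increment
  of \<open>Im L\<close>.\<close>

lemma flux_inner:
  assumes P: "slit_system P" and A: "(pk, qk) \<in> P"
    and G: "green_inf (slits P) G" and U: "hmeas (slits P) (complex_of_real ` {pk..qk}) U \<omega>"
    and L: "L holomorphic_on {z. Im z > 0}" "\<And>z. Im z > 0 \<Longrightarrow> Re (L z) = G z"
    and x: "xl < pk" "qk < xr" "\<And>x. xl \<le> x \<Longrightarrow> x < pk \<Longrightarrow> of_real x \<notin> slits P" "\<And>x. qk < x \<Longrightarrow> x \<le> xr \<Longrightarrow> of_real x \<notin> slits P"
    and lim: "(L \<longlongrightarrow> L (of_real xl)) (at (of_real xl) within {z. Im z > 0})" "(L \<longlongrightarrow> L (of_real xr)) (at (of_real xr) within {z. Im z > 0})"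
    and X: "-X \<le> xl" "xr \<le> X"
    and N: "\<And>n. ((\<lambda>x. U (\<i> * of_real (1 / real (Suc n)) + of_real x) * Im (cgrad G (\<i> * of_real (1 / real (Suc n)) + of_real x)) -
              G (\<i> * of_real (1 / real (Suc n)) + of_real x) * Im (cgrad U (\<i> * of_real (1 / real (Suc n)) + of_real x))) has_integral N n) {-X..X}"
  shows "N \<longlonglongrightarrow> Im (L (of_real xr)) - Im (L (of_real xl))"
proof -
  let ?K = "slits P" and ?H = "{z. Im z > 0}"
  have fin: "finite P" using P by (simp add: slit_system_def)
  have Kc: "compact ?K" "?K \<noteq> {}" "?K \<subseteq> \<real>" using compact_slits[OF fin] slits_nonempty[OF P] slits_real by auto
  have HK: "?H \<subseteq> - ?K" using Kc(3) by (auto elim!: Reals_cases)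
  have hG: "harm G (- ?K)" and hU: "harm U (- ?K)" using G U by (auto simp: green_inf_def hmeas_def)
  have pk: "pk < qk" using P A by (auto simp: slit_system_def)
  define z where "z = (\<lambda>n x. \<i> * of_real (1 / real (Suc n)) + complex_of_real x)"
  have zH: "z n x \<in> ?H" for n x by (simp add: z_def)
  define g where "g = (\<lambda>n x. U (z n x) * Im (cgrad G (z n x)) - G (z n x) * Im (cgrad U (z n x)))"
  have N': "(g n has_integral N n) {-X..X}" for n using N[of n] by (simp add: g_def z_def)
  define Ends where "Ends = fst ` P \<union> snd ` P"
  have finE: "finite Ends" using fin by (simp add: Ends_def)
  \<comment> \<open>The cut is made at \<open>xl\<close> and \<open>xr\<close> and not at the ends
    of the slit: these points lie in gaps, where \<open>L\<close> has boundary values, and the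
    pieces in the gaps contribute nothing in the limit.\<close>
  define chi where "chi = (\<lambda>x::real. if x \<in> {xl..xr} then 1 else (0::real))"
  \<comment> \<open>At the finitely many endpoints the gradient bounds say nothing; setting
    \<open>f\<close> to 0 there leaves the integrals unchanged.\<close>
  define f where "f = (\<lambda>n x. if x \<in> Ends then 0 else g n x - chi x * Im (cgrad G (z n x)))"
  have GH: "harm G ?H" by (rule harm_subset[OF hG convex_upper_half(2) HK])
  have Ld: "deriv L w = cgrad G w" if "w \<in> ?H" for w
    using cgrad_Re[OF L(1) convex_upper_half(2) that, of G] L(2) by simp
  have mid: "((\<lambda>x. Im (cgrad G (z n x))) has_integral (Im (L (z n xr)) - Im (L (z n xl)))) {xl..xr}" for n
  proof (rule fundamental_theorem_of_calculus)
    show "xl \<le> xr" using x pk by simp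
    fix t assume "t \<in> {xl..xr}"
    have "((\<lambda>w. Im (L w)) has_derivative (\<lambda>h. Im (cgrad G (z n t) * h))) (at (z n t))"
      using holomorphic_derivI[OF L(1) convex_upper_half(2) zH[of n t]] Ld[OF zH[of n t]]
      unfolding has_field_derivative_def by (intro has_derivative_Im) simp
    then have "((\<lambda>w. Im (L w)) has_derivative (\<lambda>h. Im (cgrad G (z n t)) * Re h + Re (cgrad G (z n t)) * Im h)) (at (\<i> * of_real (1 / real (Suc n)) + of_real t))"
      by (simp add: z_def add.commute)
    from DERIV_along_Re[OF this]
    show "((\<lambda>x. Im (L (z n x))) has_vector_derivative Im (cgrad G (z n t))) (at t within {xl..xr})"
      by (simp add: z_def has_real_derivative_iff_has_vector_derivative[symmetric] has_field_derivative_at_within)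
  qed
  have mid': "((\<lambda>x. chi x * Im (cgrad G (z n x))) has_integral (Im (L (z n xr)) - Im (L (z n xl)))) {-X..X}" for n
  proof -
    have "((\<lambda>x. if x \<in> {xl..xr} then Im (cgrad G (z n x)) else 0) has_integral (Im (L (z n xr)) - Im (L (z n xl)))) {-X..X}"
      using mid[of n] by (subst has_integral_restrict) (use X in auto)
    moreover have "(\<lambda>x. if x \<in> {xl..xr} then Im (cgrad G (z n x)) else 0) = (\<lambda>x. chi x * Im (cgrad G (z n x)))"
      by (auto simp: chi_def)
    ultimately show ?thesis by simp
  qed
  have fint: "(f n has_integral (N n - (Im (L (z n xr)) - Im (L (z n xl))))) {-X..X}" for n
    by (rule has_integral_spike_finite[OF finE _ has_integral_diff[OF N' mid']]) (auto simp: f_def)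
  obtain CG where CG: "CG > 0" "\<And>x y. \<bar>x\<bar> \<le> X \<Longrightarrow> 0 \<le> y \<Longrightarrow> y \<le> 1 \<Longrightarrow> \<i> * of_real y + of_real x \<notin> ?K \<Longrightarrow> x \<notin> fst ` P \<union> snd ` P \<Longrightarrow>
      cmod (cgrad G (\<i> * of_real y + of_real x)) \<le> CG * (1 + (\<Sum>(p, q)\<in>P. 1 / sqrt \<bar>x - p\<bar> + 1 / sqrt \<bar>x - q\<bar>))"
  proof (rule cgrad_bound_near_slits[OF P hG])
    fix p q assume "(p, q) \<in> P"
    then show "\<exists>c. \<forall>x\<in>complex_of_real ` {p..q}. (G \<longlongrightarrow> c) (at x within - ?K)"
      using G unfolding green_inf_def slits_def by (intro exI[of _ 0]) fastforce
  qed (rule that)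
  obtain CU where CU: "CU > 0" "\<And>x y. \<bar>x\<bar> \<le> X \<Longrightarrow> 0 \<le> y \<Longrightarrow> y \<le> 1 \<Longrightarrow> \<i> * of_real y + of_real x \<notin> ?K \<Longrightarrow> x \<notin> fst ` P \<union> snd ` P \<Longrightarrow>
      cmod (cgrad U (\<i> * of_real y + of_real x)) \<le> CU * (1 + (\<Sum>(p, q)\<in>P. 1 / sqrt \<bar>x - p\<bar> + 1 / sqrt \<bar>x - q\<bar>))"
  proof (rule cgrad_bound_near_slits[OF P hU])
    fix p q assume pq: "(p, q) \<in> P"
    define c :: real where "c = (if (p, q) = (pk, qk) then 1 else 0)"
    have "(U \<longlongrightarrow> c) (at x within - ?K)" if x: "x \<in> complex_of_real ` {p..q}" for x
    proof -
      have "x \<in> ?K" using pq x by (auto simp: slits_def)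
      then have "(U \<longlongrightarrow> indicator (complex_of_real ` {pk..qk}) x) (at x within - ?K)" using U by (simp add: hmeas_def)
      moreover have "indicator (complex_of_real ` {pk..qk}) x = c"
      proof (cases "(p, q) = (pk, qk)")
        case False
        then have "{p..q} \<inter> {pk..qk} = {}"
          using P pq A unfolding slit_system_def disjoint_family_on_def by fastforce
        then show ?thesis using x False by (auto simp: c_def indicator_def)
      qed (use x in \<open>auto simp: c_def\<close>)
      ultimately show ?thesis by simp
    qed
    then show "\<exists>c. \<forall>x\<in>complex_of_real ` {p..q}. (U \<longlongrightarrow> c) (at x within - ?K)" by blast
  qed (rule that)
  define D where "D = (\<lambda>x. 1 + (\<Sum>(p, q)\<in>P. 1 / sqrt \<bar>x - p\<bar> + 1 / sqrt \<bar>x - q\<bar>))"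
  have D1: "D x \<ge> 1" for x unfolding D_def by (simp add: sum_nonneg case_prod_beta)
  have gG: "cmod (cgrad G (z n x)) \<le> CG * D x" and gU: "cmod (cgrad U (z n x)) \<le> CU * D x"
    if "x \<in> {-X..X}" "x \<notin> Ends" for n x
  proof -
    have *: "\<bar>x\<bar> \<le> X" "0 \<le> 1 / real (Suc n)" "1 / real (Suc n) \<le> 1" "\<i> * of_real (1 / real (Suc n)) + of_real x \<notin> ?K" "x \<notin> fst ` P \<union> snd ` P"
      using that subsetD[OF HK zH[of n x]] unfolding z_def Ends_def Compl_iff by auto
    show "cmod (cgrad G (z n x)) \<le> CG * D x" using CG(2)[OF *] by (simp only: z_def D_def)
    show "cmod (cgrad U (z n x)) \<le> CU * D x" using CU(2)[OF *] by (simp only: z_def D_def)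
  qed
  define box where "box = cbox (Complex (-X) 0) (Complex X 1)"
  have zbox: "z n x \<in> box - ?K" if "x \<in> {-X..X}" for n x
  proof
    show "z n x \<in> box" using that by (auto simp: z_def box_def in_cbox_complex_iff)
    show "z n x \<notin> ?K" using subsetD[OF HK zH[of n x]] by simp
  qed
  have limG: "\<exists>c. (G \<longlongrightarrow> c) (at x within - ?K)" if "x \<in> ?K" for x using G that by (auto simp: green_inf_def)
  have limU: "\<exists>c. (U \<longlongrightarrow> c) (at x within - ?K)" if "x \<in> ?K" for x using U that by (auto simp: hmeas_def)
  obtain BG where BG: "BG > 0" "\<And>w. w \<in> box - ?K \<Longrightarrow> \<bar>G w\<bar> \<le> BG"
    by (rule locally_bounded_imp_bounded[of box ?K G]) (use limG harm_isCont[OF hG] in \<open>auto simp: box_def\<close>)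
  obtain BU where BU: "BU > 0" "\<And>w. w \<in> box - ?K \<Longrightarrow> \<bar>U w\<bar> \<le> BU"
    by (rule locally_bounded_imp_bounded[of box ?K U]) (use limU harm_isCont[OF hU] in \<open>auto simp: box_def\<close>)
  define h where "h = (\<lambda>x. ((BU + 1) * CG + BG * CU) * D x)"
  have f_eq: "f n x = (U (z n x) - chi x) * Im (cgrad G (z n x)) - G (z n x) * Im (cgrad U (z n x))" if "x \<notin> Ends" for n x
    using that by (simp add: f_def g_def algebra_simps)
  have dom: "norm (f n x) \<le> h x" if xX: "x \<in> {-X..X}" for n x
  proof (cases "x \<in> Ends")
    case True
    then show ?thesis using D1[of x] BU BG CG CU by (simp add: f_def h_def)
  next
    case False
    have "\<bar>f n x\<bar> \<le> \<bar>U (z n x) - chi x\<bar> * \<bar>Im (cgrad G (z n x))\<bar> + \<bar>G (z n x)\<bar> * \<bar>Im (cgrad U (z n x))\<bar>"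
      unfolding f_eq[OF False] by (simp add: abs_mult[symmetric])
    also have "\<dots> \<le> (BU + 1) * (CG * D x) + BG * (CU * D x)"
    proof (intro add_mono mult_mono)
      show "\<bar>U (z n x) - chi x\<bar> \<le> BU + 1" using BU(2)[OF zbox[OF xX, of n]] by (auto simp: chi_def)
      show "\<bar>Im (cgrad G (z n x))\<bar> \<le> CG * D x" using gG[OF xX False] abs_Im_le_cmod order_trans by blast
      show "\<bar>Im (cgrad U (z n x))\<bar> \<le> CU * D x" using gU[OF xX False] abs_Im_le_cmod order_trans by blast
      show "\<bar>G (z n x)\<bar> \<le> BG" using BG(2)[OF zbox[OF xX, of n]] .
    qed (use BU BG in auto)
    finally show ?thesis by (simp add: h_def algebra_simps)
  qed
  have hint: "h integrable_on {-X..X}"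
  proof -
    have "-X \<le> X" using X x pk by linarith
    then have "D integrable_on {-X..X}" unfolding D_def
      by (intro integrable_add integrable_sum fin) (auto intro!: integrable_add inverse_sqrt_integrable simp: case_prod_beta)
    then show ?thesis unfolding h_def by (rule integrable_on_mult_right)
  qed
  have conv: "(\<lambda>n. f n x) \<longlonglongrightarrow> 0" if xX: "x \<in> {-X..X}" for x
  proof (cases "x \<in> Ends")
    case True then show ?thesis by (simp add: f_def)
  next
    case xE: False
    show ?thesis
    proof (cases "complex_of_real x \<in> ?K")
      case False
      then have xS: "complex_of_real x \<in> - ?K" by simp
      have zx: "(\<lambda>n. z n x) \<longlonglongrightarrow> of_real x" unfolding z_def by (rule tendsto_vertical)
      have cc: "isCont (cgrad G) (of_real x)" "isCont (cgrad U) (of_real x)"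
        using holomorphic_on_imp_continuous_on[OF holomorphic_cgrad[OF hG]] holomorphic_on_imp_continuous_on[OF holomorphic_cgrad[OF hU]]
          continuous_on_eq_continuous_at[OF harm_open[OF hG]] xS by blast+
      have "(\<lambda>n. (U (z n x) - chi x) * Im (cgrad G (z n x)) - G (z n x) * Im (cgrad U (z n x))) \<longlonglongrightarrow>
        (U (of_real x) - chi x) * Im (cgrad G (of_real x)) - G (of_real x) * Im (cgrad U (of_real x))"
        by (intro tendsto_intros isCont_tendsto_compose[OF _ zx] harm_isCont[OF hU xS] harm_isCont[OF hG xS] cc)
      moreover have "Im (cgrad G (of_real x)) = 0"
        by (rule Im_cgrad_real[OF hG xS]) (use green_inf_cnj[OF G Kc] in auto)
      moreover have "Im (cgrad U (of_real x)) = 0"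
        by (rule Im_cgrad_real[OF hU xS]) (use hmeas_cnj[OF U Kc] in auto)
      ultimately show ?thesis using f_eq[OF xE] by simp
    next
      case True
      have fl: "filterlim (\<lambda>n. z n x) (at (of_real x) within - ?K) sequentially"
      proof (rule filterlim_mono)
        show "filterlim (\<lambda>n. z n x) (at (of_real x) within ?H) sequentially" unfolding z_def by (rule filterlim_vertical)
        show "at (of_real x) within ?H \<le> at (of_real x) within - ?K" by (rule at_le[OF HK])
      qed simp
      have "(\<lambda>n. G (z n x)) \<longlonglongrightarrow> 0"
        using filterlim_compose[OF _ fl, of G "nhds 0"] G True by (simp add: green_inf_def)
      then have G0: "(\<lambda>n. \<bar>G (z n x)\<bar> * (CU * D x)) \<longlonglongrightarrow> 0" by (auto intro!: tendsto_mult_left_zero tendsto_rabs_zero)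
      have "(\<lambda>n. U (z n x)) \<longlonglongrightarrow> indicator (complex_of_real ` {pk..qk}) (complex_of_real x)"
        using filterlim_compose[OF _ fl, of U] U True by (simp add: hmeas_def)
      moreover have "indicator (complex_of_real ` {pk..qk}) (complex_of_real x) = chi x"
      proof -
        have "x \<in> {xl..xr} \<longleftrightarrow> x \<in> {pk..qk}" using x(3)[of x] x(4)[of x] x(1,2) True by force
        then show ?thesis by (auto simp: chi_def indicator_def)
      qed
      ultimately have "(\<lambda>n. U (z n x) - chi x) \<longlonglongrightarrow> 0" by (simp add: LIM_zero)
      then have U0: "(\<lambda>n. \<bar>U (z n x) - chi x\<bar> * (CG * D x)) \<longlonglongrightarrow> 0" by (auto intro!: tendsto_mult_left_zero tendsto_rabs_zero)
      have a: "(\<lambda>n. \<bar>U (z n x) - chi x\<bar> * (CG * D x) + \<bar>G (z n x)\<bar> * (CU * D x)) \<longlonglongrightarrow> 0"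
        using tendsto_add[OF U0 G0] by simp
      have b: "norm (f n x) \<le> \<bar>U (z n x) - chi x\<bar> * (CG * D x) + \<bar>G (z n x)\<bar> * (CU * D x)" for n
      proof -
        have "\<bar>f n x\<bar> \<le> \<bar>U (z n x) - chi x\<bar> * \<bar>Im (cgrad G (z n x))\<bar> + \<bar>G (z n x)\<bar> * \<bar>Im (cgrad U (z n x))\<bar>"
          unfolding f_eq[OF xE] by (simp add: abs_mult[symmetric])
        also have "\<dots> \<le> \<bar>U (z n x) - chi x\<bar> * (CG * D x) + \<bar>G (z n x)\<bar> * (CU * D x)"
          using order_trans[OF abs_Im_le_cmod gG[OF xX xE, of n]] order_trans[OF abs_Im_le_cmod gU[OF xX xE, of n]]
          by (intro add_mono mult_left_mono) auto
        finally show ?thesis by simp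
      qed
      show ?thesis by (rule Lim_null_comparison[OF always_eventually[OF allI[OF b]] a])
    qed
  qed
  have "(\<lambda>n. integral {-X..X} (f n)) \<longlonglongrightarrow> integral {-X..X} (\<lambda>x. 0)"
    by (rule dominated_convergence(2)[OF _ hint dom conv]) (use fint in blast)
  then have 1: "(\<lambda>n. N n - (Im (L (z n xr)) - Im (L (z n xl)))) \<longlonglongrightarrow> 0"
    by (simp only: integral_unique[OF fint] integral_0)
  have "(\<lambda>n. L (z n xr)) \<longlonglongrightarrow> L (of_real xr)" "(\<lambda>n. L (z n xl)) \<longlonglongrightarrow> L (of_real xl)"
    unfolding z_def by (rule filterlim_compose[OF lim(2) filterlim_vertical] filterlim_compose[OF lim(1) filterlim_vertical])+
  then have 2: "(\<lambda>n. Im (L (z n xr)) - Im (L (z n xl))) \<longlonglongrightarrow> Im (L (of_real xr)) - Im (L (of_real xl))"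
    by (intro tendsto_intros)
  from tendsto_add[OF 1 2] show ?thesis by simp
qed

text \<open>First the line descends with \<open>X\<close> fixed, by \<open>flux_inner\<close>, then
  \<open>X\<close> tends to infinity in the error term of \<open>flux_outer\<close>. Only the upper
  side of the slit is seen, hence \<open>pi\<close> and not \<open>2 * pi\<close>.\<close>

lemma flux_eq_harmonic_measure:
  assumes P: "slit_system P" and A: "(pk, qk) \<in> P"
    and G: "green_inf (slits P) G" and U: "hmeas (slits P) (complex_of_real ` {pk..qk}) U \<omega>"
    and L: "L holomorphic_on {z. Im z > 0}" "\<And>z. Im z > 0 \<Longrightarrow> Re (L z) = G z"
    and x: "xl < pk" "qk < xr" "\<And>x. xl \<le> x \<Longrightarrow> x < pk \<Longrightarrow> of_real x \<notin> slits P" "\<And>x. qk < x \<Longrightarrow> x \<le> xr \<Longrightarrow> of_real x \<notin> slits P"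
    and lim: "(L \<longlongrightarrow> L (of_real xl)) (at (of_real xl) within {z. Im z > 0})" "(L \<longlongrightarrow> L (of_real xr)) (at (of_real xr) within {z. Im z > 0})"
  shows "Im (L (of_real xl)) - Im (L (of_real xr)) = pi * \<omega>"
proof -
  have fin: "finite P" using P by (simp add: slit_system_def)
  obtain C X0 where C: "X0 > 0" "\<And>X y. X \<ge> X0 \<Longrightarrow> 0 < y \<Longrightarrow> y \<le> 1 \<Longrightarrow>
    \<exists>N. ((\<lambda>x. U (\<i> * of_real y + of_real x) * Im (cgrad G (\<i> * of_real y + of_real x)) -
              G (\<i> * of_real y + of_real x) * Im (cgrad U (\<i> * of_real y + of_real x))) has_integral N) {-X..X} \<and>
         \<bar>N + pi * \<omega>\<bar> \<le> C * (1 + ln (X + 1)) / X"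
    by (rule flux_outer[OF G U compact_slits[OF fin] slits_real]) (rule that)
  define d where "d = Im (L (of_real xr)) - Im (L (of_real xl))"
  have le: "\<bar>d + pi * \<omega>\<bar> \<le> C * (1 + ln (X + 1)) / X" if X: "X \<ge> max X0 (max \<bar>xl\<bar> \<bar>xr\<bar>)" for X
  proof -
    have "\<exists>N. ((\<lambda>x. U (\<i> * of_real (1 / real (Suc n)) + of_real x) * Im (cgrad G (\<i> * of_real (1 / real (Suc n)) + of_real x)) -
              G (\<i> * of_real (1 / real (Suc n)) + of_real x) * Im (cgrad U (\<i> * of_real (1 / real (Suc n)) + of_real x))) has_integral N) {-X..X} \<and>
         \<bar>N + pi * \<omega>\<bar> \<le> C * (1 + ln (X + 1)) / X" for n
      by (rule C(2)) (use X in auto)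
    note ex = this
    define N where "N = (\<lambda>n. integral {-X..X} (\<lambda>x. U (\<i> * of_real (1 / real (Suc n)) + of_real x) * Im (cgrad G (\<i> * of_real (1 / real (Suc n)) + of_real x)) -
              G (\<i> * of_real (1 / real (Suc n)) + of_real x) * Im (cgrad U (\<i> * of_real (1 / real (Suc n)) + of_real x))))"
    have N: "((\<lambda>x. U (\<i> * of_real (1 / real (Suc n)) + of_real x) * Im (cgrad G (\<i> * of_real (1 / real (Suc n)) + of_real x)) -
              G (\<i> * of_real (1 / real (Suc n)) + of_real x) * Im (cgrad U (\<i> * of_real (1 / real (Suc n)) + of_real x))) has_integral N n) {-X..X}
      \<and> \<bar>N n + pi * \<omega>\<bar> \<le> C * (1 + ln (X + 1)) / X" for n
    proof -
      obtain N' where N': "((\<lambda>x. U (\<i> * of_real (1 / real (Suc n)) + of_real x) * Im (cgrad G (\<i> * of_real (1 / real (Suc n)) + of_real x)) -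
              G (\<i> * of_real (1 / real (Suc n)) + of_real x) * Im (cgrad U (\<i> * of_real (1 / real (Suc n)) + of_real x))) has_integral N') {-X..X}"
         "\<bar>N' + pi * \<omega>\<bar> \<le> C * (1 + ln (X + 1)) / X" using ex[of n] by blast
      have "N n = N'" unfolding N_def by (rule integral_unique[OF N'(1)])
      with N' show ?thesis by simp
    qed
    note N = conjunct1[OF N] conjunct2[OF N]
    have "N \<longlonglongrightarrow> d" unfolding d_def
      by (rule flux_inner[OF P A G U L x lim _ _ N(1)]) (use X in auto)
    then have "(\<lambda>n. \<bar>N n + pi * \<omega>\<bar>) \<longlonglongrightarrow> \<bar>d + pi * \<omega>\<bar>" by (intro tendsto_intros)
    then show ?thesis by (rule LIMSEQ_le_const2) (use N(2) in auto)
  qed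
  have "((\<lambda>X::real. C * (1 + ln (X + 1)) / X) \<longlongrightarrow> 0) at_top" by real_asymp
  moreover have "\<forall>\<^sub>F X in at_top. \<bar>d + pi * \<omega>\<bar> \<le> C * (1 + ln (X + 1)) / X"
    using le eventually_ge_at_top by (rule eventually_mono[rotated])
  ultimately have "\<bar>d + pi * \<omega>\<bar> \<le> 0" by (intro tendsto_lowerbound) auto
  then show ?thesis by (simp add: d_def)
qed

section \<open>Lower bounds for harmonic measure\<close>

lemma eventually_diff_less:
  fixes f g :: "'a \<Rightarrow> real"
  assumes "(f \<longlongrightarrow> a) F" "(g \<longlongrightarrow> b) F" "a \<le> b" "\<epsilon> > 0"
  shows "\<forall>\<^sub>F z in F. f z - g z < \<epsilon>"
  by (rule order_tendstoD(2)[OF tendsto_diff[OF assms(1,2)]]) (use assms in auto)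

lemma frontier_open_subset:
  assumes "open S" "S \<subseteq> T" "closed T" "x \<in> frontier S" shows "x \<in> T" "x \<notin> S"
  using assms closure_minimal[of S T] by (auto simp: frontier_def interior_open)

lemma harm_tendsto: "harm u S \<Longrightarrow> x \<in> S \<Longrightarrow> (u \<longlongrightarrow> u x) (at x within T)"
  using harm_isCont continuous_at_imp_continuous_at_within continuous_within by blast

text \<open>With \<open>\<zeta> = (z - p) / r\<close> the barrier is \<open>1 - Re \<zeta>\<^sup>2 - 2 * Im \<zeta>\<close>, which equals \<open>2 * sin \<theta> * (sin \<theta> - 1) \<le> 0\<close> on the
  upper unit semicircle.\<close>
lemma hmeas_lower_bound_near:
  fixes b c :: real
  defines "A \<equiv> complex_of_real ` {b..c}" and "p \<equiv> (b + c) / 2" and "r \<equiv> (c - b) / 2"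
  assumes U: "hmeas K A U \<omega>" and K: "compact K" "K \<subseteq> \<real>" "A \<subseteq> K" and bc: "b < c"
    and z: "cmod (z - of_real p) \<le> r / 4" "z \<notin> K"
  shows "U z \<ge> 7 / 16"
proof -
  have Kne: "K \<noteq> {}" using K(3) bc by (auto simp: A_def)
  have r: "r > 0" using bc by (simp add: r_def)
  define S where "S = {z. cmod (z - of_real p) < r} \<inter> {z. Im z > 0}"
  have opS: "open S" unfolding S_def by (intro open_Int open_Collect_less continuous_intros)
  have SK: "S \<subseteq> - K" using K(2) by (auto simp: S_def elim!: Reals_cases)
  have hU: "harm U (- K)" using U by (simp add: hmeas_def)
  define v where "v = (\<lambda>z. 1 - ((Re z - p)\<^sup>2 - (Im z)\<^sup>2) / r\<^sup>2 - 2 * Im z / r)"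
  have hv: "harm v S"
  proof (rule harm_cong[OF harm_Re[OF _ opS]])
    show "(\<lambda>z. 1 - (z - of_real p)\<^sup>2 / of_real (r\<^sup>2) + 2 * \<i> * (z - of_real p) / of_real r) holomorphic_on S"
      using r by (auto intro!: holomorphic_intros)
    show "Re (1 - (z - of_real p)\<^sup>2 / of_real (r\<^sup>2) + 2 * \<i> * (z - of_real p) / of_real r) = v z" for z
      by (simp add: v_def Re_divide_of_real power2_eq_square[of "z - of_real p"]) (simp add: power2_eq_square)
  qed
  have Uv: "v z - U z \<le> 0" if "z \<in> S" for z
  proof (rule max_principle_bounded[where u = "\<lambda>z. v z - U z", OF _ _ _ that])
    show "harm (\<lambda>z. v z - U z) S" by (intro harm_diff hv harm_subset[OF hU opS SK])
    have "S \<subseteq> ball (of_real p) r" by (auto simp: S_def dist_norm norm_minus_commute)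
    then show "bounded S" using bounded_ball bounded_subset by blast
    fix x and \<epsilon> :: real assume x: "x \<in> frontier S" and e: "\<epsilon> > 0"
    have cl: "closed ({z. cmod (z - of_real p) \<le> r} \<inter> {z. Im z \<ge> 0})"
      by (intro closed_Int closed_Collect_le continuous_intros)
    have "S \<subseteq> {z. cmod (z - of_real p) \<le> r} \<inter> {z. Im z \<ge> 0}" by (auto simp: S_def)
    from frontier_open_subset[OF opS this cl x]
    have x1: "cmod (x - of_real p) \<le> r" "Im x \<ge> 0" "x \<notin> S" by auto
    have vlim: "(v \<longlongrightarrow> v x) (at x within S)" unfolding v_def by (intro tendsto_intros) (use r in auto)
    show "\<forall>\<^sub>F z in at x within S. v z - U z < \<epsilon>"
    proof (cases "Im x = 0")
      case True
      then have xr: "x = of_real (Re x)" by (simp add: complex_eq_iff)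
      then have "cmod (x - of_real p) = \<bar>Re x - p\<bar>" by (metis norm_of_real of_real_diff)
      then have "Re x \<in> {b..c}" using x1(1) by (auto simp: p_def r_def abs_if field_simps split: if_splits)
      then have xA: "x \<in> A" unfolding A_def using xr by blast
      then have "(U \<longlongrightarrow> 1) (at x within - K)" using U K(3) unfolding hmeas_def by (auto dest!: bspec[of _ _ x])
      then have "(U \<longlongrightarrow> 1) (at x within S)" using SK tendsto_within_subset by blast
      moreover have "v x \<le> 1" using True by (simp add: v_def)
      ultimately show ?thesis using eventually_diff_less[OF vlim _ _ e] by blast
    next
      case False
      then have Im: "Im x > 0" using x1 by simp
      then have nr: "cmod (x - of_real p) = r" using x1 by (auto simp: S_def)
      have xK: "x \<in> - K" using Im K(2) by (auto elim!: Reals_cases)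
      have "(U \<longlongrightarrow> U x) (at x within S)" by (rule harm_tendsto[OF hU xK])
      moreover have "v x \<le> U x"
      proof -
        have "(Re x - p)\<^sup>2 + (Im x)\<^sup>2 = r\<^sup>2" using nr cmod_power2[of "x - of_real p"] by simp
        then have "(Re x - p)\<^sup>2 - (Im x)\<^sup>2 = r\<^sup>2 - 2 * (Im x)\<^sup>2" by simp
        then have "v x = 1 - (r\<^sup>2 - 2 * (Im x)\<^sup>2) / r\<^sup>2 - 2 * Im x / r" by (simp only: v_def)
        also have "\<dots> = 2 * (Im x / r) * (Im x / r - 1)"
          using r by (simp add: diff_divide_distrib power2_eq_square algebra_simps)
        finally have "v x = 2 * (Im x / r) * (Im x / r - 1)" .
        moreover have "Im x / r \<le> 1" using abs_Im_le_cmod[of "x - of_real p"] nr r Im by simp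
        ultimately have "v x \<le> 0" by (metis Im r mult_nonneg_nonpos diff_le_0_iff_le divide_pos_pos less_imp_le mult_pos_pos zero_less_numeral)
        then show ?thesis using hmeas_nonneg[OF U K(1) Kne, of x] xK by simp
      qed
      ultimately show ?thesis using eventually_diff_less[OF vlim _ _ e] by blast
    qed
  qed
  \<comment> \<open>For scaled distance at most 1/4 from the centre the barrier is at least
    \<open>1 - 1/16 - 1/2 = 7/16\<close>. Points below the axis follow by symmetry.\<close>
  have key: "U z \<ge> 7 / 16" if zz: "cmod (z - of_real p) \<le> r / 4" "Im z > 0" for z
  proof -
    have "z \<in> S" using zz r by (auto simp: S_def)
    then have "v z \<le> U z" using Uv by force
    moreover have "(Re z - p)\<^sup>2 - (Im z)\<^sup>2 \<le> r\<^sup>2 / 16"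
    proof -
      have "(Re z - p)\<^sup>2 + (Im z)\<^sup>2 \<le> (r / 4)\<^sup>2" using cmod_power2[of "z - of_real p"] power_mono[OF zz(1), of 2] by simp
      moreover have "(r / 4)\<^sup>2 = r\<^sup>2 / 16" by (simp add: power_divide)
      moreover have "0 \<le> (Im z)\<^sup>2" by simp
      ultimately show ?thesis by argo
    qed
    then have "((Re z - p)\<^sup>2 - (Im z)\<^sup>2) / r\<^sup>2 \<le> 1 / 16" using r by (simp add: divide_le_eq)
    moreover have "2 * Im z / r \<le> 1 / 2" using abs_Im_le_cmod[of "z - of_real p"] zz r by (simp add: field_simps)
    ultimately show ?thesis unfolding v_def by linarith
  qed
  have "Im z \<noteq> 0"
  proof
    assume "Im z = 0"
    then have xr: "z = of_real (Re z)" by (simp add: complex_eq_iff)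
    then have "cmod (z - of_real p) = \<bar>Re z - p\<bar>" by (metis norm_of_real of_real_diff)
    then have "Re z \<in> {b..c}" using z(1) r by (auto simp: p_def r_def abs_if field_simps split: if_splits)
    then show False using xr z(2) K(3) unfolding A_def by blast
  qed
  moreover have "cmod (cnj z - of_real p) = cmod (z - of_real p)"
    by (metis complex_cnj_complex_of_real complex_cnj_diff complex_mod_cnj)
  ultimately show ?thesis
    using key[of z] key[of "cnj z"] hmeas_cnj[OF U K(1) Kne K(2) z(2)] z(1) by (cases "Im z > 0") auto
qed

text \<open>A quotient \<open>- s\<close> with \<open>s >= 0\<close> would make \<open>z\<close> the
  convex combination \<open>(be + s * al) / (1 + s)\<close> of the endpoints.\<close>

lemma slit_quotient_not_nonpos:
  assumes "al < be" "z \<notin> complex_of_real ` {al..be}"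
  shows "(z - of_real be) / (z - of_real al) \<notin> \<real>\<^sub>\<le>\<^sub>0"
proof
  have z: "z \<noteq> of_real al" using assms by auto
  assume "(z - of_real be) / (z - of_real al) \<in> \<real>\<^sub>\<le>\<^sub>0"
  then obtain s where s: "(z - of_real be) / (z - of_real al) = - of_real s" "s \<ge> 0"
    by (metis nonpos_Reals_cases neg_0_le_iff_le of_real_minus minus_minus)
  then have "z - of_real be = - of_real s * (z - of_real al)" using z by (simp add: field_simps)
  then have "z * of_real (1 + s) = of_real (be + s * al)" by (simp add: algebra_simps)
  moreover have "complex_of_real (1 + s) \<noteq> 0" using s(2) by (metis add_nonneg_pos of_real_eq_0_iff less_irrefl zero_less_one add.commute)
  ultimately have "z = of_real ((be + s * al) / (1 + s))" by (simp add: field_simps)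
  moreover have "(be + s * al) / (1 + s) \<in> {al..be}"
    using s(2) assms(1) mult_left_mono[of al be s] by (auto simp: field_simps)
  ultimately show False using assms(2) by blast
qed

text \<open>The barrier is a multiple of \<open>Re (W z / (z - p))\<close> with \<open>(W z)\<^sup>2 = (z - al) * (z - be)\<close>: it vanishes on the
  hull \<open>[al, be]\<close> of \<open>K\<close> and tends to a positive constant at infinity.\<close>
lemma hmeas_transfer:
  fixes al be p t \<kappa> :: real
  assumes U: "hmeas K A U \<omega>" and K: "compact K" "K \<noteq> {}" "K \<subseteq> complex_of_real ` {al..be}"
    and p: "al < be" "al \<le> p" "p \<le> be" and t: "t > 0" "\<kappa> \<ge> 0"
    and circ: "\<And>z. cmod (z - of_real p) = t \<Longrightarrow> z \<notin> K \<Longrightarrow> \<kappa> \<le> U z"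
  shows "\<kappa> * t / (be - al + t) \<le> \<omega>"
proof -
  let ?J = "complex_of_real ` {al..be}"
  have cJ: "closed ?J" by (intro compact_imp_closed compact_continuous_image continuous_intros) auto
  \<comment> \<open>The branch of \<open>sqrt ((z - al) * (z - be))\<close> off the segment that
    behaves like \<open>z\<close> at infinity, since the quotient under the root tends to 1.\<close>
  define W where "W = (\<lambda>z. (z - of_real al) * csqrt ((z - of_real be) / (z - of_real al)))"
  have Wh: "W holomorphic_on - ?J" unfolding W_def
  proof (intro holomorphic_intros)
    show "(z - of_real be) / (z - of_real al) \<notin> \<real>\<^sub>\<le>\<^sub>0" if "z \<in> - ?J" for z
      using slit_quotient_not_nonpos[OF p(1)] that by blast
    have "complex_of_real al \<in> ?J" using p(1) by simp
    then show "z - of_real al \<noteq> 0" if "z \<in> - ?J" for z using that by auto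
  qed
  have W2: "(W z)\<^sup>2 = (z - of_real al) * (z - of_real be)" for z
    unfolding W_def power_mult_distrib power2_csqrt by (cases "z = of_real al") (simp_all add: power2_eq_square)
  define P where "P = (\<lambda>z. Re (W z / (z - of_real p)))"
  \<comment> \<open>On the circle \<open>|z - p| = t\<close>, off the segment,
    \<open>|W z| <= be - al + t\<close> and so \<open>P <= (be - al + t) / t\<close>. This
    \<open>k\<close> therefore gives \<open>k * P <= \<kappa>\<close> there, and since
    \<open>P\<close> tends to 1 at infinity it is also the bound that results.\<close>
  define k where "k = \<kappa> * t / (be - al + t)"
  have k: "k \<ge> 0" using p t by (simp add: k_def)
  define S where "S = - ?J - cball (of_real p) t"
  have opS: "open S" unfolding S_def using cJ by (intro open_Diff) auto
  have SK: "S \<subseteq> - K" using K(3) by (auto simp: S_def)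
  have hU: "harm U (- K)" using U by (simp add: hmeas_def)
  have P: "harm P S" unfolding P_def
    using t(1) by (intro harm_Re opS holomorphic_intros holomorphic_on_subset[OF Wh]) (auto simp: S_def)
  define M where "M = \<bar>al\<bar> + \<bar>be\<bar> + 1"
  have M: "M > 0" by (simp add: M_def)
  define q where "q = (\<lambda>w. Re ((1 - of_real al * w) * csqrt ((1 - of_real be * w) / (1 - of_real al * w)) / (1 - of_real p * w)))"
  have nz: "1 - of_real e * w \<noteq> 0" if "\<bar>e\<bar> \<le> M" "w \<in> ball 0 (1 / M)" for e :: real and w :: complex
  proof
    assume "1 - of_real e * w = 0"
    then have "cmod (of_real e * w) = 1" by (metis eq_iff_diff_eq_0 norm_one)
    then have "\<bar>e\<bar> * cmod w = 1" by (simp add: norm_mult)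
    moreover have "\<bar>e\<bar> * cmod w \<le> M * cmod w" using that by (intro mult_right_mono) auto
    moreover have "M * cmod w < 1" using that M by (simp add: field_simps)
    ultimately show False by simp
  qed
  have bds: "\<bar>al\<bar> \<le> M" "\<bar>be\<bar> \<le> M" "\<bar>p\<bar> \<le> M" using p by (auto simp: M_def)
  have inJ: "1 / w \<notin> ?J" if "w \<in> ball 0 (1 / M)" "w \<noteq> 0" for w :: complex
  proof
    assume "1 / w \<in> ?J"
    then obtain x where x: "1 / w = of_real x" "x \<in> {al..be}" by blast
    then have "of_real x * w = 1" using that(2) by (simp add: field_simps)
    moreover have "\<bar>x\<bar> \<le> M" using x(2) by (auto simp: M_def)
    ultimately show False using nz[of x w] that by simp
  qed
  have quot: "(1 - of_real e * w) / (1 - of_real e' * w) = (1 / w - of_real e) / (1 / w - of_real e')" if "w \<noteq> 0" for e e' :: real and w :: complex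
    using that by (simp add: divide_simps)
  have q: "harm q (ball 0 (1 / M))" unfolding q_def
  proof (intro harm_Re holomorphic_intros open_ball)
    show "(1 - of_real be * w) / (1 - of_real al * w) \<notin> \<real>\<^sub>\<le>\<^sub>0" if "w \<in> ball 0 (1 / M)" for w :: complex
    proof (cases "w = 0")
      case False
      then show ?thesis using slit_quotient_not_nonpos[OF p(1) inJ[OF that False]] quot by simp
    qed simp
  qed (use nz bds in auto)
  have qP: "q w = P (1 / w)" if "w \<in> ball 0 (1 / M) - {0}" for w
  proof -
    have w0: "w \<noteq> 0" using that by auto
    have "(1 - of_real al * w) / (1 - of_real p * w) = (1 / w - of_real al) / (1 / w - of_real p)" by (rule quot[OF w0])
    moreover have "(1 - of_real be * w) / (1 - of_real al * w) = (1 / w - of_real be) / (1 / w - of_real al)" by (rule quot[OF w0])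
    ultimately show ?thesis unfolding q_def P_def W_def by (metis times_divide_eq_left)
  qed
  have le: "k * P z - U z \<le> 0" if "z \<in> S" for z
  proof (rule max_principle_sphere[where u = "\<lambda>z. k * P z - U z", OF _ _ _ _ _ that])
    show "harm (\<lambda>z. k * P z - U z) S" by (intro harm_diff harm_cmult P harm_subset[OF hU opS SK])
    show "of_real p \<notin> S" using t by (simp add: S_def)
    have "- S = ?J \<union> cball (of_real p) t" by (auto simp: S_def)
    moreover have "bounded ?J" by (intro compact_imp_bounded compact_continuous_image continuous_intros) auto
    ultimately show "bounded (- S)" by simp
    have "harm_at_inf P" unfolding harm_at_inf_def using q qP M by (intro exI[of _ "1 / M"] conjI exI[of _ q]) auto
    then show "harm_at_inf (\<lambda>z. k * P z - U z)"
      by (intro harm_at_inf_diff harm_at_inf_cmult hmeas_harm_at_inf[OF U])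
    fix x and \<epsilon> :: real assume x: "x \<in> frontier S" and e: "\<epsilon> > 0"
    have cl: "closed (- ball (complex_of_real p) t)" by (simp add: closed_Compl)
    have "S \<subseteq> - ball (of_real p) t" by (auto simp: S_def)
    from frontier_open_subset[OF opS this cl x]
    have x1: "cmod (x - of_real p) \<ge> t" "x \<notin> S" by (auto simp: dist_norm norm_minus_commute)
    have xp: "x \<noteq> of_real p" using x1 t by auto
    show "\<forall>\<^sub>F z in at x within S. k * P z - U z < \<epsilon>"
    proof (cases "x \<in> ?J")
      case True
      have U0: "0 \<le> U z" if "z \<in> S" for z using hmeas_nonneg[OF U K(1,2)] SK that by auto
      \<comment> \<open>\<open>2 * (Re W)^2 = |W^2| + Re (W^2)\<close> reduces the limit to the
        polynomial \<open>W^2\<close>, which is real and nonpositive on the segment. This avoids the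
        one-sided values of the root.\<close>
      have W0: "((\<lambda>z. Re (W z)) \<longlongrightarrow> 0) (at x within S)"
      proof -
        define Z where "Z = (\<lambda>z. (z - complex_of_real al) * (z - of_real be))"
        have "(Re (W z))\<^sup>2 = (cmod (Z z) + Re (Z z)) / 2" for z
        proof -
          have "cmod (Z z) = (cmod (W z))\<^sup>2" using W2[of z] by (simp add: Z_def norm_power[symmetric])
          moreover have "Re (Z z) = (Re (W z))\<^sup>2 - (Im (W z))\<^sup>2" unfolding Z_def W2[symmetric] by (rule Re_power2)
          ultimately show ?thesis by (simp add: cmod_power2)
        qed
        then have "\<bar>Re (W z)\<bar> = sqrt ((cmod (Z z) + Re (Z z)) / 2)" for z by (metis real_sqrt_abs)
        moreover have "((\<lambda>z. sqrt ((cmod (Z z) + Re (Z z)) / 2)) \<longlongrightarrow> sqrt ((cmod (Z x) + Re (Z x)) / 2)) (at x within S)"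
          unfolding Z_def by (intro tendsto_intros) auto
        moreover have "cmod (Z x) + Re (Z x) = 0"
        proof -
          obtain y where y: "x = of_real y" "y \<in> {al..be}" using True by blast
          then have "Z x = of_real ((y - al) * (y - be))" by (simp add: Z_def)
          moreover have "(y - al) * (y - be) \<le> 0" using y by (simp add: mult_nonneg_nonpos)
          ultimately show ?thesis by (metis Re_complex_of_real abs_of_nonpos add.left_inverse norm_of_real)
        qed
        ultimately have "((\<lambda>z. \<bar>Re (W z)\<bar>) \<longlongrightarrow> 0) (at x within S)" by simp
        then show ?thesis by (rule tendsto_rabs_zero_cancel)
      qed
      have Wb: "\<forall>\<^sub>F z in at x within S. cmod (W z) \<le> cmod (x - of_real al) + cmod (x - of_real be) + 2"
      proof -
        have "\<forall>\<^sub>F z in at x within S. dist z x < 1"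
          unfolding eventually_at by (intro exI[of _ 1]) auto
        then show ?thesis
        proof eventually_elim
          case (elim z)
          have 1: "cmod (z - of_real e) \<le> cmod (x - of_real e) + 1" for e
            using norm_triangle_ineq[of "z - x" "x - of_real e"] elim by (simp add: dist_norm)
          let ?m = "max (cmod (z - of_real al)) (cmod (z - of_real be))"
          have "(cmod (W z))\<^sup>2 = cmod (z - of_real al) * cmod (z - of_real be)" by (metis W2 norm_mult norm_power)
          also have "\<dots> \<le> ?m * ?m" by (intro mult_mono) (auto simp: le_max_iff_disj)
          finally have "(cmod (W z))\<^sup>2 \<le> ?m\<^sup>2" by (simp only: power2_eq_square)
          then have Wm: "cmod (W z) \<le> ?m" by (rule power2_le_imp_le) (simp add: le_max_iff_disj)
          have "cmod (z - of_real al) \<le> cmod (x - of_real al) + cmod (x - of_real be) + 2"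
            using 1[of al] norm_ge_zero[of "x - of_real be"] by linarith
          moreover have "cmod (z - of_real be) \<le> cmod (x - of_real al) + cmod (x - of_real be) + 2"
            using 1[of be] norm_ge_zero[of "x - of_real al"] by linarith
          ultimately have "?m \<le> cmod (x - of_real al) + cmod (x - of_real be) + 2" by simp
          with Wm show ?case by (rule order_trans)
        qed
      qed
      have "((\<lambda>z. Im (z - of_real p)) \<longlongrightarrow> 0) (at x within S)"
      proof -
        have "((\<lambda>z. Im (z - of_real p)) \<longlongrightarrow> Im (x - of_real p)) (at x within S)" by (intro tendsto_intros)
        then show ?thesis using True by auto
      qed
      then have lim0: "((\<lambda>z. \<bar>Im (z - of_real p)\<bar> * (cmod (x - of_real al) + cmod (x - of_real be) + 2)) \<longlongrightarrow> 0) (at x within S)"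
        by (intro tendsto_mult_left_zero tendsto_rabs_zero)
      have "\<forall>\<^sub>F z in at x within S. norm (Im (z - of_real p) * Im (W z)) \<le> \<bar>Im (z - of_real p)\<bar> * (cmod (x - of_real al) + cmod (x - of_real be) + 2)"
        using Wb
      proof eventually_elim
        case (elim z)
        show ?case unfolding real_norm_def abs_mult
          by (rule mult_left_mono[OF order_trans[OF abs_Im_le_cmod elim]]) simp
      qed
      from Lim_null_comparison[OF this lim0]
      have "((\<lambda>z. Im (z - of_real p) * Im (W z)) \<longlongrightarrow> 0) (at x within S)" .
      with W0 have *: "((\<lambda>z. (Re (W z) * Re (z - of_real p) + Im (z - of_real p) * Im (W z)) / (cmod (z - of_real p))\<^sup>2) \<longlongrightarrow> (0 * Re (x - of_real p) + 0) / (cmod (x - of_real p))\<^sup>2) (at x within S)"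
        using xp by (intro tendsto_intros) auto
      have eqP: "P = (\<lambda>z. (Re (W z) * Re (z - of_real p) + Im (z - of_real p) * Im (W z)) / (cmod (z - of_real p))\<^sup>2)"
        unfolding P_def Re_divide cmod_power2 by (simp add: mult.commute)
      have "(0 * Re (x - of_real p) + 0) / (cmod (x - of_real p))\<^sup>2 = 0" by simp
      with * have "(P \<longlongrightarrow> 0) (at x within S)" unfolding eqP by (simp only:)
      then have "((\<lambda>z. k * P z) \<longlongrightarrow> k * 0) (at x within S)" by (intro tendsto_intros)
      then have "\<forall>\<^sub>F z in at x within S. k * P z < \<epsilon>" using e by (auto dest: order_tendstoD(2))
      moreover have "\<forall>\<^sub>F z in at x within S. z \<in> S" by (simp add: eventually_at_filter)
      ultimately show ?thesis by eventually_elim (use U0 in fastforce)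
    next
      case False
      then have nt: "cmod (x - of_real p) = t" using x1 by (auto simp: S_def dist_norm norm_minus_commute)
      have xK: "x \<in> - K" using False K(3) by blast
      have "isCont W x" using holomorphic_on_imp_continuous_on[OF Wh] False cJ
        by (meson Compl_iff continuous_on_eq_continuous_at open_Compl)
      then have "((\<lambda>z. k * P z) \<longlongrightarrow> k * P x) (at x within S)" unfolding P_def
        using xp continuous_at_imp_continuous_at_within[of x W S] by (intro tendsto_intros) (auto simp: continuous_within)
      moreover have "(U \<longlongrightarrow> U x) (at x within S)" by (rule harm_tendsto[OF hU xK])
      moreover have "k * P x \<le> U x"
      proof -
        have "cmod (x - of_real e) \<le> be - al + t" if "e \<in> {al..be}" for e
        proof -
          have "x - of_real e = (x - of_real p) + of_real (p - e)" by simp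
          then have "cmod (x - of_real e) \<le> t + \<bar>p - e\<bar>"
            using norm_triangle_ineq[of "x - of_real p" "of_real (p - e)"] nt by (simp only: norm_of_real)
          then show ?thesis using p that by (auto simp: abs_if split: if_splits)
        qed
        then have "(cmod (W x))\<^sup>2 \<le> (be - al + t) * (be - al + t)"
          unfolding norm_power[symmetric] W2 norm_mult using p t by (intro mult_mono) auto
        then have "(cmod (W x))\<^sup>2 \<le> (be - al + t)\<^sup>2" by (simp only: power2_eq_square)
        then have "cmod (W x) \<le> be - al + t" by (rule power2_le_imp_le) (use p t in auto)
        moreover have "P x \<le> cmod (W x) / t" unfolding P_def using complex_Re_le_cmod[of "W x / (x - of_real p)"] nt by (simp add: norm_divide)
        ultimately have "P x \<le> (be - al + t) / t" using t by (smt (verit) divide_right_mono)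
        then have "k * P x \<le> k * ((be - al + t) / t)" using k by (rule mult_left_mono)
        also have "\<dots> = \<kappa>" using t p by (simp add: k_def)
        also have "\<dots> \<le> U x" using circ[OF nt] xK by simp
        finally show ?thesis .
      qed
      ultimately show ?thesis using eventually_diff_less[OF _ _ _ e] by blast
    qed
  qed
  have "isCont q 0" using harm_isCont[OF q] M by simp
  moreover have "q 0 = 1" by (simp add: q_def)
  ultimately have "(P \<longlongrightarrow> 1) at_infinity" using tendsto_at_infinity_of_inverse[of q "1 / M" P] qP M by simp
  then have Pl: "((\<lambda>z. k * P z) \<longlongrightarrow> k * 1) at_infinity" by (intro tendsto_intros)
  obtain ru qu where qu: "ru > 0" "harm qu (ball 0 ru)" "qu 0 = \<omega>" "\<And>w. w \<in> ball 0 ru - {0} \<Longrightarrow> qu w = U (1 / w)"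
    using U unfolding hmeas_def by blast
  have "isCont qu 0" using harm_isCont[OF qu(2)] qu(1) by simp
  from tendsto_at_infinity_of_inverse[OF this qu(1,4)] have Ul: "(U \<longlongrightarrow> \<omega>) at_infinity" by (simp add: qu(3))
  have "\<forall>\<^sub>F z in at_infinity. k * P z \<le> U z"
    unfolding eventually_at_infinity
  proof (intro exI[of _ "M + \<bar>p\<bar> + t"] allI impI)
    fix z :: complex assume z: "M + \<bar>p\<bar> + t \<le> cmod z"
    have "z \<notin> ?J" using z t by (auto simp: M_def)
    moreover have "z \<notin> cball (of_real p) t"
      using norm_triangle_ineq[of "z - of_real p" "of_real p"] z M by (auto simp: dist_norm norm_minus_commute)
    ultimately show "k * P z \<le> U z" using le[of z] by (simp add: S_def)
  qed
  then have "k * 1 \<le> \<omega>" by (rule tendsto_le[OF trivial_limit_at_infinity Ul Pl])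
  then show ?thesis by (simp add: k_def)
qed

text \<open>The value 7/16 is carried from the circle of radius \<open>r / 4\<close> around the
  midpoint to infinity. With \<open>be - al + r / 4 <= 2 * (be - al)\<close> the constant is 256/7,
  which is below 40. This linear bound yields positivity of \<omega> and a first smallness of the
  slits.\<close>

lemma harmonic_measure_ge_length:
  fixes al be b c :: real
  assumes U: "hmeas K (complex_of_real ` {b..c}) U \<omega>" and K: "compact K" "K \<subseteq> complex_of_real ` {al..be}" "complex_of_real ` {b..c} \<subseteq> K" and bc: "b < c"
  shows "c - b \<le> 40 * (be - al) * \<omega>"
proof -
  define r where "r = (c - b) / 2"
  define p where "p = (b + c) / 2"
  have Kr: "K \<subseteq> \<real>" "K \<noteq> {}" using K(2,3) bc by auto
  have "of_real b \<in> K" "of_real c \<in> K" using K(3) bc by auto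
  then have *: "complex_of_real b \<in> complex_of_real ` {al..be}" "complex_of_real c \<in> complex_of_real ` {al..be}" using K(2) by blast+
  then have ab: "al \<le> b" "c \<le> be" by auto
  have r: "r > 0" using bc by (simp add: r_def)
  have "7 / 16 * (r / 4) / (be - al + r / 4) \<le> \<omega>"
  proof (rule hmeas_transfer[OF U K(1) Kr(2) K(2), of p])
    show "7 / 16 \<le> U z" if "cmod (z - of_real p) = r / 4" "z \<notin> K" for z
      by (rule hmeas_lower_bound_near[OF U K(1) Kr(1) K(3) bc]) (use that in \<open>auto simp: p_def r_def\<close>)
  qed (use ab bc r in \<open>auto simp: p_def\<close>)
  then have "7 / 16 * (r / 4) \<le> \<omega> * (be - al + r / 4)" using ab bc r by (subst (asm) pos_divide_le_eq) auto
  moreover have "be - al + r / 4 \<le> 2 * (be - al)"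
  proof -
    have "r \<le> be - al" using ab bc unfolding r_def by (simp add: field_simps)
    moreover have "r / 4 \<le> r" using r by simp
    ultimately show ?thesis by argo
  qed
  moreover have "0 \<le> 7 / 16 * (r / 4) / (be - al + r / 4)" using ab bc r by (intro divide_nonneg_pos) auto
  then have w0: "\<omega> \<ge> 0" using \<open>7 / 16 * (r / 4) / (be - al + r / 4) \<le> \<omega>\<close> by (rule order_trans)
  ultimately have "7 / 16 * (r / 4) \<le> \<omega> * (2 * (be - al))" by (meson mult_left_mono order_trans)
  moreover have "\<omega> * (be - al) \<ge> 0" using w0 ab bc by simp
  ultimately show ?thesis by (simp add: r_def field_simps)
qed

text \<open>On the annulus \<open>r / 4 < |z - p| < r1\<close>, where \<open>K\<close> consists of
  the interval alone, \<open>U\<close> dominates the multiple of \<open>ln (r1 / |z - p|)\<close>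
  that is 7/16 on the inner circle. Its value on the circle of radius \<open>r1 / 2\<close> is
  carried to infinity. The logarithm of the length on the right is what makes the length
  exponentially small in \<open>1 / \<omega>\<close>.\<close>

lemma harmonic_measure_ge_log:
  fixes al be b c r1 :: real
  assumes U: "hmeas K (complex_of_real ` {b..c}) U \<omega>" and K: "compact K" "K \<subseteq> complex_of_real ` {al..be}" "complex_of_real ` {b..c} \<subseteq> K" and bc: "b < c"
    and r1: "(c - b) / 2 < r1" "\<And>x. x \<in> K \<Longrightarrow> cmod (x - of_real ((b + c) / 2)) < r1 \<Longrightarrow> x \<in> complex_of_real ` {b..c}"
  shows "7 / 16 * ln 2 * (r1 / 2) / (be - al + r1 / 2) \<le> \<omega> * ln (8 * r1 / (c - b))"
proof -
  define r where "r = (c - b) / 2"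
  define p where "p = (b + c) / 2"
  have Kr: "K \<subseteq> \<real>" "K \<noteq> {}" using K(2,3) bc by auto
  have "of_real b \<in> K" "of_real c \<in> K" using K(3) bc by auto
  then have *: "complex_of_real b \<in> complex_of_real ` {al..be}" "complex_of_real c \<in> complex_of_real ` {al..be}" using K(2) by blast+
  then have ab: "al \<le> b" "c \<le> be" by auto
  have r: "r > 0" "r < r1" using bc r1(1) by (auto simp: r_def)
  have near: "7 / 16 \<le> U z" if "cmod (z - of_real p) \<le> r / 4" "z \<notin> K" for z
    by (rule hmeas_lower_bound_near[OF U K(1) Kr(1) K(3) bc]) (use that in \<open>auto simp: p_def r_def\<close>)
  define l where "l = ln (4 * r1 / r)"
  have l: "l > 0" using r by (simp add: l_def ln_gt_zero)
  have l': "l = ln r1 - ln (r / 4)" using r by (simp add: l_def ln_div ln_mult)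
  define v where "v = (\<lambda>z. 7 / 16 / l * (ln r1 - ln (cmod (z - of_real p))))"
  define S where "S = {z. r / 4 < cmod (z - of_real p)} \<inter> {z. cmod (z - of_real p) < r1} \<inter> - K"
  have opS: "open S" unfolding S_def using K(1) by (intro open_Int open_Collect_less continuous_intros) (auto simp: compact_imp_closed)
  have SK: "S \<subseteq> - K" by (auto simp: S_def)
  have hU: "harm U (- K)" using U by (simp add: hmeas_def)
  have Uv: "v z - U z \<le> 0" if "z \<in> S" for z
  proof (rule max_principle_bounded[where u = "\<lambda>z. v z - U z", OF _ _ _ that])
    have "harm v S" unfolding v_def using r by (intro harm_cmult harm_diff harm_const opS harm_ln_norm holomorphic_intros) (auto simp: S_def)
    then show "harm (\<lambda>z. v z - U z) S" by (intro harm_diff harm_subset[OF hU opS SK])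
    have "S \<subseteq> ball (of_real p) r1" by (auto simp: S_def dist_norm norm_minus_commute)
    then show "bounded S" using bounded_ball bounded_subset by blast
    fix x and \<epsilon> :: real assume x: "x \<in> frontier S" and e: "\<epsilon> > 0"
    have cl: "closed ({z. r / 4 \<le> cmod (z - of_real p)} \<inter> {z. cmod (z - of_real p) \<le> r1})"
      by (intro closed_Int closed_Collect_le continuous_intros)
    have "S \<subseteq> {z. r / 4 \<le> cmod (z - of_real p)} \<inter> {z. cmod (z - of_real p) \<le> r1}" by (auto simp: S_def)
    from frontier_open_subset[OF opS this cl x]
    have x1: "r / 4 \<le> cmod (x - of_real p)" "cmod (x - of_real p) \<le> r1" "x \<notin> S" by auto
    have xp: "x \<noteq> of_real p" using x1 r by auto
    have vlim: "(v \<longlongrightarrow> v x) (at x within S)" unfolding v_def using xp by (intro tendsto_intros) auto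
    have vle: "v x \<le> 7 / 16"
    proof -
      have "ln (r / 4) \<le> ln (cmod (x - of_real p))" using x1 r by (subst ln_le_cancel_iff) auto
      then have "7 / 16 / l * (ln r1 - ln (cmod (x - of_real p))) \<le> 7 / 16 / l * l" unfolding l' using l l' by (intro mult_left_mono) auto
      then show ?thesis using l by (simp add: v_def)
    qed
    show "\<forall>\<^sub>F z in at x within S. v z - U z < \<epsilon>"
    proof (cases "x \<in> K")
      case True
      then have "(U \<longlongrightarrow> indicator (complex_of_real ` {b..c}) x) (at x within - K)" using U by (simp add: hmeas_def)
      then have "(U \<longlongrightarrow> indicator (complex_of_real ` {b..c}) x) (at x within S)" using SK tendsto_within_subset by blast
      moreover have "v x \<le> indicator (complex_of_real ` {b..c}) x"
      proof (cases "cmod (x - of_real p) < r1")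
        case in1: True
        then show ?thesis using r1(2)[OF True] vle by (simp add: p_def)
      next
        case False
        then have "v x = 0" using x1 by (simp add: v_def)
        then show ?thesis by simp
      qed
      ultimately show ?thesis using eventually_diff_less[OF vlim _ _ e] by blast
    next
      case False
      then have xK: "x \<in> - K" by simp
      have "(U \<longlongrightarrow> U x) (at x within S)" by (rule harm_tendsto[OF hU xK])
      moreover have "v x \<le> U x"
      proof (cases "cmod (x - of_real p) = r / 4")
        case True then show ?thesis using near[of x] vle False by simp
      next
        case ne: False
        then have "cmod (x - of_real p) = r1" using x1 False by (auto simp: S_def)
        then have "v x = 0" by (simp add: v_def)
        then show ?thesis using hmeas_nonneg[OF U K(1) Kr(2) False] by simp
      qed
      ultimately show ?thesis using eventually_diff_less[OF vlim _ _ e] by blast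
    qed
  qed
  define \<kappa> where "\<kappa> = 7 / 16 / l * ln 2"
  have "\<kappa> * (r1 / 2) / (be - al + r1 / 2) \<le> \<omega>"
  proof (rule hmeas_transfer[OF U K(1) Kr(2) K(2), of p])
    show "\<kappa> \<le> U z" if z: "cmod (z - of_real p) = r1 / 2" "z \<notin> K" for z
    proof -
      have "z \<in> S" using z r by (auto simp: S_def)
      moreover have "ln (cmod (z - of_real p)) = ln r1 - ln 2" unfolding z(1) using r by (simp add: ln_div)
      then have "v z = \<kappa>" by (simp add: v_def \<kappa>_def)
      ultimately show ?thesis using Uv by force
    qed
    show "\<kappa> \<ge> 0" using l by (simp add: \<kappa>_def)
  qed (use ab bc r in \<open>auto simp: p_def\<close>)
  then have "l * (\<kappa> * (r1 / 2) / (be - al + r1 / 2)) \<le> l * \<omega>" using l by (intro mult_left_mono) auto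
  moreover have "l * (\<kappa> * (r1 / 2) / (be - al + r1 / 2)) = 7 / 16 * ln 2 * (r1 / 2) / (be - al + r1 / 2)"
    using l by (simp add: \<kappa>_def)
  moreover have "4 * r1 / r = 8 * r1 / (c - b)" by (simp add: r_def)
  ultimately show ?thesis by (simp add: l_def mult.commute)
qed

section \<open>Single-valued functions near a pole\<close>

text \<open>The difference quotient of \<open>f\<close> at \<open>z\<close>, completed by the
  derivative, is holomorphic on the annulus and has equal integrals over the two homotopic circles.
  The kernel \<open>1 / (w - z)\<close> integrates to \<open>2 * pi * i\<close> over the outer
  circle and to 0 over the inner one.\<close>

lemma laurent_split:
  fixes c z :: complex and s1 s R1 R :: real
  assumes f: "f holomorphic_on {z. s1 < cmod (z - c)} \<inter> {z. cmod (z - c) < R}"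
    and r: "0 < s" "s1 < s" "R1 < R" and z: "s < cmod (z - c)" "cmod (z - c) < R1"
  shows "contour_integral (circlepath c R1) (\<lambda>w. f w / (w - z)) - contour_integral (circlepath c s) (\<lambda>w. f w / (w - z)) = 2 * of_real pi * \<i> * f z"
proof -
  let ?A = "{z. s1 < cmod (z - c)} \<inter> {z. cmod (z - c) < R}"
  have opA: "open ?A" by (intro open_Int open_Collect_less continuous_intros)
  have zA: "z \<in> ?A" using z r by auto
  define g where "g = (\<lambda>w. if w = z then deriv f z else (f w - f z) / (w - z))"
  have g: "g holomorphic_on ?A" unfolding g_def by (rule pole_lemma_open[OF f opA])
  have circ: "path_image (circlepath c \<rho>) \<subseteq> ?A" "z \<notin> path_image (circlepath c \<rho>)" if "\<rho> = s \<or> \<rho> = R1" for \<rho>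
    using that r z by (auto simp: dist_norm norm_minus_commute)
  have "homotopic_loops ?A (circlepath c s) (circlepath c R1)"
  proof (rule homotopic_loops_linear)
    fix t :: real assume t: "t \<in> {0..1}"
    show "closed_segment (circlepath c s t) (circlepath c R1 t) \<subseteq> ?A"
    proof
      fix w assume "w \<in> closed_segment (circlepath c s t) (circlepath c R1 t)"
      then obtain u where u: "0 \<le> u" "u \<le> 1" "w = (1 - u) *\<^sub>R circlepath c s t + u *\<^sub>R circlepath c R1 t"
        by (auto simp: closed_segment_def)
      define v where "v = (1 - u) * s + u * R1"
      have "w - c = of_real v * exp (2 * of_real pi * \<i> * of_real t)"
        unfolding u(3) by (simp add: circlepath v_def scaleR_conv_of_real algebra_simps)
      moreover have "cmod (exp (2 * of_real pi * \<i> * of_real t)) = 1" by simp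
      ultimately have "cmod (w - c) = \<bar>v\<bar>" by (simp only: norm_mult norm_of_real)
      moreover have "s \<le> v" "v \<le> R1"
      proof -
        have "v - s = u * (R1 - s)" "R1 - v = (1 - u) * (R1 - s)" by (auto simp: v_def algebra_simps)
        moreover have "u * (R1 - s) \<ge> 0" "(1 - u) * (R1 - s) \<ge> 0" using u z by auto
        ultimately have "0 \<le> v - s" "0 \<le> R1 - v" by presburger+
        then show "s \<le> v" "v \<le> R1" by auto
      qed
      ultimately show "w \<in> ?A" using r by auto
    qed
  qed auto
  then have eq: "contour_integral (circlepath c s) g = contour_integral (circlepath c R1) g"
    by (rule Cauchy_theorem_homotopic_loops[OF _ opA g]) auto
  have int: "contour_integral (circlepath c \<rho>) g = contour_integral (circlepath c \<rho>) (\<lambda>w. f w / (w - z)) - f z * contour_integral (circlepath c \<rho>) (\<lambda>w. 1 / (w - z))"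
    if \<rho>: "\<rho> = s \<or> \<rho> = R1" for \<rho>
  proof -
    have cf: "continuous_on (path_image (circlepath c \<rho>)) f"
      by (rule continuous_on_subset[OF holomorphic_on_imp_continuous_on[OF f] circ(1)[OF \<rho>]])
    have i1: "(\<lambda>w. f w / (w - z)) contour_integrable_on circlepath c \<rho>"
      using circ(2)[OF \<rho>] by (intro contour_integrable_continuous_circlepath continuous_intros cf) auto
    have i2: "(\<lambda>w. 1 / (w - z)) contour_integrable_on circlepath c \<rho>"
      using circ(2)[OF \<rho>] by (intro contour_integrable_continuous_circlepath continuous_intros) auto
    have "contour_integral (circlepath c \<rho>) g = contour_integral (circlepath c \<rho>) (\<lambda>w. f w / (w - z) - f z * (1 / (w - z)))"
      by (rule contour_integral_cong) (use circ(2)[OF \<rho>] in \<open>auto simp: g_def diff_divide_distrib\<close>)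
    also have "\<dots> = contour_integral (circlepath c \<rho>) (\<lambda>w. f w / (w - z)) - f z * contour_integral (circlepath c \<rho>) (\<lambda>w. 1 / (w - z))"
      by (simp only: contour_integral_diff[OF i1 contour_integrable_lmul[OF i2]] contour_integral_lmul[OF i2])
    finally show ?thesis .
  qed
  have "contour_integral (circlepath c R1) (\<lambda>w. 1 / (w - z)) = 2 * of_real pi * \<i>"
    by (rule contour_integral_unique) (use Cauchy_integral_circlepath_simple[of "\<lambda>_. 1" c R1 z] z in \<open>auto simp: norm_minus_commute\<close>)
  moreover have "contour_integral (circlepath c s) (\<lambda>w. 1 / (w - z)) = 0"
  proof (rule contour_integral_unique, rule Cauchy_theorem_convex_simple[of _ "ball c (cmod (z - c))"])
    show "(\<lambda>w. 1 / (w - z)) holomorphic_on ball c (cmod (z - c))"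
      by (intro holomorphic_intros) (auto simp: dist_norm norm_minus_commute)
  qed (use r z in \<open>auto simp: dist_norm norm_minus_commute\<close>)
  ultimately show ?thesis using int[of s] int[of R1] eq by (simp add: algebra_simps)
qed

text \<open>The principal part of \<open>F\<close> is small because the inner circle is, and the regular part obeys the
  maximum principle.\<close>
lemma annulus_Re_bound:
  fixes c :: complex and s1 s r0 R0 R M0 b :: real
  assumes F: "F holomorphic_on {z. s1 < cmod (z - c)} \<inter> {z. cmod (z - c) < R}"
    and r: "0 < s" "s1 < s" "2 * s \<le> r0" "r0 < R0" "R0 < R"
    and M0: "\<And>z. cmod (z - c) = s \<Longrightarrow> cmod (F z) \<le> M0"
    and b: "\<And>z. cmod (z - c) = R0 \<Longrightarrow> \<bar>Re (F z)\<bar> \<le> b"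
    and z: "cmod (z - c) = r0"
  shows "\<bar>Re (F z)\<bar> \<le> b + 4 * s * M0 / r0"
proof -
  \<comment> \<open>A radius strictly between \<open>R0\<close> and \<open>R\<close> makes the
    regular part \<open>F1\<close> holomorphic across the circle of radius \<open>R0\<close>, where
    the maximum principle reads off its boundary values.\<close>
  define R1 where "R1 = (R0 + R) / 2"
  have R1: "R0 < R1" "R1 < R" using r by (auto simp: R1_def)
  let ?A = "{z. s1 < cmod (z - c)} \<inter> {z. cmod (z - c) < R}"
  define F1 where "F1 = (\<lambda>z. contour_integral (circlepath c R1) (\<lambda>w. F w / (w - z)) / (2 * of_real pi * \<i>))"
  define F2 where "F2 = (\<lambda>z. contour_integral (circlepath c s) (\<lambda>w. F w / (w - z)) / (2 * of_real pi * \<i>))"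
  have split: "F z = F1 z - F2 z" if "s < cmod (z - c)" "cmod (z - c) < R1" for z
    using laurent_split[OF F r(1,2) R1(2) that] by (simp add: F1_def F2_def field_simps)
  have M0n: "M0 \<ge> 0"
  proof -
    have "cmod ((c + of_real s) - c) = s" using r by simp
    from M0[OF this] show ?thesis using norm_ge_zero order_trans by blast
  qed
  have sub: "path_image (circlepath c \<rho>) \<subseteq> ?A" if "\<rho> = s \<or> \<rho> = R1" for \<rho>
    using that r R1 by (auto simp: dist_norm norm_minus_commute)
  have cF: "continuous_on (path_image (circlepath c \<rho>)) F" if "\<rho> = s \<or> \<rho> = R1" for \<rho>
    by (rule continuous_on_subset[OF holomorphic_on_imp_continuous_on[OF F] sub[OF that]])
  have F2b: "cmod (F2 z) \<le> 2 * s * M0 / r0" if z: "r0 \<le> cmod (z - c)" for z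
  proof -
    have ne: "z \<notin> path_image (circlepath c s)" using z r by (auto simp: dist_norm norm_minus_commute)
    have "(\<lambda>w. F w / (w - z)) contour_integrable_on circlepath c s"
      using ne by (intro contour_integrable_continuous_circlepath continuous_intros cF) auto
    then have "((\<lambda>w. F w / (w - z)) has_contour_integral contour_integral (circlepath c s) (\<lambda>w. F w / (w - z))) (circlepath c s)"
      by (rule has_contour_integral_integral)
    then have "cmod (contour_integral (circlepath c s) (\<lambda>w. F w / (w - z))) \<le> 2 * M0 / r0 * (2 * pi * s)"
    proof (rule has_contour_integral_bound_circlepath)
      fix w assume w: "cmod (w - c) = s"
      have "r0 / 2 \<le> cmod (w - z)" using norm_triangle_ineq[of "w - z" "c - w"] w z r by (auto simp: norm_minus_commute)
      then have "cmod (F w / (w - z)) \<le> M0 / (r0 / 2)"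
        unfolding norm_divide using M0[OF w] M0n r by (intro frac_le) auto
      then show "cmod (F w / (w - z)) \<le> 2 * M0 / r0" by (simp add: mult.commute)
    qed (use r M0n in auto)
    then show ?thesis by (simp add: F2_def norm_divide norm_mult field_simps)
  qed
  have F1h: "F1 holomorphic_on ball c R1"
  proof -
    have "((\<lambda>z. contour_integral (circlepath c R1) (\<lambda>w. F w / (w - z))) has_field_derivative
      of_nat 1 * contour_integral (circlepath c R1) (\<lambda>u. F u / (u - w) ^ Suc 1)) (at w)" if w: "w \<in> ball c R1" for w
    proof (rule Cauchy_next_derivative_circlepath(2)[OF cF _ _ w])
      fix v assume "v \<in> ball c R1"
      then have "v \<notin> path_image (circlepath c R1)" by (auto simp: dist_norm norm_minus_commute)
      then have "(\<lambda>w. F w / (w - v)) contour_integrable_on circlepath c R1"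
        by (intro contour_integrable_continuous_circlepath continuous_intros cF) auto
      then show "((\<lambda>u. F u / (u - v) ^ 1) has_contour_integral contour_integral (circlepath c R1) (\<lambda>w. F w / (w - v))) (circlepath c R1)"
        by (simp add: has_contour_integral_integral)
    qed auto
    then have "(\<lambda>z. contour_integral (circlepath c R1) (\<lambda>w. F w / (w - z))) holomorphic_on ball c R1"
      using holomorphic_on_open[OF open_ball] by blast
    then show ?thesis unfolding F1_def by (intro holomorphic_intros) auto
  qed
  \<comment> \<open>On the circle of radius \<open>R0\<close> one has \<open>F1 = F + F2\<close>,
    and \<open>F2\<close> costs \<open>2 * s * M0 / r0\<close>. It costs the same again at
    \<open>z\<close>, whence the factor 4.\<close>
  define B where "B = b + 2 * s * M0 / r0"
  have F1b: "\<sigma> * Re (F1 z) - B \<le> 0" if z: "z \<in> ball c R0" and sg: "\<bar>\<sigma>\<bar> = 1" for z \<sigma>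
  proof (rule max_principle_bounded[where u = "\<lambda>z. \<sigma> * Re (F1 z) - B", OF _ bounded_ball _ z])
    show "harm (\<lambda>z. \<sigma> * Re (F1 z) - B) (ball c R0)"
      using R1 by (intro harm_diff harm_cmult harm_const harm_Re holomorphic_on_subset[OF F1h]) auto
    fix x and \<epsilon> :: real assume x: "x \<in> frontier (ball c R0)" and e: "\<epsilon> > 0"
    have xR: "cmod (x - c) = R0" using x r by (simp add: frontier_ball dist_norm norm_minus_commute)
    have "isCont F1 x" using holomorphic_on_imp_continuous_on[OF F1h] xR R1
      by (simp add: continuous_on_eq_continuous_at dist_norm norm_minus_commute)
    then have "(F1 \<longlongrightarrow> F1 x) (at x within ball c R0)"
      using continuous_at_imp_continuous_at_within continuous_within by blast
    then have lim: "((\<lambda>z. \<sigma> * Re (F1 z)) \<longlongrightarrow> \<sigma> * Re (F1 x)) (at x within ball c R0)" by (intro tendsto_intros)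
    have "F1 x = F x + F2 x" using split[of x] xR r R1 by simp
    then have "\<bar>Re (F1 x)\<bar> \<le> b + 2 * s * M0 / r0"
      using b[OF xR] abs_Re_le_cmod[of "F2 x"] F2b[of x] xR r by simp
    then have "\<sigma> * Re (F1 x) \<le> B" using sg by (auto simp: B_def abs_if split: if_splits)
    from eventually_diff_less[OF lim tendsto_const this e]
    show "\<forall>\<^sub>F z in at x within ball c R0. \<sigma> * Re (F1 z) - B < \<epsilon>" .
  qed
  have "z \<in> ball c R0" using z r by (simp add: dist_norm norm_minus_commute)
  from F1b[OF this, of 1] F1b[OF this, of "-1"] have "\<bar>Re (F1 z)\<bar> \<le> B" by auto
  moreover have "\<bar>Re (F2 z)\<bar> \<le> 2 * s * M0 / r0" using F2b[of z] z abs_Re_le_cmod[of "F2 z"] by simp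
  moreover have "Re (F z) = Re (F1 z) - Re (F2 z)" using split[of z] z r R1 by simp
  moreover have "4 * s * M0 / r0 = 2 * s * M0 / r0 + 2 * s * M0 / r0" by simp
  ultimately show ?thesis unfolding B_def by argo
qed

lemma log_green_local:
  assumes G: "harm G V" and V: "convex V"
    and L: "L holomorphic_on {z. Im z > 0}" "\<And>z. z \<in> V \<Longrightarrow> Im z > 0 \<Longrightarrow> Re (L z) = G z"
    and lim: "\<And>x. x \<in> V \<Longrightarrow> Im x = 0 \<Longrightarrow> (L \<longlongrightarrow> L x) (at x within {z. Im z > 0})"
  obtains F where "F holomorphic_on V" "\<And>z. z \<in> V \<Longrightarrow> 0 \<le> Im z \<Longrightarrow> L z = F z"
proof -
  have op: "open V" using G harm_open by blast
  obtain F where F: "F holomorphic_on V" "\<And>z. z \<in> V \<Longrightarrow> G z = Re (F z)"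
    by (rule harm_convex_Re[OF G V]) (rule that)
  let ?H = "{z. Im z > 0}"
  have h1: "(\<lambda>z. L z - F z) holomorphic_on (V \<inter> ?H)"
    by (intro holomorphic_on_diff holomorphic_on_subset[OF L(1)] holomorphic_on_subset[OF F(1)]) auto
  have h2: "open (V \<inter> ?H)" "convex (V \<inter> ?H)" using op V convex_upper_half by (auto intro: convex_Int)
  have h3: "Re (L z - F z) = 0" if "z \<in> V \<inter> ?H" for z using that L(2) F(2) by simp
  obtain k where k0: "\<And>z. z \<in> V \<inter> ?H \<Longrightarrow> L z - F z = k"
    by (rule Re_zero_imp_constant[OF h1 h2 h3]) (assumption, rule that)
  have k: "L z = F z + k" if "z \<in> V" "Im z > 0" for z using k0[of z] that by (simp add: algebra_simps)
  have cont: "isCont (\<lambda>z. F z + k) w" if "w \<in> V" for w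
    using holomorphic_on_imp_continuous_on[OF F(1)] continuous_on_eq_continuous_at[OF op] that
    by (auto intro!: continuous_add)
  have "L z = F z + k" if z: "z \<in> V" "0 \<le> Im z" for z
  proof (cases "Im z = 0")
    case True
    show ?thesis by (rule upper_half_limit_eq[OF True lim[OF z(1) True] cont[OF z(1)] op z(1) k])
  qed (use k z in auto)
  moreover have "(\<lambda>z. F z + k) holomorphic_on V" by (intro holomorphic_intros F)
  ultimately show ?thesis using that by blast
qed

text \<open>With one constant \<tau> on all real points of \<open>S\<close>, also across different
  intervals, \<open>D - i * \<tau>\<close> is real on the axis and Schwarz reflection extends it to
  \<open>S\<close>. For an annulus around a slit, equality of the constants to the left and to the
  right is the vanishing of the flux.\<close>

lemma log_green_reflect:
  assumes h: "harm h S" and S: "cnj ` S \<subseteq> S" and sym: "\<And>z. z \<in> S \<Longrightarrow> h (cnj z) = h z"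
    and D: "D holomorphic_on {z. Im z > 0}" "\<And>z. z \<in> S \<Longrightarrow> Im z > 0 \<Longrightarrow> Re (D z) = h z"
    and lim: "\<And>x. x \<in> S \<Longrightarrow> Im x = 0 \<Longrightarrow> (D \<longlongrightarrow> D x) (at x within {z. Im z > 0})"
    and \<tau>: "\<And>x. x \<in> S \<Longrightarrow> Im x = 0 \<Longrightarrow> Im (D x) = \<tau>"
  obtains F where "F holomorphic_on S" "\<And>z. z \<in> S \<Longrightarrow> Re (F z) = h z" "\<And>x. x \<in> S \<Longrightarrow> Im x = 0 \<Longrightarrow> Im (F x) = 0"
proof -
  have op: "open S" using h harm_open by blast
  define f where "f = (\<lambda>z. D z - \<i> * of_real \<tau>)"
  have loc: "\<exists>V F. open V \<and> x \<in> V \<and> F holomorphic_on V \<and> (\<forall>z\<in>V. 0 \<le> Im z \<longrightarrow> f z = F z)" if x: "x \<in> S" for x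
  proof -
    obtain r where r: "r > 0" "ball x r \<subseteq> S" using op x open_contains_ball by blast
    have hb: "harm h (ball x r)" by (rule harm_subset[OF h open_ball r(2)])
    obtain F where F: "F holomorphic_on ball x r" "\<And>z. z \<in> ball x r \<Longrightarrow> 0 \<le> Im z \<Longrightarrow> D z = F z"
      by (rule log_green_local[OF hb convex_ball D(1)]) (use D(2) lim r(2) in \<open>blast intro: that\<close>)+
    then show ?thesis using r(1)
      by (intro exI[of _ "ball x r"] exI[of _ "\<lambda>z. F z - \<i> * of_real \<tau>"]) (auto simp: f_def intro!: holomorphic_intros)
  qed
  have Ref: "Re (f z) = h z" if z: "z \<in> S" "0 \<le> Im z" for z
  proof (cases "Im z = 0")
    case True
    have "((\<lambda>z. Re (D z)) \<longlongrightarrow> Re (D z)) (at z within {z. Im z > 0})" by (intro tendsto_intros lim z True)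
    moreover have "\<forall>\<^sub>F w in at z within {z. Im z > 0}. Re (D w) = h w"
      unfolding eventually_at_filter using eventually_nhds_in_open[OF op z(1)] by eventually_elim (auto simp: D(2))
    ultimately have "(h \<longlongrightarrow> Re (D z)) (at z within {z. Im z > 0})" by (rule Lim_transform_eventually)
    moreover have "(h \<longlongrightarrow> h z) (at z within {z. Im z > 0})" by (rule harm_tendsto[OF h z(1)])
    moreover have "at z within {z. Im z > 0} \<noteq> bot" using islimpt_upper_half[OF True] by (simp add: trivial_limit_within)
    ultimately have "Re (D z) = h z" using tendsto_unique by blast
    then show ?thesis by (simp add: f_def)
  qed (use D(2) z in \<open>auto simp: f_def\<close>)
  have "(\<lambda>z. if 0 \<le> Im z then f z else cnj (f (cnj z))) holomorphic_on S"
  proof (rule Schwarz_reflection[OF op S])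
    show "f holomorphic_on S \<inter> {z. 0 < Im z}" unfolding f_def
      by (intro holomorphic_intros holomorphic_on_subset[OF D(1)]) auto
    show "continuous_on (S \<inter> {z. 0 \<le> Im z}) f"
      unfolding continuous_on_eq_continuous_within
    proof
      fix x assume x: "x \<in> S \<inter> {z. 0 \<le> Im z}"
      then obtain V F where V: "open V" "x \<in> V" "F holomorphic_on V" "\<forall>z\<in>V. 0 \<le> Im z \<longrightarrow> f z = F z" using loc by blast
      have "isCont F x" using V holomorphic_on_imp_continuous_on continuous_on_eq_continuous_at by blast
      then have "(F \<longlongrightarrow> F x) (at x within S \<inter> {z. 0 \<le> Im z})"
        using continuous_at_imp_continuous_at_within continuous_within by blast
      moreover have "\<forall>\<^sub>F z in at x within S \<inter> {z. 0 \<le> Im z}. F z = f z"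
        unfolding eventually_at_filter using eventually_nhds_in_open[OF V(1,2)] by eventually_elim (use V(4) in auto)
      ultimately have "(f \<longlongrightarrow> F x) (at x within S \<inter> {z. 0 \<le> Im z})" by (rule Lim_transform_eventually)
      moreover have "F x = f x" using V x by auto
      ultimately show "continuous (at x within S \<inter> {z. 0 \<le> Im z}) f" by (simp add: continuous_within)
    qed
    show "f z \<in> \<real>" if "z \<in> S" "z \<in> \<real>" for z
      using \<tau>[of z] that by (auto simp: f_def complex_is_Real_iff)
  qed
  then show ?thesis
  proof (rule that)
    show "Re (if 0 \<le> Im z then f z else cnj (f (cnj z))) = h z" if "z \<in> S" for z
      using Ref[of z] Ref[of "cnj z"] that sym[of z] S by (auto simp: image_subset_iff)
    show "Im (if 0 \<le> Im x then f x else cnj (f (cnj x))) = 0" if "x \<in> S" "Im x = 0" for x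
      using \<tau>[OF that] that by (simp add: f_def)
  qed
qed

section \<open>Comparison of the Green's functions\<close>

text \<open>The data that do not involve the added slits. Constants obtained in this context are
  therefore uniform along the sequence.\<close>

locale green_setup =
  fixes P :: "(real \<times> real) set" and m :: nat and c :: "nat \<Rightarrow> real"
    and GE :: "complex \<Rightarrow> real" and Gc :: "nat \<Rightarrow> complex \<Rightarrow> real"
    and LE :: "complex \<Rightarrow> complex" and Lc :: "nat \<Rightarrow> complex \<Rightarrow> complex"
  assumes P: "slit_system P" and m: "m \<ge> 1"
    and c: "\<And>k. k \<in> {1..m} \<Longrightarrow> of_real (c k) \<notin> slits P" "inj_on c {1..m}"
    and GE: "green_inf (slits P) GE" and Gc: "\<And>k. k \<in> {1..m} \<Longrightarrow> green_pt (slits P) (of_real (c k)) (Gc k)"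
    and LE: "LE holomorphic_on {z. Im z > 0}" "\<And>z. Im z > 0 \<Longrightarrow> Re (LE z) = GE z"
      "\<And>x. x \<notin> slits P \<Longrightarrow> Im x = 0 \<Longrightarrow> (LE \<longlongrightarrow> LE x) (at x within {z. Im z > 0})"
    and Lc: "\<And>k. k \<in> {1..m} \<Longrightarrow> Lc k holomorphic_on {z. Im z > 0}" "\<And>k z. k \<in> {1..m} \<Longrightarrow> Im z > 0 \<Longrightarrow> Re (Lc k z) = Gc k z"
      "\<And>k x. k \<in> {1..m} \<Longrightarrow> x \<notin> slits P \<Longrightarrow> x \<noteq> of_real (c k) \<Longrightarrow> Im x = 0 \<Longrightarrow> (Lc k \<longlongrightarrow> Lc k x) (at x within {z. Im z > 0})"
begin

abbreviation "E \<equiv> slits P"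
abbreviation "c' k \<equiv> complex_of_real (c k)"

text \<open>Comparison function for \<open>h\<close>: it has boundary values 0 on \<open>E\<close>,
  is nonnegative, and has a logarithmic pole at each \<open>c k\<close>.\<close>

definition Gsum :: "complex \<Rightarrow> real" where "Gsum z = (\<Sum>k=1..m. Gc k z)"

lemma finP: "finite P" using P by (simp add: slit_system_def)
lemma E_compact: "compact E" and E_ne: "E \<noteq> {}" and E_real: "E \<subseteq> \<real>" and E_closed: "closed E"
  using compact_slits[OF finP] slits_nonempty[OF P] slits_real compact_imp_closed by auto

lemma harm_Gc: "k \<in> {1..m} \<Longrightarrow> harm (Gc k) (- E - {c' k})" and harm_GE: "harm GE (- E)"
  using Gc GE by (auto simp: green_pt_def green_inf_def)

lemma Gc_nonneg: "k \<in> {1..m} \<Longrightarrow> z \<notin> E \<Longrightarrow> z \<noteq> c' k \<Longrightarrow> 0 \<le> Gc k z"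
  using green_pt_nonneg[OF Gc E_compact E_ne] by blast

lemma Gc_lim: "k \<in> {1..m} \<Longrightarrow> x \<in> E \<Longrightarrow> (Gc k \<longlongrightarrow> 0) (at x within - E)"
  using Gc by (auto simp: green_pt_def)

lemma Gc_at_inf: "k \<in> {1..m} \<Longrightarrow> harm_at_inf (Gc k)"
  using Gc by (auto simp: green_pt_def)

lemma Gc_cnj: "k \<in> {1..m} \<Longrightarrow> z \<notin> E \<Longrightarrow> z \<noteq> c' k \<Longrightarrow> Gc k (cnj z) = Gc k z"
  using green_pt_cnj[OF Gc E_compact E_ne E_real] by auto

lemma GE_cnj: "z \<notin> E \<Longrightarrow> GE (cnj z) = GE z"
  using green_inf_cnj[OF GE E_compact E_ne E_real] by auto

text \<open>Below the radius \<open>4 * \<rho>\<close> each \<open>c k\<close> is isolated from \<open>E\<close> and from the other poles; the bounds \<open>V\<close>, \<open>\<Gamma>\<close>, \<open>Sm\<close>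
  do not depend on the added slits.\<close>
definition good :: "real \<Rightarrow> real \<Rightarrow> real \<Rightarrow> real \<Rightarrow> bool" where
  "good \<rho> V \<Gamma> Sm \<longleftrightarrow> 0 < \<rho> \<and> 2 * \<rho> < 1 \<and> V > 0 \<and> \<Gamma> > 0 \<and> Sm > 0 \<and>
     (\<forall>k\<in>{1..m}. cball (c' k) (4 * \<rho>) \<inter> E = {}) \<and>
     (\<forall>j\<in>{1..m}. \<forall>k\<in>{1..m}. j \<noteq> k \<longrightarrow> 4 * \<rho> < \<bar>c j - c k\<bar>) \<and>
     (\<forall>k\<in>{1..m}. \<forall>z\<in>cball (c' k) \<rho> - {c' k}. \<bar>Gc k z + ln (cmod (z - c' k))\<bar> \<le> V) \<and>
     (\<forall>k\<in>{1..m}. \<forall>z\<in>cball (c' k) \<rho>. \<bar>GE z\<bar> \<le> \<Gamma>) \<and>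
     (\<forall>j\<in>{1..m}. \<forall>k\<in>{1..m}. j \<noteq> k \<longrightarrow> (\<forall>z\<in>cball (c' k) \<rho>. \<bar>Gc j z\<bar> \<le> \<Gamma>)) \<and>
     (\<forall>k\<in>{1..m}. \<forall>z. cmod (z - c' k) = \<rho> \<longrightarrow> Gsum z \<le> Sm) \<and>
     (\<forall>k\<in>{1..m}. \<forall>t. 0 < t \<longrightarrow> t < \<rho> \<longrightarrow> Im (Lc k (of_real (c k - t))) - Im (Lc k (of_real (c k + t))) = - pi)"

lemma finite_uniform_pos:
  assumes "\<And>k. k \<in> {1..m} \<Longrightarrow> \<exists>t>0. \<forall>s. 0 < s \<longrightarrow> s \<le> t \<longrightarrow> Q k s"
  obtains t :: real where "t > 0" "\<And>k s. k \<in> {1..m} \<Longrightarrow> 0 < s \<Longrightarrow> s \<le> t \<Longrightarrow> Q k s"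
proof -
  obtain t where t: "\<And>k. k \<in> {1..m} \<Longrightarrow> t k > 0" "\<And>k s. k \<in> {1..m} \<Longrightarrow> 0 < s \<Longrightarrow> s \<le> t k \<Longrightarrow> Q k s"
    using assms by metis
  define u where "u = Min (t ` {1..m})"
  have "u > 0" unfolding u_def using m t(1) by (subst Min_gr_iff) auto
  moreover have "u \<le> t k" if "k \<in> {1..m}" for k unfolding u_def using that by (intro Min_le) auto
  ultimately show ?thesis using that[of u] t(2) by (meson order_trans)
qed

lemma compact_bound:
  fixes f :: "complex \<Rightarrow> real"
  assumes "compact S" "continuous_on S f"
  obtains B where "B > 0" "\<And>z. z \<in> S \<Longrightarrow> \<bar>f z\<bar> \<le> B"
  using compact_imp_bounded[OF compact_continuous_image[OF assms(2,1)]] unfolding bounded_pos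
  by (auto intro: that)

lemma good_exists: obtains \<rho> V \<Gamma> Sm where "good \<rho> V \<Gamma> Sm"
proof -
  have "\<exists>t>0. \<forall>s. 0 < s \<longrightarrow> s \<le> t \<longrightarrow>
      cball (c' k) (4 * s) \<inter> E = {} \<and> (\<forall>j\<in>{1..m}. j \<noteq> k \<longrightarrow> 4 * s < \<bar>c j - c k\<bar>) \<and>
      (\<exists>v. harm v (ball (c' k) (2 * s)) \<and> (\<forall>z\<in>ball (c' k) (2 * s) - {c' k}. Gc k z = v z - ln (cmod (z - c' k)))) \<and>
      (\<forall>t. 0 < t \<longrightarrow> t < s \<longrightarrow> Im (Lc k (of_real (c k - t))) - Im (Lc k (of_real (c k + t))) = - pi)"
    if k: "k \<in> {1..m}" for k
  proof -
    have "open (- E)" "c' k \<in> - E" using E_closed c(1)[OF k] by auto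
    then obtain t1 where t1: "t1 > 0" "cball (c' k) t1 \<subseteq> - E" using open_contains_cball by blast
    define t2 where "t2 = Min (insert 1 ((\<lambda>j. \<bar>c j - c k\<bar>) ` ({1..m} - {k})))"
    have t2: "t2 > 0" "\<And>j. j \<in> {1..m} \<Longrightarrow> j \<noteq> k \<Longrightarrow> t2 \<le> \<bar>c j - c k\<bar>"
    proof -
      have "t2 \<in> insert 1 ((\<lambda>j. \<bar>c j - c k\<bar>) ` ({1..m} - {k}))" unfolding t2_def by (rule Min_in) auto
      moreover have "\<bar>c j - c k\<bar> > 0" if "j \<in> {1..m} - {k}" for j
        using inj_onD[OF c(2), of j k] that k by auto
      ultimately show "t2 > 0" by (elim insertE imageE) (simp, metis)
      show "t2 \<le> \<bar>c j - c k\<bar>" if "j \<in> {1..m}" "j \<noteq> k" for j unfolding t2_def using that by (intro Min_le) auto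
    qed
    obtain t3 v where t3: "t3 > 0" "harm v (ball (c' k) t3)" "\<forall>z\<in>ball (c' k) t3 - {c' k}. Gc k z = v z - ln (cmod (z - c' k))"
      using Gc[OF k] unfolding green_pt_def by blast
    obtain t4 where t4: "t4 > 0" "\<And>t. 0 < t \<Longrightarrow> t < t4 \<Longrightarrow> Im (Lc k (of_real (c k - t))) - Im (Lc k (of_real (c k + t))) = - pi"
      by (rule Im_log_green_jump[OF Gc[OF k] Gc_cnj[OF k] E_compact Lc(1,2,3)[OF k]]) (assumption+, rule that)
    define t where "t = min (min (t1 / 4) (t2 / 8)) (min (t3 / 2) t4)"
    have t: "t > 0" using t1 t2 t3 t4 by (simp add: t_def)
    have le: "4 * s \<le> t1" "4 * s < t2" "2 * s \<le> t3" "s \<le> t4" if "0 < s" "s \<le> t" for s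
      using that t2(1) by (auto simp: t_def)
    show ?thesis
    proof (intro exI[of _ t] conjI allI impI t)
      fix s assume s: "0 < s" "s \<le> t"
      note l = le[OF s]
      show "cball (c' k) (4 * s) \<inter> E = {}" using order_trans[OF subset_cball[OF l(1)] t1(2)] by blast
      show "\<forall>j\<in>{1..m}. j \<noteq> k \<longrightarrow> 4 * s < \<bar>c j - c k\<bar>" using t2(2) l(2) by force
      show "\<exists>v. harm v (ball (c' k) (2 * s)) \<and> (\<forall>z\<in>ball (c' k) (2 * s) - {c' k}. Gc k z = v z - ln (cmod (z - c' k)))"
      proof (intro exI[of _ v] conjI)
        show "harm v (ball (c' k) (2 * s))" by (rule harm_subset[OF t3(2) open_ball subset_ball[OF l(3)]])
        show "\<forall>z\<in>ball (c' k) (2 * s) - {c' k}. Gc k z = v z - ln (cmod (z - c' k))"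
          using t3(3) subset_ball[OF l(3), of "c' k"] by blast
      qed
      show "Im (Lc k (of_real (c k - t))) - Im (Lc k (of_real (c k + t))) = - pi" if "0 < t" "t < s" for t
        using t4(2)[of t] that l(4) by simp
    qed
  qed
  then obtain t where t: "t > 0" "\<And>k s. k \<in> {1..m} \<Longrightarrow> 0 < s \<Longrightarrow> s \<le> t \<Longrightarrow>
      cball (c' k) (4 * s) \<inter> E = {} \<and> (\<forall>j\<in>{1..m}. j \<noteq> k \<longrightarrow> 4 * s < \<bar>c j - c k\<bar>) \<and>
      (\<exists>v. harm v (ball (c' k) (2 * s)) \<and> (\<forall>z\<in>ball (c' k) (2 * s) - {c' k}. Gc k z = v z - ln (cmod (z - c' k)))) \<and>
      (\<forall>t. 0 < t \<longrightarrow> t < s \<longrightarrow> Im (Lc k (of_real (c k - t))) - Im (Lc k (of_real (c k + t))) = - pi)"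
    by (rule finite_uniform_pos) (blast, rule that)
  \<comment> \<open>The bound 1/4 gives \<open>2 * \<rho> < 1\<close>, so that
    \<open>ln |z - c k|\<close> is negative within distance \<rho> of the pole.\<close>
  define \<rho> where "\<rho> = min t (1 / 4)"
  have \<rho>: "0 < \<rho>" "2 * \<rho> < 1" "\<rho> \<le> t" using t(1) by (auto simp: \<rho>_def)
  note tr = t(2)[OF _ \<rho>(1,3)]
  have sub: "cball (c' k) \<rho> \<subseteq> - E" if "k \<in> {1..m}" for k
    using tr[OF that] subset_cball[of \<rho> "4 * \<rho>" "c' k"] \<rho>(1) by auto
  have subj: "cball (c' k) \<rho> \<subseteq> - E - {c' j}" if "k \<in> {1..m}" "j \<in> {1..m}" "j \<noteq> k" for j k
  proof -
    have "4 * \<rho> < \<bar>c j - c k\<bar>" using tr[OF that(1)] that by blast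
    then have "c' j \<notin> cball (c' k) \<rho>" using \<rho>(1) by (auto simp: dist_norm abs_minus_commute simp flip: of_real_diff)
    then show ?thesis using sub[OF that(1)] by blast
  qed
  have "\<exists>V>0. \<forall>k\<in>{1..m}. \<forall>z\<in>cball (c' k) \<rho> - {c' k}. \<bar>Gc k z + ln (cmod (z - c' k))\<bar> \<le> V"
  proof -
    have "\<exists>V>0. \<forall>z\<in>cball (c' k) \<rho> - {c' k}. \<bar>Gc k z + ln (cmod (z - c' k))\<bar> \<le> V" if k: "k \<in> {1..m}" for k
    proof -
      obtain v where v: "harm v (ball (c' k) (2 * \<rho>))" "\<forall>z\<in>ball (c' k) (2 * \<rho>) - {c' k}. Gc k z = v z - ln (cmod (z - c' k))"
        using tr[OF k] by blast
      have sb: "cball (c' k) \<rho> \<subseteq> ball (c' k) (2 * \<rho>)" using \<rho>(1) by auto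
      obtain B where B: "B > 0" "\<And>z. z \<in> cball (c' k) \<rho> \<Longrightarrow> \<bar>v z\<bar> \<le> B"
        by (rule compact_bound[OF compact_cball continuous_on_subset[OF harm_continuous_on[OF v(1)] sb]]) (rule that)
      show ?thesis
      proof (intro exI[of _ B] conjI ballI B(1))
        fix z assume z: "z \<in> cball (c' k) \<rho> - {c' k}"
        then have "z \<in> ball (c' k) (2 * \<rho>) - {c' k}" using sb by blast
        then show "\<bar>Gc k z + ln (cmod (z - c' k))\<bar> \<le> B" using v(2) B(2)[of z] z by auto
      qed
    qed
    then obtain V where V: "\<And>k. k \<in> {1..m} \<Longrightarrow> V k > 0" "\<And>k z. k \<in> {1..m} \<Longrightarrow> z \<in> cball (c' k) \<rho> - {c' k} \<Longrightarrow> \<bar>Gc k z + ln (cmod (z - c' k))\<bar> \<le> V k"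
      by metis
    have "V k \<le> (\<Sum>k\<in>{1..m}. V k)" if "k \<in> {1..m}" for k using V(1) that by (intro member_le_sum) (auto intro: less_imp_le)
    moreover have "(\<Sum>k\<in>{1..m}. V k) > 0" using V(1) m by (intro sum_pos) auto
    ultimately show ?thesis using V(2) by (intro exI[of _ "\<Sum>k\<in>{1..m}. V k"]) (meson order_trans)
  qed
  then obtain V where V: "V > 0" "\<forall>k\<in>{1..m}. \<forall>z\<in>cball (c' k) \<rho> - {c' k}. \<bar>Gc k z + ln (cmod (z - c' k))\<bar> \<le> V" by blast
  have cc: "compact (\<Union>k\<in>{1..m}. cball (c' k) \<rho>)" by (intro compact_UN) auto
  obtain \<Gamma>1 where \<Gamma>1: "\<Gamma>1 > 0" "\<And>z. z \<in> (\<Union>k\<in>{1..m}. cball (c' k) \<rho>) \<Longrightarrow> \<bar>GE z\<bar> \<le> \<Gamma>1"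
    by (rule compact_bound[OF cc continuous_on_subset[OF harm_continuous_on[OF harm_GE]]]) (use sub in blast, rule that)
  have "\<exists>B>0. \<forall>k\<in>{1..m}. j \<noteq> k \<longrightarrow> (\<forall>z\<in>cball (c' k) \<rho>. \<bar>Gc j z\<bar> \<le> B)" if j: "j \<in> {1..m}" for j
  proof -
    have cc: "compact (\<Union>k\<in>{1..m} - {j}. cball (c' k) \<rho>)" by (intro compact_UN) auto
    obtain B where "B > 0" "\<And>z. z \<in> (\<Union>k\<in>{1..m} - {j}. cball (c' k) \<rho>) \<Longrightarrow> \<bar>Gc j z\<bar> \<le> B"
      by (rule compact_bound[OF cc continuous_on_subset[OF harm_continuous_on[OF harm_Gc[OF j]]]]) (use subj j in blast, rule that)
    then show ?thesis using j by blast
  qed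
  then obtain B where B: "\<And>j. j \<in> {1..m} \<Longrightarrow> B j > 0" "\<And>j k z. j \<in> {1..m} \<Longrightarrow> k \<in> {1..m} \<Longrightarrow> j \<noteq> k \<Longrightarrow> z \<in> cball (c' k) \<rho> \<Longrightarrow> \<bar>Gc j z\<bar> \<le> B j"
    by metis
  have Bs: "B j \<le> (\<Sum>k\<in>{1..m}. B k)" if "j \<in> {1..m}" for j using B(1) that by (intro member_le_sum) (auto intro: less_imp_le)
  have Bs0: "(\<Sum>k\<in>{1..m}. B k) > 0" using B(1) m by (intro sum_pos) auto
  have cs: "compact (\<Union>k\<in>{1..m}. sphere (c' k) \<rho>)" by (intro compact_UN) auto
  have "sphere (c' k) \<rho> \<subseteq> - E - {c' j}" if "k \<in> {1..m}" "j \<in> {1..m}" for j k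
  proof (cases "j = k")
    case True
    then show ?thesis using sub[OF that(1)] \<rho>(1) by auto
  next
    case False
    have "sphere (c' k) \<rho> \<subseteq> cball (c' k) \<rho>" by (rule sphere_cball)
    then show ?thesis using subj[OF that False] by blast
  qed
  then have "continuous_on (\<Union>k\<in>{1..m}. sphere (c' k) \<rho>) Gsum" unfolding Gsum_def
    by (intro continuous_on_sum continuous_on_subset[OF harm_continuous_on[OF harm_Gc]]) blast+
  then obtain Sm where Sm: "Sm > 0" "\<And>z. z \<in> (\<Union>k\<in>{1..m}. sphere (c' k) \<rho>) \<Longrightarrow> \<bar>Gsum z\<bar> \<le> Sm"
    by (rule compact_bound[OF cs]) (rule that)
  have Sm2: "Gsum z \<le> Sm" if "k \<in> {1..m}" "cmod (z - c' k) = \<rho>" for k z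
    using Sm(2)[of z] that by (force simp: dist_norm norm_minus_commute)
  have "good \<rho> V (\<Gamma>1 + (\<Sum>k\<in>{1..m}. B k)) Sm"
    unfolding good_def
  proof (intro conjI ballI allI impI)
    show "\<bar>GE z\<bar> \<le> \<Gamma>1 + (\<Sum>k\<in>{1..m}. B k)" if "k \<in> {1..m}" "z \<in> cball (c' k) \<rho>" for k z
      using \<Gamma>1(2)[of z] that Bs0 by fastforce
    show "\<bar>Gc j z\<bar> \<le> \<Gamma>1 + (\<Sum>k\<in>{1..m}. B k)" if "j \<in> {1..m}" "k \<in> {1..m}" "j \<noteq> k" "z \<in> cball (c' k) \<rho>" for j k z
      using B(2)[OF that] Bs[OF that(1)] \<Gamma>1(1) by linarith
    show "0 < \<rho>" "2 * \<rho> < 1" "0 < V" "0 < Sm" by fact+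
    show "0 < \<Gamma>1 + (\<Sum>k\<in>{1..m}. B k)" using \<Gamma>1(1) Bs0 by simp
    show "cball (c' k) (4 * \<rho>) \<inter> E = {}" if "k \<in> {1..m}" for k using tr[OF that] by blast
    show "4 * \<rho> < \<bar>c j - c k\<bar>" if "j \<in> {1..m}" "k \<in> {1..m}" "j \<noteq> k" for j k using tr[OF that(2)] that by blast
    show "\<bar>Gc k z + ln (cmod (z - c' k))\<bar> \<le> V" if "k \<in> {1..m}" "z \<in> cball (c' k) \<rho> - {c' k}" for k z
      using V(2) that by blast
    show "Gsum z \<le> Sm" if "k \<in> {1..m}" "cmod (z - c' k) = \<rho>" for k z by (rule Sm2[OF that])
    show "Im (Lc k (of_real (c k - t))) - Im (Lc k (of_real (c k + t))) = - pi" if "k \<in> {1..m}" "0 < t" "t < \<rho>" for k t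
      using tr[OF that(1)] that by blast
  qed
  then show ?thesis using that by blast
qed

end

text \<open>\<open>s\<close> plays the role of \<open>max \<omega>\<^sub>k\<^sup>2\<close>.\<close>
locale perturbed_green = green_setup +
  fixes B C :: "nat \<Rightarrow> real" and G :: "complex \<Rightarrow> real" and L :: "complex \<Rightarrow> complex"
    and U :: "nat \<Rightarrow> complex \<Rightarrow> real" and \<omega> :: "nat \<Rightarrow> real" and s :: real
  assumes PQ: "slit_system (P \<union> (\<lambda>k. (B k, C k)) ` {1..m})"
    and cBC: "\<And>k. k \<in> {1..m} \<Longrightarrow> B k \<le> c k \<and> c k \<le> C k"
    and G: "green_inf (slits (P \<union> (\<lambda>k. (B k, C k)) ` {1..m})) G"
    and U: "\<And>k. k \<in> {1..m} \<Longrightarrow> hmeas (slits (P \<union> (\<lambda>k. (B k, C k)) ` {1..m})) (complex_of_real ` {B k..C k}) (U k) (\<omega> k)"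
    and L: "L holomorphic_on {z. Im z > 0}" "\<And>z. Im z > 0 \<Longrightarrow> Re (L z) = G z"
      "\<And>x. x \<notin> slits (P \<union> (\<lambda>k. (B k, C k)) ` {1..m}) \<Longrightarrow> Im x = 0 \<Longrightarrow> (L \<longlongrightarrow> L x) (at x within {z. Im z > 0})"
    and s: "s > 0" "\<And>k. k \<in> {1..m} \<Longrightarrow> C k - B k < s / 2"
begin

abbreviation "K \<equiv> slits (P \<union> (\<lambda>k. (B k, C k)) ` {1..m})"

definition h :: "complex \<Rightarrow> real" where "h z = G z - GE z + (\<Sum>k=1..m. \<omega> k * Gc k z)"
definition D :: "complex \<Rightarrow> complex" where "D z = L z - LE z + (\<Sum>k=1..m. of_real (\<omega> k) * Lc k z)"

lemma K_eq: "K = E \<union> (\<Union>k\<in>{1..m}. complex_of_real ` {B k..C k})"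
  by (auto simp: slits_def)

lemma finPQ: "finite (P \<union> (\<lambda>k. (B k, C k)) ` {1..m})" using finP by auto
lemma K_compact: "compact K" and K_ne: "K \<noteq> {}" and K_real: "K \<subseteq> \<real>" and K_closed: "closed K"
  using compact_slits[OF finPQ] slits_nonempty[OF PQ] slits_real compact_imp_closed by auto

lemma E_K: "E \<subseteq> K" unfolding K_eq by blast
text \<open>The poles of the functions \<open>Gc k\<close> lie on the added slits, so
  \<open>h\<close> has no singularities off \<open>K\<close>.\<close>

lemma c_K: "k \<in> {1..m} \<Longrightarrow> c' k \<in> K" using cBC unfolding K_eq by fastforce

lemma K_cases:
  assumes "x \<in> K" shows "x \<in> E \<or> (\<exists>k\<in>{1..m}. x \<in> complex_of_real ` {B k..C k} \<and> cmod (x - c' k) < s / 2)"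
proof -
  have "cmod (x - c' k) < s / 2" if "k \<in> {1..m}" "x \<in> complex_of_real ` {B k..C k}" for k
  proof -
    obtain t where t: "x = of_real t" "B k \<le> t" "t \<le> C k" using \<open>x \<in> complex_of_real ` {B k..C k}\<close> by auto
    have "x - c' k = of_real (t - c k)" by (simp add: t(1))
    then have "cmod (x - c' k) = \<bar>t - c k\<bar>" by (simp only: norm_of_real)
    then show ?thesis using t(2,3) cBC[OF that(1)] s(2)[OF that(1)] by linarith
  qed
  then show ?thesis using assms unfolding K_eq by blast
qed

lemma harm_h: "harm h (- K)"
  unfolding h_def using G E_K c_K E_closed K_closed
  by (intro harm_add harm_diff harm_sum harm_cmult harm_subset[OF harm_GE] harm_subset[OF harm_Gc])
    (auto simp: green_inf_def)

text \<open>The logarithmic poles of \<open>G\<close> and \<open>GE\<close> at infinity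
  cancel.\<close>

lemma h_at_inf: "harm_at_inf h"
proof -
  have 1: "h = (\<lambda>z. ((G z - ln (cmod z)) - (GE z - ln (cmod z))) + (\<Sum>k=1..m. \<omega> k * Gc k z))"
    by (simp add: h_def fun_eq_iff)
  have 2: "harm_at_inf (\<lambda>z. G z - ln (cmod z))" "harm_at_inf (\<lambda>z. GE z - ln (cmod z))"
    using G GE unfolding green_inf_def by blast+
  show ?thesis unfolding 1
    by (rule harm_at_inf_add[OF harm_at_inf_diff[OF 2] harm_at_inf_sum[OF harm_at_inf_cmult[OF Gc_at_inf]]])
qed

lemma h_cnj: "z \<notin> K \<Longrightarrow> h (cnj z) = h z"
proof -
  assume z: "z \<notin> K"
  have "G (cnj z) = G z" by (rule green_inf_cnj[OF G K_compact K_ne K_real z])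
  moreover have "GE (cnj z) = GE z" using GE_cnj z E_K by blast
  moreover have "Gc k (cnj z) = Gc k z" if "k \<in> {1..m}" for k using Gc_cnj[OF that] z E_K c_K[OF that] by blast
  ultimately show ?thesis by (simp add: h_def)
qed

lemma h_lim: assumes x: "x \<in> E" shows "(h \<longlongrightarrow> 0) (at x within - K)"
proof -
  have sub: "(f \<longlongrightarrow> 0) (at x within - E) \<Longrightarrow> (f \<longlongrightarrow> 0) (at x within - K)" for f :: "complex \<Rightarrow> real"
    by (erule tendsto_within_subset) (use E_K in auto)
  have "(G \<longlongrightarrow> 0) (at x within - K)" using G x E_K by (auto simp: green_inf_def)
  moreover have "(GE \<longlongrightarrow> 0) (at x within - K)" using GE x by (intro sub) (auto simp: green_inf_def)
  moreover have "(Gc k \<longlongrightarrow> 0) (at x within - K)" if "k \<in> {1..m}" for k by (rule sub[OF Gc_lim[OF that x]])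
  then have "((\<lambda>z. \<Sum>k=1..m. \<omega> k * Gc k z) \<longlongrightarrow> (\<Sum>k=1..m. \<omega> k * 0)) (at x within - K)" by (intro tendsto_intros) auto
  ultimately have "(h \<longlongrightarrow> 0 - 0 + (\<Sum>k=1..m. \<omega> k * 0)) (at x within - K)" unfolding h_def by (intro tendsto_add tendsto_diff)
  then show ?thesis by simp
qed

text \<open>Monotonicity in the domain: at points of \<open>K\<close> the function \<open>G\<close>
  tends to 0 and \<open>GE\<close> to a nonnegative limit.\<close>

lemma G_le_GE: assumes z: "z \<notin> K" shows "0 \<le> G z" "G z \<le> GE z"
proof -
  show "0 \<le> G z" by (rule green_inf_nonneg[OF G K_compact K_ne z])
  obtain e where e: "e \<in> K" using K_ne by blast
  have hG: "harm G (- K)" using G by (simp add: green_inf_def)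
  have "G z - GE z \<le> 0"
  proof (rule max_principle_sphere[of "\<lambda>z. G z - GE z" "- K" e])
    show "harm (\<lambda>z. G z - GE z) (- K)" using hG E_K K_closed by (intro harm_diff harm_subset[OF harm_GE]) auto
    show "bounded (- (- K))" using K_compact compact_imp_bounded by simp
    have "harm_at_inf (\<lambda>z. G z - ln (cmod z))" "harm_at_inf (\<lambda>z. GE z - ln (cmod z))"
      using G GE unfolding green_inf_def by blast+
    from harm_at_inf_diff[OF this] show "harm_at_inf (\<lambda>z. G z - GE z)" by simp
    fix x and \<epsilon> :: real assume x: "x \<in> frontier (- K)" and \<epsilon>: "\<epsilon> > 0"
    have xK: "x \<in> K" using frontier_Compl_finite[of K x "{}"] x K_closed by auto
    have G0: "(G \<longlongrightarrow> 0) (at x within - K)" using G xK by (simp add: green_inf_def)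
    have "\<exists>b\<ge>0. (GE \<longlongrightarrow> b) (at x within - K)"
    proof (cases "x \<in> E")
      case True
      then have "(GE \<longlongrightarrow> 0) (at x within - E)" using GE by (simp add: green_inf_def)
      then have "(GE \<longlongrightarrow> 0) (at x within - K)" by (rule tendsto_within_subset) (use E_K in auto)
      then show ?thesis by blast
    next
      case False
      then show ?thesis using harm_tendsto[OF harm_GE, of x] green_inf_nonneg[OF GE E_compact E_ne False] by blast
    qed
    then show "\<forall>\<^sub>F z in at x within - K. G z - GE z < \<epsilon>" using eventually_diff_less[OF G0 _ _ \<epsilon>] by blast
  qed (use e z in auto)
  then show "G z \<le> GE z" by simp
qed

lemma D_holo: "D holomorphic_on {z. Im z > 0}"
  unfolding D_def by (intro holomorphic_intros L(1) LE(1) Lc(1)) auto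

lemma Re_D: "Im z > 0 \<Longrightarrow> Re (D z) = h z"
  by (simp add: D_def h_def L(2) LE(2) Lc(2))

lemma D_lim: assumes x: "x \<notin> K" "Im x = 0" shows "(D \<longlongrightarrow> D x) (at x within {z. Im z > 0})"
  unfolding D_def using x E_K c_K by (intro tendsto_intros L(3) LE(3) Lc(3)) auto

lemma Im_D_gap: assumes "a \<le> b" "complex_of_real ` {a..b} \<subseteq> - K" shows "Im (D (of_real a)) = Im (D (of_real b))"
  by (rule Im_log_green_gap[OF harm_h _ D_holo _ _ assms]) (use h_cnj Re_D D_lim in auto)

context
  fixes \<rho> V \<Gamma> Sm assumes good: "good \<rho> V \<Gamma> Sm" and s\<rho>: "s < \<rho>"
begin

lemma \<rho>: "0 < \<rho>" "2 * \<rho> < 1" "V > 0" "\<Gamma> > 0" "Sm > 0" using good by (auto simp: good_def)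

lemma good_E: assumes "k \<in> {1..m}" "cmod (z - c' k) \<le> 4 * \<rho>" shows "z \<notin> E"
proof -
  have "cball (c' k) (4 * \<rho>) \<inter> E = {}" using good assms(1) unfolding good_def by blast
  moreover have "z \<in> cball (c' k) (4 * \<rho>)" using assms(2) by (simp add: dist_norm norm_minus_commute)
  ultimately show ?thesis by blast
qed

lemma good_sep: "j \<in> {1..m} \<Longrightarrow> k \<in> {1..m} \<Longrightarrow> j \<noteq> k \<Longrightarrow> 4 * \<rho> < \<bar>c j - c k\<bar>"
  using good unfolding good_def by blast

lemma annulus_K: assumes k: "k \<in> {1..m}" and z: "s / 2 \<le> cmod (z - c' k)" "cmod (z - c' k) \<le> 2 * \<rho>" shows "z \<notin> K"
proof
  assume "z \<in> K"
  then consider "z \<in> E" | j where "j \<in> {1..m}" "cmod (z - c' j) < s / 2" using K_cases by blast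
  then show False
  proof cases
    case 1
    then show False using good_E[OF k, of z] z(2) \<rho>(1) by simp
  next
    case 2
    then have "j \<noteq> k" using z by auto
    then have "4 * \<rho> < \<bar>c j - c k\<bar>" using good_sep 2 k by blast
    moreover have "c' j - c' k = (z - c' k) - (z - c' j)" by simp
    then have "cmod (c' j - c' k) \<le> cmod (z - c' k) + cmod (z - c' j)" by (metis norm_triangle_ineq4)
    then have "\<bar>c j - c k\<bar> \<le> cmod (z - c' k) + cmod (z - c' j)" by (metis norm_of_real of_real_diff)
    ultimately show False using z 2 s(1) s\<rho> by linarith
  qed
qed

text \<open>Two jumps cancel: \<open>pi * \<omega> k\<close> from \<open>L\<close>, by the flux
  identity, and \<open>- pi * \<omega> k\<close> from the pole of \<open>Lc k\<close>. Neither
  \<open>LE\<close> nor the other \<open>Lc j\<close> jumps across \<open>c k\<close>, because their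
  real parts are harmonic near the whole segment.\<close>

lemma Im_D_jump: assumes k: "k \<in> {1..m}" shows "Im (D (of_real (c k - s))) = Im (D (of_real (c k + s)))"
proof -
  have kP: "(B k, C k) \<in> P \<union> (\<lambda>k. (B k, C k)) ` {1..m}" using k by auto
  have cb: "c k - s < B k" "C k < c k + s" using cBC[OF k] s k by (smt (verit) field_sum_of_halves)+
  have nK: "complex_of_real x \<notin> K" if "\<bar>x - c k\<bar> \<le> 2 * \<rho>" "x < B k \<or> C k < x" for x
  proof
    assume xK: "complex_of_real x \<in> K"
    have "of_real x - c' k = of_real (x - c k)" by simp
    then have n: "cmod (of_real x - c' k) = \<bar>x - c k\<bar>" by (simp only: norm_of_real)
    then have "cmod (of_real x - c' k) < s / 2" using annulus_K[OF k, of "of_real x"] that xK by force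
    from K_cases[OF xK] show False
    proof
      assume "complex_of_real x \<in> E"
      then show False using good_E[OF k, of "of_real x"] n that(1) \<rho>(1) by simp
    next
      assume "\<exists>j\<in>{1..m}. complex_of_real x \<in> complex_of_real ` {B j..C j} \<and> cmod (of_real x - c' j) < s / 2"
      then obtain j where j: "j \<in> {1..m}" "x \<in> {B j..C j}" "cmod (of_real x - c' j) < s / 2" by auto
      then have "j \<noteq> k" using that(2) by auto
      then have "4 * \<rho> < \<bar>c j - c k\<bar>" using good_sep j k by blast
      moreover have "of_real x - c' j = of_real (x - c j)" by simp
      then have "cmod (of_real x - c' j) = \<bar>x - c j\<bar>" by (simp only: norm_of_real)
      ultimately show False using j(3) that(1) s(1) s\<rho> by linarith
    qed
  qed
  have pts: "complex_of_real (c k - s) \<notin> K" "complex_of_real (c k + s) \<notin> K"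
    by (rule nK; use cb s(1) s\<rho> in auto)+
  have flux: "Im (L (of_real (c k - s))) - Im (L (of_real (c k + s))) = pi * \<omega> k"
  proof (rule flux_eq_harmonic_measure[OF PQ kP G U[OF k] L(1,2) cb])
    show "complex_of_real x \<notin> K" if "c k - s \<le> x" "x < B k" for x
      by (rule nK) (use that cBC[OF k] s(1) s\<rho> in auto)
    show "complex_of_real x \<notin> K" if "C k < x" "x \<le> c k + s" for x
      by (rule nK) (use that cBC[OF k] s(1) s\<rho> in auto)
  qed (use pts L(3) in auto)
  have seg: "complex_of_real ` {c k - s..c k + s} \<subseteq> cball (c' k) \<rho>"
  proof
    fix z assume "z \<in> complex_of_real ` {c k - s..c k + s}"
    then obtain x where x: "z = of_real x" "x \<in> {c k - s..c k + s}" by blast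
    then have "c' k - z = of_real (c k - x)" by simp
    then have "cmod (c' k - z) = \<bar>c k - x\<bar>" by (simp only: norm_of_real)
    then show "z \<in> cball (c' k) \<rho>" using x(2) s\<rho> by (auto simp: dist_norm)
  qed
  have cE: "cball (c' k) \<rho> \<subseteq> - E"
  proof
    fix z assume "z \<in> cball (c' k) \<rho>"
    then show "z \<in> - E" using good_E[OF k, of z] \<rho>(1) by (simp add: dist_norm norm_minus_commute)
  qed
  have e0: "Im (LE (of_real (c k - s))) = Im (LE (of_real (c k + s)))"
    by (rule Im_log_green_gap[OF harm_GE _ LE(1)]) (use GE_cnj LE s(1) seg cE in auto)
  have ej: "Im (Lc j (of_real (c k - s))) = Im (Lc j (of_real (c k + s)))" if j: "j \<in> {1..m}" "j \<noteq> k" for j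
  proof (rule Im_log_green_gap[OF harm_Gc[OF j(1)] _ Lc(1)[OF j(1)]])
    have "4 * \<rho> < \<bar>c j - c k\<bar>" using good_sep j k by blast
    moreover have "c' k - c' j = of_real (c k - c j)" by simp
    then have "cmod (c' k - c' j) = \<bar>c k - c j\<bar>" by (simp only: norm_of_real)
    ultimately have "c' j \<notin> cball (c' k) \<rho>" using \<rho>(1) by (auto simp: dist_norm)
    then show "complex_of_real ` {c k - s..c k + s} \<subseteq> - E - {c' j}" using seg cE by blast
  qed (use Gc_cnj[OF j(1)] Lc[OF j(1)] s(1) in auto)
  have ek: "Im (Lc k (of_real (c k - s))) - Im (Lc k (of_real (c k + s))) = - pi"
    using good k s(1) s\<rho> by (auto simp: good_def)
  have "(\<Sum>j=1..m. \<omega> j * Im (Lc j (of_real (c k - s)))) - (\<Sum>j=1..m. \<omega> j * Im (Lc j (of_real (c k + s))))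
      = (\<Sum>j=1..m. if j = k then - pi * \<omega> k else 0)"
    unfolding sum_subtractf[symmetric] by (rule sum.cong) (use ej ek in \<open>auto simp flip: right_diff_distrib\<close>)
  also have "\<dots> = - pi * \<omega> k" using k by simp
  finally show ?thesis using flux e0 by (simp add: D_def)
qed

text \<open>An O(1) bound that holds down to radius \<open>s / 2\<close>. The only term that grows
  near \<open>c k\<close> is \<open>\<omega> k * Gc k\<close>, and \<open>Gc k\<close> is at most
  \<open>V + ln (2 / s)\<close> there, so the assumption on \<open>\<omega> k * ln (2 / s)\<close>
  tames it.\<close>

lemma h_bound_near:
  assumes k: "k \<in> {1..m}" and z: "s / 2 < cmod (z - c' k)" "cmod (z - c' k) \<le> \<rho>"
    and \<omega>: "\<And>j. j \<in> {1..m} \<Longrightarrow> 0 \<le> \<omega> j \<and> \<omega> j \<le> 1" "\<omega> k * ln (2 / s) \<le> 1"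
  shows "\<bar>h z\<bar> \<le> \<Gamma> * (1 + real m) + V + 1"
proof -
  have zK: "z \<notin> K" using annulus_K[OF k] z \<rho>(1) by simp
  have zb: "z \<in> cball (c' k) \<rho>" using z by (simp add: dist_norm norm_minus_commute)
  have "\<bar>GE z\<bar> \<le> \<Gamma>" using good k zb by (auto simp: good_def)
  then have 1: "\<bar>G z - GE z\<bar> \<le> \<Gamma>" using G_le_GE[OF zK] by linarith
  have z0: "cmod (z - c' k) > 0" using z s(1) by linarith
  have 2: "\<bar>\<omega> k * Gc k z\<bar> \<le> V + 1"
  proof -
    have "\<bar>Gc k z + ln (cmod (z - c' k))\<bar> \<le> V" using good k zb z0 by (auto simp: good_def)
    moreover have "ln (cmod (z - c' k)) \<le> 0" using z \<rho> z0 by (subst ln_le_zero_iff) auto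
    moreover have "ln (s / 2) \<le> ln (cmod (z - c' k))" using z s(1) z0 by (subst ln_le_cancel_iff) auto
    moreover have "ln (s / 2) = - ln (2 / s)" using s(1) by (simp add: ln_div)
    ultimately have "\<bar>Gc k z\<bar> \<le> V + ln (2 / s)" by linarith
    then have "\<omega> k * \<bar>Gc k z\<bar> \<le> \<omega> k * (V + ln (2 / s))" using \<omega>(1)[OF k] by (intro mult_left_mono) auto
    also have "\<dots> \<le> 1 * V + 1" using \<omega> k \<rho>(3) unfolding distrib_left by (intro add_mono mult_right_mono) auto
    finally show ?thesis using \<omega>(1)[OF k] by (simp add: abs_mult)
  qed
  have 3: "\<bar>\<omega> j * Gc j z\<bar> \<le> \<Gamma>" if j: "j \<in> {1..m} - {k}" for j
  proof -
    have "\<bar>Gc j z\<bar> \<le> \<Gamma>" using good k zb j unfolding good_def by blast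
    then have "\<omega> j * \<bar>Gc j z\<bar> \<le> 1 * \<Gamma>" using \<omega>(1)[of j] j by (intro mult_mono) auto
    then show ?thesis using \<omega>(1)[of j] j by (simp add: abs_mult)
  qed
  have "(\<Sum>j=1..m. \<omega> j * Gc j z) = \<omega> k * Gc k z + (\<Sum>j\<in>{1..m} - {k}. \<omega> j * Gc j z)"
    by (rule sum.remove) (use k in auto)
  moreover have "\<bar>\<Sum>j\<in>{1..m} - {k}. \<omega> j * Gc j z\<bar> \<le> of_nat (card ({1..m} - {k})) * \<Gamma>"
    by (rule order_trans[OF sum_abs sum_bounded_above[OF 3]])
  moreover have "real (card ({1..m} - {k})) * \<Gamma> \<le> real m * \<Gamma>" using \<rho>(4) k by (intro mult_right_mono) auto
  ultimately have "\<bar>h z\<bar> \<le> \<Gamma> + (V + 1) + real m * \<Gamma>" using 1 2 unfolding h_def by linarith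
  then show ?thesis by (simp add: algebra_simps)
qed

text \<open>Zero flux makes \<open>h\<close> the real part of a single-valued function around \<open>I\<^sub>k\<close>.\<close>
lemma h_Re_annulus:
  assumes k: "k \<in> {1..m}"
  obtains F where "F holomorphic_on {z. s / 2 < cmod (z - c' k)} \<inter> {z. cmod (z - c' k) < 2 * \<rho>}"
    "\<And>z. s / 2 < cmod (z - c' k) \<Longrightarrow> cmod (z - c' k) < 2 * \<rho> \<Longrightarrow> Re (F z) = h z" "Im (F (of_real (c k + s))) = 0"
proof -
  let ?A = "{z. s / 2 < cmod (z - c' k)} \<inter> {z. cmod (z - c' k) < 2 * \<rho>}"
  have opA: "open ?A" by (intro open_Int open_Collect_less continuous_intros)
  have AK: "?A \<subseteq> - K" using annulus_K[OF k] by force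
  have n: "cmod (cnj z - c' k) = cmod (z - c' k)" for z
    by (metis complex_cnj_complex_of_real complex_cnj_diff complex_mod_cnj)
  have nr: "cmod (of_real x - c' k) = \<bar>x - c k\<bar>" for x
    by (metis norm_of_real of_real_diff)
  have seg: "complex_of_real ` {a..b} \<subseteq> - K" if "\<And>x. x \<in> {a..b} \<Longrightarrow> s / 2 < \<bar>x - c k\<bar> \<and> \<bar>x - c k\<bar> < 2 * \<rho>" for a b
  proof
    fix z assume "z \<in> complex_of_real ` {a..b}"
    then obtain x where "z = of_real x" "x \<in> {a..b}" by blast
    then have "z \<in> ?A" using that[of x] nr[of x] by simp
    then show "z \<in> - K" using AK by blast
  qed
  have \<tau>: "Im (D x) = Im (D (of_real (c k + s)))" if x: "x \<in> ?A" "Im x = 0" for x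
  proof -
    obtain y where y: "x = of_real y" using x(2) by (metis complex_is_Real_iff Reals_cases)
    have yb: "s / 2 < \<bar>y - c k\<bar>" "\<bar>y - c k\<bar> < 2 * \<rho>" using x(1) nr[of y] by (auto simp: y)
    show ?thesis
    proof (cases "y > c k")
      case True
      have "Im (D (of_real (min y (c k + s)))) = Im (D (of_real (max y (c k + s))))"
        by (rule Im_D_gap[OF _ seg]) (use yb True s(1) s\<rho> in auto)
      then show ?thesis by (cases "y \<le> c k + s") (auto simp: y min_def max_def)
    next
      case False
      have "Im (D (of_real (min y (c k - s)))) = Im (D (of_real (max y (c k - s))))"
        by (rule Im_D_gap[OF _ seg]) (use yb False s(1) s\<rho> in auto)
      then have "Im (D x) = Im (D (of_real (c k - s)))" by (cases "y \<le> c k - s") (auto simp: y min_def max_def)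
      then show ?thesis using Im_D_jump[OF k] by simp
    qed
  qed
  have 1: "harm h ?A" by (rule harm_subset[OF harm_h opA AK])
  have 2: "cnj ` ?A \<subseteq> ?A" using n by auto
  have 3: "h (cnj z) = h z" if "z \<in> ?A" for z using h_cnj AK that by blast
  have 4: "(D \<longlongrightarrow> D x) (at x within {z. Im z > 0})" if "x \<in> ?A" "Im x = 0" for x using D_lim[of x] AK that by blast
  obtain F where F: "F holomorphic_on ?A" "\<And>z. z \<in> ?A \<Longrightarrow> Re (F z) = h z" "\<And>x. x \<in> ?A \<Longrightarrow> Im x = 0 \<Longrightarrow> Im (F x) = 0"
    by (rule log_green_reflect[OF 1 2 3 D_holo Re_D 4 \<tau>]) (assumption+, rule that)
  have "of_real (c k + s) \<in> ?A" using nr[of "c k + s"] s(1) s\<rho> by simp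
  then show ?thesis using that[OF F(1)] F(2,3) by auto
qed

text \<open>The gradient of \<open>h\<close> is at most \<open>32 * M0 / s\<close> on the circle, so
  along the arc from the real point \<open>c k + s\<close>, where \<open>F\<close> is real,
  \<open>F\<close> varies by at most \<open>32 * M0 * pi\<close>. With \<open>pi < 4\<close> this
  gives \<open>129 * M0\<close>.\<close>

lemma F_bound_circle:
  assumes k: "k \<in> {1..m}" and F: "F holomorphic_on {z. s / 2 < cmod (z - c' k)} \<inter> {z. cmod (z - c' k) < 2 * \<rho>}"
    "\<And>z. s / 2 < cmod (z - c' k) \<Longrightarrow> cmod (z - c' k) < 2 * \<rho> \<Longrightarrow> Re (F z) = h z" "Im (F (of_real (c k + s))) = 0"
    and M0: "M0 > 0" "\<And>z. s / 2 < cmod (z - c' k) \<Longrightarrow> cmod (z - c' k) < 3 * s / 2 \<Longrightarrow> \<bar>h z\<bar> \<le> M0"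
    and z: "cmod (z - c' k) = s"
  shows "cmod (F z) \<le> 300 * M0"
proof -
  let ?A = "{z. s / 2 < cmod (z - c' k)} \<inter> {z. cmod (z - c' k) < 2 * \<rho>}"
  have opA: "open ?A" by (intro open_Int open_Collect_less continuous_intros)
  have AK: "?A \<subseteq> - K" using annulus_K[OF k] by force
  have dF: "(F has_field_derivative cgrad h w) (at w)" and bF: "cmod (cgrad h w) \<le> 32 * M0 / s" if w: "cmod (w - c' k) = s" for w
  proof -
    have wA: "w \<in> ?A" using w s(1) s\<rho> by auto
    have "cgrad h w = deriv F w" by (rule cgrad_Re[OF F(1) opA wA]) (use F(2) in auto)
    then show "(F has_field_derivative cgrad h w) (at w)" using holomorphic_derivI[OF F(1) opA wA] by simp
    have b: "s / 2 < cmod (y - c' k) \<and> cmod (y - c' k) < 3 * s / 2" if "y \<in> ball w (s / 2)" for y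
      using that w norm_triangle_ineq[of "y - w" "w - c' k"] norm_triangle_ineq[of "w - y" "y - c' k"]
      by (auto simp: dist_norm norm_minus_commute)
    have "cmod (cgrad h w) \<le> 16 * M0 / (s / 2)"
    proof (rule cgrad_bound[OF harm_subset[OF harm_h open_ball]])
      show "ball w (s / 2) \<subseteq> - K" using b AK s\<rho> s(1) by fastforce
    qed (use b M0 s(1) in auto)
    then show "cmod (cgrad h w) \<le> 32 * M0 / s" by simp
  qed
  define p where "p = (\<lambda>t. c' k + of_real s * cis t)"
  have p: "cmod (p t - c' k) = s" for t using s(1) by (simp add: p_def norm_mult)
  have dp: "((\<lambda>t. F (p t)) has_vector_derivative (\<i> * of_real s * cis t * cgrad h (p t))) (at t)" for t
  proof -
    have "(p has_vector_derivative (\<i> * of_real s * cis t)) (at t)"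
      unfolding p_def cis_conv_exp
      by (rule has_vector_derivative_real_field) (auto intro!: derivative_eq_intros simp: algebra_simps)
    from field_vector_diff_chain_at[OF this dF[OF p]] show ?thesis by (simp add: o_def)
  qed
  have bd: "cmod (F (p t) - F (p 0)) \<le> 32 * M0 * \<bar>t\<bar>" for t
  proof -
    have "norm (F (p t) - F (p 0)) \<le> 32 * M0 * norm (t - 0)"
    proof (rule differentiable_bound[of UNIV])
      show "((\<lambda>t. F (p t)) has_derivative (\<lambda>h'. h' *\<^sub>R (\<i> * of_real s * cis t * cgrad h (p t)))) (at t within UNIV)" for t
        using dp[of t] by (simp add: has_vector_derivative_def)
      show "onorm (\<lambda>h'. h' *\<^sub>R (\<i> * of_real s * cis t * cgrad h (p t))) \<le> 32 * M0" for t
      proof (rule onorm_le)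
        fix x :: real
        have "norm (x *\<^sub>R (\<i> * of_real s * cis t * cgrad h (p t))) = \<bar>x\<bar> * (s * cmod (cgrad h (p t)))"
          using s(1) by (simp add: norm_mult)
        also have "\<dots> \<le> \<bar>x\<bar> * (s * (32 * M0 / s))" using bF[OF p[of t]] s(1) by (intro mult_left_mono) auto
        also have "\<dots> = 32 * M0 * norm x" using s(1) by simp
        finally show "norm (x *\<^sub>R (\<i> * of_real s * cis t * cgrad h (p t))) \<le> 32 * M0 * norm x" .
      qed
    qed auto
    then show ?thesis by simp
  qed
  define t where "t = Arg (z - c' k)"
  have "z = p t"
  proof -
    have "z - c' k = of_real (cmod (z - c' k)) * cis (Arg (z - c' k))" by (metis rcis_cmod_Arg rcis_def)
    then show ?thesis using z by (simp add: p_def t_def algebra_simps)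
  qed
  moreover have "\<bar>t\<bar> \<le> pi" using Arg_bounded[of "z - c' k"] by (auto simp: t_def abs_le_iff)
  moreover have "p 0 = of_real (c k + s)" by (simp add: p_def)
  moreover have "cmod (F (of_real (c k + s))) \<le> M0"
  proof -
    have n: "cmod (of_real (c k + s) - c' k) = s" using s(1) by simp
    have "F (of_real (c k + s)) = of_real (h (of_real (c k + s)))"
      using F(2)[of "of_real (c k + s)"] F(3) n s(1) s\<rho> by (simp add: complex_eq_iff)
    then show ?thesis using M0(2)[of "of_real (c k + s)"] n s(1) by simp
  qed
  ultimately have "cmod (F z) \<le> 32 * M0 * \<bar>t\<bar> + M0"
    using bd[of t] norm_triangle_ineq[of "F (p t) - F (p 0)" "F (p 0)"] by simp
  also have "32 * M0 * \<bar>t\<bar> \<le> 32 * M0 * 4" using \<open>\<bar>t\<bar> \<le> pi\<close> M0(1) pi_less_4 by (intro mult_left_mono) linarith+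
  finally show ?thesis using M0(1) by simp
qed

text \<open>Let \<open>M\<close> be the maximum of \<open>|h|\<close> on the circles of radius
  \<open>r0\<close>. The third condition on \<open>r0\<close> makes \<open>Gsum >= 2 * Sm\<close>
  there, so \<open>|h| <= M / 2\<close> on the circle of radius \<rho>. Returning to
  \<open>r0\<close> by \<open>annulus_Re_bound\<close> gives
  \<open>M <= M / 2 + 1200 * s * M0 / r0\<close>, and the first term is absorbed.\<close>

lemma h_bound:
  assumes r0: "0 < r0" "2 * r0 \<le> \<rho>" "2 * Sm \<le> - V - ln r0" "2 * s \<le> r0"
    and \<omega>: "\<And>j. j \<in> {1..m} \<Longrightarrow> 0 \<le> \<omega> j \<and> \<omega> j \<le> 1" "\<And>k. k \<in> {1..m} \<Longrightarrow> \<omega> k * ln (2 / s) \<le> 1"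
    and z: "z \<notin> E" "\<And>k. k \<in> {1..m} \<Longrightarrow> r0 < cmod (z - c' k)"
  shows "\<bar>h z\<bar> \<le> 2400 * (\<Gamma> * (1 + real m) + V + 1) / r0 * s"
proof -
  define Sph where "Sph = (\<Union>k\<in>{1..m}. sphere (c' k) r0)"
  define S where "S = - E - (\<Union>k\<in>{1..m}. cball (c' k) r0)"
  have opS: "open S" unfolding S_def using E_closed by (intro open_Diff open_Compl closed_UN) auto
  have SK: "S \<subseteq> - K" using K_cases r0 s(1) by (fastforce simp: S_def dist_norm norm_minus_commute)
  have SphK: "x \<notin> K" if "k \<in> {1..m}" "cmod (x - c' k) = r0" for x k
    by (rule annulus_K[OF that(1)]) (use that r0 s(1) \<rho> in auto)
  have "compact Sph" unfolding Sph_def by (intro compact_UN) auto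
  moreover have "Sph \<noteq> {}"
  proof -
    have "c' 1 + of_real r0 \<in> sphere (c' 1) r0" using r0 by (simp add: dist_norm)
    moreover have "1 \<in> {1..m}" using m by simp
    ultimately show ?thesis unfolding Sph_def by blast
  qed
  moreover have "continuous_on Sph (\<lambda>z. \<bar>h z\<bar>)"
    using SphK by (intro continuous_intros continuous_on_subset[OF harm_continuous_on[OF harm_h]]) (auto simp: Sph_def dist_norm norm_minus_commute)
  ultimately obtain x0 where x0: "x0 \<in> Sph" "\<And>z. z \<in> Sph \<Longrightarrow> \<bar>h z\<bar> \<le> \<bar>h x0\<bar>"
    using continuous_attains_sup[of Sph "\<lambda>z. \<bar>h z\<bar>"] by blast
  define M where "M = \<bar>h x0\<bar>"
  have M: "M \<ge> 0" by (simp add: M_def)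
  have sph_S: "2 * Sm \<le> Gsum x" if k: "k \<in> {1..m}" "cmod (x - c' k) = r0" for x k
  proof -
    have xK: "x \<notin> K" by (rule SphK[OF k])
    then have nn: "0 \<le> Gc j x" if "j \<in> {1..m}" for j using Gc_nonneg[OF that] E_K c_K[OF that] by blast
    have "x \<in> cball (c' k) \<rho> - {c' k}" using k r0 \<rho> by (auto simp: dist_norm norm_minus_commute)
    then have "\<bar>Gc k x + ln (cmod (x - c' k))\<bar> \<le> V" using good k(1) by (auto simp: good_def)
    then have "- V \<le> Gc k x + ln r0" unfolding k(2) abs_le_iff by linarith
    then have "2 * Sm \<le> Gc k x" using r0(3) by linarith
    also have "\<dots> \<le> Gsum x" unfolding Gsum_def using nn k(1) by (intro member_le_sum) auto
    finally show ?thesis .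
  qed
  have fr: "x \<in> E \<or> (\<exists>k\<in>{1..m}. cmod (x - c' k) = r0)" if x: "x \<in> frontier S" for x
  proof -
    have cl: "closed (\<Inter>k\<in>{1..m}. - ball (c' k) r0)" by (intro closed_INT) auto
    have "S \<subseteq> (\<Inter>k\<in>{1..m}. - ball (c' k) r0)" by (auto simp: S_def)
    from frontier_open_subset[OF opS this cl x] show ?thesis
      by (force simp: S_def dist_norm norm_minus_commute)
  qed
  obtain e where e: "e \<in> E" using E_ne by blast
  have eS: "e \<notin> S" using e by (simp add: S_def)
  have bS: "bounded (- S)"
  proof -
    have "- S = E \<union> (\<Union>k\<in>{1..m}. cball (c' k) r0)" by (auto simp: S_def)
    then show ?thesis using compact_imp_bounded[OF E_compact] by (auto intro!: bounded_UN)
  qed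
  have hS: "harm h S" by (rule harm_subset[OF harm_h opS SK])
  have SS: "harm Gsum S" unfolding Gsum_def
  proof (intro harm_sum opS)
    show "harm (Gc k) S" if "k \<in> {1..m}" for k
      by (rule harm_subset[OF harm_Gc[OF that] opS]) (use that r0 in \<open>auto simp: S_def\<close>)
  qed
  have hlim: "(h \<longlongrightarrow> 0) (at x within S)" if "x \<in> E" for x
    using h_lim[OF that] SK tendsto_within_subset by blast
  have Slim: "(Gsum \<longlongrightarrow> 0) (at x within S)" if "x \<in> E" for x
  proof -
    have "((\<lambda>z. \<Sum>k=1..m. Gc k z) \<longlongrightarrow> (\<Sum>k=1..m. 0)) (at x within S)"
      by (intro tendsto_sum tendsto_within_subset[OF Gc_lim[OF _ that]]) (auto simp: S_def)
    then show ?thesis by (simp add: Gsum_def[abs_def])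
  qed
  \<comment> \<open>One comparison for two uses: \<open>a = 0\<close>, \<open>b = M\<close> bounds
    \<open>|h|\<close> by \<open>M\<close> on all of \<open>S\<close>, and
    \<open>a = M / (2 * Sm)\<close>, \<open>b = 0\<close> gives the decay away from the
    poles.\<close>
  have main: "\<sigma> * h z - (a * Gsum z + b) \<le> 0"
    if z: "z \<in> S" and sg: "\<bar>\<sigma>\<bar> = 1" and ab: "b \<ge> 0" "\<And>x k. k \<in> {1..m} \<Longrightarrow> cmod (x - c' k) = r0 \<Longrightarrow> M \<le> a * Gsum x + b" for z a b \<sigma> :: "_"
  proof (rule max_principle_sphere[where u = "\<lambda>z. \<sigma> * h z - (a * Gsum z + b)", OF _ eS bS _ _ z])
    show "harm (\<lambda>z. \<sigma> * h z - (a * Gsum z + b)) S" by (intro harm_diff harm_add harm_cmult harm_const hS SS opS)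
    show "harm_at_inf (\<lambda>z. \<sigma> * h z - (a * Gsum z + b))"
      unfolding Gsum_def by (intro harm_at_inf_diff harm_at_inf_add harm_at_inf_cmult harm_at_inf_const harm_at_inf_sum h_at_inf Gc_at_inf)
    fix x and \<epsilon> :: real assume x: "x \<in> frontier S" and \<epsilon>: "\<epsilon> > 0"
    from fr[OF x] show "\<forall>\<^sub>F z in at x within S. \<sigma> * h z - (a * Gsum z + b) < \<epsilon>"
    proof
      assume xE: "x \<in> E"
      have 1: "((\<lambda>z. \<sigma> * h z) \<longlongrightarrow> \<sigma> * 0) (at x within S)" by (intro tendsto_intros hlim xE)
      have 2: "((\<lambda>z. a * Gsum z + b) \<longlongrightarrow> a * 0 + b) (at x within S)" by (intro tendsto_intros Slim xE)
      show ?thesis by (rule eventually_diff_less[OF 1 2 _ \<epsilon>]) (use ab in simp)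
    next
      assume "\<exists>k\<in>{1..m}. cmod (x - c' k) = r0"
      then obtain k where k: "k \<in> {1..m}" "cmod (x - c' k) = r0" by blast
      have xK: "x \<notin> K" by (rule SphK[OF k])
      have 1: "((\<lambda>z. \<sigma> * h z) \<longlongrightarrow> \<sigma> * h x) (at x within S)"
        by (intro tendsto_intros harm_tendsto[OF harm_h]) (use xK in auto)
      have "((\<lambda>z. \<Sum>k=1..m. Gc k z) \<longlongrightarrow> (\<Sum>k=1..m. Gc k x)) (at x within S)"
      proof (intro tendsto_sum)
        fix j assume j: "j \<in> {1..m}"
        show "(Gc j \<longlongrightarrow> Gc j x) (at x within S)"
          by (rule harm_tendsto[OF harm_Gc[OF j]]) (use xK E_K c_K[OF j] in auto)
      qed
      then have "(Gsum \<longlongrightarrow> Gsum x) (at x within S)" by (simp add: Gsum_def[abs_def])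
      then have 2: "((\<lambda>z. a * Gsum z + b) \<longlongrightarrow> a * Gsum x + b) (at x within S)" by (intro tendsto_intros)
      have "x \<in> Sph" using k by (auto simp: Sph_def dist_norm norm_minus_commute)
      then have "\<bar>h x\<bar> \<le> M" using x0(2) by (simp add: M_def)
      then have "\<sigma> * h x \<le> a * Gsum x + b" using ab(2)[OF k] sg by (auto simp: abs_if split: if_splits)
      then show ?thesis by (rule eventually_diff_less[OF 1 2 _ \<epsilon>])
    qed
  qed
  have bdM: "\<bar>h z\<bar> \<le> M" if "z \<in> S" for z
    using main[OF that, of 1 M 0] main[OF that, of "-1" M 0] M by auto
  have bdG: "\<bar>h z\<bar> \<le> M / (2 * Sm) * Gsum z" if "z \<in> S" for z
  proof -
    have *: "M \<le> M / (2 * Sm) * Gsum x + 0" if "k \<in> {1..m}" "cmod (x - c' k) = r0" for x k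
    proof -
      have "M / (2 * Sm) * (2 * Sm) \<le> M / (2 * Sm) * Gsum x"
        using sph_S[OF that] M \<rho>(5) by (intro mult_left_mono) auto
      then show ?thesis using \<rho>(5) by simp
    qed
    have "\<sigma> * h z - (M / (2 * Sm) * Gsum z + 0) \<le> 0" if "\<bar>\<sigma>\<bar> = 1" for \<sigma>
      by (rule main[OF \<open>z \<in> S\<close> that]) (use * in auto)
    from this[of 1] this[of "-1"] show ?thesis by auto
  qed
  define M0 where "M0 = \<Gamma> * (1 + real m) + V + 1"
  have M0: "M0 > 0" using \<rho> by (simp add: M0_def add_pos_pos)
  obtain k where k: "k \<in> {1..m}" "cmod (x0 - c' k) = r0" using x0(1) by (auto simp: Sph_def dist_norm norm_minus_commute)
  obtain F where F: "F holomorphic_on {z. s / 2 < cmod (z - c' k)} \<inter> {z. cmod (z - c' k) < 2 * \<rho>}"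
    "\<And>z. s / 2 < cmod (z - c' k) \<Longrightarrow> cmod (z - c' k) < 2 * \<rho> \<Longrightarrow> Re (F z) = h z" "Im (F (of_real (c k + s))) = 0"
    by (rule h_Re_annulus[OF k(1)]) (rule that)
  have "\<bar>Re (F x0)\<bar> \<le> M / 2 + 4 * s * (300 * M0) / r0"
  proof (rule annulus_Re_bound[OF F(1), of s r0 \<rho>])
    show "cmod (F z) \<le> 300 * M0" if "cmod (z - c' k) = s" for z
    proof (rule F_bound_circle[OF k(1) F M0 _ that])
      show "\<bar>h z\<bar> \<le> M0" if "s / 2 < cmod (z - c' k)" "cmod (z - c' k) < 3 * s / 2" for z
        unfolding M0_def by (rule h_bound_near[OF k(1) that(1) _ \<omega>(1) \<omega>(2)[OF k(1)]]) (use that(2) r0 s(1) in auto)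
    qed
    show "\<bar>Re (F z)\<bar> \<le> M / 2" if z: "cmod (z - c' k) = \<rho>" for z
    proof -
      have zS: "z \<in> S"
      proof -
        have "z \<notin> E" using good_E[OF k(1), of z] z \<rho>(1) by simp
        moreover have "z \<notin> cball (c' j) r0" if j: "j \<in> {1..m}" for j
        proof (cases "j = k")
          case True
          then show ?thesis using z r0 by (simp add: dist_norm norm_minus_commute)
        next
          case False
          then have "4 * \<rho> < \<bar>c j - c k\<bar>" using good_sep j k by blast
          moreover have "c' j - c' k = (z - c' k) - (z - c' j)" by simp
          then have "cmod (c' j - c' k) \<le> cmod (z - c' k) + cmod (z - c' j)" by (metis norm_triangle_ineq4)
          then have "\<bar>c j - c k\<bar> \<le> cmod (z - c' k) + cmod (z - c' j)" by (metis norm_of_real of_real_diff)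
          ultimately show ?thesis using z r0 by (simp add: dist_norm norm_minus_commute)
        qed
        ultimately show ?thesis by (auto simp: S_def)
      qed
      have "Gsum z \<le> Sm" using good k(1) z by (auto simp: good_def)
      then have "M / (2 * Sm) * Gsum z \<le> M / (2 * Sm) * Sm" using M \<rho>(5) by (intro mult_left_mono) auto
      also have "\<dots> = M / 2" using \<rho>(5) by simp
      finally show ?thesis using bdG[OF zS] F(2)[of z] z \<rho>(1) s(1) s\<rho> by simp
    qed
  qed (use s(1) s\<rho> r0 \<rho> k in auto)
  moreover have "Re (F x0) = h x0" by (rule F(2)) (use k r0 s(1) \<rho> in auto)
  ultimately have "M \<le> M / 2 + 4 * s * (300 * M0) / r0" by (simp add: M_def)
  then have "M \<le> 2 * (4 * s * (300 * M0) / r0)" by linarith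
  also have "\<dots> = 2400 * M0 / r0 * s" by simp
  finally have "M \<le> 2400 * M0 / r0 * s" .
  moreover have "z \<in> S" using z by (auto simp: S_def dist_norm norm_minus_commute) (use not_le in blast)
  ultimately show ?thesis using bdM[of z] unfolding M0_def by linarith
qed

end

end

section \<open>Integration of the gradient of \<open>h\<close> from the endpoint of
  \<open>E\<close>\<close>

context perturbed_green
begin

lemma cgrad_h_far:
  assumes A: "A > 0" and bd: "\<And>z. z \<notin> E \<Longrightarrow> (\<And>k. k \<in> {1..m} \<Longrightarrow> r0 < cmod (z - c' k)) \<Longrightarrow> \<bar>h z\<bar> \<le> A"
    and d: "d > 0" "2 * r0 \<le> d" "s \<le> r0"
    and z: "\<And>e. e \<in> E \<Longrightarrow> d \<le> cmod (z - e)" "\<And>k. k \<in> {1..m} \<Longrightarrow> d \<le> cmod (z - c' k)"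
  shows "cmod (cgrad h z) \<le> 32 * A / d"
proof -
  have far: "w \<notin> E" "\<And>k. k \<in> {1..m} \<Longrightarrow> r0 < cmod (w - c' k)" if w: "w \<in> ball z (d / 2)" for w
  proof -
    have wz: "cmod (z - w) < d / 2" using w by (simp add: dist_norm)
    have tri: "cmod (z - x) \<le> cmod (z - w) + cmod (w - x)" for x
      using norm_triangle_ineq[of "z - w" "w - x"] by simp
    show "w \<notin> E" using z(1)[of w] wz d(1) by force
    show "r0 < cmod (w - c' k)" if "k \<in> {1..m}" for k using z(2)[OF that] tri[of "c' k"] wz d(2) by linarith
  qed
  have "ball z (d / 2) \<subseteq> - K"
  proof
    fix w assume w: "w \<in> ball z (d / 2)"
    show "w \<in> - K"
    proof
      assume "w \<in> K"
      then consider "w \<in> E" | k where "k \<in> {1..m}" "cmod (w - c' k) < s / 2" using K_cases by blast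
      then show False using far[OF w] d(3) s(1) by cases force+
    qed
  qed
  then have "cmod (cgrad h z) \<le> 16 * A / (d / 2)"
    by (intro cgrad_bound[OF harm_subset[OF harm_h open_ball]] bd far A) (use d(1) in auto)
  then show ?thesis by simp
qed

text \<open>The ellipse parameter \<open>R\<close> depends on \<open>E\<close> and on the discs of
  radius \<rho> alone, so the bound is \<open>A\<close> times a quantity that does not see the added
  slits.\<close>

lemma cgrad_h_near_slit:
  assumes A: "A > 0" and bd: "\<And>z. z \<notin> E \<Longrightarrow> (\<And>k. k \<in> {1..m} \<Longrightarrow> r0 < cmod (z - c' k)) \<Longrightarrow> \<bar>h z\<bar> \<le> A"
    and pa: "(p, a) \<in> P" and R: "R > 1"
    and av: "\<And>z. z \<in> (E - complex_of_real ` {p..a}) \<union> (\<Union>k\<in>{1..m}. cball (c' k) \<rho>) \<Longrightarrow>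
        (a - p) / 2 * (R + 1 / R) \<le> cmod (z - of_real p) + cmod (z - of_real a)"
    and r: "r0 \<le> \<rho>" "s \<le> \<rho>"
    and z: "z \<notin> complex_of_real ` {p..a}" "cmod (z - of_real p) + cmod (z - of_real a) < (a - p) / 2 * ((1 + R) / 2 + 1 / ((1 + R) / 2))"
  shows "cmod (cgrad h z) * sqrt (cmod (z - of_real p) * cmod (z - of_real a)) \<le> 32 * A * R / ln R"
proof -
  let ?J = "complex_of_real ` {p..a}"
  define N where "N = {z. cmod (z - of_real p) + cmod (z - of_real a) < (a - p) / 2 * (R + 1 / R)}"
  have opN: "open N" unfolding N_def by (intro open_Collect_less continuous_intros)
  have clJ: "closed ?J" by (intro compact_imp_closed compact_continuous_image continuous_intros) auto
  have pq: "p < a" using P pa by (auto simp: slit_system_def)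
  have JE: "?J \<subseteq> E" using pa by (auto simp: slits_def)
  have N1: "w \<notin> E" "\<And>k. k \<in> {1..m} \<Longrightarrow> \<rho> < cmod (w - c' k)" if w: "w \<in> N - ?J" for w
  proof -
    have nav: "w \<notin> (E - ?J) \<union> (\<Union>k\<in>{1..m}. cball (c' k) \<rho>)" using av[of w] w by (auto simp: N_def)
    then show "w \<notin> E" using w by blast
    show "\<rho> < cmod (w - c' k)" if "k \<in> {1..m}" for k
      using nav that by (auto simp: dist_norm norm_minus_commute not_le)
  qed
  have NK: "N - ?J \<subseteq> - K"
  proof
    fix w assume w: "w \<in> N - ?J"
    show "w \<in> - K"
    proof
      assume "w \<in> K"
      then consider "w \<in> E" | k where "k \<in> {1..m}" "cmod (w - c' k) < s / 2" using K_cases by blast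
      then show False using N1[OF w] r(2) s(1) by cases force+
    qed
  qed
  have JN: "?J \<subseteq> N"
  proof
    fix w assume w: "w \<in> ?J"
    have "a - p = (a - p) / 2 * 2" by simp
    also have "\<dots> < (a - p) / 2 * (R + 1 / R)"
      using plus_inverse_strict_mono[of 1 R] R pq by (intro mult_strict_left_mono) auto
    finally show "w \<in> N" unfolding N_def mem_Collect_eq dist_sum_on_segment[OF w] .
  qed
  show ?thesis
  proof (rule slit_cgrad_bound[OF pq R A])
    show "harm h ({z. cmod (z - of_real p) + cmod (z - of_real a) < (a - p) / 2 * (R + 1 / R)} - ?J)"
      using NK opN clJ unfolding N_def[symmetric] by (intro harm_subset[OF harm_h] open_Diff) auto
    show "\<bar>h w\<bar> \<le> A" if "w \<in> {z. cmod (z - of_real p) + cmod (z - of_real a) < (a - p) / 2 * (R + 1 / R)} - ?J" for w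
      using bd[of w] N1[of w] that r(1) unfolding N_def[symmetric] by force
    show "(h \<longlongrightarrow> 0) (at x within - ?J)" if x: "x \<in> ?J" for x
    proof -
      have "(h \<longlongrightarrow> 0) (at x within - K)" using h_lim x JE by blast
      moreover have "at x within - K = at x within - ?J"
      proof (rule at_within_nhd[of x N])
        show "x \<in> N" using JN x by blast
        show "- K \<inter> N - {x} = - ?J \<inter> N - {x}" using NK JE E_K by blast
      qed (rule opN)
      ultimately show ?thesis by simp
    qed
    show "z \<in> {z. cmod (z - of_real p) + cmod (z - of_real a) < (a - p) / 2 * ((1 + R) / 2 + 1 / ((1 + R) / 2))} - ?J"
      using z by simp
  qed
qed

lemma D_deriv: assumes "Im z > 0" shows "(D has_field_derivative cgrad h z) (at z)"
proof -
  have z: "z \<in> {z. Im z > 0}" using assms by simp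
  have "cgrad h z = deriv D z" by (rule cgrad_Re[OF D_holo convex_upper_half(2) z]) (simp add: Re_D)
  then show ?thesis using holomorphic_derivI[OF D_holo convex_upper_half(2) z] by simp
qed

text \<open>Close to the endpoint \<open>a\<close> the gradient of \<open>h\<close> is \<open>O(1 / sqrt y)\<close>, which is integrable.\<close>
lemma D_bound_near_endpoint:
  assumes A: "A > 0" and bd: "\<And>z. z \<notin> E \<Longrightarrow> (\<And>k. k \<in> {1..m} \<Longrightarrow> r0 < cmod (z - c' k)) \<Longrightarrow> \<bar>h z\<bar> \<le> A"
    and pa: "(p, a) \<in> P" and R: "R > 1"
    and av: "\<And>z. z \<in> (E - complex_of_real ` {p..a}) \<union> (\<Union>k\<in>{1..m}. cball (c' k) \<rho>) \<Longrightarrow>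
        (a - p) / 2 * (R + 1 / R) \<le> cmod (z - of_real p) + cmod (z - of_real a)"
    and r: "r0 \<le> \<rho>" "s \<le> \<rho>"
    and y0: "y0 > 0" "a - p + 2 * y0 < (a - p) / 2 * ((1 + R) / 2 + 1 / ((1 + R) / 2))"
    and lim: "(D \<longlongrightarrow> 0) (at (of_real a) within {z. Im z > 0})"
  shows "cmod (D (of_real a + \<i> * of_real y0)) \<le> 64 * R / (ln R * sqrt (a - p)) * sqrt y0 * A"
proof -
  have pq: "p < a" using P pa by (auto simp: slit_system_def)
  have lnR: "ln R > 0" using R by simp
  define Q where "Q = 32 * A * R / (ln R * sqrt (a - p))"
  have Q: "Q \<ge> 0" using A R lnR pq by (simp add: Q_def)
  have gb: "cmod (cgrad h (of_real a + \<i> * of_real y)) \<le> Q / sqrt y" if y: "0 < y" "y \<le> y0" for y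
  proof -
    let ?z = "of_real a + \<i> * of_real y"
    have za: "cmod (?z - of_real a) = y" using y by (simp add: norm_mult)
    have e: "?z - of_real p = of_real (a - p) + \<i> * of_real y" by simp
    have zp: "cmod (?z - of_real p) \<le> a - p + y"
      unfolding e using norm_triangle_ineq[of "of_real (a - p)" "\<i> * of_real y"] pq y by (simp add: norm_mult del: of_real_diff)
    have zp2: "a - p \<le> cmod (?z - of_real p)" using abs_Re_le_cmod[of "?z - of_real p"] pq by simp
    have "cmod (cgrad h ?z) * sqrt (cmod (?z - of_real p) * cmod (?z - of_real a)) \<le> 32 * A * R / ln R"
    proof (rule cgrad_h_near_slit[OF A bd pa R av r])
      show "?z \<notin> complex_of_real ` {p..a}" using y by (auto simp: complex_eq_iff)
      show "cmod (?z - of_real p) + cmod (?z - of_real a) < (a - p) / 2 * ((1 + R) / 2 + 1 / ((1 + R) / 2))"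
        using zp za y y0(2) by linarith
    qed
    moreover have "sqrt ((a - p) * y) \<le> sqrt (cmod (?z - of_real p) * cmod (?z - of_real a))"
      unfolding za using zp2 y pq by (intro real_sqrt_le_mono mult_right_mono) auto
    then have "cmod (cgrad h ?z) * sqrt ((a - p) * y) \<le> cmod (cgrad h ?z) * sqrt (cmod (?z - of_real p) * cmod (?z - of_real a))"
      by (rule mult_left_mono) simp
    ultimately have "cmod (cgrad h ?z) * sqrt ((a - p) * y) \<le> 32 * A * R / ln R" by linarith
    then have "cmod (cgrad h ?z) * (sqrt (a - p) * sqrt y) \<le> 32 * A * R / ln R" by (simp only: real_sqrt_mult)
    then have "cmod (cgrad h ?z) \<le> 32 * A * R / ln R / (sqrt (a - p) * sqrt y)"
      using y pq by (subst pos_le_divide_eq) auto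
    then show ?thesis by (simp add: Q_def field_simps)
  qed
  \<comment> \<open>\<open>2 * Q * sqrt t\<close> is a primitive of the majorant
    \<open>Q / sqrt t\<close> of the derivative. Letting \<open>y\<close> tend to 0 along the
    vertical line, where \<open>D\<close> tends to 0, gives the bound on \<open>D\<close>
    itself.\<close>
  have step: "cmod (D (of_real a + \<i> * of_real y0) - D (of_real a + \<i> * of_real y)) \<le> 2 * Q * sqrt y0 - 2 * Q * sqrt y" if y: "0 < y" "y < y0" for y
  proof (rule differentiable_bound_general[OF y(2), where f = "\<lambda>t. D (of_real a + \<i> * of_real t)" and \<phi> = "\<lambda>t. 2 * Q * sqrt t"
      and f' = "\<lambda>t. \<i> * cgrad h (of_real a + \<i> * of_real t)" and \<phi>' = "\<lambda>t. Q / sqrt t"])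
    have dd: "((\<lambda>t. D (of_real a + \<i> * of_real t)) has_vector_derivative \<i> * cgrad h (of_real a + \<i> * of_real t)) (at t)" if "t > 0" for t
    proof -
      have "((\<lambda>t. of_real a + \<i> * of_real t) has_vector_derivative \<i>) (at t)"
        by (auto intro!: derivative_eq_intros simp: has_vector_derivative_def scaleR_conv_of_real mult.commute)
      from field_vector_diff_chain_at[OF this D_deriv] that show ?thesis by (simp add: o_def)
    qed
    show "continuous_on {y..y0} (\<lambda>t. D (of_real a + \<i> * of_real t))"
      by (intro continuous_at_imp_continuous_on ballI has_vector_derivative_continuous[OF dd]) (use y in auto)
    show "continuous_on {y..y0} (\<lambda>t. 2 * Q * sqrt t)" by (intro continuous_intros)
    show "((\<lambda>t. D (of_real a + \<i> * of_real t)) has_vector_derivative \<i> * cgrad h (of_real a + \<i> * of_real t)) (at t)" if "y < t" "t < y0" for t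
      using dd that y by simp
    show "((\<lambda>t. 2 * Q * sqrt t) has_vector_derivative Q / sqrt t) (at t)" if "y < t" "t < y0" for t
      unfolding has_real_derivative_iff_has_vector_derivative[symmetric]
      using that y by (auto intro!: derivative_eq_intros simp: field_simps)
    show "norm (\<i> * cgrad h (of_real a + \<i> * of_real t)) \<le> Q / sqrt t" if "y < t" "t < y0" for t
      using gb[of t] that y by (simp add: norm_mult)
  qed
  have "(\<lambda>n. D (\<i> * of_real (1 / real (Suc n)) + complex_of_real a)) \<longlonglongrightarrow> 0"
    by (rule filterlim_compose[OF lim filterlim_vertical])
  then have "(\<lambda>n. cmod (D (of_real a + \<i> * of_real y0) - D (\<i> * of_real (1 / real (Suc n)) + complex_of_real a))) \<longlonglongrightarrow> cmod (D (of_real a + \<i> * of_real y0) - 0)"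
    by (intro tendsto_intros)
  moreover have "\<forall>\<^sub>F n in sequentially. cmod (D (of_real a + \<i> * of_real y0) - D (\<i> * of_real (1 / real (Suc n)) + complex_of_real a)) \<le> 2 * Q * sqrt y0"
  proof -
    have "\<forall>\<^sub>F n in sequentially. 1 / real (Suc n) < y0"
      using order_tendstoD(2)[OF LIMSEQ_Suc[OF lim_1_over_n] y0(1)] by simp
    then show ?thesis
    proof eventually_elim
      case (elim n)
      have "2 * Q * sqrt (1 / real (Suc n)) \<ge> 0" using Q by simp
      then show ?case using step[of "1 / real (Suc n)"] elim by (simp add: add.commute)
    qed
  qed
  ultimately have "cmod (D (of_real a + \<i> * of_real y0) - 0) \<le> 2 * Q * sqrt y0"
    by (intro tendsto_upperbound[where F = sequentially]) auto
  then show ?thesis by (simp add: Q_def mult.commute mult.left_commute)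
qed

text \<open>\<open>D\<close> is integrated along a path from the endpoint: up to height
  \<open>y0\<close>, up to \<open>Y + 1\<close>, horizontally to the abscissa of \<open>z\<close>,
  and down to a point just above \<open>z\<close>. After the first piece the path keeps distance
  \<open>d\<close> from \<open>E\<close> and the poles, where \<open>cgrad_h_far\<close> applies.
  The lengths \<open>Y + 1\<close>, \<open>|a| + Y\<close> and \<open>2 * Y + 1\<close> add up to
  \<open>4 * Y + |a| + 2\<close>.\<close>

lemma D_bound:
  assumes A: "A > 0" and bd: "\<And>z. z \<notin> E \<Longrightarrow> (\<And>k. k \<in> {1..m} \<Longrightarrow> r0 < cmod (z - c' k)) \<Longrightarrow> \<bar>h z\<bar> \<le> A"
    and pa: "(p, a) \<in> P" and R: "R > 1"
    and av: "\<And>z. z \<in> (E - complex_of_real ` {p..a}) \<union> (\<Union>k\<in>{1..m}. cball (c' k) \<rho>) \<Longrightarrow>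
        (a - p) / 2 * (R + 1 / R) \<le> cmod (z - of_real p) + cmod (z - of_real a)"
    and r: "r0 \<le> \<rho>" "s \<le> \<rho>"
    and y0: "y0 > 0" "a - p + 2 * y0 < (a - p) / 2 * ((1 + R) / 2 + 1 / ((1 + R) / 2))"
    and lim: "(D \<longlongrightarrow> 0) (at (of_real a) within {z. Im z > 0})"
    and d: "d > 0" "d \<le> y0" "2 * r0 \<le> d" "s \<le> r0" and Y: "y0 \<le> Y"
    and z: "\<And>e. e \<in> E \<Longrightarrow> d \<le> cmod (z - e)" "\<And>k. k \<in> {1..m} \<Longrightarrow> d \<le> cmod (z - c' k)" "0 \<le> Im z" "cmod z \<le> Y"
  shows "cmod (D z) \<le> (64 * R / (ln R * sqrt (a - p)) * sqrt y0 + 32 / d * (4 * Y + \<bar>a\<bar> + 2)) * A"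
proof -
  have seg: "cmod (D u - D v) \<le> 32 * A / d * cmod (u - v)"
    if uv: "closed_segment u v \<subseteq> {z. Im z > 0}"
      "\<And>w e. w \<in> closed_segment u v \<Longrightarrow> Im e = 0 \<Longrightarrow> e \<in> E \<or> e \<in> c' ` {1..m} \<Longrightarrow> d \<le> cmod (w - e)" for u v
  proof (rule field_differentiable_bound[of "closed_segment v u" D "cgrad h"])
    show "(D has_field_derivative cgrad h w) (at w within closed_segment v u)" if "w \<in> closed_segment v u" for w
      using D_deriv[of w] uv(1) that by (auto simp: closed_segment_commute intro: has_field_derivative_at_within)
    show "cmod (cgrad h w) \<le> 32 * A / d" if "w \<in> closed_segment v u" for w
    proof (rule cgrad_h_far[OF A bd d(1,3,4)])
      have w: "w \<in> closed_segment u v" using that by (simp add: closed_segment_commute)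
      show "d \<le> cmod (w - e)" if "e \<in> E" for e
        using uv(2)[OF w, of e] that E_real by (auto simp: complex_is_Real_iff)
      show "d \<le> cmod (w - c' k)" if "k \<in> {1..m}" for k
        using uv(2)[OF w, of "c' k"] that by auto
    qed
  qed auto
  have im: "\<bar>Im w\<bar> \<le> cmod (w - e)" if "Im e = 0" for w e
    using abs_Im_le_cmod[of "w - e"] that by simp
  have Ymx: "Y > 0" using y0 Y by simp
  let ?z1 = "of_real a + \<i> * of_real y0"
  let ?z2 = "of_real a + \<i> * of_real (Y + 1)"
  let ?z3 = "of_real (Re z) + \<i> * of_real (Y + 1)"
  have s1: "cmod (D ?z2 - D ?z1) \<le> 32 * A / d * (Y + 1)"
  proof -
    have *: "Im w \<ge> y0" if w: "w \<in> closed_segment ?z2 ?z1" for w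
    proof -
      obtain u where u: "0 \<le> u" "u \<le> 1" "w = (1 - u) *\<^sub>R ?z2 + u *\<^sub>R ?z1" using w by (auto simp: closed_segment_def)
      have "Im w = (1 - u) * (Y + 1) + u * y0" by (simp add: u(3))
      moreover have "(1 - u) * y0 \<le> (1 - u) * (Y + 1)" using u Y by (intro mult_left_mono) auto
      ultimately show ?thesis by (simp add: algebra_simps)
    qed
    have "cmod (D ?z2 - D ?z1) \<le> 32 * A / d * cmod (?z2 - ?z1)"
    proof (rule seg)
      show "closed_segment ?z2 ?z1 \<subseteq> {z. Im z > 0}" using * y0 by force
      show "d \<le> cmod (w - e)" if "w \<in> closed_segment ?z2 ?z1" "Im e = 0" for w e
        using *[OF that(1)] im[OF that(2), of w] d(2) by linarith
    qed
    moreover have "?z2 - ?z1 = \<i> * of_real (Y + 1 - y0)" by (simp add: algebra_simps)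
    then have "cmod (?z2 - ?z1) \<le> Y + 1" using Y y0 by (simp add: norm_mult del: of_real_diff)
    ultimately show ?thesis using A d(1) by (smt (verit) divide_nonneg_pos mult_left_mono)
  qed
  have s2: "cmod (D ?z3 - D ?z2) \<le> 32 * A / d * (\<bar>a\<bar> + Y)"
  proof -
    have *: "Im w = Y + 1" if w: "w \<in> closed_segment ?z3 ?z2" for w
    proof -
      obtain u where u: "w = (1 - u) *\<^sub>R ?z3 + u *\<^sub>R ?z2" using w by (auto simp: closed_segment_def)
      show ?thesis by (simp add: u algebra_simps)
    qed
    have "cmod (D ?z3 - D ?z2) \<le> 32 * A / d * cmod (?z3 - ?z2)"
    proof (rule seg)
      show "closed_segment ?z3 ?z2 \<subseteq> {z. Im z > 0}" using * Ymx by force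
      show "d \<le> cmod (w - e)" if "w \<in> closed_segment ?z3 ?z2" "Im e = 0" for w e
        using *[OF that(1)] im[OF that(2), of w] d(2) Y by linarith
    qed
    moreover have "cmod (?z3 - ?z2) \<le> \<bar>a\<bar> + Y"
    proof -
      have "?z3 - ?z2 = of_real (Re z - a)" by simp
      then have "cmod (?z3 - ?z2) = \<bar>Re z - a\<bar>" by (simp only: norm_of_real)
      then show ?thesis using abs_Re_le_cmod[of z] z(4) by linarith
    qed
    ultimately show ?thesis using A d(1) by (smt (verit) divide_nonneg_pos mult_left_mono)
  qed
  \<comment> \<open>The endpoint is shifted up by \<open>t\<close> because \<open>D\<close> is
    holomorphic in the open half-plane only and \<open>z\<close> may be real. Points vertically
    above \<open>z\<close> are at least as far from every real point as \<open>z\<close> is.\<close>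
  have s3: "cmod (D (z + \<i> * of_real t) - D ?z3) \<le> 32 * A / d * (2 * Y + 1)" if t: "0 < t" "t \<le> 1" for t
  proof -
    have *: "Re w = Re z \<and> Im z \<le> Im w \<and> 0 < Im w" if w: "w \<in> closed_segment (z + \<i> * of_real t) ?z3" for w
    proof -
      obtain u where u: "0 \<le> u" "u \<le> 1" "w = (1 - u) *\<^sub>R (z + \<i> * of_real t) + u *\<^sub>R ?z3" using w by (auto simp: closed_segment_def)
      have i: "Im w = Im z + (1 - u) * t + u * (Y + 1 - Im z)" by (simp add: u(3) algebra_simps)
      have zY: "Im z \<le> Y" using abs_Im_le_cmod[of z] z(4) by linarith
      have n: "0 \<le> (1 - u) * t" "0 \<le> u * (Y + 1 - Im z)" using u t zY by auto
      have p: "0 < (1 - u) * t \<or> 0 < u * (Y + 1 - Im z)" using u t zY by (cases "u = 1") auto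
      have "Re w = Re z" by (simp add: u(3) algebra_simps)
      moreover have "Im z \<le> Im w" "0 < Im w" unfolding i using n p z(3) by linarith+
      ultimately show ?thesis by simp
    qed
    have "cmod (D (z + \<i> * of_real t) - D ?z3) \<le> 32 * A / d * cmod ((z + \<i> * of_real t) - ?z3)"
    proof (rule seg)
      show "closed_segment (z + \<i> * of_real t) ?z3 \<subseteq> {z. Im z > 0}" using * by auto
      show "d \<le> cmod (w - e)" if w: "w \<in> closed_segment (z + \<i> * of_real t) ?z3" "Im e = 0" "e \<in> E \<or> e \<in> c' ` {1..m}" for w e
      proof -
        have "d \<le> cmod (z - e)" using z(1,2) w(3) by auto
        also have "\<dots> \<le> cmod (w - e)" unfolding cmod_def
        proof (intro real_sqrt_le_mono add_mono)
          show "(Re (z - e))\<^sup>2 \<le> (Re (w - e))\<^sup>2" using *[OF w(1)] by simp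
          show "(Im (z - e))\<^sup>2 \<le> (Im (w - e))\<^sup>2" using *[OF w(1)] w(2) z(3) by (intro power_mono) auto
        qed
        finally show ?thesis .
      qed
    qed
    moreover have "cmod ((z + \<i> * of_real t) - ?z3) \<le> 2 * Y + 1"
    proof -
      have "(z + \<i> * of_real t) - ?z3 = \<i> * of_real (Im z + t - (Y + 1))" by (simp add: complex_eq_iff)
      then have "cmod ((z + \<i> * of_real t) - ?z3) = \<bar>Im z + t - (Y + 1)\<bar>" by (simp only: norm_mult norm_ii norm_of_real mult_1)
      then show ?thesis using abs_Im_le_cmod[of z] z(3,4) t Ymx by linarith
    qed
    ultimately show ?thesis using A d(1) by (smt (verit) divide_nonneg_pos mult_left_mono)
  qed
  have s0: "cmod (D ?z1) \<le> 64 * R / (ln R * sqrt (a - p)) * sqrt y0 * A"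
    by (rule D_bound_near_endpoint[OF A bd pa R av r y0 lim])
  define T where "T = 64 * R / (ln R * sqrt (a - p)) * sqrt y0 * A + 32 * A / d * (4 * Y + \<bar>a\<bar> + 2)"
  have n4: "cmod (x1 + x2 + x3 + x4) \<le> cmod x1 + cmod x2 + cmod x3 + cmod x4" for x1 x2 x3 x4
    by (intro order_trans[OF norm_triangle_ineq] add_mono order_refl)
  have bt: "cmod (D (z + \<i> * of_real t)) \<le> T" if t: "0 < t" "t \<le> 1" for t
  proof -
    have "D (z + \<i> * of_real t) = (D (z + \<i> * of_real t) - D ?z3) + (D ?z3 - D ?z2) + (D ?z2 - D ?z1) + D ?z1" by simp
    then have "cmod (D (z + \<i> * of_real t)) \<le> cmod (D (z + \<i> * of_real t) - D ?z3) + cmod (D ?z3 - D ?z2) + cmod (D ?z2 - D ?z1) + cmod (D ?z1)"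
      by (metis n4)
    also have "\<dots> \<le> 32 * A / d * (2 * Y + 1) + 32 * A / d * (\<bar>a\<bar> + Y) + 32 * A / d * (Y + 1) + 64 * R / (ln R * sqrt (a - p)) * sqrt y0 * A"
      using s0 s1 s2 s3[OF t] by (intro add_mono)
    also have "q * (2 * Y + 1) + q * (\<bar>a\<bar> + Y) + q * (Y + 1) = q * (4 * Y + \<bar>a\<bar> + 2)" for q by (simp add: algebra_simps)
    then have "32 * A / d * (2 * Y + 1) + 32 * A / d * (\<bar>a\<bar> + Y) + 32 * A / d * (Y + 1) + 64 * R / (ln R * sqrt (a - p)) * sqrt y0 * A = T"
      unfolding T_def by (simp only: add.commute)
    finally show ?thesis .
  qed
  have zK: "z \<notin> K"
  proof
    assume "z \<in> K"
    then consider "z \<in> E" | k where "k \<in> {1..m}" "cmod (z - c' k) < s / 2" using K_cases by blast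
    then show False using z(1)[of z] z(2) d s(1) by cases force+
  qed
  have "(\<lambda>n. D (z + \<i> * of_real (1 / real (Suc n)))) \<longlonglongrightarrow> D z"
  proof (cases "Im z = 0")
    case True
    then have zr: "z = of_real (Re z)" by (simp add: complex_eq_iff)
    have "(\<lambda>n. D (\<i> * of_real (1 / real (Suc n)) + of_real (Re z))) \<longlonglongrightarrow> D z"
      by (rule filterlim_compose[OF _ filterlim_vertical]) (use D_lim[OF zK True] zr in auto)
    then show ?thesis using zr by (simp add: add.commute)
  next
    case False
    then have "isCont D z" using D_deriv[of z] z(3) DERIV_isCont by force
    moreover have "(\<lambda>n. z + \<i> * of_real (1 / real (Suc n))) \<longlonglongrightarrow> z + \<i> * of_real 0"
      by (intro tendsto_intros LIMSEQ_Suc[OF lim_1_over_n])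
    ultimately show ?thesis by (intro isCont_tendsto_compose[of _ D]) auto
  qed
  then have "(\<lambda>n. cmod (D (z + \<i> * of_real (1 / real (Suc n))))) \<longlonglongrightarrow> cmod (D z)" by (intro tendsto_intros)
  then have DT: "cmod (D z) \<le> T" by (rule LIMSEQ_le_const2) (intro exI[of _ 0] allI impI bt; simp)
  have e: "32 / d * X * A = 32 * A / d * X" for X by simp
  show ?thesis using DT unfolding T_def distrib_right e .
qed

end

section \<open>Uniform bounds and the asymptotic formula\<close>

context green_setup
begin

text \<open>The constants \<open>Cc\<close> and \<open>s0\<close> are fixed before the perturbation
  is quantified; this is the uniformity along the sequence and on the compact set
  \<open>Z\<close>.\<close>

lemma uniform_bound:
  assumes pa: "(p, a) \<in> P" and Z: "compact Z" "Z \<subseteq> - E - c' ` {1..m}"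
  obtains Cc s0 where "s0 > 0" "\<And>B C G L U \<omega> s z. perturbed_green P m c GE Gc LE Lc B C G L U \<omega> s \<Longrightarrow> s \<le> s0 \<Longrightarrow>
    (\<And>j. j \<in> {1..m} \<Longrightarrow> 0 \<le> \<omega> j \<and> \<omega> j \<le> 1) \<Longrightarrow> (\<And>k. k \<in> {1..m} \<Longrightarrow> \<omega> k * ln (2 / s) \<le> 1) \<Longrightarrow>
    ((\<lambda>z. L z - LE z + (\<Sum>k=1..m. of_real (\<omega> k) * Lc k z)) \<longlongrightarrow> 0) (at (of_real a) within {z. Im z > 0}) \<Longrightarrow>
    z \<in> Z \<Longrightarrow> 0 \<le> Im z \<Longrightarrow> cmod (L z - LE z + (\<Sum>k=1..m. of_real (\<omega> k) * Lc k z)) \<le> Cc * s"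
proof -
  obtain \<rho> V \<Gamma> Sm where good: "good \<rho> V \<Gamma> Sm" by (rule good_exists)
  have \<rho>: "0 < \<rho>" "V > 0" "\<Gamma> > 0" using good by (auto simp: good_def)
  have pq: "p < a" using P pa by (auto simp: slit_system_def)
  let ?J = "complex_of_real ` {p..a}"
  define CC where "CC = (E - ?J) \<union> (\<Union>k\<in>{1..m}. cball (c' k) \<rho>)"
  have "compact (E - ?J)" using slits_remove[OF P pa] compact_slits[of "P - {(p, a)}"] finP by simp
  then have 1: "compact CC" unfolding CC_def by (intro compact_Un compact_UN) auto
  have JE: "?J \<subseteq> E" using pa by (auto simp: slits_def)
  have cE: "cball (c' k) \<rho> \<inter> E = {}" if "k \<in> {1..m}" for k
  proof -
    have "cball (c' k) (4 * \<rho>) \<inter> E = {}" using good that unfolding good_def by blast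
    moreover have "cball (c' k) \<rho> \<subseteq> cball (c' k) (4 * \<rho>)" using \<rho>(1) by (intro subset_cball) auto
    ultimately show ?thesis by blast
  qed
  have 2: "CC \<inter> ?J = {}" unfolding CC_def using JE cE by blast
  obtain R where R: "R > 1" "\<And>z. z \<in> CC \<Longrightarrow> (a - p) / 2 * (R + 1 / R) \<le> cmod (z - of_real p) + cmod (z - of_real a)"
    by (rule ellipse_avoid[OF pq 1 2]) (rule that)
  note av = R(2)[unfolded CC_def]
  define g where "g = (a - p) / 2 * ((1 + R) / 2 + 1 / ((1 + R) / 2)) - (a - p)"
  have g: "g > 0"
  proof -
    have "a - p = (a - p) / 2 * 2" by simp
    also have "\<dots> < (a - p) / 2 * ((1 + R) / 2 + 1 / ((1 + R) / 2))"
      using plus_inverse_strict_mono[of 1 "(1 + R) / 2"] R(1) pq by (intro mult_strict_left_mono) auto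
    finally show ?thesis unfolding g_def by (simp only: diff_gt_0_iff_gt)
  qed
  \<comment> \<open>\<open>g\<close> is the room in the focal sum between the slit and the smaller
    ellipse. A quarter of it keeps the vertical segment of height \<open>y0\<close> above the
    endpoint inside that ellipse.\<close>
  define y0 where "y0 = g / 4"
  have y0: "y0 > 0" "a - p + 2 * y0 < (a - p) / 2 * ((1 + R) / 2 + 1 / ((1 + R) / 2))"
  proof -
    have X: "(a - p) / 2 * ((1 + R) / 2 + 1 / ((1 + R) / 2)) = g + (a - p)" unfolding g_def by (simp only: diff_add_cancel)
    show "y0 > 0" "a - p + 2 * y0 < (a - p) / 2 * ((1 + R) / 2 + 1 / ((1 + R) / 2))"
      unfolding X y0_def using g by simp_all
  qed
  have fin: "finite (c' ` {1..m})" by simp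
  have clE: "closed (E \<union> c' ` {1..m})" using E_closed fin finite_imp_closed by blast
  obtain d1 where d1: "d1 > 0" "\<And>z e. z \<in> Z \<Longrightarrow> e \<in> E \<union> c' ` {1..m} \<Longrightarrow> d1 \<le> dist z e"
    using separate_compact_closed[OF Z(1) clE] Z(2) by blast
  obtain Y1 where Y1: "\<And>z. z \<in> Z \<Longrightarrow> cmod z \<le> Y1" using compact_imp_bounded[OF Z(1)] bounded_iff by metis
  define Y where "Y = max Y1 y0"
  have Y: "y0 \<le> Y" "\<And>z. z \<in> Z \<Longrightarrow> cmod z \<le> Y" using Y1 by (auto simp: Y_def intro: le_max_iff_disj[THEN iffD2])
  define d where "d = min d1 y0"
  have d: "d > 0" "d \<le> y0" "d \<le> d1" using d1 y0 by (auto simp: d_def)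
  \<comment> \<open>The three bounds provide in turn \<open>2 * r0 <= \<rho>\<close>, a distance of
    \<open>2 * r0\<close> between \<open>Z\<close> and the poles, and
    \<open>2 * Sm <= - V - ln r0\<close> for the halving in \<open>h_bound\<close>.\<close>
  define r0 where "r0 = min (min (\<rho> / 2) (d / 2)) (exp (- V - 2 * Sm))"
  have r0: "0 < r0" "2 * r0 \<le> \<rho>" "2 * r0 \<le> d" using \<rho> d by (auto simp: r0_def)
  have "ln r0 \<le> ln (exp (- V - 2 * Sm))" using r0(1) by (subst ln_le_cancel_iff) (auto simp: r0_def)
  then have r0': "2 * Sm \<le> - V - ln r0" by simp
  define A0 where "A0 = 2400 * (\<Gamma> * (1 + real m) + V + 1) / r0"
  have A0: "A0 > 0" using \<rho> r0 by (simp add: A0_def add_pos_pos)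
  define Cc where "Cc = (64 * R / (ln R * sqrt (a - p)) * sqrt y0 + 32 / d * (4 * Y + \<bar>a\<bar> + 2)) * A0"
  have main: "cmod (L z - LE z + (\<Sum>k=1..m. of_real (\<omega> k) * Lc k z)) \<le> Cc * s"
    if pg: "perturbed_green P m c GE Gc LE Lc B C G L U \<omega> s" and sle: "s \<le> r0 / 2"
      and \<omega>: "\<And>j. j \<in> {1..m} \<Longrightarrow> 0 \<le> \<omega> j \<and> \<omega> j \<le> 1" "\<And>k. k \<in> {1..m} \<Longrightarrow> \<omega> k * ln (2 / s) \<le> 1"
      and lim: "((\<lambda>z. L z - LE z + (\<Sum>k=1..m. of_real (\<omega> k) * Lc k z)) \<longlongrightarrow> 0) (at (of_real a) within {z. Im z > 0})"
      and z: "z \<in> Z" "0 \<le> Im z" for B C G L U \<omega> s z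
  proof -
    interpret perturbed_green P m c GE Gc LE Lc B C G L U \<omega> s by (rule pg)
    have s\<rho>: "s < \<rho>" "s \<le> r0" "s \<le> \<rho>" "2 * s \<le> r0"
      using sle r0 \<open>0 < \<rho>\<close> s(1) by auto
    have hb: "\<bar>h z\<bar> \<le> A0 * s" if "z \<notin> E" "\<And>k. k \<in> {1..m} \<Longrightarrow> r0 < cmod (z - c' k)" for z
      unfolding A0_def by (rule h_bound[OF good s\<rho>(1) r0(1,2) r0' s\<rho>(4) \<omega> that])
    have r0\<rho>: "r0 \<le> \<rho>" using r0 by linarith
    have A: "A0 * s > 0" using A0 s(1) by simp
    have lim': "(D \<longlongrightarrow> 0) (at (of_real a) within {z. Im z > 0})" using lim unfolding D_def .
    have z1: "d \<le> cmod (z - e)" if "e \<in> E" for e using d1(2)[OF z(1), of e] that d(3) by (simp add: dist_norm)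
    have z2: "d \<le> cmod (z - c' k)" if "k \<in> {1..m}" for k using d1(2)[OF z(1), of "c' k"] that d(3) by (simp add: dist_norm)
    have "cmod (D z) \<le> (64 * R / (ln R * sqrt (a - p)) * sqrt y0 + 32 / d * (4 * Y + \<bar>a\<bar> + 2)) * (A0 * s)"
      by (rule D_bound[OF A hb pa R(1) av r0\<rho> s\<rho>(3) y0 lim' d(1,2) r0(3) s\<rho>(2) Y(1) z1 z2 z(2) Y(2)[OF z(1)]])
    then show ?thesis by (simp add: D_def Cc_def mult.assoc)
  qed
  show ?thesis by (rule that[of "r0 / 2" Cc]) (use r0(1) main in auto)
qed

end

lemma Max_tendsto_0:
  fixes \<omega> :: "nat \<Rightarrow> nat \<Rightarrow> real"
  assumes m: "m \<ge> 1" and lim: "\<And>k. k \<in> {1..m} \<Longrightarrow> (\<lambda>i. \<omega> k i) \<longlonglongrightarrow> 0" and pos: "\<And>i k. k \<in> {1..m} \<Longrightarrow> \<omega> k i > 0"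
  shows "filterlim (\<lambda>i. MAX k\<in>{1..m}. \<omega> k i) (at_right 0) sequentially"
proof -
  have W: "(MAX k\<in>{1..m}. \<omega> k i) > 0" for i using m pos by (subst Max_gr_iff) (auto intro!: bexI[of _ 1])
  have lim0: "(\<lambda>i. MAX k\<in>{1..m}. \<omega> k i) \<longlonglongrightarrow> 0"
  proof (rule order_tendstoI)
    fix a :: real assume "a < 0"
    then show "\<forall>\<^sub>F i in sequentially. a < (MAX k\<in>{1..m}. \<omega> k i)" using W by (intro always_eventually) (meson order_less_trans)
  next
    fix a :: real assume a: "0 < a"
    have "\<forall>\<^sub>F i in sequentially. \<forall>k\<in>{1..m}. \<omega> k i < a"
      using order_tendstoD(2)[OF lim a] by (intro eventually_ball_finite) auto
    then show "\<forall>\<^sub>F i in sequentially. (MAX k\<in>{1..m}. \<omega> k i) < a"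
      by eventually_elim (use m in \<open>subst Max_less_iff, auto\<close>)
  qed
  have gt: "x \<in> {0<..} \<and> x \<noteq> 0" if "x > 0" for x :: real using that by auto
  have "(MAX k\<in>{1..m}. \<omega> k i) \<in> {0<..} \<and> (MAX k\<in>{1..m}. \<omega> k i) \<noteq> 0" for i
    using gt[OF W[of i]] .
  then have "\<forall>\<^sub>F i in sequentially. (MAX k\<in>{1..m}. \<omega> k i) \<in> {0<..} \<and> (MAX k\<in>{1..m}. \<omega> k i) \<noteq> 0"
    by (intro always_eventually allI)
  then show ?thesis unfolding filterlim_at using lim0 by blast
qed

text \<open>The linear bound of \<open>harmonic_measure_ge_length\<close> makes the \<omega>
  positive and the lengths small enough to isolate the slits. Then
  \<open>harmonic_measure_ge_log\<close> gives \<open>C - B <= 8 * r1 * exp (- c5 / W)\<close> with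
  \<open>W\<close> the largest \<omega>, which is eventually below any power of
  \<open>W\<close>.\<close>

lemma lengths_small:
  fixes \<omega> B C :: "nat \<Rightarrow> nat \<Rightarrow> real" and E :: "real set" and c :: "nat \<Rightarrow> real"
  assumes m: "m \<ge> 1" and c: "inj_on c {1..m}" "\<And>k. k \<in> {1..m} \<Longrightarrow> c k \<notin> E" and E: "compact E"
    and BC: "\<And>i k. k \<in> {1..m} \<Longrightarrow> B k i < C k i" "\<And>i k. k \<in> {1..m} \<Longrightarrow> B k i \<le> c k \<and> c k \<le> C k i"
    and U: "\<And>i k. k \<in> {1..m} \<Longrightarrow> \<exists>U. hmeas (complex_of_real ` (E \<union> (\<Union>k\<in>{1..m}. {B k i..C k i}))) (complex_of_real ` {B k i..C k i}) U (\<omega> k i)"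
    and lim: "\<And>k. k \<in> {1..m} \<Longrightarrow> (\<lambda>i. \<omega> k i) \<longlonglongrightarrow> 0"
  shows "\<forall>k\<in>{1..m}. \<omega> k i > 0"
    and "\<forall>\<^sub>F i in sequentially. \<forall>k\<in>{1..m}. C k i - B k i < (MAX k\<in>{1..m}. \<omega> k i)\<^sup>2 / 2"
proof -
  obtain M1 where M1: "\<And>x. x \<in> E \<Longrightarrow> \<bar>x\<bar> \<le> M1" using compact_imp_bounded[OF E] unfolding bounded_iff by auto
  define M where "M = \<bar>M1\<bar> + (\<Sum>k=1..m. \<bar>c k\<bar>) + 1"
  have cs: "\<bar>c k\<bar> \<le> (\<Sum>k=1..m. \<bar>c k\<bar>)" if "k \<in> {1..m}" for k using that by (intro member_le_sum) auto
  have M: "M > 0" "\<And>x. x \<in> E \<Longrightarrow> \<bar>x\<bar> \<le> M" "\<And>k. k \<in> {1..m} \<Longrightarrow> \<bar>c k\<bar> \<le> M"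
  proof -
    have "0 \<le> (\<Sum>k=1..m. \<bar>c k\<bar>)" by (intro sum_nonneg) auto
    then show "M > 0" unfolding M_def by linarith
    show "\<bar>x\<bar> \<le> M" if "x \<in> E" for x unfolding M_def using M1[OF that] \<open>0 \<le> (\<Sum>k=1..m. \<bar>c k\<bar>)\<close> by linarith
    show "\<And>k. k \<in> {1..m} \<Longrightarrow> \<bar>c k\<bar> \<le> M" using cs by (force simp: M_def)
  qed
  define K where "K = (\<lambda>i. complex_of_real ` (E \<union> (\<Union>k\<in>{1..m}. {B k i..C k i})))"
  define len where "len = (\<lambda>i. MAX k\<in>{1..m}. C k i - B k i)"
  have len: "C k i - B k i \<le> len i" if "k \<in> {1..m}" for k i unfolding len_def using that by (intro Max_ge) auto
  have len_ex: "\<exists>k\<in>{1..m}. len i = C k i - B k i" for i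
  proof -
    have "len i \<in> (\<lambda>k. C k i - B k i) ` {1..m}" unfolding len_def using m by (intro Max_in) auto
    then show ?thesis by blast
  qed
  have len_pos: "len i > 0" for i using len_ex[of i] BC(1) by force
  have Kc: "compact (K i)" for i unfolding K_def using E by (intro compact_continuous_image continuous_intros compact_Un compact_UN) auto
  have Khull: "K i \<subseteq> complex_of_real ` {- (M + len i)..M + len i}" for i
  proof -
    have "x \<in> {- (M + len i)..M + len i}" if x: "x \<in> E \<union> (\<Union>k\<in>{1..m}. {B k i..C k i})" for x
    proof (cases "x \<in> E")
      case True then show ?thesis using M(2)[of x] len_pos[of i] by auto
    next
      case False
      then obtain k where k: "k \<in> {1..m}" "B k i \<le> x" "x \<le> C k i" using x by auto
      then show ?thesis using M(3)[OF k(1)] len[OF k(1), of i] BC(2)[OF k(1), of i] by auto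
    qed
    then show ?thesis unfolding K_def by blast
  qed
  have IK: "complex_of_real ` {B k i..C k i} \<subseteq> K i" if "k \<in> {1..m}" for k i unfolding K_def using that by blast
  have ge_len: "C k i - B k i \<le> 80 * (M + len i) * \<omega> k i" if k: "k \<in> {1..m}" for k i
  proof -
    obtain U where "hmeas (K i) (complex_of_real ` {B k i..C k i}) U (\<omega> k i)" using U[OF k] unfolding K_def by blast
    from harmonic_measure_ge_length[OF this Kc Khull IK[OF k] BC(1)[OF k]] show ?thesis by simp
  qed
  have pos: "\<omega> k i > 0" if k: "k \<in> {1..m}" for k i
  proof -
    have "0 < 80 * (M + len i) * \<omega> k i" using ge_len[OF k, of i] BC(1)[OF k, of i] by linarith
    then show ?thesis using M(1) len_pos[of i] by (simp add: zero_less_mult_iff)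
  qed
  then show "\<forall>k\<in>{1..m}. \<omega> k i > 0" by blast
  define W where "W = (\<lambda>i. MAX k\<in>{1..m}. \<omega> k i)"
  have W: "filterlim W (at_right 0) sequentially" unfolding W_def by (rule Max_tendsto_0[OF m lim pos])
  have W0: "W \<longlonglongrightarrow> 0" and Wpos: "\<forall>\<^sub>F i in sequentially. W i > 0" using W unfolding filterlim_at by (auto elim: eventually_mono)
  have Wge: "\<omega> k i \<le> W i" if "k \<in> {1..m}" for k i unfolding W_def using that by (intro Max_ge) auto
  define t where "t = Min (insert 1 ((\<lambda>(j, k). \<bar>c j - c k\<bar>) ` {(j, k) \<in> {1..m} \<times> {1..m}. j \<noteq> k}))"
  have fin2: "finite {(j, k) \<in> {1..m} \<times> {1..m}. j \<noteq> k}" by (rule finite_subset[of _ "{1..m} \<times> {1..m}"]) auto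
  have t: "t > 0" "\<And>j k. j \<in> {1..m} \<Longrightarrow> k \<in> {1..m} \<Longrightarrow> j \<noteq> k \<Longrightarrow> t \<le> \<bar>c j - c k\<bar>"
  proof -
    have "t \<in> insert 1 ((\<lambda>(j, k). \<bar>c j - c k\<bar>) ` {(j, k) \<in> {1..m} \<times> {1..m}. j \<noteq> k})" unfolding t_def using fin2 by (intro Min_in) auto
    then consider "t = 1" | j k where "j \<in> {1..m}" "k \<in> {1..m}" "j \<noteq> k" "t = \<bar>c j - c k\<bar>" by auto
    then show "t > 0"
    proof cases
      case 2
      then have "c j \<noteq> c k" using inj_onD[OF c(1)] by blast
      then show ?thesis using 2 by simp
    qed simp
    show "t \<le> \<bar>c j - c k\<bar>" if "j \<in> {1..m}" "k \<in> {1..m}" "j \<noteq> k" for j k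
      unfolding t_def using fin2 that by (intro Min_le) (auto intro!: image_eqI[of _ _ "(j, k)"])
  qed
  have "compact (c ` {1..m})" by (simp add: finite_imp_compact)
  moreover have "c ` {1..m} \<inter> E = {}" using c(2) by blast
  ultimately obtain t' where t': "t' > 0" "\<And>x y. x \<in> c ` {1..m} \<Longrightarrow> y \<in> E \<Longrightarrow> t' \<le> dist x y"
    using separate_compact_closed[OF _ compact_imp_closed[OF E]] by metis
  \<comment> \<open>The quarter leaves room: with lengths below \<open>r1 / 2\<close>, a disc of
    radius \<open>r1\<close> around the midpoint of a slit meets neither \<open>E\<close> nor
    another slit.\<close>
  define r1 where "r1 = min t t' / 4"
  have r1: "r1 > 0" "\<And>j k. j \<in> {1..m} \<Longrightarrow> k \<in> {1..m} \<Longrightarrow> j \<noteq> k \<Longrightarrow> 4 * r1 \<le> \<bar>c j - c k\<bar>" "\<And>k x. k \<in> {1..m} \<Longrightarrow> x \<in> E \<Longrightarrow> 4 * r1 \<le> \<bar>x - c k\<bar>"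
  proof -
    have r: "4 * r1 \<le> t" "4 * r1 \<le> t'" by (auto simp: r1_def)
    show "r1 > 0" using t t' by (simp add: r1_def)
    show "4 * r1 \<le> \<bar>c j - c k\<bar>" if "j \<in> {1..m}" "k \<in> {1..m}" "j \<noteq> k" for j k
      using order_trans[OF r(1) t(2)[OF that]] .
    show "4 * r1 \<le> \<bar>x - c k\<bar>" if "k \<in> {1..m}" "x \<in> E" for k x
      using order_trans[OF r(2) t'(2)[of "c k" x]] that by (simp add: dist_real_def abs_minus_commute)
  qed
  \<comment> \<open>The left side of \<open>harmonic_measure_ge_log\<close> with the width of the
    hull, \<open>2 * (M + len i)\<close>, replaced by its upper bound \<open>4 * M\<close>.\<close>
  define c5 where "c5 = 7 / 16 * ln 2 * (r1 / 2) / (4 * M + r1 / 2)"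
  have c5: "c5 > 0" using r1 M(1) by (simp add: c5_def)
  have "\<forall>\<^sub>F w in at_right 0. 8 * r1 * exp (- c5 / w) < w\<^sup>2 / 2"
    using r1(1) c5 by real_asymp
  then have "\<forall>\<^sub>F i in sequentially. 8 * r1 * exp (- c5 / W i) < (W i)\<^sup>2 / 2"
    by (rule eventually_compose_filterlim[OF _ W])
  moreover have "\<forall>\<^sub>F i in sequentially. W i < 1 / 160" by (rule order_tendstoD(2)[OF W0]) simp
  moreover have "\<forall>\<^sub>F i in sequentially. W i < r1 / (320 * M)" by (rule order_tendstoD(2)[OF W0]) (use r1(1) M(1) in simp)
  ultimately show "\<forall>\<^sub>F i in sequentially. \<forall>k\<in>{1..m}. C k i - B k i < (MAX k\<in>{1..m}. \<omega> k i)\<^sup>2 / 2"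
    using Wpos
  proof eventually_elim
    case (elim i)
    \<comment> \<open>The bound contains \<open>len i\<close> on both sides.
      \<open>W i < 1 / 160\<close> first gives \<open>len i <= M\<close>; inserting this gives
      \<open>len i <= 160 * M * W i < r1 / 2\<close>.\<close>
    have lenW: "len i \<le> 80 * (M + len i) * W i"
    proof -
      obtain k where k: "k \<in> {1..m}" "len i = C k i - B k i" using len_ex by blast
      have "len i \<le> 80 * (M + len i) * \<omega> k i" using ge_len[OF k(1), of i] k(2) by simp
      also have "\<dots> \<le> 80 * (M + len i) * W i" using Wge[OF k(1)] M(1) len_pos[of i] by (intro mult_left_mono) auto
      finally show ?thesis .
    qed
    have "80 * (M + len i) * W i \<le> 80 * (M + len i) * (1 / 160)" using elim(2) M(1) len_pos[of i] by (intro mult_left_mono) auto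
    then have lM: "len i \<le> M" using lenW by simp
    have "80 * (M + len i) * W i \<le> 160 * M * W i" using lM elim(4) M(1) by (intro mult_right_mono) auto
    also have "\<dots> < 160 * M * (r1 / (320 * M))" using elim(3) M(1) by (intro mult_strict_left_mono) auto
    also have "\<dots> = r1 / 2" using M(1) by simp
    finally have lr: "len i < r1 / 2" using lenW by simp
    show ?case
    proof
      fix k assume k: "k \<in> {1..m}"
      let ?l = "C k i - B k i"
      have l: "?l > 0" "?l \<le> len i" using BC(1)[OF k, of i] len[OF k, of i] by auto
      obtain U where U: "hmeas (K i) (complex_of_real ` {B k i..C k i}) U (\<omega> k i)" using U[OF k] unfolding K_def by blast
      have "7 / 16 * ln 2 * (r1 / 2) / (M + len i - - (M + len i) + r1 / 2) \<le> \<omega> k i * ln (8 * r1 / ?l)"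
      proof (rule harmonic_measure_ge_log[OF U Kc Khull IK[OF k] BC(1)[OF k]])
        show "?l / 2 < r1" using l lr by argo
        fix x assume x: "x \<in> K i" "cmod (x - of_real ((B k i + C k i) / 2)) < r1"
        obtain y where y: "x = of_real y" "y \<in> E \<union> (\<Union>k\<in>{1..m}. {B k i..C k i})" using x(1) unfolding K_def by blast
        have "x - of_real ((B k i + C k i) / 2) = of_real (y - (B k i + C k i) / 2)" by (simp add: y(1))
        then have "\<bar>y - (B k i + C k i) / 2\<bar> < r1" using x(2) by (simp only: norm_of_real)
        moreover have "\<bar>(B k i + C k i) / 2 - c k\<bar> \<le> ?l" using BC(2)[OF k, of i] by (auto simp: abs_le_iff field_simps)
        ultimately have yc: "\<bar>y - c k\<bar> < 3 / 2 * r1" using l lr by linarith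
        show "x \<in> complex_of_real ` {B k i..C k i}"
        proof (cases "y \<in> E")
          case True
          then show ?thesis using r1(3)[OF k, of y] yc r1(1) by linarith
        next
          case False
          then obtain j where j: "j \<in> {1..m}" "B j i \<le> y" "y \<le> C j i" using y(2) by auto
          have "\<bar>y - c j\<bar> \<le> len i" using j(2,3) BC(2)[OF j(1), of i] len[OF j(1), of i] by linarith
          then have "\<bar>c j - c k\<bar> < 2 * r1" using yc lr by linarith
          then have "j = k" using r1(2)[OF j(1) k] r1(1) by force
          then show ?thesis using j y(1) by auto
        qed
      qed
      moreover have "c5 \<le> 7 / 16 * ln 2 * (r1 / 2) / (M + len i - - (M + len i) + r1 / 2)"
        unfolding c5_def using lM M(1) r1(1) len_pos[of i] by (intro divide_left_mono mult_pos_pos) auto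
      moreover have "\<omega> k i * ln (8 * r1 / ?l) \<le> W i * ln (8 * r1 / ?l)"
      proof (intro mult_right_mono Wge k)
        have "1 \<le> 8 * r1 / ?l" using l lr r1(1) by (simp add: le_divide_eq)
        then show "0 \<le> ln (8 * r1 / ?l)" by simp
      qed
      ultimately have "c5 \<le> W i * ln (8 * r1 / ?l)" by linarith
      then have "c5 / W i \<le> ln (8 * r1 / ?l)" using elim(4) by (simp add: pos_divide_le_eq mult.commute)
      then have "exp (c5 / W i) \<le> 8 * r1 / ?l" using l(1) r1(1) by (subst ln_ge_iff[symmetric]) auto
      then have "?l * exp (c5 / W i) \<le> 8 * r1" using l(1) by (simp add: pos_le_divide_eq mult.commute)
      then have "?l * exp (c5 / W i) * exp (- c5 / W i) \<le> 8 * r1 * exp (- c5 / W i)" by (rule mult_right_mono) simp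
      then have "?l \<le> 8 * r1 * exp (- c5 / W i)" by (simp add: mult.assoc flip: exp_add)
      then show "?l < (MAX k\<in>{1..m}. \<omega> k i)\<^sup>2 / 2" using elim(1) unfolding W_def by linarith
    qed
  qed
qed

section \<open>Reduction to the upper half-plane and the asymptotic formula\<close>

lemma real_in_frontier:
  assumes "Im x = 0" "H = {z. Im z > 0} \<or> H = {z. Im z < 0}" shows "x \<in> frontier H"
proof -
  have u: "y \<in> closure {z. Im z > 0}" if "Im y = 0" for y
    using islimpt_upper_half[OF that] by (simp add: closure_def)
  have "x \<in> closure {z. Im z < 0}"
    using assms(1) closure_halfspace_lt[of "\<i>" 0] by (simp add: inner_complex_def)
  moreover have "open H" using assms(2) open_halfspace_Im_gt open_halfspace_Im_lt by blast
  ultimately show ?thesis using assms u[OF assms(1)] by (auto simp: frontier_def interior_open)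
qed

text \<open>Conjugation by \<open>\<sigma>\<close> reduces the lower half-plane to the upper one.\<close>
lemma log_green_upper:
  assumes L: "is_log_complex_green K z0 a H L"
    and \<sigma>: "H = {z. Im z > 0} \<and> \<sigma> = (\<lambda>z. z) \<or> H = {z. Im z < 0} \<and> \<sigma> = cnj" and a: "Im a = 0"
  shows "\<exists>g. is_green_function K z0 g \<and> (\<forall>z. Im z > 0 \<longrightarrow> Re (\<sigma> (L (\<sigma> z))) = g (Some (\<sigma> z)))"
    and "(\<lambda>z. \<sigma> (L (\<sigma> z))) holomorphic_on {z. Im z > 0}"
    and "((\<lambda>z. \<sigma> (L (\<sigma> z))) \<longlongrightarrow> 0) (at a within {z. Im z > 0})"
    and "\<And>x. Im x = 0 \<Longrightarrow> x \<notin> K \<Longrightarrow> Some x \<noteq> z0 \<Longrightarrow> ((\<lambda>z. \<sigma> (L (\<sigma> z))) \<longlongrightarrow> \<sigma> (L (\<sigma> x))) (at x within {z. Im z > 0})"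
proof -
  let ?U = "{z. Im z > 0}"
  obtain g where g: "is_green_function K z0 g" "\<forall>z\<in>H. Re (L z) = g (Some z)"
    and hol: "L holomorphic_on H" and la: "(L \<longlongrightarrow> 0) (at a within H)"
    and lim: "\<forall>x\<in>frontier H. x \<notin> K \<longrightarrow> Some x \<noteq> z0 \<longrightarrow> (L \<longlongrightarrow> L x) (at x within H)"
    using L unfolding is_log_complex_green_def by blast
  have \<sigma>H: "\<sigma> z \<in> H" if "Im z > 0" for z using \<sigma> that by auto
  have Re\<sigma>: "Re (\<sigma> w) = Re w" for w using \<sigma> by auto
  show "\<exists>g. is_green_function K z0 g \<and> (\<forall>z. Im z > 0 \<longrightarrow> Re (\<sigma> (L (\<sigma> z))) = g (Some (\<sigma> z)))"
    using g \<sigma>H Re\<sigma> by (intro exI[of _ g]) auto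
  show "(\<lambda>z. \<sigma> (L (\<sigma> z))) holomorphic_on ?U" using \<sigma>
  proof
    assume H: "H = {z. Im z < 0} \<and> \<sigma> = cnj"
    then have "cnj -` H = ?U" by auto
    then show ?thesis using holomorphic_on_cnj_cnj[OF hol] H open_halfspace_Im_lt by auto
  qed (use hol in auto)
  have tr: "((\<lambda>z. \<sigma> (L (\<sigma> z))) \<longlongrightarrow> \<sigma> b) (at x within ?U)" if x: "Im x = 0" "(L \<longlongrightarrow> b) (at x within H)" for x b
    using \<sigma>
  proof
    assume H: "H = {z. Im z < 0} \<and> \<sigma> = cnj"
    have cx: "cnj x = x" using x(1) by (simp add: complex_eq_iff)
    have "filterlim cnj (at x within H) (at x within ?U)"
      unfolding filterlim_at
    proof
      have "(cnj \<longlongrightarrow> cnj x) (at x within ?U)" by (intro tendsto_intros)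
      then show "(cnj \<longlongrightarrow> x) (at x within ?U)" by (simp add: cx)
      have "cnj z \<in> H \<and> cnj z \<noteq> x" if "z \<in> ?U" for z
      proof -
        have "Im (cnj z) < 0" using that by simp
        then show ?thesis using H x(1) by (metis (mono_tags, lifting) less_irrefl mem_Collect_eq)
      qed
      then show "\<forall>\<^sub>F z in at x within ?U. cnj z \<in> H \<and> cnj z \<noteq> x"
        by (simp add: eventually_at_filter)
    qed
    from filterlim_compose[OF x(2) this] have "((\<lambda>z. L (cnj z)) \<longlongrightarrow> b) (at x within ?U)" .
    then show ?thesis using H by (auto intro: tendsto_cnj)
  qed (use x in auto)
  have \<sigma>0: "\<sigma> 0 = 0" using \<sigma> by auto
  show "((\<lambda>z. \<sigma> (L (\<sigma> z))) \<longlongrightarrow> 0) (at a within ?U)" using tr[OF a la] by (simp add: \<sigma>0)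
  fix x assume x: "Im x = 0" "x \<notin> K" "Some x \<noteq> z0"
  have "x \<in> frontier H" by (rule real_in_frontier[OF x(1)]) (use \<sigma> in auto)
  then have "(L \<longlongrightarrow> L x) (at x within H)" using lim x by blast
  moreover have "\<sigma> x = x" using \<sigma> x(1) by (auto simp: complex_eq_iff)
  ultimately show "((\<lambda>z. \<sigma> (L (\<sigma> z))) \<longlongrightarrow> \<sigma> (L (\<sigma> x))) (at x within ?U)" using tr[OF x(1), of "L x"] by simp
qed

text \<open>For a component \<open>A\<close> of \<open>K\<close> the harmonic measure therefore
  prescribes a limit at every point of \<open>K\<close>, as \<open>hmeas\<close> requires.\<close>

lemma continuous_indicator_clopen:
  assumes "closed A" "closed (K - A)" "x \<in> K"
  shows "continuous (at x within K) (indicator A :: complex \<Rightarrow> real)"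
proof -
  have "\<forall>\<^sub>F y in at x within K. indicator A x = (indicator A y :: real)"
  proof (cases "x \<in> A")
    case True
    have "\<forall>\<^sub>F y in nhds x. y \<in> - (K - A)" by (rule eventually_nhds_in_open[OF open_Compl[OF assms(2)]]) (use True in simp)
    then show ?thesis unfolding eventually_at_filter by eventually_elim (use True in \<open>auto simp: indicator_def\<close>)
  next
    case False
    have "\<forall>\<^sub>F y in nhds x. y \<in> - A" by (rule eventually_nhds_in_open[OF open_Compl[OF assms(1)]]) (use False in simp)
    then show ?thesis unfolding eventually_at_filter by eventually_elim (use False in \<open>auto simp: indicator_def\<close>)
  qed
  then have "(indicator A \<longlongrightarrow> (indicator A x :: real)) (at x within K)"
    by (rule Lim_transform_eventually[OF tendsto_const])
  then show ?thesis by (simp add: continuous_within)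
qed

theorem theorem0p1:
  fixes l m :: nat and a :: "nat \<Rightarrow> real" and E :: "real set"
    and r :: "nat \<Rightarrow> nat" and B C :: "nat \<Rightarrow> nat \<Rightarrow> real" and I :: "nat \<Rightarrow> real set"
    and \<delta> :: real and c :: "nat \<Rightarrow> real" and \<omega> :: "nat \<Rightarrow> nat \<Rightarrow> real"
    and H :: "complex set"
    and log\<phi>E :: "complex \<Rightarrow> complex"
    and log\<phi>c log\<phi>EI :: "nat \<Rightarrow> complex \<Rightarrow> complex"
    and Z :: "complex set"
  assumes l: "l \<ge> 1" and m: "m \<ge> 1"
    and a: "strict_mono_on {1..2 * l} a"
    and E: "E = (\<Union>j\<in>{1..l}. {a (2 * j - 1)..a (2 * j)})"
    and r: "strict_mono r"
    and BC: "\<And>n k. n \<in> range r \<Longrightarrow> k \<in> {1..m} \<Longrightarrow> B k n < C k n"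
    and disj: "\<And>n. n \<in> range r \<Longrightarrow> disjoint_family_on (\<lambda>k. {B k n..C k n}) {1..m}"
    and I: "\<And>n. n \<in> range r \<Longrightarrow> I n = (\<Union>k\<in>{1..m}. {B k n..C k n})"
    and \<delta>: "\<delta> > 0" "\<And>n. n \<in> range r \<Longrightarrow> setdist E (I n) \<ge> \<delta>"
    and c: "\<And>k. k \<in> {1..m} \<Longrightarrow> (\<Inter>n\<in>range r. {B k n..C k n}) = {c k}"
    and \<omega>: "\<And>n k. n \<in> range r \<Longrightarrow> k \<in> {1..m} \<Longrightarrow>
          is_harmonic_measure None (complex_of_real ` {B k n..C k n})
            (complex_of_real ` (E \<union> I n)) (\<omega> k n)"
    and \<omega>_lim: "\<And>k. k \<in> {1..m} \<Longrightarrow> (\<lambda>i. \<omega> k (r i)) \<longlonglongrightarrow> 0"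
    and H: "H = {z. Im z > 0} \<or> H = {z. Im z < 0}"
    and log\<phi>E: "is_log_complex_green (complex_of_real ` E) None (a (2 * l)) H log\<phi>E"
    and log\<phi>c: "\<And>k. k \<in> {1..m} \<Longrightarrow>
          is_log_complex_green (complex_of_real ` E) (Some (c k)) (a (2 * l)) H (log\<phi>c k)"
    and log\<phi>EI: "\<And>n. n \<in> range r \<Longrightarrow>
          is_log_complex_green (complex_of_real ` (E \<union> I n)) None (a (2 * l)) H (log\<phi>EI n)"
    and Z: "compact Z" "Z \<subseteq> - (complex_of_real ` (E \<union> c ` {1..m}))"
  shows "\<exists>M. \<forall>\<^sub>F i in sequentially. \<forall>z \<in> Z \<inter> closure H. \<exists>\<epsilon>.
           exp (log\<phi>EI (r i) z) =
             exp (log\<phi>E z) / (\<Prod>k=1..m. exp (\<omega> k (r i) * log\<phi>c k z)) * (1 + \<epsilon>) \<and>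
           cmod \<epsilon> \<le> M * (MAX k\<in>{1..m}. (\<omega> k (r i))\<^sup>2)"
proof -
  let ?UH = "{z. Im z > 0}"
  \<comment> \<open>\<sigma> carries the upper half-plane onto \<open>H\<close>, fixes the real axis
    and is its own inverse. All logarithms are conjugated by it, and \<open>Z\<close> is replaced by
    its image.\<close>
  define \<sigma> :: "complex \<Rightarrow> complex" where "\<sigma> = (if H = {z. Im z > 0} then (\<lambda>z. z) else cnj)"
  have \<sigma>: "H = {z. Im z > 0} \<and> \<sigma> = (\<lambda>z. z) \<or> H = {z. Im z < 0} \<and> \<sigma> = cnj"
    using H by (auto simp: \<sigma>_def)
  have \<sigma>2: "\<sigma> = (\<lambda>z. z) \<or> \<sigma> = cnj" using \<sigma> by blast
  define P where "P = (\<lambda>j. (a (2 * j - 1), a (2 * j))) ` {1..l}"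
  define Q where "Q = (\<lambda>n. (\<lambda>k. (B k n, C k n)) ` {1..m})"
  have am: "a i < a j" if "i < j" "1 \<le> i" "j \<le> 2 * l" for i j
    using a that by (auto simp: strict_mono_on_def)
  have sP: "slits P = complex_of_real ` E" unfolding slits_def P_def E by auto
  have P: "slit_system P" unfolding slit_system_def
  proof (intro conjI)
    show "finite P" "P \<noteq> {}" using l by (auto simp: P_def)
    show "\<forall>(p, q)\<in>P. p < q" using am by (auto simp: P_def)
    have "{a (2 * j - 1)..a (2 * j)} \<inter> {a (2 * k - 1)..a (2 * k)} = {}" if "j \<in> {1..l}" "k \<in> {1..l}" "j < k" for j k
    proof -
      have "2 * j < 2 * k - 1" "1 \<le> 2 * j" "2 * k - 1 \<le> 2 * l" using that by auto
      then have "a (2 * j) < a (2 * k - 1)" by (rule am)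
      then show ?thesis by auto
    qed
    then have "{a (2 * j - 1)..a (2 * j)} \<inter> {a (2 * k - 1)..a (2 * k)} = {}" if "j \<in> {1..l}" "k \<in> {1..l}" "j \<noteq> k" for j k
      using that by (metis Int_commute linorder_neqE_nat)
    then show "disjoint_family_on (\<lambda>(p, q). {p..q}) P" unfolding disjoint_family_on_def P_def by fastforce
  qed
  have Ec: "compact E" unfolding E by (intro compact_UN) auto
  have EI: "x \<notin> E" if "n \<in> range r" "x \<in> I n" for n x
  proof
    assume "x \<in> E"
    then have "setdist E (I n) \<le> dist x x" using that(2) by (rule setdist_le_dist)
    then show False using \<delta>(2)[OF that(1)] \<delta>(1) by simp
  qed
  have sPQ: "slits (P \<union> Q n) = complex_of_real ` (E \<union> I n)" if "n \<in> range r" for n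
  proof -
    have "slits (Q n) = complex_of_real ` I n" unfolding slits_def Q_def I[OF that] by auto
    moreover have "slits (P \<union> Q n) = slits P \<union> slits (Q n)" unfolding slits_def by blast
    ultimately show ?thesis using sP by (simp add: image_Un)
  qed
  have PQ: "slit_system (P \<union> Q n)" if n: "n \<in> range r" for n
    unfolding slit_system_def
  proof (intro conjI)
    show "finite (P \<union> Q n)" "P \<union> Q n \<noteq> {}" using P by (auto simp: slit_system_def Q_def)
    show "\<forall>(p, q)\<in>P \<union> Q n. p < q" using P BC[OF n] by (auto simp: slit_system_def Q_def)
    have 1: "{fst x..snd x} \<inter> {fst y..snd y} = {}" if "x \<in> P" "y \<in> P" "x \<noteq> y" for x y
      using P that unfolding slit_system_def disjoint_family_on_def by (auto simp: case_prod_beta)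
    have 2: "{fst x..snd x} \<inter> {fst y..snd y} = {}" if "x \<in> P" "y \<in> Q n" for x y
    proof -
      have "{fst x..snd x} \<subseteq> E" using that(1) unfolding P_def E by auto
      moreover have "{fst y..snd y} \<subseteq> I n" using that(2) unfolding Q_def I[OF n] by auto
      ultimately show ?thesis using EI[OF n] by blast
    qed
    have 3: "{fst x..snd x} \<inter> {fst y..snd y} = {}" if "x \<in> Q n" "y \<in> Q n" "x \<noteq> y" for x y
      using disj[OF n] that unfolding disjoint_family_on_def Q_def by fastforce
    show "disjoint_family_on (\<lambda>(p, q). {p..q}) (P \<union> Q n)"
      unfolding disjoint_family_on_def case_prod_beta using 1 2 3 by (metis Int_commute Un_iff)
  qed
  have cBC: "B k n \<le> c k \<and> c k \<le> C k n" if "n \<in> range r" "k \<in> {1..m}" for n k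
  proof -
    have "c k \<in> (\<Inter>n\<in>range r. {B k n..C k n})" using c[OF that(2)] by simp
    then have "c k \<in> {B k n..C k n}" using that(1) by (rule INT_D)
    then show ?thesis by simp
  qed
  have r0: "r 0 \<in> range r" by simp
  have cI: "c k \<in> I n" if "n \<in> range r" "k \<in> {1..m}" for n k
    using cBC[OF that] that(2) unfolding I[OF that(1)] by force
  have cE: "c k \<notin> E" if "k \<in> {1..m}" for k using EI[OF r0 cI[OF r0 that]] .
  have cinj: "inj_on c {1..m}"
  proof (rule inj_onI, rule ccontr)
    fix j k assume jk: "j \<in> {1..m}" "k \<in> {1..m}" "c j = c k" "j \<noteq> k"
    then have "{B j (r 0)..C j (r 0)} \<inter> {B k (r 0)..C k (r 0)} = {}"
      using disj[OF r0] unfolding disjoint_family_on_def by blast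
    then show False using cBC[OF r0 jk(1)] cBC[OF r0 jk(2)] jk(3) by auto
  qed
  have fPQ: "finite (P \<union> Q n)" for n by (auto simp: P_def Q_def)
  have Kc: "compact (slits P)" "slits P \<noteq> {}" "slits P \<subseteq> \<real>"
    using compact_slits slits_nonempty[OF P] slits_real P by (auto simp: slit_system_def)
  have Knc: "compact (slits (P \<union> Q n))" "slits (P \<union> Q n) \<noteq> {}" "slits (P \<union> Q n) \<subseteq> \<real>" if "n \<in> range r" for n
    using compact_slits[OF fPQ] slits_nonempty[OF PQ[OF that]] slits_real by auto
  have a0: "Im (complex_of_real (a (2 * l))) = 0" by simp
  note lE = log_green_upper[OF log\<phi>E[folded sP] \<sigma> a0]
  note lc = log_green_upper[OF log\<phi>c[folded sP] \<sigma> a0]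
  have "is_log_complex_green (slits (P \<union> Q n)) None (a (2 * l)) H (log\<phi>EI n)" if "n \<in> range r" for n
    using log\<phi>EI[OF that] sPQ[OF that] by simp
  note lEI = log_green_upper[OF this \<sigma> a0]
  define LE where "LE = (\<lambda>z. \<sigma> (log\<phi>E (\<sigma> z)))"
  define Lc where "Lc = (\<lambda>k z. \<sigma> (log\<phi>c k (\<sigma> z)))"
  define LI where "LI = (\<lambda>n z. \<sigma> (log\<phi>EI n (\<sigma> z)))"
  obtain gE where gE: "is_green_function (slits P) None gE" "\<forall>z. Im z > 0 \<longrightarrow> Re (LE z) = gE (Some (\<sigma> z))"
    using lE(1) unfolding LE_def by blast
  have "\<forall>k\<in>{1..m}. \<exists>g. is_green_function (slits P) (Some (c k)) g \<and> (\<forall>z. Im z > 0 \<longrightarrow> Re (Lc k z) = g (Some (\<sigma> z)))"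
    using lc(1) unfolding Lc_def by blast
  from bchoice[OF this] obtain gc where gc: "\<And>k. k \<in> {1..m} \<Longrightarrow> is_green_function (slits P) (Some (c k)) (gc k)"
      "\<And>k z. k \<in> {1..m} \<Longrightarrow> Im z > 0 \<Longrightarrow> Re (Lc k z) = gc k (Some (\<sigma> z))"
    by blast
  have "\<forall>n\<in>range r. \<exists>g. is_green_function (slits (P \<union> Q n)) None g \<and> (\<forall>z. Im z > 0 \<longrightarrow> Re (LI n z) = g (Some (\<sigma> z)))"
    using lEI(1) unfolding LI_def by blast
  from bchoice[OF this] obtain gI where gI: "\<And>n. n \<in> range r \<Longrightarrow> is_green_function (slits (P \<union> Q n)) None (gI n)"
      "\<And>n z. n \<in> range r \<Longrightarrow> Im z > 0 \<Longrightarrow> Re (LI n z) = gI n (Some (\<sigma> z))"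
    by blast
  have GE: "green_inf (slits P) (\<lambda>z. gE (Some z))" by (rule green_inf_if_is_green_function[OF gE(1) Kc(1)])
  have Gc: "green_pt (slits P) (of_real (c k)) (\<lambda>z. gc k (Some z))" if "k \<in> {1..m}" for k
    by (rule green_pt_if_is_green_function[OF gc(1)[OF that] Kc(1)])
  have GI: "green_inf (slits (P \<union> Q n)) (\<lambda>z. gI n (Some z))" if "n \<in> range r" for n
    by (rule green_inf_if_is_green_function[OF gI(1)[OF that] Knc(1)[OF that]])
  have up: "z \<notin> S" if "Im z > 0" "S \<subseteq> \<real>" for z S using that by (auto elim!: Reals_cases)
  \<comment> \<open>The Green's functions are symmetric about the real axis, so the real part after
    conjugation by \<sigma> is still the same Green's function.\<close>
  have ReLE: "Re (LE z) = gE (Some z)" if "Im z > 0" for z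
    using gE(2) that green_inf_cnj[OF GE Kc up[OF that Kc(3)]] \<sigma>2 by auto
  have ReLc: "Re (Lc k z) = gc k (Some z)" if "k \<in> {1..m}" "Im z > 0" for k z
  proof -
    have "z \<noteq> of_real (c k)" using that(2) by auto
    then show ?thesis using gc(2)[OF that] green_pt_cnj[OF Gc[OF that(1)] Kc Reals_of_real up[OF that(2) Kc(3)]] \<sigma>2 by auto
  qed
  have ReLI: "Re (LI n z) = gI n (Some z)" if "n \<in> range r" "Im z > 0" for n z
    using gI(2)[OF that] green_inf_cnj[OF GI[OF that(1)] Knc[OF that(1)] up[OF that(2) Knc(3)[OF that(1)]]] \<sigma>2 by auto
  interpret green_setup P m c "\<lambda>z. gE (Some z)" "\<lambda>k z. gc k (Some z)" LE Lc
  proof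
    show "complex_of_real (c k) \<notin> slits P" if "k \<in> {1..m}" for k using cE[OF that] unfolding sP by auto
    show "(LE \<longlongrightarrow> LE x) (at x within ?UH)" if "x \<notin> slits P" "Im x = 0" for x
      using lE(4)[OF that(2,1)] unfolding LE_def by simp
    show "(Lc k \<longlongrightarrow> Lc k x) (at x within ?UH)" if "k \<in> {1..m}" "x \<notin> slits P" "x \<noteq> of_real (c k)" "Im x = 0" for k x
      using lc(4)[OF that(1,4,2)] that(3) unfolding Lc_def by simp
    show "LE holomorphic_on ?UH" unfolding LE_def by (rule lE(2))
    show "Lc k holomorphic_on ?UH" if "k \<in> {1..m}" for k unfolding Lc_def by (rule lc(2)[OF that])
    show "slit_system P" "m \<ge> 1" "inj_on c {1..m}" "green_inf (slits P) (\<lambda>z. gE (Some z))" by fact+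
    show "green_pt (slits P) (complex_of_real (c k)) (\<lambda>z. gc k (Some z))" if "k \<in> {1..m}" for k by (rule Gc[OF that])
    show "Re (LE z) = gE (Some z)" if "0 < Im z" for z by (rule ReLE[OF that])
    show "Re (Lc k z) = gc k (Some z)" if "k \<in> {1..m}" "0 < Im z" for k z by (rule ReLc[OF that])
  qed
  have harmU: "\<exists>U. hmeas (slits (P \<union> Q n)) (complex_of_real ` {B k n..C k n}) U (\<omega> k n)" if n: "n \<in> range r" and k: "k \<in> {1..m}" for n k
  proof -
    have kP: "(B k n, C k n) \<in> P \<union> Q n" using k by (auto simp: Q_def)
    have 1: "closed (complex_of_real ` {B k n..C k n})"
      by (intro compact_imp_closed compact_continuous_image continuous_intros) auto
    have 2: "closed (slits (P \<union> Q n) - complex_of_real ` {B k n..C k n})"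
      unfolding slits_remove[OF PQ[OF n] kP] using fPQ by (intro compact_imp_closed compact_slits) auto
    have "is_harmonic_measure None (complex_of_real ` {B k n..C k n}) (slits (P \<union> Q n)) (\<omega> k n)"
      using \<omega>[OF n k] sPQ[OF n] by simp
    then obtain U where "hmeas (slits (P \<union> Q n)) (complex_of_real ` {B k n..C k n}) U (\<omega> k n)"
      by (rule hmeas_if_is_harmonic_measure[OF _ Knc(1)[OF n] continuous_indicator_clopen[OF 1 2]])
    then show ?thesis by blast
  qed
  then obtain U where U: "\<And>n k. n \<in> range r \<Longrightarrow> k \<in> {1..m} \<Longrightarrow> hmeas (slits (P \<union> Q n)) (complex_of_real ` {B k n..C k n}) (U n k) (\<omega> k n)"
    by metis
  have Kr: "slits (P \<union> Q (r i)) = complex_of_real ` (E \<union> (\<Union>k\<in>{1..m}. {B k (r i)..C k (r i)}))" for i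
    using sPQ[of "r i"] I[of "r i"] by simp
  have U': "\<exists>U. hmeas (complex_of_real ` (E \<union> (\<Union>k\<in>{1..m}. {B k (r i)..C k (r i)}))) (complex_of_real ` {B k (r i)..C k (r i)}) U (\<omega> k (r i))"
    if "k \<in> {1..m}" for i k using harmU[of "r i" k] that unfolding Kr by simp
  have BC': "B k (r i) < C k (r i)" "B k (r i) \<le> c k \<and> c k \<le> C k (r i)" if "k \<in> {1..m}" for i k
    using BC[of "r i" k] cBC[of "r i" k] that by auto
  note ls = lengths_small[where c = c and E = E and B = "\<lambda>k i. B k (r i)" and C = "\<lambda>k i. C k (r i)" and \<omega> = "\<lambda>k i. \<omega> k (r i)"]
  have small1: "\<forall>k\<in>{1..m}. \<omega> k (r i) > 0" for i
    by (rule ls(1)[OF m cinj _ Ec]) (fact cE BC' U' \<omega>_lim)+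
  have small2: "\<forall>\<^sub>F i in sequentially. \<forall>k\<in>{1..m}. C k (r i) - B k (r i) < (MAX k\<in>{1..m}. \<omega> k (r i))\<^sup>2 / 2"
    by (rule ls(2)[OF m cinj _ Ec]) (fact cE BC' U' \<omega>_lim)+
  have pos: "\<omega> k (r i) > 0" if "k \<in> {1..m}" for k i using small1 that by blast
  define W where "W = (\<lambda>i. MAX k\<in>{1..m}. \<omega> k (r i))"
  have W: "filterlim W (at_right 0) sequentially" unfolding W_def by (rule Max_tendsto_0[OF m \<omega>_lim pos])
  have Wge: "\<omega> k (r i) \<le> W i" if "k \<in> {1..m}" for k i unfolding W_def using that by (intro Max_ge) auto
  \<comment> \<open>The estimate is in terms of the square of the maximum, the claim in terms of the
    maximum of the squares; the maximum is attained at some \<open>k\<close>.\<close>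
  have Wsq: "(W i)\<^sup>2 \<le> (MAX k\<in>{1..m}. (\<omega> k (r i))\<^sup>2)" for i
  proof -
    have "W i \<in> (\<lambda>k. \<omega> k (r i)) ` {1..m}" unfolding W_def using m by (intro Max_in) auto
    then obtain k where "k \<in> {1..m}" "W i = \<omega> k (r i)" by blast
    then show ?thesis by (auto intro!: Max_ge)
  qed
  have pa: "(a (2 * l - 1), a (2 * l)) \<in> P" using l by (auto simp: P_def)
  have cont\<sigma>: "continuous_on S \<sigma>" for S using \<sigma>2 by (auto intro: continuous_intros)
  have \<sigma>\<sigma>: "\<sigma> (\<sigma> z) = z" "\<sigma> (of_real x) = of_real x" for z x using \<sigma>2 by auto
  have Z\<sigma>: "compact (\<sigma> ` Z)" by (intro compact_continuous_image cont\<sigma> Z(1))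
  have Z\<sigma>': "\<sigma> ` Z \<subseteq> - slits P - (\<lambda>k. complex_of_real (c k)) ` {1..m}"
  proof
    fix w assume "w \<in> \<sigma> ` Z"
    then obtain z where z: "z \<in> Z" "w = \<sigma> z" by blast
    have "w \<noteq> of_real x" if "x \<in> E \<union> c ` {1..m}" for x
    proof
      assume "w = of_real x"
      then have "z = of_real x" using z(2) \<sigma>\<sigma> by metis
      then show False using Z(2) z(1) that by blast
    qed
    then show "w \<in> - slits P - (\<lambda>k. complex_of_real (c k)) ` {1..m}" unfolding sP by blast
  qed
  show ?thesis
  proof (rule uniform_bound[OF pa Z\<sigma> Z\<sigma>'])
    fix Cc s0 :: real
    assume s0: "s0 > 0" and bound: "\<And>B C G L U \<omega> s z. perturbed_green P m c (\<lambda>z. gE (Some z)) (\<lambda>k z. gc k (Some z)) LE Lc B C G L U \<omega> s \<Longrightarrow> s \<le> s0 \<Longrightarrow>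
      (\<And>j. j \<in> {1..m} \<Longrightarrow> 0 \<le> \<omega> j \<and> \<omega> j \<le> 1) \<Longrightarrow> (\<And>k. k \<in> {1..m} \<Longrightarrow> \<omega> k * ln (2 / s) \<le> 1) \<Longrightarrow>
      ((\<lambda>z. L z - LE z + (\<Sum>k=1..m. of_real (\<omega> k) * Lc k z)) \<longlongrightarrow> 0) (at (of_real (a (2 * l))) within ?UH) \<Longrightarrow>
      z \<in> \<sigma> ` Z \<Longrightarrow> 0 \<le> Im z \<Longrightarrow> cmod (L z - LE z + (\<Sum>k=1..m. of_real (\<omega> k) * Lc k z)) \<le> Cc * s"
    define M where "M = 3 * \<bar>Cc\<bar>"
    \<comment> \<open>With \<open>s = w^2\<close>: the first condition is \<open>s <= s0\<close>,
      the second keeps \<open>|Dz| <= 1\<close>, and \<open>w * ln (2 / w^2) < 1\<close> yields the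
      condition on \<open>\<omega> k * ln (2 / s)\<close>.\<close>
    have "\<forall>\<^sub>F w in at_right 0. w\<^sup>2 < s0" "\<forall>\<^sub>F w in at_right 0. \<bar>Cc\<bar> * w\<^sup>2 < 1"
      "\<forall>\<^sub>F w in at_right (0::real). w < 1" "\<forall>\<^sub>F w in at_right (0::real). w * ln (2 / w\<^sup>2) < 1" "\<forall>\<^sub>F w in at_right (0::real). 0 < w"
    proof -
      have t: "((\<lambda>w::real. b * w\<^sup>2) \<longlongrightarrow> 0) (at_right 0)" for b by real_asymp
      show "\<forall>\<^sub>F w in at_right 0. w\<^sup>2 < s0" using order_tendstoD(2)[OF t[of 1] s0] by simp
      show "\<forall>\<^sub>F w in at_right 0. \<bar>Cc\<bar> * w\<^sup>2 < 1" using order_tendstoD(2)[OF t[of "\<bar>Cc\<bar>"], of 1] by simp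
      show "\<forall>\<^sub>F w in at_right (0::real). w < 1" "\<forall>\<^sub>F w in at_right (0::real). w * ln (2 / w\<^sup>2) < 1" "\<forall>\<^sub>F w in at_right (0::real). 0 < w"
        by real_asymp+
    qed
    note ev = this[THEN eventually_compose_filterlim[OF _ W]]
    show "\<exists>M. \<forall>\<^sub>F i in sequentially. \<forall>z \<in> Z \<inter> closure H. \<exists>\<epsilon>.
             exp (log\<phi>EI (r i) z) =
               exp (log\<phi>E z) / (\<Prod>k=1..m. exp (\<omega> k (r i) * log\<phi>c k z)) * (1 + \<epsilon>) \<and>
             cmod \<epsilon> \<le> M * (MAX k\<in>{1..m}. (\<omega> k (r i))\<^sup>2)"
    proof (intro exI[of _ M])
      from ev small2
      show "\<forall>\<^sub>F i in sequentially. \<forall>z \<in> Z \<inter> closure H. \<exists>\<epsilon>.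
             exp (log\<phi>EI (r i) z) =
               exp (log\<phi>E z) / (\<Prod>k=1..m. exp (\<omega> k (r i) * log\<phi>c k z)) * (1 + \<epsilon>) \<and>
             cmod \<epsilon> \<le> M * (MAX k\<in>{1..m}. (\<omega> k (r i))\<^sup>2)"
      proof eventually_elim
        case (elim i)
        let ?n = "r i" and ?s = "(W i)\<^sup>2"
        have n: "?n \<in> range r" by simp
        have pg: "perturbed_green P m c (\<lambda>z. gE (Some z)) (\<lambda>k z. gc k (Some z)) LE Lc (\<lambda>k. B k ?n) (\<lambda>k. C k ?n) (\<lambda>z. gI ?n (Some z)) (LI ?n) (U ?n) (\<lambda>k. \<omega> k ?n) ?s"
        proof
          show "(LI ?n \<longlongrightarrow> LI ?n x) (at x within ?UH)" if "x \<notin> slits (P \<union> (\<lambda>k. (B k ?n, C k ?n)) ` {1..m})" "Im x = 0" for x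
            using lEI(4)[OF n that(2)] that(1) unfolding LI_def Q_def by simp
          show "LI ?n holomorphic_on ?UH" unfolding LI_def by (rule lEI(2)[OF n])
          show "slit_system (P \<union> (\<lambda>k. (B k ?n, C k ?n)) ` {1..m})" using PQ[OF n] unfolding Q_def .
          show "green_inf (slits (P \<union> (\<lambda>k. (B k ?n, C k ?n)) ` {1..m})) (\<lambda>z. gI ?n (Some z))" using GI[OF n] unfolding Q_def .
          show "hmeas (slits (P \<union> (\<lambda>k. (B k ?n, C k ?n)) ` {1..m})) (complex_of_real ` {B k ?n..C k ?n}) (U ?n k) (\<omega> k ?n)" if "k \<in> {1..m}" for k
            using U[OF n that] unfolding Q_def .
          show "C k ?n - B k ?n < ?s / 2" if "k \<in> {1..m}" for k using elim(6) that unfolding W_def by blast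
        qed (use BC' ReLI[OF n] elim(5) in auto)
        have \<omega>1: "0 \<le> \<omega> j ?n \<and> \<omega> j ?n \<le> 1" if "j \<in> {1..m}" for j
          using pos[OF that, of i] Wge[OF that, of i] elim(3) by linarith
        have \<omega>2: "\<omega> k ?n * ln (2 / ?s) \<le> 1" if "k \<in> {1..m}" for k
        proof -
          have "?s \<le> 1" using elim(3,5) by (simp add: power_le_one)
          then have "1 \<le> 2 / ?s" using elim(5) by simp
          then have "0 \<le> ln (2 / ?s)" by simp
          then have "\<omega> k ?n * ln (2 / ?s) \<le> W i * ln (2 / ?s)" using Wge[OF that] by (intro mult_right_mono)
          then show ?thesis using elim(4) by linarith
        qed
        \<comment> \<open>All logarithms are normalised to 0 at the same endpoint, so their
          combination tends to 0 there; this fixes the imaginary constant in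
          \<open>D\<close>.\<close>
        have "((\<lambda>z. LI ?n z - LE z + (\<Sum>k=1..m. of_real (\<omega> k ?n) * Lc k z)) \<longlongrightarrow> 0 - 0 + (\<Sum>k=1..m. of_real (\<omega> k ?n) * 0)) (at (of_real (a (2 * l))) within ?UH)"
          unfolding LI_def LE_def Lc_def by (intro tendsto_intros lE(3) lc(3) lEI(3)[OF n])
        then have lim: "((\<lambda>z. LI ?n z - LE z + (\<Sum>k=1..m. of_real (\<omega> k ?n) * Lc k z)) \<longlongrightarrow> 0) (at (of_real (a (2 * l))) within ?UH)" by simp
        show ?case
        proof
          fix z assume z: "z \<in> Z \<inter> closure H"
          have "closure H \<subseteq> {z. Im (\<sigma> z) \<ge> 0}" using \<sigma>
          proof
            assume "H = {z. Im z > 0} \<and> \<sigma> = (\<lambda>z. z)"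
            then show ?thesis by (intro closure_minimal) (auto intro!: closed_Collect_le continuous_intros)
          next
            assume "H = {z. Im z < 0} \<and> \<sigma> = cnj"
            then show ?thesis by (intro closure_minimal) (auto intro!: closed_Collect_le continuous_intros)
          qed
          then have Imz: "0 \<le> Im (\<sigma> z)" using z by blast
          define S where "S = (\<Sum>k=1..m. of_real (\<omega> k ?n) * log\<phi>c k z)"
          \<comment> \<open>A logarithm of the left side divided by the main term on the right, so
            that the relative error is \<open>exp Dz - 1\<close>.\<close>
          define Dz where "Dz = log\<phi>EI ?n z - log\<phi>E z + S"
          have "LI ?n (\<sigma> z) - LE (\<sigma> z) + (\<Sum>k=1..m. of_real (\<omega> k ?n) * Lc k (\<sigma> z)) = \<sigma> Dz"
            using \<sigma>2 by (auto simp: LI_def LE_def Lc_def Dz_def S_def)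
          moreover have "cmod (\<sigma> Dz) = cmod Dz" using \<sigma>2 by auto
          moreover have "cmod (LI ?n (\<sigma> z) - LE (\<sigma> z) + (\<Sum>k=1..m. of_real (\<omega> k ?n) * Lc k (\<sigma> z))) \<le> Cc * ?s"
            by (rule bound[OF pg less_imp_le[OF elim(1)] \<omega>1 \<omega>2 lim _ Imz]) (use z in auto)
          ultimately have "cmod Dz \<le> Cc * ?s" by simp
          also have "\<dots> \<le> \<bar>Cc\<bar> * ?s" by (intro mult_right_mono) auto
          finally have D1: "cmod Dz \<le> \<bar>Cc\<bar> * ?s" .
          then have D2: "cmod Dz \<le> 1" using elim(2) by linarith
          \<comment> \<open>Taylor's formula of order 0; with \<open>|Dz| <= 1\<close> the factor is
            at most \<open>exp 1\<close>, hence at most 3, the constant in \<open>M\<close>.\<close>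
          have "cmod (exp Dz - 1) \<le> exp \<bar>Re Dz\<bar> * cmod Dz" using Taylor_exp[of Dz 0] by simp
          also have "\<dots> \<le> 3 * cmod Dz"
          proof (rule mult_right_mono)
            have "exp \<bar>Re Dz\<bar> \<le> exp 1" using abs_Re_le_cmod[of Dz] D2 by simp
            then show "exp \<bar>Re Dz\<bar> \<le> 3" using exp_le by linarith
          qed simp
          also have "\<dots> \<le> 3 * (\<bar>Cc\<bar> * ?s)" using D1 by simp
          also have "\<dots> = M * ?s" by (simp add: M_def)
          also have "\<dots> \<le> M * (MAX k\<in>{1..m}. (\<omega> k (r i))\<^sup>2)" using Wsq by (intro mult_left_mono) (auto simp: M_def)
          finally have eps: "cmod (exp Dz - 1) \<le> M * (MAX k\<in>{1..m}. (\<omega> k (r i))\<^sup>2)" .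
          have "(\<Prod>k=1..m. exp (\<omega> k ?n * log\<phi>c k z)) = exp S" unfolding S_def by (simp add: exp_sum)
          moreover have "exp (log\<phi>EI ?n z) = exp (log\<phi>E z) / exp S * exp Dz"
            by (simp add: Dz_def exp_add exp_diff)
          ultimately show "\<exists>\<epsilon>. exp (log\<phi>EI (r i) z) = exp (log\<phi>E z) / (\<Prod>k=1..m. exp (\<omega> k (r i) * log\<phi>c k z)) * (1 + \<epsilon>) \<and>
             cmod \<epsilon> \<le> M * (MAX k\<in>{1..m}. (\<omega> k (r i))\<^sup>2)"
            using eps by (intro exI[of _ "exp Dz - 1"]) simp
        qed
      qed
    qed
  qed
qed

end
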